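(* Let $V$ be a complex vector space of dimension $n+1$, let $d\ge 1$, and set $m=\lceil d/2\rceil$. Suppose $f=\sum_{i=1}^r v_i^{d}$ (with $v_i\in V$) is a general form of rank $r$ in $S^{d}V$, let $z_i=[v_i]\in\mathbb{P}(V)$ be the corresponding points and let $Z=\{z_1,\ldots,z_r\}$. Let $C_f=C_f^m\colon S^mV^*\to S^{d-m}V$ be the catalecticant map of $f$, and let $Z'\subset \mathbb{P}(V)$ be the common zero-set of the polynomials in $\ker C_f$. (1) If $d$ is even and $r\le \binom{n+m}{n}-n-1$, or if $d$ is odd and $r\le\binom{n+m-1}{n}$, then $$\ker C_f=I_{Z,m},$$ where $I_{Z,m}\subset S^mV^*$ denotes the subspace of polynomials of degree $m$ vanishing on $Z$. Moreover the Catalecticant Algorithm, applied to $f$, produces the unique Waring decomposition of $f$. (2) If $d$ is even and $r=\binom{n+m}{n}-n$, then it is possible that $Z\subsetneq Z'$. Still, when $n=2$, the Catalecticant Algorithm produces the unique minimal Waring decomposition of $f$. Further, when $n\ge 3$, the Catalecticant Algorithm succeeds in producing it after repeating its step (4) finitely many times, using subsets $Z''\subset Z'$ of size $\operatorname{rank}(C_f)$ in place of $Z'$.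
   Context: $S^dV$ is the space of symmetric tensors of order $d$ (homogeneous polynomials of degree $d$ in a basis of $V$). The (symmetric) rank of $f\in S^dV$ is the minimum number $r$ of summands in an expression $f=\sum_{i=1}^r c_i v_i^d$ with $v_i\in V$, $c_i\in\mathbb{C}$; such a minimal expression is a Waring decomposition of $f$. Uniqueness is up to reordering the summands and rescaling the $v_i$ (with the compensating rescaling of $c_i$). $\mathbb{P}(V)$ is the projective space of lines in $V$, so $S^mV^*$ is the space of degree $m$ forms on $\mathbb{P}(V)$. "General" means that the property holds for all elements of a dense (Zariski open) subset of the irreducible family in question, here the forms of rank $r$. Catalecticant map: for $m\le d$, $C_f^m\colon S^mV^*\to S^{d-m}V$ sends a polynomial in $S^mV^*$ to the result of applying it to $f$ as a constant coefficient differential operator, i.e. for a basis $x_0,\dots,x_n$ of $V$ the monomial dual to $x_{i_1}\cdots x_{i_m}$ goes to $\frac{\partial^m f}{\partial x_{i_1}\cdots\partial x_{i_m}}$. Catalecticant Algorithm. Input: $f\in S^dV$. (1) Construct $C_f=C_f^m$ with $m=\lceil d/2\rceil$. (2) Compute $\ker C_f$. (3) Find the zero-set $Z'$ of the polynomials in $\ker C_f$; if $Z'$ is not given by finitely many reduced points, stop (the method fails); otherwise write $Z'=\{[v_1],\ldots,[v_s]\}$. (4) Solve the linear system $f=\sum_{i=1}^s c_iv_i^d$ in the unknowns $c_i\in\mathbb{C}$. Output: the resulting expression of $f$ (summands with $c_i=0$ being discarded). *)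

theory Defs
  imports Complex_Main "HOL-Library.Poly_Mapping" "HOL-Library.Multiset"
begin

text \<open>
  The complex vector space \<open>V\<close> of dimension \<open>n + 1\<close> has the basis \<open>x\<^sub>0, \<dots>, x\<^sub>n\<close>, and
  polynomials in the \<open>x\<^sub>i\<close> are finitely supported functions from exponent vectors to
  coefficients.  \<open>S\<^sup>d V\<close> is the space of forms of degree \<open>d\<close> in the \<open>x\<^sub>i\<close>; in particular
  \<open>V\<close> itself is \<open>S\<^sup>1 V\<close>, the space of linear forms, so that \<open>v ^ d\<close> for \<open>v \<in> V\<close> is a power
  in the polynomial ring.  \<open>S\<^sup>m V\<^sup>*\<close> is the space of forms of degree \<open>m\<close> in the dual basis
  \<open>y\<^sub>0, \<dots>, y\<^sub>n\<close> of \<open>V\<^sup>*\<close>; its elements are represented by the same type, and which of the two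
  spaces is meant is clear from whether a polynomial is evaluated (or used as a differential
  operator) or not.
\<close>

type_synonym 'i cpoly = "('i \<Rightarrow>\<^sub>0 nat) \<Rightarrow>\<^sub>0 complex"

definition mono_degree :: "(nat \<Rightarrow>\<^sub>0 nat) \<Rightarrow> nat" where
  "mono_degree \<alpha> = (\<Sum>i\<in>Poly_Mapping.keys \<alpha>. Poly_Mapping.lookup \<alpha> i)"

definition polys :: "nat \<Rightarrow> nat cpoly set" where
  "polys n = {p. \<forall>\<alpha>\<in>Poly_Mapping.keys p. Poly_Mapping.keys \<alpha> \<subseteq> {0..n}}"

definition forms :: "nat \<Rightarrow> nat \<Rightarrow> nat cpoly set" where
  "forms n d = {p \<in> polys n. \<forall>\<alpha>\<in>Poly_Mapping.keys p. mono_degree \<alpha> = d}"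

abbreviation vecs :: "nat \<Rightarrow> nat cpoly set" where
  "vecs n \<equiv> forms n 1"

definition cscale :: "complex \<Rightarrow> nat cpoly \<Rightarrow> nat cpoly" where
  "cscale c p = Poly_Mapping.single 0 c * p"

global_interpretation cpoly: vector_space cscale
  by unfold_locales
    (simp_all add: cscale_def algebra_simps single_add mult_single flip: mult.assoc)

definition poly_eval :: "'i cpoly \<Rightarrow> ('i \<Rightarrow> complex) \<Rightarrow> complex" where
  "poly_eval p x = (\<Sum>\<alpha>\<in>Poly_Mapping.keys p.
     Poly_Mapping.lookup p \<alpha> * (\<Prod>i\<in>Poly_Mapping.keys \<alpha>. x i ^ Poly_Mapping.lookup \<alpha> i))"

text \<open>The coordinate \<open>y\<^sub>i(v)\<close> of \<open>v \<in> V\<close>, i.e. the coefficient of \<open>x\<^sub>i\<close>.\<close>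

definition coord :: "nat cpoly \<Rightarrow> nat \<Rightarrow> complex" where
  "coord v i = Poly_Mapping.lookup v (Poly_Mapping.single i 1)"

definition line :: "nat cpoly \<Rightarrow> nat cpoly set" where
  "line v = cpoly.span {v}"

definition proj_space :: "nat \<Rightarrow> nat cpoly set set" where
  "proj_space n = line ` (vecs n - {0})"

definition vanishes_at :: "nat cpoly \<Rightarrow> nat cpoly set \<Rightarrow> bool" where
  "vanishes_at p z \<longleftrightarrow> (\<forall>v\<in>z. poly_eval p (coord v) = 0)"

definition zero_set :: "nat \<Rightarrow> nat cpoly set \<Rightarrow> nat cpoly set set" where
  "zero_set n K = {z \<in> proj_space n. \<forall>p\<in>K. vanishes_at p z}"

definition vanishing_forms :: "nat \<Rightarrow> nat \<Rightarrow> nat cpoly set set \<Rightarrow> nat cpoly set" where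
  "vanishing_forms n m Z = {p \<in> forms n m. \<forall>z\<in>Z. vanishes_at p z}"

text \<open>
  Reducedness concerns the projective scheme \<open>Proj (R / J)\<close>, where \<open>R = \<complex>[y\<^sub>0, \<dots>, y\<^sub>n]\<close> and
  \<open>J\<close> is the ideal generated by a set of forms.  This scheme is reduced iff the saturation of
  \<open>J\<close> with respect to the irrelevant ideal is a radical ideal.
\<close>

definition ideal_of :: "nat \<Rightarrow> nat cpoly set \<Rightarrow> nat cpoly set" where
  "ideal_of n K = {p. \<exists>A a. finite A \<and> A \<subseteq> K \<and> (\<forall>q\<in>A. a q \<in> polys n) \<and> p = (\<Sum>q\<in>A. a q * q)}"

definition saturation :: "nat \<Rightarrow> nat cpoly set \<Rightarrow> nat cpoly set" where
  "saturation n J = {p \<in> polys n. \<exists>k. \<forall>q\<in>forms n k. q * p \<in> J}"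

definition reduced_zero_scheme :: "nat \<Rightarrow> nat cpoly set \<Rightarrow> bool" where
  "reduced_zero_scheme n K \<longleftrightarrow>
     (\<forall>p\<in>polys n. \<forall>e. p ^ e \<in> saturation n (ideal_of n K) \<longrightarrow> p \<in> saturation n (ideal_of n K))"

text \<open>
  An expression \<open>\<Sum>\<^sub>i c\<^sub>i v\<^sub>i\<^sup>d\<close> is recorded as the list of the pairs \<open>(c\<^sub>i, v\<^sub>i)\<close>.
\<close>

type_synonym power_expr = "(complex \<times> nat cpoly) list"

definition expr_value :: "nat \<Rightarrow> power_expr \<Rightarrow> nat cpoly" where
  "expr_value d xs = (\<Sum>(c, v)\<leftarrow>xs. cscale c (v ^ d))"

definition expr_of :: "nat \<Rightarrow> nat \<Rightarrow> nat cpoly \<Rightarrow> power_expr \<Rightarrow> bool" where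
  "expr_of n d f xs \<longleftrightarrow> (\<forall>(c, v)\<in>set xs. v \<in> vecs n) \<and> expr_value d xs = f"

definition sym_rank :: "nat \<Rightarrow> nat \<Rightarrow> nat cpoly \<Rightarrow> nat" where
  "sym_rank n d f = (LEAST r. \<exists>xs. expr_of n d f xs \<and> length xs = r)"

definition waring_decomposition :: "nat \<Rightarrow> nat \<Rightarrow> nat cpoly \<Rightarrow> power_expr \<Rightarrow> bool" where
  "waring_decomposition n d f xs \<longleftrightarrow> expr_of n d f xs \<and> length xs = sym_rank n d f"

definition expr_equiv :: "nat \<Rightarrow> power_expr \<Rightarrow> power_expr \<Rightarrow> bool" where
  "expr_equiv d xs ys \<longleftrightarrow> (\<exists>zs. mset zs = mset ys \<and>
     list_all2 (\<lambda>(a, v) (b, w). \<exists>t. t \<noteq> 0 \<and> w = cscale t v \<and> a = b * t ^ d) xs zs)"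

definition unique_waring_decomposition :: "nat \<Rightarrow> nat \<Rightarrow> nat cpoly \<Rightarrow> power_expr \<Rightarrow> bool" where
  "unique_waring_decomposition n d f xs \<longleftrightarrow> waring_decomposition n d f xs \<and>
     (\<forall>ys. waring_decomposition n d f ys \<longrightarrow> expr_equiv d xs ys)"

definition forms_of_rank :: "nat \<Rightarrow> nat \<Rightarrow> nat \<Rightarrow> nat cpoly set" where
  "forms_of_rank n d r = {f \<in> forms n d. sym_rank n d f = r}"

text \<open>
  The Zariski topology on a space of polynomials: regular functions are polynomials in the
  coefficients, i.e. the variables are indexed by the exponent vectors.
\<close>

definition zariski_open_in :: "nat cpoly set \<Rightarrow> nat cpoly set \<Rightarrow> bool" where
  "zariski_open_in F U \<longleftrightarrow> (\<exists>PP :: (nat \<Rightarrow>\<^sub>0 nat) cpoly set.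
     U = {f \<in> F. \<exists>P\<in>PP. poly_eval P (Poly_Mapping.lookup f) \<noteq> 0})"

definition zariski_dense_in :: "nat cpoly set \<Rightarrow> nat cpoly set \<Rightarrow> bool" where
  "zariski_dense_in F U \<longleftrightarrow> U \<subseteq> F \<and> (\<forall>P :: (nat \<Rightarrow>\<^sub>0 nat) cpoly.
     (\<forall>f\<in>U. poly_eval P (Poly_Mapping.lookup f) = 0) \<longrightarrow>
     (\<forall>f\<in>F. poly_eval P (Poly_Mapping.lookup f) = 0))"

text \<open>
  Irreducible spaces are nonempty by convention; the condition \<open>U \<noteq> {}\<close> excludes
  statements about an empty family.
\<close>

definition for_general :: "nat cpoly set \<Rightarrow> (nat cpoly \<Rightarrow> bool) \<Rightarrow> bool" where
  "for_general F Q \<longleftrightarrow>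
     (\<exists>U. U \<noteq> {} \<and> zariski_open_in F U \<and> zariski_dense_in F U \<and> (\<forall>f\<in>U. Q f))"

definition is_power_sum :: "nat \<Rightarrow> nat \<Rightarrow> nat \<Rightarrow> (nat \<Rightarrow> nat cpoly) \<Rightarrow> nat cpoly \<Rightarrow> bool" where
  "is_power_sum n d r v f \<longleftrightarrow> (\<forall>i\<in>{1..r}. v i \<in> vecs n) \<and> f = (\<Sum>i=1..r. v i ^ d)"

definition points :: "nat \<Rightarrow> (nat \<Rightarrow> nat cpoly) \<Rightarrow> nat cpoly set set" where
  "points r v = (\<lambda>i. line (v i)) ` {1..r}"

definition partial :: "nat \<Rightarrow> nat cpoly \<Rightarrow> nat cpoly" where
  "partial i f = (\<Sum>\<alpha>\<in>Poly_Mapping.keys f.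
     Poly_Mapping.single (\<alpha> - Poly_Mapping.single i 1)
       (of_nat (Poly_Mapping.lookup \<alpha> i) * Poly_Mapping.lookup f \<alpha>))"

text \<open>The partial derivatives commute, so the order of composition does not matter.\<close>

definition iter_partial :: "(nat \<Rightarrow>\<^sub>0 nat) \<Rightarrow> nat cpoly \<Rightarrow> nat cpoly" where
  "iter_partial \<alpha> f =
     foldr (\<lambda>i. partial i ^^ Poly_Mapping.lookup \<alpha> i) (sorted_list_of_set (Poly_Mapping.keys \<alpha>)) f"

text \<open>
  \<open>catalecticant f\<close>, restricted to \<open>forms n m\<close>, is the map \<open>C\<^sub>f\<^sup>m\<close> from \<open>S\<^sup>m V\<^sup>*\<close> to
  \<open>S\<^sup>d\<^sup>-\<^sup>m V\<close>.
\<close>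

definition catalecticant :: "nat cpoly \<Rightarrow> nat cpoly \<Rightarrow> nat cpoly" where
  "catalecticant f p =
     (\<Sum>\<alpha>\<in>Poly_Mapping.keys p. cscale (Poly_Mapping.lookup p \<alpha>) (iter_partial \<alpha> f))"

definition cat_ker :: "nat \<Rightarrow> nat \<Rightarrow> nat cpoly \<Rightarrow> nat cpoly set" where
  "cat_ker n m f = {p \<in> forms n m. catalecticant f p = 0}"

definition cat_rank :: "nat \<Rightarrow> nat \<Rightarrow> nat cpoly \<Rightarrow> nat" where
  "cat_rank n m f = cpoly.dim (catalecticant f ` forms n m)"

definition cat_order :: "nat \<Rightarrow> nat" where
  "cat_order d = nat \<lceil>real d / 2\<rceil>"

definition cat_zero_set :: "nat \<Rightarrow> nat \<Rightarrow> nat cpoly \<Rightarrow> nat cpoly set set" where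
  "cat_zero_set n d f = zero_set n (cat_ker n (cat_order d) f)"

definition cat_step3 :: "nat \<Rightarrow> nat \<Rightarrow> nat cpoly \<Rightarrow> bool" where
  "cat_step3 n d f \<longleftrightarrow>
     finite (cat_zero_set n d f) \<and> reduced_zero_scheme n (cat_ker n (cat_order d) f)"

text \<open>
  Step (4) for the set of points \<open>Y\<close>, as a relation to the possible outputs: the
  representatives of the points and the solution of the linear system are arbitrary.
\<close>

definition cat_step4 ::
  "nat \<Rightarrow> nat \<Rightarrow> nat cpoly \<Rightarrow> nat cpoly set set \<Rightarrow> power_expr \<Rightarrow> bool" where
  "cat_step4 n d f Y out \<longleftrightarrow> (\<exists>vs cs.
     set vs \<subseteq> vecs n - {0} \<and> distinct (map line vs) \<and> set (map line vs) = Y \<and>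
     length cs = length vs \<and> expr_value d (zip cs vs) = f \<and>
     out = filter (\<lambda>(c, v). c \<noteq> 0) (zip cs vs))"

definition cat_algorithm :: "nat \<Rightarrow> nat \<Rightarrow> nat cpoly \<Rightarrow> power_expr \<Rightarrow> bool" where
  "cat_algorithm n d f out \<longleftrightarrow> cat_step3 n d f \<and> cat_step4 n d f (cat_zero_set n d f) out"

text \<open>
  The variant that repeats step (4) with the subsets of \<open>Z'\<close> of size \<open>rank C\<^sub>f\<close> until the linear
  system is solvable.  Since step (3) requires \<open>Z'\<close> to be finite, there are finitely many of them;
  the order in which they are tried is arbitrary, so any solvable one may be the source of the
  output.
\<close>

definition cat_algorithm_subsets :: "nat \<Rightarrow> nat \<Rightarrow> nat cpoly \<Rightarrow> power_expr \<Rightarrow> bool" where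
  "cat_algorithm_subsets n d f out \<longleftrightarrow> cat_step3 n d f \<and>
     (\<exists>Y \<subseteq> cat_zero_set n d f. card Y = cat_rank n (cat_order d) f \<and> cat_step4 n d f Y out)"

text \<open>
  The algorithm terminates with an output, and whatever choices are made, the output is the
  Waring decomposition of \<open>f\<close>, which is unique.
\<close>

definition produces_unique_waring ::
  "(nat \<Rightarrow> nat \<Rightarrow> nat cpoly \<Rightarrow> power_expr \<Rightarrow> bool) \<Rightarrow> nat \<Rightarrow> nat \<Rightarrow> nat cpoly \<Rightarrow> bool" where
  "produces_unique_waring alg n d f \<longleftrightarrow>
     (\<exists>out. alg n d f out) \<and> (\<forall>out. alg n d f out \<longrightarrow> unique_waring_decomposition n d f out)"

end

theory Submission
  imports Defs "HOL-Library.FuncSet" "HOL-Computational_Algebra.Fundamental_Theorem_Algebra"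
    "HOL-Computational_Algebra.Field_as_Ring" "Jordan_Normal_Form.Determinant" "Subresultants.Subresultant_Gcd"
begin

text \<open>
  The kernel, the zero set and its reducedness are determined at one explicit configuration of
  points and then spread to the general one.  The form \<open>f = \<Sum>\<^sub>i v\<^sub>i\<^sup>d\<close> is the functional
  \<open>g \<mapsto> \<Sum>\<^sub>i g(v\<^sub>i)\<close> on forms of degree \<open>d\<close> in the dual variables, so if the \<open>v\<^sub>i\<close> have Lagrange
  polynomials of degree \<open>d - m\<close>, then the kernel of \<open>C\<^sub>f\<close> consists of the forms of degree \<open>m\<close> that
  vanish at the \<open>v\<^sub>i\<close>, and a rank count places every decomposition of \<open>f\<close> of length \<open>r\<close> in their
  zero set.

  The special points are lattice points \<open>(1, b)\<close>: with \<open>\<bar>b\<bar> < m\<close> if \<open>d\<close> is odd, and in the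
  grid \<open>{0, \<dots>, m - 1}\<^sup>n\<close> with \<open>\<bar>b\<bar> \<le> m\<close> if \<open>d\<close> is even.  There are \<open>(n + m choose n) - n\<close> of the
  latter; the forms of degree \<open>m\<close> vanishing at all of them cut out the whole grid, a complete
  intersection, whereas if the origin is left out they cut out just the remaining points.
  Newton interpolation makes these ideals explicit, and since spanning and squarefreeness are
  open conditions, the ideals of nearby configurations have the same shape.

  The map \<open>(v\<^sub>i) \<mapsto> f\<close> has a left invertible Jacobian at the special configuration; hence its
  coordinates contain a transcendence basis of the function field of the configurations, so a
  general form of rank \<open>r\<close> has only general decompositions, and all of them have the same tangent
  space.  For \<open>n = 2\<close> uniqueness follows as the \<open>d\<close>-th powers of all grid points are independent.
  For \<open>n \<ge> 3\<close> it follows as the forms of degree \<open>2 m\<close> that are singular at the points of one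
  decomposition are singular at those of any other, and do not all vanish at a further base point.
\<close>

text \<open>Explicit computation controls only configurations near a special one, while the claim is
  about every representation of a general \<open>f\<close>, and a second one could lie far away. So
  each open condition on configurations is traded for the nonvanishing of a polynomial in the
  coefficients of \<open>f\<close>: the lowest nonzero coefficient of an algebraic relation for
  \<open>G\<close> vanishes wherever \<open>G\<close> does. Nearby configurations are reached by
  correcting every generator with Lagrange forms, so that it vanishes at the moved points. Extra
  base points move in an unknown way; for them a linear form that separates the grid takes over:
  modulo the ideal all forms become polynomials in it, and simple roots stay simple. The case
  \<open>n = 2\<close> is apart because the whole grid imposes independent conditions on forms of
  degree \<open>2 * m\<close> if \<open>n * (m - 1) \<le> 2 * m\<close>, which fails for
  \<open>n \<ge> 3\<close> and large \<open>m\<close>. Singular forms replace this argument: they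
  are the annihilator of the tangent space.\<close>

lemma underdetermined_system:
  fixes c :: "'a \<Rightarrow> 'b \<Rightarrow> 'c::field"
  assumes "finite B" "finite A" "card B < card A"
  shows "\<exists>x. (\<exists>a\<in>A. x a \<noteq> 0) \<and> (\<forall>b\<in>B. (\<Sum>a\<in>A. x a * c a b) = 0)"
  using assms
proof (induction B arbitrary: A c rule: finite_induct)
  case empty
  then have "A \<noteq> {}" by auto
  then show ?case by (intro exI[of _ "\<lambda>_. 1"]) auto
next
  case (insert b B)
  show ?case
  proof (cases "\<forall>a\<in>A. c a b = 0")
    case True
    obtain x where "\<exists>a\<in>A. x a \<noteq> 0" "\<forall>b\<in>B. (\<Sum>a\<in>A. x a * c a b) = 0"
      using insert.IH[of A c] insert.prems insert.hyps by auto
    with True show ?thesis by (intro exI[of _ x]) auto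
  next
    case False
    then obtain a0 where a0: "a0 \<in> A" "c a0 b \<noteq> 0" by auto
    \<comment> \<open>The unknown \<open>a0\<close> is the pivot: equation \<open>b\<close>
      expresses it by the others, and the induction hypothesis is applied to the equations from
      which it has been eliminated.\<close>
    define A' where "A' = A - {a0}"
    have A': "finite A'" "A = insert a0 A'" "a0 \<notin> A'" "card B < card A'"
      using a0 insert.prems insert.hyps by (auto simp: A'_def card_Diff_singleton)
    obtain x where x: "\<exists>a\<in>A'. x a \<noteq> 0"
        "\<forall>b'\<in>B. (\<Sum>a\<in>A'. x a * (c a b' - c a b / c a0 b * c a0 b')) = 0"
      using insert.IH[OF A'(1,4), of "\<lambda>a b'. c a b' - c a b / c a0 b * c a0 b'"] by blast
    define y where "y a = (if a = a0 then - (\<Sum>a\<in>A'. x a * c a b / c a0 b) else x a)" for a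
    have ys: "(\<Sum>a\<in>A. y a * c a b') = - (\<Sum>a\<in>A'. x a * c a b / c a0 b) * c a0 b' + (\<Sum>a\<in>A'. x a * c a b')" for b'
    proof -
      have "(\<Sum>a\<in>A'. y a * c a b') = (\<Sum>a\<in>A'. x a * c a b')"
        using A'(3) by (intro sum.cong) (auto simp: y_def)
      then show ?thesis using A' by (simp add: y_def)
    qed
    have "\<exists>a\<in>A. y a \<noteq> 0" using x(1) A' by (auto simp: y_def intro!: bexI)
    moreover have "(\<Sum>a\<in>A. y a * c a b') = 0" if "b' \<in> B" for b'
    proof -
      have "0 = (\<Sum>a\<in>A'. x a * (c a b' - c a b / c a0 b * c a0 b'))" using x(2) that by simp
      also have "\<dots> = (\<Sum>a\<in>A'. x a * c a b') - (\<Sum>a\<in>A'. x a * c a b / c a0 b * c a0 b')"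
        by (simp add: algebra_simps sum_subtractf)
      also have "\<dots> = (\<Sum>a\<in>A. y a * c a b')" unfolding ys by (simp add: sum_distrib_right)
      finally show ?thesis by simp
    qed
    moreover have "(\<Sum>a\<in>A. y a * c a b) = 0"
      unfolding ys using a0(2) by (simp add: sum_distrib_right)
    ultimately show ?thesis by (intro exI[of _ y]) auto
  qed
qed

text \<open>Uniqueness of the expansion in base \<open>k\<close>. It serves the Kronecker
  substitution for monomials and the linear form that separates the grid points.\<close>

lemma digits_inj:
  fixes a b :: "nat \<Rightarrow> nat"
  assumes "\<forall>i<M. a i < k" "\<forall>i<M. b i < k" "(\<Sum>i<M. a i * k ^ i) = (\<Sum>i<M. b i * k ^ i)"
  shows "\<forall>i<M. a i = b i"
  using assms
proof (induction M arbitrary: a b)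
  case (Suc M)
  have split: "(\<Sum>i<Suc M. f i * k ^ i) = f 0 + k * (\<Sum>i<M. f (Suc i) * k ^ i)" for f :: "nat \<Rightarrow> nat"
    by (subst sum.lessThan_Suc_shift) (auto simp: sum_distrib_left intro!: sum.cong)
  have k: "a 0 < k" "b 0 < k" using Suc.prems by auto
  have eq: "a 0 + k * (\<Sum>i<M. a (Suc i) * k ^ i) = b 0 + k * (\<Sum>i<M. b (Suc i) * k ^ i)"
    using Suc.prems(3) unfolding split .
  from arg_cong[OF eq, of "\<lambda>x. x mod k"] have 1: "a 0 = b 0"
    using k by (simp only: mod_mult_self2 mod_less)
  have k0: "k \<noteq> 0" using k(1) by (rule gr_implies_not0)
  from eq have "(\<Sum>i<M. a (Suc i) * k ^ i) = (\<Sum>i<M. b (Suc i) * k ^ i)"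
    by (simp only: 1 add_left_cancel mult_cancel1 k0 simp_thms)
  moreover have "\<forall>i<M. a (Suc i) < k" "\<forall>i<M. b (Suc i) < k" using Suc.prems(1,2) by auto
  ultimately have "\<forall>i<M. a (Suc i) = b (Suc i)"
    using Suc.IH[of "\<lambda>i. a (Suc i)" "\<lambda>i. b (Suc i)"] by blast
  show ?case
  proof (intro allI impI)
    fix i assume "i < Suc M"
    with 1 \<open>\<forall>i<M. a (Suc i) = b (Suc i)\<close> show "a i = b i" by (cases i) auto
  qed
qed simp

section \<open>Polynomial functions\<close>

text \<open>Polynomials are represented by the functions that they define, so that composition and
  equality need no syntax. The number \<open>k\<close> is only an upper bound for the
  degree.\<close>

inductive poldeg :: "'a set \<Rightarrow> nat \<Rightarrow> (('a \<Rightarrow> complex) \<Rightarrow> complex) \<Rightarrow> bool" for I where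
  const: "poldeg I k (\<lambda>_. c)"
| var: "i \<in> I \<Longrightarrow> poldeg I k p \<Longrightarrow> poldeg I (Suc k) (\<lambda>x. x i * p x)"
| add: "poldeg I k p \<Longrightarrow> poldeg I k q \<Longrightarrow> poldeg I k (\<lambda>x. p x + q x)"

lemma poldeg_mono: "poldeg I k p \<Longrightarrow> k \<le> l \<Longrightarrow> poldeg I l p"
proof (induction arbitrary: l rule: poldeg.induct)
  case (const k c)
  show ?case by (rule poldeg.const)
next
  case (var i k p)
  obtain l' where l': "l = Suc l'" "k \<le> l'" using var.prems by (cases l) auto
  show ?case unfolding l'(1) by (rule poldeg.var[OF var.hyps(1) var.IH[OF l'(2)]])
next
  case (add k p q)
  show ?case by (rule poldeg.add[OF add.IH(1)[OF add.prems] add.IH(2)[OF add.prems]])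
qed

lemma poldeg_cmult: "poldeg I k p \<Longrightarrow> poldeg I k (\<lambda>x. c * p x)"
proof (induction rule: poldeg.induct)
  case (const k a)
  show ?case by (rule poldeg.const)
next
  case (var i k p)
  have "(\<lambda>x. c * (x i * p x)) = (\<lambda>x. x i * (c * p x))" by (simp add: fun_eq_iff)
  then show ?case using poldeg.var[OF var.hyps(1) var.IH] by simp
next
  case (add k p q)
  show ?case unfolding distrib_left by (rule poldeg.add[OF add.IH])
qed

lemma poldeg_mult: "poldeg I k p \<Longrightarrow> poldeg I l q \<Longrightarrow> poldeg I (k + l) (\<lambda>x. p x * q x)"
proof (induction rule: poldeg.induct)
  case (const k c)
  show ?case by (rule poldeg_mono[OF poldeg_cmult[OF const]]) simp
next
  case (var i k p)
  show ?case unfolding mult.assoc add_Suc by (rule poldeg.var[OF var.hyps(1) var.IH[OF var.prems]])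
next
  case (add k p p')
  show ?case unfolding distrib_right by (rule poldeg.add[OF add.IH(1)[OF add.prems] add.IH(2)[OF add.prems]])
qed

definition pol :: "'a set \<Rightarrow> (('a \<Rightarrow> complex) \<Rightarrow> complex) \<Rightarrow> bool" where
  "pol I p \<longleftrightarrow> (\<exists>k. poldeg I k p)"

lemma pol_const [simp]: "pol I (\<lambda>_. c)"
  unfolding pol_def by (rule exI, rule poldeg.const[of I 0])

lemma pol_add:
  assumes "pol I p" "pol I q"
  shows "pol I (\<lambda>x. p x + q x)"
proof -
  obtain k l where kl: "poldeg I k p" "poldeg I l q" using assms unfolding pol_def by blast
  have "poldeg I (max k l) p" by (rule poldeg_mono[OF kl(1)]) simp
  moreover have "poldeg I (max k l) q" by (rule poldeg_mono[OF kl(2)]) simp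
  ultimately show ?thesis unfolding pol_def by (intro exI) (rule poldeg.add)
qed

lemma pol_mult:
  assumes "pol I p" "pol I q"
  shows "pol I (\<lambda>x. p x * q x)"
proof -
  obtain k l where kl: "poldeg I k p" "poldeg I l q" using assms unfolding pol_def by blast
  show ?thesis unfolding pol_def by (rule exI, rule poldeg_mult[OF kl])
qed

lemma pol_var: "i \<in> I \<Longrightarrow> pol I (\<lambda>x. x i)"
  using poldeg.var[of i I 0 "\<lambda>_. 1", OF _ poldeg.const] unfolding pol_def by auto

lemma pol_sum: "(\<And>a. a \<in> S \<Longrightarrow> pol I (p a)) \<Longrightarrow> pol I (\<lambda>x. \<Sum>a\<in>S. p a x)"
  by (induction S rule: infinite_finite_induct) (simp_all add: pol_add)

lemma pol_prod: "(\<And>a. a \<in> S \<Longrightarrow> pol I (p a)) \<Longrightarrow> pol I (\<lambda>x. \<Prod>a\<in>S. p a x)"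
  by (induction S rule: infinite_finite_induct) (simp_all add: pol_mult)

lemma pol_power: "pol I p \<Longrightarrow> pol I (\<lambda>x. p x ^ k)"
  by (induction k) (simp_all add: pol_mult)

lemma pol_induct [consumes 1, case_names const var add]:
  assumes "pol I p" "\<And>c. P (\<lambda>_. c)" "\<And>i p. i \<in> I \<Longrightarrow> pol I p \<Longrightarrow> P p \<Longrightarrow> P (\<lambda>x. x i * p x)"
    "\<And>p q. pol I p \<Longrightarrow> pol I q \<Longrightarrow> P p \<Longrightarrow> P q \<Longrightarrow> P (\<lambda>x. p x + q x)"
  shows "P p"
proof -
  obtain k where "poldeg I k p" using assms(1) unfolding pol_def by blast
  then show ?thesis
  proof induction
    case (var i k p)
    then show ?case using assms(3)[of i p] unfolding pol_def by blast
  next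
    case (add k p q)
    then show ?case using assms(4)[of p q] unfolding pol_def by blast
  qed (rule assms(2))
qed

lemma pol_comp:
  assumes "pol J p" "\<And>j. j \<in> J \<Longrightarrow> pol I (f j)"
  shows "pol I (\<lambda>x. p (\<lambda>j. f j x))"
  using assms(1) by (induction rule: pol_induct) (simp_all add: assms(2) pol_mult pol_add)

lemma pol_cong: "pol I p \<Longrightarrow> (\<And>i. i \<in> I \<Longrightarrow> x i = y i) \<Longrightarrow> p x = p y"
  by (induction rule: pol_induct) auto

lemma pol_line: "pol I p \<Longrightarrow> \<exists>P. \<forall>s. p (\<lambda>i. x i + s * u i) = poly P s"
proof (induction rule: pol_induct)
  case (const c)
  show ?case by (rule exI[of _ "[:c:]"]) simp
next
  case (var i p)
  then obtain P where "\<forall>s. p (\<lambda>i. x i + s * u i) = poly P s" by auto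
  then show ?case by (intro exI[of _ "[:x i, u i:] * P"]) (simp add: algebra_simps)
next
  case (add p q)
  then obtain P Q where "\<forall>s. p (\<lambda>i. x i + s * u i) = poly P s" "\<forall>s. q (\<lambda>i. x i + s * u i) = poly Q s"
    by auto
  then show ?case by (intro exI[of _ "P + Q"]) simp
qed

text \<open>Restricted to the line through \<open>x\<close> and \<open>y\<close>, the two functions
  become univariate polynomials that are nonzero at 0 and at 1 respectively.\<close>

lemma pol_nonzero_mult:
  assumes "pol I p" "pol I q" "p x \<noteq> 0" "q y \<noteq> 0"
  shows "\<exists>z. p z * q z \<noteq> 0"
proof -
  obtain P where P: "\<forall>s. p (\<lambda>i. x i + s * (y i - x i)) = poly P s" using pol_line[OF assms(1), of x "\<lambda>i. y i - x i"] ..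
  obtain Q where Q: "\<forall>s. q (\<lambda>i. x i + s * (y i - x i)) = poly Q s" using pol_line[OF assms(2), of x "\<lambda>i. y i - x i"] ..
  have "poly P 0 \<noteq> 0" "poly Q 1 \<noteq> 0" using assms(3,4) P[rule_format, of 0] Q[rule_format, of 1] by auto
  then have "P * Q \<noteq> 0" by auto
  then obtain s where "poly (P * Q) s \<noteq> 0" using poly_all_0_iff_0 by blast
  with P Q show ?thesis by (intro exI[of _ "\<lambda>i. x i + s * (y i - x i)"]) auto
qed

text \<open>Density of nonempty Zariski open sets, in the form in which an identity known where
  \<open>p\<close> is nonzero is extended to all points.\<close>

lemma pol_zero_if_mult_zero:
  assumes "pol I p" "pol I q" "p x \<noteq> 0" "\<And>z. p z \<noteq> 0 \<Longrightarrow> q z = 0"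
  shows "q z = 0"
  using pol_nonzero_mult[OF assms(1,2,3), of z] assms(4) by fastforce

lemma pol_nonzero_prod:
  assumes "finite S" "\<And>a. a \<in> S \<Longrightarrow> pol I (p a)" "\<And>a. a \<in> S \<Longrightarrow> \<exists>x. p a x \<noteq> 0"
  shows "\<exists>x. (\<Prod>a\<in>S. p a x) \<noteq> 0"
  using assms
proof (induction S rule: finite_induct)
  case (insert a S)
  have "\<exists>x. p a x \<noteq> 0" "\<exists>y. (\<Prod>a\<in>S. p a y) \<noteq> 0" using insert by simp_all
  then obtain x y where "p a x \<noteq> 0" "(\<Prod>a\<in>S. p a y) \<noteq> 0" by blast
  moreover have "pol I (p a)" "pol I (\<lambda>x. \<Prod>a\<in>S. p a x)" using insert.prems(1) by (simp_all add: pol_prod)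
  ultimately show ?case using pol_nonzero_mult[of I "p a" "\<lambda>x. \<Prod>a\<in>S. p a x"] insert.hyps by simp
qed auto

definition power_product :: "'a set \<Rightarrow> ('a \<Rightarrow> nat) \<Rightarrow> ('a \<Rightarrow> complex) \<Rightarrow> complex" where
  "power_product I b x = (\<Prod>i\<in>I. x i ^ b i)"

lemma pol_mono: "pol I (power_product I b)"
  unfolding power_product_def[abs_def] by (intro pol_prod pol_power pol_var)

text \<open>Bounding each exponent separately, rather than their sum, makes the index set a product
  whose cardinality is a power; the dimension count for algebraic relations relies on this.\<close>

lemma poldeg_monos:
  assumes "poldeg I k p" "finite I"
  shows "\<exists>c. \<forall>x. p x = (\<Sum>b\<in>Pi\<^sub>E I (\<lambda>_. {..k}). c b * power_product I b x)"
  using assms(1)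
proof induction
  case (const k c)
  define b0 where "b0 = (\<lambda>i\<in>I. 0::nat)"
  have "b0 \<in> Pi\<^sub>E I (\<lambda>_. {..k})" by (auto simp: b0_def)
  moreover have "power_product I b0 x = 1" for x by (simp add: power_product_def b0_def)
  ultimately have "(\<Sum>b\<in>Pi\<^sub>E I (\<lambda>_. {..k}). (if b = b0 then c else 0) * power_product I b x) = c" for x
    using assms(2) by (simp add: if_distrib[of "\<lambda>c. c * _"] finite_PiE cong: if_cong)
  then show ?case by (intro exI[of _ "\<lambda>b. if b = b0 then c else 0"]) simp
next
  case (var i k p)
  then obtain c where c: "\<forall>x. p x = (\<Sum>b\<in>Pi\<^sub>E I (\<lambda>_. {..k}). c b * power_product I b x)" by blast
  let ?h = "\<lambda>b. b(i := Suc (b i))"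
  let ?g = "\<lambda>b. b(i := b i - 1)"
  have inj: "inj_on ?h (Pi\<^sub>E I (\<lambda>_. {..k}))"
    by (rule inj_on_inverseI[of _ ?g]) auto
  have sub: "?h ` (Pi\<^sub>E I (\<lambda>_. {..k})) \<subseteq> Pi\<^sub>E I (\<lambda>_. {..Suc k})"
    using var(1) by (auto simp: PiE_iff extensional_def le_SucI)
  have m: "power_product I (?h b) x = x i * power_product I b x" for b x
    using var(1) assms(2) by (simp add: power_product_def prod.remove[of I i])
  define c' where "c' b = (if b \<in> ?h ` (Pi\<^sub>E I (\<lambda>_. {..k})) then c (?g b) else 0)" for b
  have "x i * p x = (\<Sum>b\<in>Pi\<^sub>E I (\<lambda>_. {..Suc k}). c' b * power_product I b x)" for x
  proof -
    have "x i * p x = (\<Sum>b\<in>Pi\<^sub>E I (\<lambda>_. {..k}). c b * power_product I (?h b) x)"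
      unfolding c[rule_format] m sum_distrib_left by (simp add: mult_ac)
    also have "\<dots> = (\<Sum>b\<in>Pi\<^sub>E I (\<lambda>_. {..k}). c' (?h b) * power_product I (?h b) x)"
      by (intro sum.cong) (auto simp: c'_def)
    also have "\<dots> = (\<Sum>b\<in>?h ` (Pi\<^sub>E I (\<lambda>_. {..k})). c' b * power_product I b x)"
      by (subst sum.reindex[OF inj]) simp
    also have "\<dots> = (\<Sum>b\<in>Pi\<^sub>E I (\<lambda>_. {..Suc k}). c' b * power_product I b x)"
      using sub assms(2) by (intro sum.mono_neutral_left) (auto simp: finite_PiE c'_def)
    finally show ?thesis .
  qed
  then show ?case by blast
next
  case (add k p q)
  then obtain c d where "\<forall>x. p x = (\<Sum>b\<in>Pi\<^sub>E I (\<lambda>_. {..k}). c b * power_product I b x)"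
    "\<forall>x. q x = (\<Sum>b\<in>Pi\<^sub>E I (\<lambda>_. {..k}). d b * power_product I b x)" by blast
  then show ?case by (intro exI[of _ "\<lambda>b. c b + d b"]) (simp add: distrib_right sum.distrib)
qed

text \<open>Kronecker substitution: \<open>s ^ (k ^ h i)\<close> in place of the variable
  \<open>i\<close> sends monomials with exponents below \<open>k\<close> to distinct powers of
  \<open>s\<close>, by uniqueness of base \<open>k\<close> digits.\<close>

lemma monos_independent:
  assumes "finite I" "\<And>y. (\<Sum>b\<in>Pi\<^sub>E I (\<lambda>_. {..<k}). x b * power_product I b y) = 0" "b \<in> Pi\<^sub>E I (\<lambda>_. {..<k})"
  shows "x b = 0"
proof -
  obtain h where h: "bij_betw h I {..<card I}" using assms(1) ex_bij_betw_finite_nat lessThan_atLeast0 by metis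
  define S where "S = Pi\<^sub>E I (\<lambda>_. {..<k})"
  have fin: "finite S" using assms(1) by (auto simp: S_def finite_PiE)
  define e where "e b = (\<Sum>i\<in>I. b i * k ^ h i)" for b
  have e: "e b = (\<Sum>j<card I. b (inv_into I h j) * k ^ j)" for b
    unfolding e_def using h by (intro sum.reindex_bij_witness[of _ "inv_into I h" h])
      (auto simp: bij_betw_def inv_into_into f_inv_into_f)
  have inj: "inj_on e S"
  proof (rule inj_onI)
    fix a b assume ab: "a \<in> S" "b \<in> S" "e a = e b"
    have mem: "inv_into I h j \<in> I" if "j < card I" for j
      using h that by (auto simp: bij_betw_def intro!: inv_into_into)
    have "\<forall>j<card I. a (inv_into I h j) = b (inv_into I h j)"
    proof (rule digits_inj)
      show "\<forall>j<card I. a (inv_into I h j) < k" "\<forall>j<card I. b (inv_into I h j) < k"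
        using ab mem by (auto simp: S_def PiE_iff)
      show "(\<Sum>j<card I. a (inv_into I h j) * k ^ j) = (\<Sum>j<card I. b (inv_into I h j) * k ^ j)"
        using ab(3) by (simp add: e)
    qed
    moreover have "i \<in> I \<Longrightarrow> i = inv_into I h (h i) \<and> h i < card I" for i
      using h by (auto simp: bij_betw_def)
    ultimately have "\<forall>i\<in>I. a i = b i" by metis
    with ab show "a = b" by (auto simp: S_def PiE_iff extensional_def fun_eq_iff)
  qed
  define P where "P = (\<Sum>b\<in>S. Polynomial.monom (x b) (e b))"
  have "poly P s = 0" for s
  proof -
    have "poly P s = (\<Sum>b\<in>S. x b * power_product I b (\<lambda>i. s ^ (k ^ h i)))"
      by (simp add: P_def poly_sum poly_monom power_product_def e_def power_sum mult_ac flip: power_mult)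
    then show ?thesis using assms(2) by (simp add: S_def)
  qed
  then have "P = 0" using poly_all_0_iff_0 by blast
  then have "0 = poly.coeff P (e b)" by simp
  also have "\<dots> = (\<Sum>b'\<in>S. if b' = b then x b' else 0)"
    unfolding P_def coeff_sum using inj assms(3)
    by (intro sum.cong) (auto simp: S_def[symmetric] inj_on_eq_iff)
  also have "\<dots> = x b" using fin assms(3) by (simp add: S_def)
  finally show ?thesis by simp
qed

text \<open>The chain rule along arbitrary curves is taken as the definition, because it passes
  through sums and products by induction and is later applied to curves
  \<open>\<psi> (v + s u)\<close> that are not lines.\<close>

definition is_gradient :: "'a set \<Rightarrow> (('a \<Rightarrow> complex) \<Rightarrow> complex) \<Rightarrow> ('a \<Rightarrow> ('a \<Rightarrow> complex) \<Rightarrow> complex) \<Rightarrow> bool" where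
  "is_gradient I p q \<longleftrightarrow> (\<forall>c c' s. (\<forall>i\<in>I. ((\<lambda>s. c s i) has_field_derivative c' i) (at s)) \<longrightarrow>
      ((\<lambda>s. p (c s)) has_field_derivative (\<Sum>i\<in>I. q i (c s) * c' i)) (at (s::complex)))"

lemma is_gradientD:
  "is_gradient I p q \<Longrightarrow> \<forall>i\<in>I. ((\<lambda>s. c s i) has_field_derivative c' i) (at s) \<Longrightarrow>
      ((\<lambda>s. p (c s)) has_field_derivative (\<Sum>i\<in>I. q i (c s) * c' i)) (at s)"
  unfolding is_gradient_def by simp

text \<open>Truncated subtraction gives no drop of degree at \<open>k = 0\<close>; the separate
  clause that the gradient then vanishes stands in for the degree bound -1 and makes inductions on
  the degree possible.\<close>

lemma pol_gradient_ex:
  assumes "poldeg I k p" "finite I"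
  shows "\<exists>q. (\<forall>i\<in>I. poldeg I (k - 1) (q i)) \<and> (k = 0 \<longrightarrow> (\<forall>i x. q i x = 0)) \<and> is_gradient I p q"
  using assms(1)
proof induction
  case (const k c)
  show ?case by (intro exI[of _ "\<lambda>_ _. 0"]) (simp add: poldeg.const is_gradient_def)
next
  case (var i k p)
  then obtain q where q: "\<forall>i\<in>I. poldeg I (k - 1) (q i)" "k = 0 \<longrightarrow> (\<forall>i x. q i x = 0)"
    "is_gradient I p q" by blast
  define q' where "q' j x = x i * q j x + (if j = i then p x else 0)" for j x
  have 1: "poldeg I k (\<lambda>x. x i * q j x)" if "j \<in> I" for j
  proof (cases k)
    case 0
    then have "(\<lambda>x. x i * q j x) = (\<lambda>x. 0)" using q by simp
    then show ?thesis by (simp only: poldeg.const)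
  next
    case (Suc k')
    then show ?thesis using q(1) that var(1) poldeg.var[of i I k' "q j"] by simp
  qed
  have "poldeg I k (q' j)" if "j \<in> I" for j
    using poldeg.add[OF 1[OF that] var(2)] 1[OF that] by (cases "j = i") (simp_all add: q'_def[abs_def])
  moreover have "is_gradient I (\<lambda>x. x i * p x) q'"
    unfolding is_gradient_def
  proof (intro allI impI)
    fix c c' and s :: complex
    assume c: "\<forall>i\<in>I. ((\<lambda>s. c s i) has_field_derivative c' i) (at s)"
    have "((\<lambda>s. c s i * p (c s)) has_field_derivative c' i * p (c s) + (\<Sum>i\<in>I. q i (c s) * c' i) * c s i) (at s)"
      using is_gradientD[OF q(3) c] c var(1) by (intro DERIV_mult) simp_all
    moreover have "(\<Sum>j\<in>I. q' j (c s) * c' j) = c' i * p (c s) + (\<Sum>i\<in>I. q i (c s) * c' i) * c s i"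
      using var(1) assms(2) by (simp add: q'_def distrib_right distrib_left sum.distrib sum_distrib_right
          sum_distrib_left mult_ac if_distrib[of "\<lambda>c. _ * c"] cong: if_cong)
    ultimately show "((\<lambda>s. c s i * p (c s)) has_field_derivative (\<Sum>j\<in>I. q' j (c s) * c' j)) (at s)"
      by simp
  qed
  ultimately show ?case by (intro exI[of _ q']) simp
next
  case (add k p p')
  obtain q where q: "\<forall>i\<in>I. poldeg I (k - 1) (q i)" "k = 0 \<longrightarrow> (\<forall>i x. q i x = 0)"
    "is_gradient I p q" using add.IH(1) by blast
  obtain q' where q': "\<forall>i\<in>I. poldeg I (k - 1) (q' i)" "k = 0 \<longrightarrow> (\<forall>i x. q' i x = 0)"
    "is_gradient I p' q'" using add.IH(2) by blast
  have "is_gradient I (\<lambda>x. p x + p' x) (\<lambda>i x. q i x + q' i x)"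
    unfolding is_gradient_def distrib_right sum.distrib
    by (intro allI impI DERIV_add is_gradientD[OF q(3)] is_gradientD[OF q'(3)])
  moreover have "\<forall>i\<in>I. poldeg I (k - 1) (\<lambda>x. q i x + q' i x)" using q(1) q'(1) by (simp add: poldeg.add)
  ultimately show ?case using q(2) q'(2) by (intro exI[of _ "\<lambda>i x. q i x + q' i x"]) simp
qed

text \<open>A total function, so that derivatives can be written down without a differentiability
  proof; for polynomial functions \<open>pol_dd\<close> shows that it is the directional
  derivative.\<close>

definition dd :: "(('a \<Rightarrow> complex) \<Rightarrow> complex) \<Rightarrow> ('a \<Rightarrow> complex) \<Rightarrow> ('a \<Rightarrow> complex) \<Rightarrow> complex" where
  "dd p x u = (THE D. ((\<lambda>s. p (\<lambda>i. x i + s * u i)) has_field_derivative D) (at 0))"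

definition unitv :: "'a \<Rightarrow> 'a \<Rightarrow> complex" where
  "unitv i j = (if i = j then 1 else 0)"

lemma curve_line: "((\<lambda>s. x i + s * u i) has_field_derivative u i) (at (s::complex))"
  by (auto intro!: derivative_eq_intros)

lemma dd_eqI: "((\<lambda>s. p (\<lambda>i. x i + s * u i)) has_field_derivative D) (at 0) \<Longrightarrow> dd p x u = D"
  unfolding dd_def by (rule the_equality) (auto dest: DERIV_unique)

lemma pol_gradient:
  assumes "poldeg I k p" "finite I"
  obtains q where "\<forall>i\<in>I. poldeg I (k - 1) (q i)" "k = 0 \<longrightarrow> (\<forall>i x. q i x = 0)"
    "\<And>x i. i \<in> I \<Longrightarrow> dd p x (unitv i) = q i x" "\<And>x u. dd p x u = (\<Sum>i\<in>I. q i x * u i)"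
    "is_gradient I p q"
proof -
  obtain q where q: "\<forall>i\<in>I. poldeg I (k - 1) (q i)" "k = 0 \<longrightarrow> (\<forall>i x. q i x = 0)"
    "is_gradient I p q"
    using pol_gradient_ex[OF assms] by blast
  have 1: "dd p x u = (\<Sum>i\<in>I. q i x * u i)" for x u
    using is_gradientD[OF q(3), of "\<lambda>s i. x i + s * u i" u 0] by (intro dd_eqI) (simp add: curve_line)
  have "dd p x (unitv i) = q i x" if "i \<in> I" for x i
    using that assms(2) by (simp add: 1 unitv_def if_distrib[of "\<lambda>c. _ * c"] cong: if_cong)
  from that[OF q(1,2) this 1 q(3)] show ?thesis .
qed

lemma pol_dd:
  assumes "pol I p" "finite I"
  shows "dd p x u = (\<Sum>i\<in>I. dd p x (unitv i) * u i)" (is ?A)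
    and "pol I (\<lambda>x. dd p x u)" (is ?B)
    and "(\<forall>i\<in>I. ((\<lambda>s. c s i) has_field_derivative c' i) (at s)) \<Longrightarrow>
      ((\<lambda>s. p (c s)) has_field_derivative dd p (c s) c') (at s)" (is "?D \<Longrightarrow> ?C")
    and "((\<lambda>s. p (\<lambda>i. x i + s * u i)) has_field_derivative dd p x u) (at 0)" (is ?E)
proof -
  obtain k where k: "poldeg I k p" using assms(1) unfolding pol_def by blast
  obtain q where q: "\<forall>i\<in>I. poldeg I (k - 1) (q i)" "k = 0 \<longrightarrow> (\<forall>i x. q i x = 0)"
    "\<And>x i. i \<in> I \<Longrightarrow> dd p x (unitv i) = q i x" "\<And>x u. dd p x u = (\<Sum>i\<in>I. q i x * u i)"
    "is_gradient I p q"
    by (rule pol_gradient[OF k assms(2)]) (rule that)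
  show ?A using q(3,4) by simp
  show ?B unfolding q(4) using q(1) by (intro pol_sum pol_mult pol_const) (simp only: pol_def, blast)
  show ?C if ?D using is_gradientD[OF q(5) that] by (simp add: q(4))
  show ?E using is_gradientD[OF q(5), of "\<lambda>s i. x i + s * u i" u 0] by (simp add: curve_line q(4))
qed

lemma dd_add: "pol I p \<Longrightarrow> pol I q \<Longrightarrow> finite I \<Longrightarrow> dd (\<lambda>x. p x + q x) x u = dd p x u + dd q x u"
  by (intro dd_eqI DERIV_add pol_dd(4)[of I]) assumption+

lemma dd_mult: "pol I p \<Longrightarrow> pol I q \<Longrightarrow> finite I \<Longrightarrow> dd (\<lambda>x. p x * q x) x u = dd p x u * q x + dd q x u * p x"
  using DERIV_mult[OF pol_dd(4) pol_dd(4), of I p I q x u x u] by (intro dd_eqI) simp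

lemma dd_cmult: "pol I p \<Longrightarrow> finite I \<Longrightarrow> dd (\<lambda>x. c * p x) x u = c * dd p x u"
  by (intro dd_eqI DERIV_cmult pol_dd(4)[of I]) assumption+

lemma dd_sum:
  "(\<And>a. a \<in> S \<Longrightarrow> pol I (p a)) \<Longrightarrow> finite I \<Longrightarrow> dd (\<lambda>x. \<Sum>a\<in>S. p a x) x u = (\<Sum>a\<in>S. dd (p a) x u)"
  by (intro dd_eqI DERIV_sum pol_dd(4)[of I]) auto

section \<open>Rational functions near a point\<close>

text \<open>A filter lets finitely many open conditions at \<open>v0\<close> be combined by
  \<open>eventually_elim\<close>. The sets \<open>G \<noteq> 0\<close> form a base since they are
  closed under intersection, by taking products.\<close>

definition zariski_at :: "'a set \<Rightarrow> ('a \<Rightarrow> complex) \<Rightarrow> ('a \<Rightarrow> complex) filter" where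
  "zariski_at I v0 = (INF G\<in>{G. pol I G \<and> G v0 \<noteq> 0}. principal {v. G v \<noteq> 0})"

lemma eventually_zar:
  "eventually P (zariski_at I v0) \<longleftrightarrow> (\<exists>G. pol I G \<and> G v0 \<noteq> 0 \<and> (\<forall>v. G v \<noteq> 0 \<longrightarrow> P v))"
proof -
  let ?B = "{G. pol I G \<and> G v0 \<noteq> 0}"
  have "(\<lambda>_. 1) \<in> ?B" by simp
  then have ne: "?B \<noteq> {}" by blast
  have dir: "\<exists>H\<in>?B. principal {v. H v \<noteq> 0} \<le> inf (principal {v. F v \<noteq> 0}) (principal {v. G v \<noteq> 0})"
    if "F \<in> ?B" "G \<in> ?B" for F G
    using that by (intro bexI[of _ "\<lambda>v. F v * G v"]) (auto simp: pol_mult)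
  show ?thesis
    using eventually_INF_base[OF ne, of "\<lambda>G. principal {v. G v \<noteq> 0}" P] dir
    unfolding zariski_at_def by (simp add: eventually_principal Bex_def conj_assoc)
qed

lemma eventually_zarI: "pol I G \<Longrightarrow> G v0 \<noteq> 0 \<Longrightarrow> (\<And>v. G v \<noteq> 0 \<Longrightarrow> P v) \<Longrightarrow> eventually P (zariski_at I v0)"
  unfolding eventually_zar by blast

lemma eventually_zar_at: "eventually P (zariski_at I v0) \<Longrightarrow> P v0"
  unfolding eventually_zar by blast

text \<open>Elements of the local ring at \<open>v0\<close>, as total functions: where the
  denominator vanishes nothing is said about \<open>f\<close>.\<close>

definition reg :: "'a set \<Rightarrow> ('a \<Rightarrow> complex) \<Rightarrow> (('a \<Rightarrow> complex) \<Rightarrow> complex) \<Rightarrow> bool" where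
  "reg I v0 f \<longleftrightarrow> (\<exists>N D. pol I N \<and> pol I D \<and> D v0 \<noteq> 0 \<and> (\<forall>v. D v \<noteq> 0 \<longrightarrow> f v = N v / D v))"

lemma regI: "pol I N \<Longrightarrow> pol I D \<Longrightarrow> D v0 \<noteq> 0 \<Longrightarrow> (\<And>v. D v \<noteq> 0 \<Longrightarrow> f v = N v / D v) \<Longrightarrow> reg I v0 f"
  unfolding reg_def by blast

lemma regE:
  assumes "reg I v0 f"
  obtains N D where "pol I N" "pol I D" "D v0 \<noteq> 0" "\<And>v. D v \<noteq> 0 \<Longrightarrow> f v = N v / D v"
  using assms unfolding reg_def by blast

lemma reg_pol: "pol I p \<Longrightarrow> reg I v0 p"
  by (rule regI[of I p "\<lambda>_. 1"]) auto

lemma reg_const: "reg I v0 (\<lambda>_. c)"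
  by (rule reg_pol) simp

lemma reg_add:
  assumes "reg I v0 f" "reg I v0 g"
  shows "reg I v0 (\<lambda>v. f v + g v)"
proof -
  obtain N D where 1: "pol I N" "pol I D" "D v0 \<noteq> 0" "\<And>v. D v \<noteq> 0 \<Longrightarrow> f v = N v / D v"
    by (rule regE[OF assms(1)]) (rule that)
  obtain N' D' where 2: "pol I N'" "pol I D'" "D' v0 \<noteq> 0" "\<And>v. D' v \<noteq> 0 \<Longrightarrow> g v = N' v / D' v"
    by (rule regE[OF assms(2)]) (rule that)
  show ?thesis
    by (rule regI[of I "\<lambda>v. N v * D' v + N' v * D v" "\<lambda>v. D v * D' v"])
      (use 1 2 in \<open>simp_all add: pol_add pol_mult add_frac_eq\<close>)
qed

lemma reg_mult:
  assumes "reg I v0 f" "reg I v0 g"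
  shows "reg I v0 (\<lambda>v. f v * g v)"
proof -
  obtain N D where 1: "pol I N" "pol I D" "D v0 \<noteq> 0" "\<And>v. D v \<noteq> 0 \<Longrightarrow> f v = N v / D v"
    by (rule regE[OF assms(1)]) (rule that)
  obtain N' D' where 2: "pol I N'" "pol I D'" "D' v0 \<noteq> 0" "\<And>v. D' v \<noteq> 0 \<Longrightarrow> g v = N' v / D' v"
    by (rule regE[OF assms(2)]) (rule that)
  show ?thesis
    by (rule regI[of I "\<lambda>v. N v * N' v" "\<lambda>v. D v * D' v"])
      (use 1 2 in \<open>simp_all add: pol_mult\<close>)
qed

lemma reg_sum: "(\<And>a. a \<in> S \<Longrightarrow> reg I v0 (f a)) \<Longrightarrow> reg I v0 (\<lambda>v. \<Sum>a\<in>S. f a v)"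
  by (induction S rule: infinite_finite_induct) (simp_all add: reg_add reg_const)

lemma reg_prod: "(\<And>a. a \<in> S \<Longrightarrow> reg I v0 (f a)) \<Longrightarrow> reg I v0 (\<lambda>v. \<Prod>a\<in>S. f a v)"
  by (induction S rule: infinite_finite_induct) (simp_all add: reg_mult reg_const)

lemma reg_power: "reg I v0 f \<Longrightarrow> reg I v0 (\<lambda>v. f v ^ k)"
  by (induction k) (simp_all add: reg_mult reg_const)

lemma reg_uminus: "reg I v0 f \<Longrightarrow> reg I v0 (\<lambda>v. - f v)"
  using reg_mult[OF reg_const[of I v0 "-1"], of f] by simp

lemma reg_diff: "reg I v0 f \<Longrightarrow> reg I v0 g \<Longrightarrow> reg I v0 (\<lambda>v. f v - g v)"
  using reg_add[of I v0 f "\<lambda>v. - g v"] by (simp add: reg_uminus)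

lemma reg_inverse:
  assumes "reg I v0 f" "f v0 \<noteq> 0"
  shows "reg I v0 (\<lambda>v. inverse (f v))"
proof -
  obtain N D where 1: "pol I N" "pol I D" "D v0 \<noteq> 0" "\<And>v. D v \<noteq> 0 \<Longrightarrow> f v = N v / D v"
    by (rule regE[OF assms(1)]) (rule that)
  have "N v0 \<noteq> 0" using 1(3) 1(4)[of v0] assms(2) by auto
  then show ?thesis
    by (intro regI[of I "\<lambda>v. D v * D v" "\<lambda>v. N v * D v"]) (use 1 in \<open>simp_all add: pol_mult\<close>)
qed

lemma reg_nonzero:
  assumes "reg I v0 f" "f v0 \<noteq> 0"
  shows "eventually (\<lambda>v. f v \<noteq> 0) (zariski_at I v0)"
proof -
  obtain N D where 1: "pol I N" "pol I D" "D v0 \<noteq> 0" "\<And>v. D v \<noteq> 0 \<Longrightarrow> f v = N v / D v"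
    by (rule regE[OF assms(1)]) (rule that)
  have "N v0 \<noteq> 0" using 1(3) 1(4)[of v0] assms(2) by auto
  then show ?thesis
    by (intro eventually_zarI[of I "\<lambda>v. N v * D v"]) (use 1 in \<open>simp_all add: pol_mult\<close>)
qed

lemma reg_det:
  assumes "\<And>v. M v \<in> carrier_mat n n" "\<And>i j. i < n \<Longrightarrow> j < n \<Longrightarrow> reg I v0 (\<lambda>v. M v $$ (i, j))"
  shows "reg I v0 (\<lambda>v. Determinant.det (M v))"
  unfolding det_def'[OF assms(1)]
proof (intro reg_sum reg_mult reg_prod reg_const)
  fix p i assume "p \<in> {p. p permutes {0..<n}}" "i \<in> {0..<n}"
  then have "i < n" "p i < n" by (auto dest: permutes_in_image[of p _ i])
  then show "reg I v0 (\<lambda>v. M v $$ (i, p i))" by (rule assms(2))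
qed

text \<open>Cramer's rule: cofactors are polynomial in the entries, and the determinant is nonzero
  at \<open>v0\<close> because \<open>B0\<close> is an inverse there. Hence the inverse has regular
  entries near \<open>v0\<close>.\<close>

lemma near_inverse:
  fixes A :: "'x \<Rightarrow> 'x \<Rightarrow> ('a \<Rightarrow> complex) \<Rightarrow> complex"
  assumes "finite X" and rA: "\<And>x y. x \<in> X \<Longrightarrow> y \<in> X \<Longrightarrow> reg I v0 (A x y)"
    and inv: "\<And>x z. x \<in> X \<Longrightarrow> z \<in> X \<Longrightarrow> (\<Sum>y\<in>X. A x y v0 * B0 y z) = (if x = z then 1 else 0)"
  obtains B where "\<And>x y. x \<in> X \<Longrightarrow> y \<in> X \<Longrightarrow> reg I v0 (B x y)"
    "eventually (\<lambda>v. \<forall>x\<in>X. \<forall>z\<in>X. (\<Sum>y\<in>X. A x y v * B y z v) = (if x = z then 1 else 0) \<and>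
      (\<Sum>y\<in>X. B x y v * A y z v) = (if x = z then 1 else 0)) (zariski_at I v0)"
proof -
  define n where "n = card X"
  obtain h where h: "bij_betw h {..<n} X"
    using assms(1) ex_bij_betw_nat_finite unfolding n_def lessThan_atLeast0 by metis
  define k where "k = inv_into {..<n} h"
  have hX: "h i \<in> X" if "i < n" for i using h that by (auto simp: bij_betw_def)
  have k: "k x < n" "h (k x) = x" if "x \<in> X" for x
    using h that inv_into_into[of x h "{..<n}"] f_inv_into_f[of x h "{..<n}"]
    by (auto simp: k_def bij_betw_def)
  have inj: "h i = h j \<longleftrightarrow> i = j" if "i < n" "j < n" for i j
    using h that by (auto simp: bij_betw_def inj_on_def)
  define M where "M v = mat n n (\<lambda>(i,j). A (h i) (h j) v)" for v
  have M: "M v \<in> carrier_mat n n" for v by (simp add: M_def)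
  have sumX: "(\<Sum>y\<in>X. f y) = (\<Sum>j<n. f (h j))" for f :: "'x \<Rightarrow> complex"
    using sum.reindex_bij_betw[OF h, of f] by simp
  have rdet: "reg I v0 (\<lambda>v. Determinant.det (M v))"
    by (rule reg_det[OF M]) (simp add: M_def rA hX)
  have rcof: "reg I v0 (\<lambda>v. cofactor (M v) j i)" if "i < n" "j < n" for i j
    unfolding cofactor_def
  proof (intro reg_mult reg_const reg_det)
    show "mat_delete (M v) j i \<in> carrier_mat (n - 1) (n - 1)" for v using M by (rule mat_delete_carrier)
    show "reg I v0 (\<lambda>v. mat_delete (M v) j i $$ (a, b))" if "a < n - 1" "b < n - 1" for a b
      using that by (simp add: mat_delete_def M_def rA hX)
  qed
  have "M v0 * mat n n (\<lambda>(i,j). B0 (h i) (h j)) = 1\<^sub>m n"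
    by (rule eq_matI) (auto simp: M_def scalar_prod_def inv[symmetric] inj hX sumX lessThan_atLeast0 simp flip: inj)
  then have "Determinant.det (M v0) * Determinant.det (mat n n (\<lambda>(i,j). B0 (h i) (h j))) = 1"
    using det_mult[OF M, of "mat n n (\<lambda>(i,j). B0 (h i) (h j))" v0] by simp
  then have d0: "Determinant.det (M v0) \<noteq> 0" by auto
  define B where "B x y v = cofactor (M v) (k y) (k x) * inverse (Determinant.det (M v))" for x y v
  have rB: "reg I v0 (B x y)" if "x \<in> X" "y \<in> X" for x y
    unfolding B_def[abs_def] using that by (intro reg_mult rcof reg_inverse rdet d0 k)
  have kh: "k (h i) = i" if "i < n" for i using that k inj hX by blast
  have adj: "adj_mat (M v) $$ (i, j) = cofactor (M v) j i" if "i < n" "j < n" for i j v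
    using that by (simp add: adj_mat_def M_def)
  have 1: "(\<Sum>y\<in>X. A x y v * B y z v) = (if x = z then 1 else 0)"
    if xz: "x \<in> X" "z \<in> X" and d: "Determinant.det (M v) \<noteq> 0" for x z v
  proof -
    have "(\<Sum>j<n. M v $$ (k x, j) * adj_mat (M v) $$ (j, k z)) = (M v * adj_mat (M v)) $$ (k x, k z)"
      using k[OF xz(1)] k[OF xz(2)] M[of v] adj_mat(1)[OF M, of v]
      by (simp add: scalar_prod_def lessThan_atLeast0)
    also have "\<dots> = (if x = z then Determinant.det (M v) else 0)"
      using k[OF xz(1)] k[OF xz(2)] by (auto simp: adj_mat(2)[OF M])
    finally have "(\<Sum>j<n. M v $$ (k x, j) * adj_mat (M v) $$ (j, k z)) = (if x = z then Determinant.det (M v) else 0)" .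
    moreover have "(\<Sum>y\<in>X. A x y v * B y z v) = (\<Sum>j<n. M v $$ (k x, j) * adj_mat (M v) $$ (j, k z)) * inverse (Determinant.det (M v))"
      unfolding sumX sum_distrib_right using k[OF xz(1)] k[OF xz(2)]
      by (intro sum.cong) (auto simp: B_def M_def[symmetric] adj kh, simp add: M_def)
    ultimately show ?thesis using d by simp
  qed
  have 2: "(\<Sum>y\<in>X. B x y v * A y z v) = (if x = z then 1 else 0)"
    if xz: "x \<in> X" "z \<in> X" and d: "Determinant.det (M v) \<noteq> 0" for x z v
  proof -
    have "(\<Sum>j<n. adj_mat (M v) $$ (k x, j) * M v $$ (j, k z)) = (adj_mat (M v) * M v) $$ (k x, k z)"
      using k[OF xz(1)] k[OF xz(2)] M[of v] adj_mat(1)[OF M, of v]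
      by (simp add: scalar_prod_def lessThan_atLeast0)
    also have "\<dots> = (if x = z then Determinant.det (M v) else 0)"
      using k[OF xz(1)] k[OF xz(2)] by (auto simp: adj_mat(3)[OF M])
    finally have "(\<Sum>j<n. adj_mat (M v) $$ (k x, j) * M v $$ (j, k z)) = (if x = z then Determinant.det (M v) else 0)" .
    moreover have "(\<Sum>y\<in>X. B x y v * A y z v) = (\<Sum>j<n. adj_mat (M v) $$ (k x, j) * M v $$ (j, k z)) * inverse (Determinant.det (M v))"
      unfolding sumX sum_distrib_right using k[OF xz(1)] k[OF xz(2)]
      by (intro sum.cong) (auto simp: B_def M_def[symmetric] adj kh, simp add: M_def)
    ultimately show ?thesis using d by simp
  qed
  have "eventually (\<lambda>v. \<forall>x\<in>X. \<forall>z\<in>X. (\<Sum>y\<in>X. A x y v * B y z v) = (if x = z then 1 else 0) \<and>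
      (\<Sum>y\<in>X. B x y v * A y z v) = (if x = z then 1 else 0)) (zariski_at I v0)"
    by (rule eventually_mono[OF reg_nonzero[OF rdet d0]]) (intro ballI conjI 1 2)
  from that[OF rB this] show ?thesis .
qed

section \<open>Algebraic dependence and generic transfer\<close>

text \<open>A dimension count: \<open>card I + 1\<close> polynomials in \<open>card I\<close>
  variables have more monomials than fit into the space of polynomials of the resulting degree. The
  relation is sorted by powers of \<open>G\<close>.\<close>

lemma algebraic_dependence:
  assumes I: "finite I" and psi: "\<And>c. c \<in> I \<Longrightarrow> pol I (\<psi> c)" and G: "pol I G"
  shows "\<exists>k Q. (\<forall>j. pol I (Q j)) \<and> (\<exists>j<k. \<exists>y. Q j y \<noteq> 0) \<and> (\<forall>v. (\<Sum>j<k. Q j (\<lambda>c. \<psi> c v) * G v ^ j) = 0)"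
proof -
  obtain eG where eG: "poldeg I eG G" using G unfolding pol_def by blast
  have "\<forall>c\<in>I. \<exists>e. poldeg I e (\<psi> c)" using psi unfolding pol_def by blast
  then obtain ep where ep: "\<And>c. c \<in> I \<Longrightarrow> poldeg I (ep c) (\<psi> c)" by metis
  define e where "e = eG + sum ep I"
  have e: "poldeg I e G" "\<And>c. c \<in> I \<Longrightarrow> poldeg I e (\<psi> c)"
  proof -
    show "poldeg I e G" by (rule poldeg_mono[OF eG]) (simp add: e_def)
    show "poldeg I e (\<psi> c)" if "c \<in> I" for c
      by (rule poldeg_mono[OF ep[OF that]]) (use that I in \<open>simp add: e_def member_le_sum trans_le_add2\<close>)
  qed
  \<comment> \<open>With \<open>e\<close> bounding all degrees, the \<open>k ^ (M + 1)\<close>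
    monomials with exponents below \<open>k\<close> in the \<open>\<psi>\<close>'s and
    \<open>G\<close> have degree at most \<open>E * k\<close>, and so involve at most
    \<open>(E * k + 1) ^ M\<close> power products. The choice of \<open>k\<close> makes the first
    number the larger one.\<close>
  define M where "M = card I"
  define E where "E = (M + 1) * e"
  define k where "k = (E + 1) ^ M + 1"
  have pw: "poldeg I (j * e) (\<lambda>v. p v ^ j)" if "poldeg I e p" for p j
  proof (induction j)
    case 0 show ?case by (simp add: poldeg.const)
  next
    case (Suc j) show ?case using poldeg_mult[OF that Suc] by simp
  qed
  have pp: "poldeg I (sum a J * e) (\<lambda>v. \<Prod>c\<in>J. \<psi> c v ^ a c)" if "J \<subseteq> I" for J a
    using finite_subset[OF that I] that
  proof (induction J rule: finite_induct)
    case empty show ?case by (simp add: poldeg.const)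
  next
    case (insert c J)
    have "poldeg I (a c * e + sum a J * e) (\<lambda>v. \<psi> c v ^ a c * (\<Prod>c\<in>J. \<psi> c v ^ a c))"
      using insert by (intro poldeg_mult pw e) simp_all
    then show ?case using insert.hyps by (simp add: distrib_right)
  qed
  let ?A = "Pi\<^sub>E I (\<lambda>_. {..<k}) \<times> {..<k}"
  let ?B = "Pi\<^sub>E I (\<lambda>_. {..E * k})"
  have deg: "\<exists>c. \<forall>v. (\<Prod>i\<in>I. \<psi> i v ^ fst aj i) * G v ^ snd aj = (\<Sum>b\<in>?B. c b * power_product I b v)" if "aj \<in> ?A" for aj
  proof (rule poldeg_monos[OF _ I])
    have "sum (fst aj) I \<le> (\<Sum>i\<in>I. k)" using that by (intro sum_mono) (auto simp: PiE_iff less_imp_le)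
    then have "sum (fst aj) I + snd aj \<le> (M + 1) * k" using that by (auto simp: M_def)
    from mult_right_mono[OF this, of e]
    have "sum (fst aj) I * e + snd aj * e \<le> E * k" by (simp add: E_def algebra_simps)
    then show "poldeg I (E * k) (\<lambda>v. (\<Prod>i\<in>I. \<psi> i v ^ fst aj i) * G v ^ snd aj)"
      by (rule poldeg_mono[OF poldeg_mult[OF pp[OF order_refl] pw[OF e(1)]]])
  qed
  have "\<forall>aj\<in>?A. \<exists>c. \<forall>v. (\<Prod>i\<in>I. \<psi> i v ^ fst aj i) * G v ^ snd aj = (\<Sum>b\<in>?B. c b * power_product I b v)"
    using deg by blast
  from bchoice[OF this] obtain c where
    c: "\<And>aj v. aj \<in> ?A \<Longrightarrow> (\<Prod>i\<in>I. \<psi> i v ^ fst aj i) * G v ^ snd aj = (\<Sum>b\<in>?B. c aj b * power_product I b v)" by blast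
  have fin: "finite ?A" "finite ?B" using I by (auto simp: finite_PiE)
  have "(E * k + 1) ^ M \<le> ((E + 1) * k) ^ M"
    by (rule power_mono) (simp_all add: k_def)
  also have "\<dots> = (E + 1) ^ M * k ^ M" by (rule power_mult_distrib)
  also have "\<dots> < k * k ^ M" by (intro mult_strict_right_mono) (simp_all add: k_def)
  finally have "card ?B < card ?A"
    using I by (simp add: card_PiE card_cartesian_product M_def mult.commute)
  from underdetermined_system[OF fin(2,1) this, of c] obtain x where
    x: "\<exists>a\<in>?A. x a \<noteq> 0" "\<And>b. b \<in> ?B \<Longrightarrow> (\<Sum>a\<in>?A. x a * c a b) = 0" by blast
  define Q where "Q j y = (\<Sum>a\<in>Pi\<^sub>E I (\<lambda>_. {..<k}). x (a, j) * power_product I a y)" for j y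
  have "pol I (Q j)" for j
    unfolding Q_def[abs_def] by (intro pol_sum pol_mult pol_const pol_mono)
  moreover have "\<exists>j<k. \<exists>y. Q j y \<noteq> 0"
  proof -
    obtain a j where aj: "a \<in> Pi\<^sub>E I (\<lambda>_. {..<k})" "j < k" "x (a, j) \<noteq> 0" using x(1) by auto
    have "\<exists>y. Q j y \<noteq> 0"
    proof (rule ccontr)
      assume "\<not> (\<exists>y. Q j y \<noteq> 0)"
      then have "x (a, j) = 0" using monos_independent[where k = k and x = "\<lambda>a. x (a, j)" and b = a, OF I] aj(1) by (simp add: Q_def)
      with aj(3) show False ..
    qed
    with aj(2) show ?thesis by blast
  qed
  moreover have "(\<Sum>j<k. Q j (\<lambda>c. \<psi> c v) * G v ^ j) = 0" for v
  proof -
    have "(\<Sum>j<k. Q j (\<lambda>c. \<psi> c v) * G v ^ j) =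
        (\<Sum>j<k. \<Sum>a\<in>Pi\<^sub>E I (\<lambda>_. {..<k}). x (a, j) * ((\<Prod>i\<in>I. \<psi> i v ^ a i) * G v ^ j))"
      by (simp add: Q_def sum_distrib_right power_product_def mult.assoc)
    also have "\<dots> = (\<Sum>aj\<in>?A. x aj * ((\<Prod>i\<in>I. \<psi> i v ^ fst aj i) * G v ^ snd aj))"
      by (subst sum.swap) (simp add: sum.cartesian_product split_def)
    also have "\<dots> = (\<Sum>aj\<in>?A. \<Sum>b\<in>?B. x aj * c aj b * power_product I b v)"
      by (intro sum.cong refl) (simp add: c sum_distrib_left mult.assoc)
    also have "\<dots> = (\<Sum>b\<in>?B. (\<Sum>aj\<in>?A. x aj * c aj b) * power_product I b v)"
      by (subst sum.swap) (simp add: sum_distrib_right)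
    also have "\<dots> = 0" using x(2) by simp
    finally show ?thesis .
  qed
  ultimately show ?thesis by blast
qed

section \<open>Algebraically independent coordinates near a point with invertible Jacobian\<close>

context
  fixes I :: "'a set" and v0 :: "'a \<Rightarrow> complex" and \<psi> :: "'a \<Rightarrow> ('a \<Rightarrow> complex) \<Rightarrow> complex"
  assumes I: "finite I" and psi: "\<And>c. c \<in> I \<Longrightarrow> pol I (\<psi> c)"
    and jac: "\<And>c c'. c \<in> I \<Longrightarrow> c' \<in> I \<Longrightarrow> dd (\<psi> c) v0 (unitv c') = (if c = c' then 1 else 0)"
begin

text \<open>Invertibility of the Jacobian is stated as triviality of its left kernel, which is the
  form in which the chain rule produces relations between the gradients.\<close>

lemma jacobian_near:
  "eventually (\<lambda>v. \<forall>q. (\<forall>u. (\<Sum>c\<in>I. q c * dd (\<psi> c) v u) = 0) \<longrightarrow> (\<forall>c\<in>I. q c = 0)) (zariski_at I v0)"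
proof -
  obtain B where B: "\<And>x y. x \<in> I \<Longrightarrow> y \<in> I \<Longrightarrow> reg I v0 (B x y)"
    "eventually (\<lambda>v. \<forall>x\<in>I. \<forall>z\<in>I. (\<Sum>y\<in>I. dd (\<psi> x) v (unitv y) * B y z v) = (if x = z then 1 else 0) \<and>
      (\<Sum>y\<in>I. B x y v * dd (\<psi> y) v (unitv z)) = (if x = z then 1 else 0)) (zariski_at I v0)"
  proof (rule near_inverse[OF I, of I v0 "\<lambda>c c' v. dd (\<psi> c) v (unitv c')" "\<lambda>x y. if x = y then 1 else 0"])
    show "reg I v0 (\<lambda>v. dd (\<psi> x) v (unitv y))" if "x \<in> I" "y \<in> I" for x y
      by (rule reg_pol, rule pol_dd(2)[OF psi[OF that(1)] I])
    show "(\<Sum>y\<in>I. dd (\<psi> x) v0 (unitv y) * (if y = z then 1 else 0)) = (if x = z then 1 else 0)"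
      if "x \<in> I" "z \<in> I" for x z
      using that I jac by (simp add: if_distrib[of "\<lambda>c. _ * c"] cong: if_cong)
  qed (rule that)
  show ?thesis
  proof (rule eventually_mono[OF B(2)], intro allI impI ballI)
    fix v q z
    assume a: "\<forall>x\<in>I. \<forall>z\<in>I. (\<Sum>y\<in>I. dd (\<psi> x) v (unitv y) * B y z v) = (if x = z then 1 else 0) \<and>
      (\<Sum>y\<in>I. B x y v * dd (\<psi> y) v (unitv z)) = (if x = z then 1 else 0)"
      and q: "\<forall>u. (\<Sum>c\<in>I. q c * dd (\<psi> c) v u) = 0" and z: "z \<in> I"
    have "0 = (\<Sum>y\<in>I. (\<Sum>c\<in>I. q c * dd (\<psi> c) v (unitv y)) * B y z v)" using q by simp
    also have "\<dots> = (\<Sum>c\<in>I. q c * (\<Sum>y\<in>I. dd (\<psi> c) v (unitv y) * B y z v))"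
      unfolding sum_distrib_left sum_distrib_right by (subst sum.swap) (simp add: mult.assoc)
    also have "\<dots> = (\<Sum>c\<in>I. if c = z then q c else 0)" using a z by (intro sum.cong) auto
    also have "\<dots> = q z" using I z by simp
    finally show "q z = 0" by simp
  qed
qed

lemma comp_deriv:
  assumes "pol I Q"
  shows "((\<lambda>s. Q (\<lambda>c. \<psi> c (\<lambda>i. v i + s * u i))) has_field_derivative
     (\<Sum>c\<in>I. dd Q (\<lambda>c. \<psi> c v) (unitv c) * dd (\<psi> c) v u)) (at 0)"
proof -
  have "((\<lambda>s. Q (\<lambda>c. \<psi> c (\<lambda>i. v i + s * u i))) has_field_derivative
     dd Q (\<lambda>c. \<psi> c (\<lambda>i. v i + 0 * u i)) (\<lambda>c. dd (\<psi> c) v u)) (at 0)"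
    by (rule pol_dd(3)[OF assms I, where c = "\<lambda>s c. \<psi> c (\<lambda>i. v i + s * u i)"])
      (use pol_dd(4)[OF psi I] in blast)
  then show ?thesis
    by (subst pol_dd(1)[OF assms I, symmetric]) simp
qed

text \<open>Differentiating the relation \<open>Q (\<psi> v) = 0\<close> shows that the partial
  derivatives of \<open>Q\<close> satisfy it too; by induction on the degree they are zero, so
  \<open>Q\<close> is constant, and its value is 0.\<close>

lemma algebraic_independence:
  assumes "pol I Q" "\<And>v. Q (\<lambda>c. \<psi> c v) = 0"
  shows "Q y = 0"
proof -
  obtain G where G: "pol I G" "G v0 \<noteq> 0"
    "\<And>v. G v \<noteq> 0 \<Longrightarrow> \<forall>q. (\<forall>u. (\<Sum>c\<in>I. q c * dd (\<psi> c) v u) = 0) \<longrightarrow> (\<forall>c\<in>I. q c = 0)"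
    using jacobian_near unfolding eventually_zar by blast
  obtain k where "poldeg I k Q" using assms(1) unfolding pol_def by blast
  then show ?thesis using assms(2)
  proof (induction k arbitrary: Q y rule: less_induct)
    case (less k)
    have pQ: "pol I Q" using less.prems(1) unfolding pol_def by blast
    obtain q where q: "\<forall>i\<in>I. poldeg I (k - 1) (q i)" "k = 0 \<longrightarrow> (\<forall>i x. q i x = 0)"
      "\<And>x i. i \<in> I \<Longrightarrow> dd Q x (unitv i) = q i x" "\<And>x u. dd Q x u = (\<Sum>i\<in>I. q i x * u i)"
      "is_gradient I Q q"
      by (rule pol_gradient[OF less.prems(1) I]) (rule that)
    have pq: "pol I (q c)" if "c \<in> I" for c using q(1) that unfolding pol_def by blast
    \<comment> \<open>The chain rule turns the relation into a linear relation between the gradients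
      of the \<open>\<psi>\<close>'s. Its coefficients vanish where the Jacobian is invertible,
      hence everywhere by density.\<close>
    have 0: "q c (\<lambda>c. \<psi> c v) = 0" if "c \<in> I" for c v
    proof (rule pol_zero_if_mult_zero[where q = "\<lambda>v. q c (\<lambda>c. \<psi> c v)", OF G(1) _ G(2)])
      show "pol I (\<lambda>v. q c (\<lambda>c. \<psi> c v))" by (rule pol_comp[OF pq[OF that] psi])
      fix v assume v: "G v \<noteq> 0"
      have "(\<Sum>c\<in>I. q c (\<lambda>c. \<psi> c v) * dd (\<psi> c) v u) = 0" for u
      proof (rule DERIV_unique[of "\<lambda>s. 0"])
        show "((\<lambda>s. 0) has_field_derivative (\<Sum>c\<in>I. q c (\<lambda>c. \<psi> c v) * dd (\<psi> c) v u)) (at 0)"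
          using comp_deriv[OF pQ, of v u] by (simp add: less.prems(2) q(3))
      qed simp
      then show "q c (\<lambda>c. \<psi> c v) = 0"
        using spec[OF G(3)[OF v], of "\<lambda>c'. q c' (\<lambda>c. \<psi> c v)"] that by simp
    qed
    have q0: "q c x = 0" if "c \<in> I" for c x
    proof (cases "k = 0")
      case True then show ?thesis using q(2) by simp
    next
      case False
      then show ?thesis using less.IH[of "k - 1" "q c" x] q(1) that 0[OF that] by simp
    qed
    \<comment> \<open>All partial derivatives are zero, so \<open>Q\<close> is constant along every
      line through the origin.\<close>
    have const: "Q (\<lambda>i. 0) = Q y" for y
    proof -
      obtain P where P: "\<forall>s. Q (\<lambda>i. 0 + s * y i) = poly P s" using pol_line[OF pQ, of "\<lambda>_. 0" y] ..
      have "poly (pderiv P) s = 0" for s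
      proof (rule DERIV_unique[of "poly P" _ s])
        show "(poly P has_field_derivative poly (pderiv P) s) (at s)" by (rule poly_DERIV)
        have "((\<lambda>s. Q (\<lambda>i. 0 + s * y i)) has_field_derivative (\<Sum>i\<in>I. q i (\<lambda>i. 0 + s * y i) * y i)) (at s)"
          by (rule is_gradientD[OF q(5)]) (use curve_line[of "\<lambda>_. 0" _ y] in simp)
        moreover have "(\<lambda>s. Q (\<lambda>i. 0 + s * y i)) = poly P" using P by (simp add: fun_eq_iff)
        ultimately show "(poly P has_field_derivative 0) (at s)" using q0 by simp
      qed
      then have "pderiv P = 0" using poly_all_0_iff_0 by blast
      then obtain c where "P = [:c:]" by (auto simp: pderiv_eq_0_iff degree_eq_zeroE elim: degree_eq_zeroE)
      then show ?thesis using P[rule_format, of 0] P[rule_format, of 1] by simp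
    qed
    have "Q y = Q (\<lambda>c. \<psi> c undefined)" using const[of y] const[of "\<lambda>c. \<psi> c undefined"] by simp
    then show ?case using less.prems(2) by simp
  qed
qed

text \<open>In a relation for \<open>G\<close> over the \<open>\<psi>\<close>'s, cancel the largest
  common power of \<open>G\<close>. The constant term that remains is a polynomial in the
  \<open>\<psi>\<close>'s that vanishes wherever \<open>G\<close> does, and it is not identically
  zero by algebraic independence.\<close>

lemma algebraic_transfer:
  assumes G: "pol I G" "G v0 \<noteq> 0"
  shows "\<exists>Q. pol I Q \<and> (\<exists>v. Q (\<lambda>c. \<psi> c v) \<noteq> 0) \<and> (\<forall>v. Q (\<lambda>c. \<psi> c v) \<noteq> 0 \<longrightarrow> G v \<noteq> 0)"
proof -
  obtain k Q where Q: "\<And>j. pol I (Q j)" "\<exists>j<k. \<exists>y. Q j y \<noteq> 0"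
    "\<And>v. (\<Sum>j<k. Q j (\<lambda>c. \<psi> c v) * G v ^ j) = 0"
    using algebraic_dependence[where \<psi> = \<psi>, OF I psi G(1)] by blast
  define j0 where "j0 = (LEAST j. j < k \<and> (\<exists>y. Q j y \<noteq> 0))"
  have j0: "j0 < k" "\<exists>y. Q j0 y \<noteq> 0"
    using LeastI_ex[of "\<lambda>j. j < k \<and> (\<exists>y. Q j y \<noteq> 0)"] Q(2) unfolding j0_def by blast+
  have small: "Q j y = 0" if "j < j0" for j y
  proof -
    have "\<not> (j < k \<and> (\<exists>y. Q j y \<noteq> 0))" using that unfolding j0_def by (rule not_less_Least)
    then show ?thesis using that j0(1) by (meson less_trans)
  qed
  \<comment> \<open>The relation divided by \<open>G v ^ j0\<close>; it holds where \<open>G\<close>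
    is nonzero and therefore everywhere, in particular at the zeros of \<open>G\<close>.\<close>
  define R where "R v = (\<Sum>j\<in>{j0..<k}. Q j (\<lambda>c. \<psi> c v) * G v ^ (j - j0))" for v
  have R0: "R v = 0" for v
  proof (rule pol_zero_if_mult_zero[where q = R, OF G(1) _ G(2)])
    show "pol I R" unfolding R_def[abs_def] by (intro pol_sum pol_mult pol_power G(1) pol_comp[OF Q(1)] psi)
    fix v assume v: "G v \<noteq> 0"
    have "G v ^ j0 * R v = (\<Sum>j\<in>{j0..<k}. Q j (\<lambda>c. \<psi> c v) * G v ^ j)"
      unfolding R_def sum_distrib_left
    proof (rule sum.cong)
      fix j assume "j \<in> {j0..<k}"
      then have "G v ^ j = G v ^ j0 * G v ^ (j - j0)" by (simp flip: power_add)
      then show "G v ^ j0 * (Q j (\<lambda>c. \<psi> c v) * G v ^ (j - j0)) = Q j (\<lambda>c. \<psi> c v) * G v ^ j" by simp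
    qed simp
    also have "\<dots> = (\<Sum>j<k. Q j (\<lambda>c. \<psi> c v) * G v ^ j)"
      by (rule sum.mono_neutral_left) (auto simp: small)
    finally show "R v = 0" using Q(3) v by simp
  qed
  have "G v \<noteq> 0" if "Q j0 (\<lambda>c. \<psi> c v) \<noteq> 0" for v
  proof
    assume "G v = 0"
    then have "R v = (\<Sum>j\<in>{j0..<k}. if j = j0 then Q j (\<lambda>c. \<psi> c v) else 0)"
      unfolding R_def by (intro sum.cong) auto
    also have "\<dots> = Q j0 (\<lambda>c. \<psi> c v)" using j0(1) by simp
    finally show False using R0 that by simp
  qed
  moreover have "\<exists>v. Q j0 (\<lambda>c. \<psi> c v) \<noteq> 0" using algebraic_independence[OF Q(1)] j0(2) by blast
  ultimately show ?thesis using Q(1) by blast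
qed

text \<open>
  Differentiating a relation of minimal degree for \<open>F\<close> over the \<open>\<psi>\<close>'s; by minimality the
  coefficient \<open>S\<close> of \<open>dF\<close> is not identically zero.
\<close>

lemma tangent_relation:
  assumes F: "pol I F"
  shows "\<exists>T S. pol (insert None (Some ` I)) S \<and> (\<exists>v. S (case_option (F v) (\<lambda>c. \<psi> c v)) \<noteq> 0) \<and>
    (\<forall>v u. (\<Sum>c\<in>I. T c (case_option (F v) (\<lambda>c. \<psi> c v)) * dd (\<psi> c) v u)
       + S (case_option (F v) (\<lambda>c. \<psi> c v)) * dd F v u = 0)"
proof -
  \<comment> \<open>Here \<open>k\<close> exceeds the degree in \<open>F\<close>, so that a relation
    with the least \<open>k\<close> has minimal degree.\<close>
  define rel where "rel k Q \<longleftrightarrow> (\<forall>j. pol I (Q j)) \<and> (\<exists>j<k. \<exists>y. Q j y \<noteq> 0) \<and>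
    (\<forall>v. (\<Sum>j<k. Q j (\<lambda>c. \<psi> c v) * F v ^ j) = 0)" for k and Q :: "nat \<Rightarrow> ('a \<Rightarrow> complex) \<Rightarrow> complex"
  define k where "k = (LEAST k. \<exists>Q. rel k Q)"
  have "\<exists>k Q. rel k Q" unfolding rel_def using algebraic_dependence[where \<psi> = \<psi>, OF I psi F] by blast
  then have "\<exists>Q. rel k Q" unfolding k_def by (rule LeastI_ex)
  then obtain Q where Q: "rel k Q" ..
  have min: "\<not> rel l Q'" if "l < k" for l Q' using not_less_Least[OF that[unfolded k_def]] by blast
  have pQ: "pol I (Q j)" for j using Q unfolding rel_def by blast
  have k0: "k \<noteq> 0" using Q unfolding rel_def by auto
  \<comment> \<open>The index \<open>None\<close> carries the value of \<open>F\<close> and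
    \<open>Some c\<close> that of \<open>\<psi> c\<close>, so \<open>S\<close> and \<open>T\<close>
    are functions of these values alone.\<close>
  define y where "y v = case_option (F v) (\<lambda>c. \<psi> c v)" for v
  define S where "S z = (\<Sum>j<k. Q j (\<lambda>c. z (Some c)) * (of_nat j * z None ^ (j - 1)))" for z
  define T where "T c z = (\<Sum>j<k. dd (Q j) (\<lambda>c. z (Some c)) (unitv c) * z None ^ j)" for c z
  have "pol (insert None (Some ` I)) S"
    unfolding S_def[abs_def]
    by (intro pol_sum pol_mult pol_power pol_const pol_comp[OF pQ] pol_var) auto
  moreover have "\<exists>v. S (y v) \<noteq> 0"
  proof (rule ccontr)
    assume "\<not> (\<exists>v. S (y v) \<noteq> 0)"
    then have S0: "S (y v) = 0" for v by blast
    \<comment> \<open>The formal derivative with respect to \<open>F\<close>. If \<open>S\<close>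
      vanished identically, it would be a shorter relation; so its coefficients are zero, only
      \<open>Q 0\<close> is left, and that vanishes by algebraic independence.\<close>
    define Q' where "Q' j z = of_nat (Suc j) * Q (Suc j) z" for j z
    have "(\<Sum>j<k - 1. Q' j (\<lambda>c. \<psi> c v) * F v ^ j) = S (y v)" for v
    proof -
      obtain l where l: "k = Suc l" using k0 by (cases k) auto
      show ?thesis unfolding S_def y_def l Q'_def by (subst sum.lessThan_Suc_shift) (simp add: mult_ac)
    qed
    moreover have "pol I (Q' j)" for j unfolding Q'_def[abs_def] by (intro pol_mult pol_const pQ)
    ultimately have "\<not> (\<exists>j<k - 1. \<exists>z. Q' j z \<noteq> 0)"
      using min[of "k - 1" Q'] k0 S0 unfolding rel_def by auto
    then have Q0: "Q j z = 0" if "0 < j" "j < k" for j z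
      using that by (cases j) (auto simp: Q'_def simp del: of_nat_Suc)
    have "Q 0 (\<lambda>c. \<psi> c v) = 0" for v
    proof -
      have "0 = (\<Sum>j<k. Q j (\<lambda>c. \<psi> c v) * F v ^ j)" using Q unfolding rel_def by simp
      also have "\<dots> = (\<Sum>j<k. if j = 0 then Q 0 (\<lambda>c. \<psi> c v) else 0)"
        by (intro sum.cong) (auto simp: Q0)
      also have "\<dots> = Q 0 (\<lambda>c. \<psi> c v)" using k0 by simp
      finally show ?thesis by simp
    qed
    then have "Q 0 z = 0" for z by (rule algebraic_independence[OF pQ])
    then have "Q j z = 0" if "j < k" for j z using Q0 that by (cases "j = 0") auto
    then show False using Q unfolding rel_def by blast
  qed
  moreover have "(\<Sum>c\<in>I. T c (y v) * dd (\<psi> c) v u) + S (y v) * dd F v u = 0" for v u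
  proof (rule DERIV_unique[of "\<lambda>s. 0"])
    have "((\<lambda>s. \<Sum>j<k. Q j (\<lambda>c. \<psi> c (\<lambda>i. v i + s * u i)) * F (\<lambda>i. v i + s * u i) ^ j) has_field_derivative
       (\<Sum>j<k. (\<Sum>c\<in>I. dd (Q j) (\<lambda>c. \<psi> c v) (unitv c) * dd (\<psi> c) v u) * F (\<lambda>i. v i + 0 * u i) ^ j
          + of_nat j * F (\<lambda>i. v i + 0 * u i) ^ (j - 1) * dd F v u * Q j (\<lambda>c. \<psi> c (\<lambda>i. v i + 0 * u i)))) (at 0)"
    proof (intro DERIV_sum DERIV_mult comp_deriv pQ)
      fix j
      have "((\<lambda>s. F (\<lambda>i. v i + s * u i) ^ j) has_field_derivative
        of_nat j * (dd F v u * F (\<lambda>i. v i + 0 * u i) ^ (j - Suc 0))) (at 0)"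
        by (rule DERIV_power[OF pol_dd(4)[OF F I]])
      then show "((\<lambda>s. F (\<lambda>i. v i + s * u i) ^ j) has_field_derivative
        of_nat j * F (\<lambda>i. v i + 0 * u i) ^ (j - 1) * dd F v u) (at 0)" by (simp add: mult_ac)
    qed
    moreover have "(\<Sum>j<k. Q j (\<lambda>c. \<psi> c w) * F w ^ j) = 0" for w using Q unfolding rel_def by blast
    moreover have "(\<Sum>j<k. (\<Sum>c\<in>I. dd (Q j) (\<lambda>c. \<psi> c v) (unitv c) * dd (\<psi> c) v u) * F (\<lambda>i. v i + 0 * u i) ^ j
          + of_nat j * F (\<lambda>i. v i + 0 * u i) ^ (j - 1) * dd F v u * Q j (\<lambda>c. \<psi> c (\<lambda>i. v i + 0 * u i)))
      = (\<Sum>c\<in>I. T c (y v) * dd (\<psi> c) v u) + S (y v) * dd F v u"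
    proof -
      have "(\<Sum>c\<in>I. T c (y v) * dd (\<psi> c) v u) =
        (\<Sum>j<k. (\<Sum>c\<in>I. dd (Q j) (\<lambda>c. \<psi> c v) (unitv c) * dd (\<psi> c) v u) * F v ^ j)"
        unfolding T_def y_def sum_distrib_right by (subst sum.swap) (simp add: mult_ac)
      moreover have "S (y v) * dd F v u = (\<Sum>j<k. of_nat j * F (\<lambda>i. v i + 0 * u i) ^ (j - 1) * dd F v u
          * Q j (\<lambda>c. \<psi> c (\<lambda>i. v i + 0 * u i)))"
        unfolding S_def y_def sum_distrib_right by (intro sum.cong) simp_all
      ultimately show ?thesis unfolding sum.distrib by simp
    qed
    ultimately show "((\<lambda>s. 0) has_field_derivative (\<Sum>c\<in>I. T c (y v) * dd (\<psi> c) v u) + S (y v) * dd F v u) (at 0)"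
      by simp
  qed simp
  ultimately show ?thesis unfolding y_def by blast
qed

end

text \<open>Near a point where the Jacobian of \<open>\<phi>\<close> has a left inverse, genericity
  can be read off from the values of \<open>\<phi>\<close>. On the set \<open>P \<noteq> 0\<close>
  the gradients of the \<open>\<phi>\<close>'s are combinations of those of the
  \<open>\<psi>\<close>'s whose coefficients depend only on the value of \<open>\<phi>\<close>; so
  two points with the same value have comparable tangent spaces.\<close>

lemma generic_transfer:
  fixes \<phi> :: "'b \<Rightarrow> ('a \<Rightarrow> complex) \<Rightarrow> complex" and a :: "'a \<Rightarrow> 'b \<Rightarrow> complex"
  assumes I: "finite I" and B: "finite B" and phi: "\<And>b. b \<in> B \<Longrightarrow> pol I (\<phi> b)"
    and jac: "\<And>c c'. c \<in> I \<Longrightarrow> c' \<in> I \<Longrightarrow>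
      (\<Sum>b\<in>B. a c b * dd (\<phi> b) v0 (unitv c')) = (if c = c' then 1 else 0)"
    and near: "eventually Good (zariski_at I v0)"
  shows "\<exists>P. pol B P \<and> (\<exists>v. P (\<lambda>b. \<phi> b v) \<noteq> 0) \<and>
    (\<forall>v. P (\<lambda>b. \<phi> b v) \<noteq> 0 \<longrightarrow> Good v \<and>
      (\<forall>w. (\<forall>b\<in>B. \<phi> b w = \<phi> b v) \<longrightarrow>
        (\<forall>x. (\<forall>u. (\<Sum>b\<in>B. x b * dd (\<phi> b) v u) = 0) \<longrightarrow> (\<forall>u. (\<Sum>b\<in>B. x b * dd (\<phi> b) w u) = 0))))"
proof -
  \<comment> \<open>The left inverse \<open>a\<close> picks as many linear combinations of the
    \<open>\<phi>\<close>'s as there are coordinates, with identity Jacobian at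
    \<open>v0\<close>.\<close>
  define \<psi> where "\<psi> c v = (\<Sum>b\<in>B. a c b * \<phi> b v)" for c v
  have psi: "pol I (\<psi> c)" for c unfolding \<psi>_def[abs_def] by (intro pol_sum pol_mult pol_const phi)
  have ddpsi: "dd (\<psi> c) v u = (\<Sum>b\<in>B. a c b * dd (\<phi> b) v u)" for c v u
  proof -
    have "dd (\<psi> c) v u = (\<Sum>b\<in>B. dd (\<lambda>v. a c b * \<phi> b v) v u)"
      unfolding \<psi>_def[abs_def] by (rule dd_sum[where I = I]) (intro pol_mult pol_const phi I, simp, rule I)
    also have "\<dots> = (\<Sum>b\<in>B. a c b * dd (\<phi> b) v u)" using dd_cmult[OF phi I] by (intro sum.cong) simp_all
    finally show ?thesis .
  qed
  have jac': "dd (\<psi> c) v0 (unitv c') = (if c = c' then 1 else 0)" if "c \<in> I" "c' \<in> I" for c c'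
    using jac[OF that] by (simp add: ddpsi)
  obtain G where G: "pol I G" "G v0 \<noteq> 0" "\<And>v. G v \<noteq> 0 \<Longrightarrow> Good v \<and>
      (\<forall>q. (\<forall>u. (\<Sum>c\<in>I. q c * dd (\<psi> c) v u) = 0) \<longrightarrow> (\<forall>c\<in>I. q c = 0))"
    using eventually_conj[OF near jacobian_near[where \<psi> = \<psi>, OF I psi jac']] unfolding eventually_zar by blast
  obtain Q where Q: "pol I Q" "\<exists>v. Q (\<lambda>c. \<psi> c v) \<noteq> 0" "\<And>v. Q (\<lambda>c. \<psi> c v) \<noteq> 0 \<Longrightarrow> G v \<noteq> 0"
    using algebraic_transfer[where \<psi> = \<psi>, OF I psi jac' G(1,2)] by blast
  define y where "y b v = case_option (\<phi> b v) (\<lambda>c. \<psi> c v)" for b v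
  have "\<forall>b\<in>B. \<exists>TS. pol (insert None (Some ` I)) (snd TS) \<and> (\<exists>v. snd TS (y b v) \<noteq> 0) \<and>
    (\<forall>v u. (\<Sum>c\<in>I. fst TS c (y b v) * dd (\<psi> c) v u) + snd TS (y b v) * dd (\<phi> b) v u = 0)"
  proof
    fix b assume "b \<in> B"
    from tangent_relation[where \<psi> = \<psi>, OF I psi jac' phi[OF this]]
    obtain T S where "pol (insert None (Some ` I)) S \<and> (\<exists>v. S (y b v) \<noteq> 0) \<and>
      (\<forall>v u. (\<Sum>c\<in>I. T c (y b v) * dd (\<psi> c) v u) + S (y b v) * dd (\<phi> b) v u = 0)"
      unfolding y_def by blast
    then show "\<exists>TS. pol (insert None (Some ` I)) (snd TS) \<and> (\<exists>v. snd TS (y b v) \<noteq> 0) \<and>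
      (\<forall>v u. (\<Sum>c\<in>I. fst TS c (y b v) * dd (\<psi> c) v u) + snd TS (y b v) * dd (\<phi> b) v u = 0)"
      by (intro exI[of _ "(T, S)"]) simp
  qed
  from bchoice[OF this] obtain TS where TS: "\<And>b. b \<in> B \<Longrightarrow> pol (insert None (Some ` I)) (snd (TS b))"
    "\<And>b. b \<in> B \<Longrightarrow> \<exists>v. snd (TS b) (y b v) \<noteq> 0"
    "\<And>b v u. b \<in> B \<Longrightarrow> (\<Sum>c\<in>I. fst (TS b) c (y b v) * dd (\<psi> c) v u) + snd (TS b) (y b v) * dd (\<phi> b) v u = 0"
    by blast
  define z where "z b x = case_option (x b) (\<lambda>c. \<Sum>b\<in>B. a c b * x b)" for b and x :: "'b \<Rightarrow> complex"
  have zy: "z b (\<lambda>b. \<phi> b v) = y b v" for b v unfolding z_def y_def \<psi>_def ..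
  have zpol: "pol B (\<lambda>x. z b x j)" if "b \<in> B" "j \<in> insert None (Some ` I)" for b j
    using that by (cases j) (simp_all add: z_def pol_var pol_sum pol_mult)
  \<comment> \<open>The first factor guarantees \<open>Good\<close>; the others allow division by
    the coefficient of the gradient of \<open>\<phi> b\<close> in its relation.\<close>
  define P where "P x = Q (\<lambda>c. \<Sum>b\<in>B. a c b * x b) * (\<Prod>b\<in>B. snd (TS b) (z b x))" for x
  have P_phi: "P (\<lambda>b. \<phi> b v) = Q (\<lambda>c. \<psi> c v) * (\<Prod>b\<in>B. snd (TS b) (y b v))" for v
    unfolding P_def zy \<psi>_def ..
  have "pol B P" unfolding P_def[abs_def]
  proof (intro pol_mult pol_prod)
    show "pol B (\<lambda>x. Q (\<lambda>c. \<Sum>b\<in>B. a c b * x b))"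
      by (rule pol_comp[OF Q(1)]) (intro pol_sum pol_mult pol_const pol_var)
    fix b assume b: "b \<in> B"
    show "pol B (\<lambda>x. snd (TS b) (z b x))"
      using pol_comp[OF TS(1)[OF b], of B "\<lambda>j x. z b x j"] zpol[OF b] by simp
  qed
  moreover have "\<exists>v. P (\<lambda>b. \<phi> b v) \<noteq> 0"
  proof -
    have pS: "pol I (\<lambda>v. snd (TS b) (y b v))" if b: "b \<in> B" for b
    proof -
      have "pol I (\<lambda>v. y b v j)" if "j \<in> insert None (Some ` I)" for j
        using that phi[OF b] psi by (cases j) (simp_all add: y_def)
      then show ?thesis using pol_comp[OF TS(1)[OF b], of I "\<lambda>j v. y b v j"] by simp
    qed
    obtain v1 where v1: "Q (\<lambda>c. \<psi> c v1) \<noteq> 0" using Q(2) ..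
    obtain v2 where v2: "(\<Prod>b\<in>B. snd (TS b) (y b v2)) \<noteq> 0"
      using pol_nonzero_prod[where p = "\<lambda>b v. snd (TS b) (y b v)", OF B pS TS(2)] by blast
    have "\<exists>v. Q (\<lambda>c. \<psi> c v) * (\<Prod>b\<in>B. snd (TS b) (y b v)) \<noteq> 0"
      by (rule pol_nonzero_mult[where I = I and p = "\<lambda>v. Q (\<lambda>c. \<psi> c v)" and
            q = "\<lambda>v. \<Prod>b\<in>B. snd (TS b) (y b v)", OF _ _ v1 v2])
        (intro pol_comp[OF Q(1)] psi, intro pol_prod pS)
    then show ?thesis by (simp add: P_phi)
  qed
  moreover have "Good v \<and>
      (\<forall>w. (\<forall>b\<in>B. \<phi> b w = \<phi> b v) \<longrightarrow>
        (\<forall>x. (\<forall>u. (\<Sum>b\<in>B. x b * dd (\<phi> b) v u) = 0) \<longrightarrow> (\<forall>u. (\<Sum>b\<in>B. x b * dd (\<phi> b) w u) = 0)))"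
    if Pv: "P (\<lambda>b. \<phi> b v) \<noteq> 0" for v
  proof -
    have "Q (\<lambda>c. \<psi> c v) \<noteq> 0" and S0: "\<And>b. b \<in> B \<Longrightarrow> snd (TS b) (y b v) \<noteq> 0"
      using Pv B by (auto simp: P_phi)
    then have Gv: "Good v" "\<And>q. (\<forall>u. (\<Sum>c\<in>I. q c * dd (\<psi> c) v u) = 0) \<Longrightarrow> (\<forall>c\<in>I. q c = 0)"
      using G(3)[OF Q(3)] by blast+
    have "(\<Sum>b\<in>B. x b * dd (\<phi> b) w u) = 0"
      if w: "\<forall>b\<in>B. \<phi> b w = \<phi> b v" and x: "\<forall>u. (\<Sum>b\<in>B. x b * dd (\<phi> b) v u) = 0" for w x u
    proof -
      \<comment> \<open>The combination of gradients with weights \<open>x\<close>, rewritten in the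
        gradients of the \<open>\<psi>\<close>'s, has these coefficients at \<open>v\<close> and at
        \<open>w\<close> alike. Independence at \<open>v\<close> forces them to be 0, and then the
        combination vanishes at \<open>w\<close>.\<close>
      define \<kappa> where "\<kappa> c = (\<Sum>b\<in>B. x b * (fst (TS b) c (y b v) / snd (TS b) (y b v)))" for c
      have yw: "y b w = y b v" if "b \<in> B" for b
      proof -
        have "\<psi> c w = \<psi> c v" for c unfolding \<psi>_def using w by (intro sum.cong) auto
        then show ?thesis using w that unfolding y_def by simp
      qed
      have key: "(\<Sum>b\<in>B. x b * dd (\<phi> b) w' u) = - (\<Sum>c\<in>I. \<kappa> c * dd (\<psi> c) w' u)"
        if "w' = v \<or> w' = w" for w' u
      proof -
        have "x b * dd (\<phi> b) w' u = - (\<Sum>c\<in>I. x b * (fst (TS b) c (y b v) / snd (TS b) (y b v)) * dd (\<psi> c) w' u)"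
          if b: "b \<in> B" for b
        proof -
          let ?s = "\<Sum>c\<in>I. fst (TS b) c (y b v) * dd (\<psi> c) w' u"
          have "?s + snd (TS b) (y b v) * dd (\<phi> b) w' u = 0"
            using TS(3)[OF b, of w' u] \<open>w' = v \<or> w' = w\<close> yw[OF b] by auto
          then have "snd (TS b) (y b v) * dd (\<phi> b) w' u = - ?s" by (simp only: add_eq_0_iff)
          then have "dd (\<phi> b) w' u = - ?s / snd (TS b) (y b v)"
            using nonzero_mult_div_cancel_left[OF S0[OF b], of "dd (\<phi> b) w' u"] by simp
          then have "x b * dd (\<phi> b) w' u = - (x b / snd (TS b) (y b v) * ?s)" by simp
          also have "x b / snd (TS b) (y b v) * ?s = (\<Sum>c\<in>I. x b * (fst (TS b) c (y b v) / snd (TS b) (y b v)) * dd (\<psi> c) w' u)"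
            unfolding sum_distrib_left by (intro sum.cong) simp_all
          finally show ?thesis .
        qed
        then have "(\<Sum>b\<in>B. x b * dd (\<phi> b) w' u) =
          (\<Sum>b\<in>B. - (\<Sum>c\<in>I. x b * (fst (TS b) c (y b v) / snd (TS b) (y b v)) * dd (\<psi> c) w' u))"
          by (intro sum.cong) simp_all
        also have "\<dots> = - (\<Sum>c\<in>I. \<kappa> c * dd (\<psi> c) w' u)"
          unfolding sum_negf \<kappa>_def sum_distrib_right by (subst sum.swap) simp
        finally show ?thesis .
      qed
      have "\<forall>u. (\<Sum>c\<in>I. \<kappa> c * dd (\<psi> c) v u) = 0" using key[of v] x by simp
      from Gv(2)[OF this] have "\<forall>c\<in>I. \<kappa> c = 0" .
      then show ?thesis using key[of w u] by simp
    qed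
    with Gv(1) show ?thesis by blast
  qed
  ultimately show ?thesis by blast
qed

section \<open>Homogeneous polynomial functions\<close>

text \<open>Here the degree is exact, in contrast to \<open>poldeg\<close>; the zero function is a
  form of every degree, as there is always the variable with index 0.\<close>

inductive form :: "nat \<Rightarrow> nat \<Rightarrow> ((nat \<Rightarrow> complex) \<Rightarrow> complex) \<Rightarrow> bool" for n where
  const: "form n 0 (\<lambda>_. c)"
| var: "i \<le> n \<Longrightarrow> form n t p \<Longrightarrow> form n (Suc t) (\<lambda>x. x i * p x)"
| add: "form n t p \<Longrightarrow> form n t q \<Longrightarrow> form n t (\<lambda>x. p x + q x)"

lemma form_eq: "form n t p \<Longrightarrow> (\<And>x. q x = p x) \<Longrightarrow> form n t q"
  by (subgoal_tac "q = p") auto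

lemma form_cmult: "form n t p \<Longrightarrow> form n t (\<lambda>x. c * p x)"
proof (induction rule: form.induct)
  case (const a)
  show ?case by (rule form.const)
next
  case (var i t p)
  show ?case by (rule form_eq[OF form.var[OF var.hyps(1) var.IH]]) simp
next
  case (add t p q)
  show ?case unfolding distrib_left by (rule form.add[OF add.IH])
qed

lemma form_zero: "form n t (\<lambda>_. 0)"
proof (induction t)
  case 0 show ?case by (rule form.const)
next
  case (Suc t)
  show ?case by (rule form_eq[OF form.var[of 0 n, OF _ Suc]]) simp_all
qed

lemma form_mult: "form n t p \<Longrightarrow> form n s q \<Longrightarrow> form n (t + s) (\<lambda>x. p x * q x)"
proof (induction rule: form.induct)
  case (const a)
  show ?case using form_cmult[OF const] by simp
next
  case (var i t p)
  show ?case unfolding mult.assoc add_Suc by (rule form.var[OF var.hyps(1) var.IH[OF var.prems]])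
next
  case (add t p q')
  show ?case unfolding distrib_right by (rule form.add[OF add.IH(1)[OF add.prems] add.IH(2)[OF add.prems]])
qed

lemma form_sum: "(\<And>a. a \<in> S \<Longrightarrow> form n t (p a)) \<Longrightarrow> form n t (\<lambda>x. \<Sum>a\<in>S. p a x)"
  by (induction S rule: infinite_finite_induct) (simp_all add: form_zero form.add)

lemma form_diff: "form n t p \<Longrightarrow> form n t q \<Longrightarrow> form n t (\<lambda>x. p x - q x)"
  using form.add[OF _ form_cmult[of n t q "-1"], of p] by simp

lemma form_var1: "i \<le> n \<Longrightarrow> form n 1 (\<lambda>x. x i)"
  using form.var[OF _ form.const[of n 1], of i] by simp

lemma form_prod: "finite S \<Longrightarrow> (\<And>a. a \<in> S \<Longrightarrow> form n (d a) (p a)) \<Longrightarrow> form n (sum d S) (\<lambda>x. \<Prod>a\<in>S. p a x)"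
  by (induction S rule: finite_induct) (simp_all add: form.const form_mult)

lemma form_power: "form n t p \<Longrightarrow> form n (k * t) (\<lambda>x. p x ^ k)"
  by (induction k) (simp_all add: form.const form_mult)

lemma form_poldeg: "form n t p \<Longrightarrow> poldeg {..n} t p"
proof (induction rule: form.induct)
  case (const c)
  show ?case by (rule poldeg.const)
next
  case (var i t p)
  then show ?case by (intro poldeg.var) simp_all
next
  case (add t p q)
  then show ?case by (intro poldeg.add)
qed

lemma form_pol: "form n t p \<Longrightarrow> pol {..n} p"
  using form_poldeg unfolding pol_def by blast

lemma form_cong: "form n t p \<Longrightarrow> (\<And>i. i \<le> n \<Longrightarrow> x i = y i) \<Longrightarrow> p x = p y"
  using pol_cong[OF form_pol, of n t p x y] by simp

lemma form_scale: "form n t p \<Longrightarrow> p (\<lambda>i. c * x i) = c ^ t * p x"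
  by (induction rule: form.induct) (simp_all add: algebra_simps)

lemma form_scale_cong:
  assumes "form n t p" "\<And>i. i \<le> n \<Longrightarrow> y i = c * x i"
  shows "p y = c ^ t * p x"
  using form_cong[OF assms(1), of y "\<lambda>i. c * x i"] assms form_scale[OF assms(1)] by simp

lemma form_euler: "form n t p \<Longrightarrow> dd p x x = of_nat t * p x"
proof -
  assume f: "form n t p"
  have "(\<lambda>s. p (\<lambda>i. x i + s * x i)) = (\<lambda>s. (1 + s) ^ t * p x)"
    using form_scale[OF f, of "1 + _" x] by (simp add: distrib_right)
  moreover have "((\<lambda>s. (1 + s) ^ t * p x) has_field_derivative of_nat t * p x) (at 0)"
    by (auto intro!: derivative_eq_intros)
  ultimately show ?thesis by (intro dd_eqI) simp
qed

text \<open>If \<open>K\<close> consists of forms of degree \<open>m\<close>, this is the part of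
  degree \<open>m + s\<close> of the ideal generated by \<open>K\<close>. Recording the degree
  \<open>s\<close> of the cofactors keeps the predicate independent of \<open>m\<close>.\<close>

inductive prods :: "nat \<Rightarrow> ((nat \<Rightarrow> complex) \<Rightarrow> complex) set \<Rightarrow> nat \<Rightarrow> ((nat \<Rightarrow> complex) \<Rightarrow> complex) \<Rightarrow> bool"
  for n K where
  zero: "prods n K s (\<lambda>_. 0)"
| step: "k \<in> K \<Longrightarrow> form n s q \<Longrightarrow> prods n K s p \<Longrightarrow> prods n K s (\<lambda>x. k x * q x + p x)"

lemma prods_eq: "prods n K s p \<Longrightarrow> (\<And>x. q x = p x) \<Longrightarrow> prods n K s q"
  by (subgoal_tac "q = p") auto

lemma prods_gen: "k \<in> K \<Longrightarrow> form n s q \<Longrightarrow> prods n K s (\<lambda>x. k x * q x)"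
  using prods.step[OF _ _ prods.zero, of k K n s q] by simp

lemma prods_add: "prods n K s p \<Longrightarrow> prods n K s q \<Longrightarrow> prods n K s (\<lambda>x. p x + q x)"
proof (induction rule: prods.induct)
  case (zero s)
  then show ?case by simp
next
  case (step k s q' p)
  show ?case unfolding add.assoc by (rule prods.step[OF step.hyps(1,2) step.IH[OF step.prems]])
qed

lemma prods_mult: "prods n K s p \<Longrightarrow> form n u q \<Longrightarrow> prods n K (s + u) (\<lambda>x. p x * q x)"
proof (induction rule: prods.induct)
  case (zero s)
  then show ?case by (simp add: prods.zero)
next
  case (step k s q' p)
  show ?case
    by (rule prods_eq[OF prods.step[OF step.hyps(1) form_mult[OF step.hyps(2) step.prems] step.IH[OF step.prems]]])
      (simp add: algebra_simps)
qed

lemma prods_cmult: "prods n K s p \<Longrightarrow> prods n K s (\<lambda>x. c * p x)"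
  using prods_mult[OF _ form.const[of n c], of K s p] by (simp add: mult.commute)

lemma prods_diff: "prods n K s p \<Longrightarrow> prods n K s q \<Longrightarrow> prods n K s (\<lambda>x. p x - q x)"
  using prods_add[OF _ prods_cmult[of n K s q "-1"], of p] by simp

lemma prods_sum: "(\<And>a. a \<in> S \<Longrightarrow> prods n K s (p a)) \<Longrightarrow> prods n K s (\<lambda>x. \<Sum>a\<in>S. p a x)"
  by (induction S rule: infinite_finite_induct) (simp_all add: prods.zero prods_add)

lemma prods_vanish: "prods n K s p \<Longrightarrow> (\<And>k. k \<in> K \<Longrightarrow> k z = 0) \<Longrightarrow> p z = 0"
  by (induction rule: prods.induct) simp_all

lemma prods_form: "prods n K s p \<Longrightarrow> (\<And>k. k \<in> K \<Longrightarrow> form n m k) \<Longrightarrow> form n (m + s) p"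
  by (induction rule: prods.induct) (simp_all add: form_zero form.add form_mult)

lemma prods_mono: "prods n K s p \<Longrightarrow> K \<subseteq> K' \<Longrightarrow> prods n K' s p"
  by (induction rule: prods.induct) (auto intro: prods.intros)

section \<open>Newton bases and lattice points\<close>

definition weight :: "nat \<Rightarrow> (nat \<Rightarrow> nat) \<Rightarrow> nat" where
  "weight n b = (\<Sum>i\<in>{1..n}. b i)"

text \<open>
  Only the entries \<open>b 1, \<dots>, b n\<close> of an exponent vector are used; the lattice point \<open>b\<close> stands for
  the projective point \<open>(1, b 1, \<dots>, b n)\<close>.
\<close>

definition simplex :: "nat \<Rightarrow> nat \<Rightarrow> (nat \<Rightarrow> nat) set" where
  "simplex n t = {b. (\<forall>i. i \<notin> {1..n} \<longrightarrow> b i = 0) \<and> weight n b \<le> t}"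

definition box :: "nat \<Rightarrow> nat \<Rightarrow> (nat \<Rightarrow> nat) set" where
  "box n m = {b. (\<forall>i. i \<notin> {1..n} \<longrightarrow> b i = 0) \<and> (\<forall>i\<in>{1..n}. b i < m)}"

definition lattice_pt :: "(nat \<Rightarrow> nat) \<Rightarrow> nat \<Rightarrow> complex" where
  "lattice_pt b i = (if i = 0 then 1 else of_nat (b i))"

lemma wt_ge: "i \<in> {1..n} \<Longrightarrow> b i \<le> weight n b"
  unfolding weight_def by (rule member_le_sum) auto

lemma finite_supp_bounded: "finite {b::nat \<Rightarrow> nat. (\<forall>i. i \<notin> {1..n} \<longrightarrow> b i = 0) \<and> (\<forall>i\<in>{1..n}. b i \<le> t)}"
proof -
  have "{b::nat \<Rightarrow> nat. (\<forall>i. i \<notin> {1..n} \<longrightarrow> b i = 0) \<and> (\<forall>i\<in>{1..n}. b i \<le> t)} =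
    {f. \<forall>i. (i \<in> {1..n} \<longrightarrow> f i \<in> {..t}) \<and> (i \<notin> {1..n} \<longrightarrow> f i = 0)}" by auto
  then show ?thesis by (simp only: finite_set_of_finite_funs[OF finite_atLeastAtMost finite_atMost])
qed

lemma finite_idx: "finite (simplex n t)"
proof (rule finite_subset[OF _ finite_supp_bounded[of n t]], rule subsetI)
  fix b assume b: "b \<in> simplex n t"
  have "b i \<le> t" if "i \<in> {1..n}" for i using wt_ge[OF that, of b] b by (simp add: simplex_def)
  with b show "b \<in> {b. (\<forall>i. i \<notin> {1..n} \<longrightarrow> b i = 0) \<and> (\<forall>i\<in>{1..n}. b i \<le> t)}" unfolding simplex_def by blast
qed

lemma finite_box: "finite (box n m)"
  by (rule finite_subset[OF _ finite_supp_bounded[of n m]]) (auto simp: box_def intro: less_imp_le)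

lemma box_subset_idx: "n * (m - 1) \<le> t \<Longrightarrow> box n m \<subseteq> simplex n t"
proof
  fix b assume t: "n * (m - 1) \<le> t" and b: "b \<in> box n m"
  have "b i \<le> m - 1" if "i \<in> {1..n}" for i
  proof -
    have "b i < m" using b that unfolding box_def by blast
    then show ?thesis by simp
  qed
  then have "weight n b \<le> (\<Sum>i\<in>{1..n}. m - 1)" unfolding weight_def by (intro sum_mono) blast
  then show "b \<in> simplex n t" using b t by (auto simp: simplex_def box_def)
qed

lemma idx_trivial: "n = 0 \<or> t = 0 \<Longrightarrow> simplex n t = {\<lambda>_. 0}"
proof -
  assume nt: "n = 0 \<or> t = 0"
  have "b i = 0" if b: "b \<in> simplex n t" for b i
  proof (cases "i \<in> {1..n}")
    case True
    then have "t = 0" using nt by simp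
    then show ?thesis using wt_ge[OF True, of b] b by (simp add: simplex_def)
  next
    case False
    then show ?thesis using b unfolding simplex_def by blast
  qed
  then have "simplex n t \<subseteq> {\<lambda>_. 0}" by (auto simp: fun_eq_iff)
  moreover have "(\<lambda>_. 0) \<in> simplex n t" by (simp add: simplex_def weight_def)
  ultimately show ?thesis by blast
qed

text \<open>Pascal's rule: either \<open>b n = 0\<close>, which lowers the number of variables, or
  one can be subtracted from \<open>b n\<close>, which lowers the degree.\<close>

lemma card_idx: "card (simplex n t) = (n + t) choose n"
proof (induction "n + t" arbitrary: n t)
  case 0
  then show ?case using idx_trivial[of n t] by simp
next
  case (Suc s)
  show ?case
  proof (cases "n = 0 \<or> t = 0")
    case True
    with idx_trivial[OF True] show ?thesis by auto
  next
    case False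
    then obtain n' t' where nt: "n = Suc n'" "t = Suc t'" using not0_implies_Suc by blast
    let ?h = "\<lambda>b. b(n := Suc (b n))"
    have wtS: "weight (Suc n') b = weight n' b + b (Suc n')" for b by (simp add: weight_def)
    have wtu: "weight n' (b(Suc n' := c)) = weight n' b" for b c unfolding weight_def by (intro sum.cong) auto
    define supp where "supp n b \<longleftrightarrow> (\<forall>i. i \<notin> {1..n} \<longrightarrow> b i = 0)" for n and b :: "nat \<Rightarrow> nat"
    have simplex: "b \<in> simplex n t \<longleftrightarrow> supp n b \<and> weight n b \<le> t" for n t b unfolding simplex_def supp_def by blast
    have supp_Suc: "supp n' b \<longleftrightarrow> supp n b \<and> b n = 0" for b
    proof -
      have "i \<notin> {1..n'} \<longleftrightarrow> i \<notin> {1..n} \<or> i = n" for i unfolding nt by auto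
      then show ?thesis unfolding supp_def by blast
    qed
    have supp_upd: "supp n (b(n := c)) \<longleftrightarrow> supp n b" for b c
    proof -
      have "i \<notin> {1..n} \<Longrightarrow> (b(n := c)) i = b i" for i unfolding nt by (cases "i = Suc n'") auto
      then show ?thesis unfolding supp_def by metis
    qed
    have "simplex n t = simplex n' t \<union> ?h ` simplex n t'"
    proof (intro equalityI subsetI)
      fix b assume b: "b \<in> simplex n t"
      show "b \<in> simplex n' t \<union> ?h ` simplex n t'"
      proof (cases "b n = 0")
        case True
        then have "b \<in> simplex n' t" using b unfolding simplex supp_Suc nt wtS by simp
        then show ?thesis ..
      next
        case False
        have "b(n := b n - 1) \<in> simplex n t'" using b False unfolding simplex supp_upd unfolding nt wtS wtu by auto
        moreover have "b = ?h (b(n := b n - 1))" using False by auto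
        ultimately show ?thesis by blast
      qed
    next
      fix b assume "b \<in> simplex n' t \<union> ?h ` simplex n t'"
      then show "b \<in> simplex n t"
      proof
        assume "b \<in> simplex n' t"
        then show ?thesis unfolding simplex supp_Suc nt wtS by simp
      next
        assume "b \<in> ?h ` simplex n t'"
        then obtain b' where b': "b = ?h b'" "b' \<in> simplex n t'" by blast
        then show ?thesis unfolding simplex b'(1) supp_upd unfolding nt wtS wtu by simp
      qed
    qed
    moreover have "simplex n' t \<inter> ?h ` simplex n t' = {}" using simplex supp_Suc by auto
    moreover have "inj_on ?h (simplex n t')" by (rule inj_on_inverseI[of _ "\<lambda>b. b(n := b n - 1)"]) auto
    ultimately have "card (simplex n t) = card (simplex n' t) + card (simplex n t')"
      by (simp add: card_Un_disjoint finite_idx card_image)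
    moreover have "card (simplex n' t) = (n' + t) choose n'" "card (simplex n t') = (n + t') choose n"
      using Suc nt by simp_all
    ultimately show ?thesis by (simp add: nt)
  qed
qed

text \<open>
  The nodes \<open>\<nu>\<close> are either the identity, for interpolation on the simplex, or \<open>\<lambda>j. j mod m\<close>, for
  which every basis element outside the box is a multiple of a form that vanishes on the grid.
\<close>

definition newton :: "nat \<Rightarrow> (nat \<Rightarrow> nat) \<Rightarrow> nat \<Rightarrow> (nat \<Rightarrow> nat) \<Rightarrow> (nat \<Rightarrow> complex) \<Rightarrow> complex" where
  "newton n \<nu> t b x = x 0 ^ (t - weight n b) * (\<Prod>i\<in>{1..n}. \<Prod>j<b i. x i - of_nat (\<nu> j) * x 0)"

lemma form_lin_diff: "i \<le> n \<Longrightarrow> form n 1 (\<lambda>x. x i - c * x 0)"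
  by (intro form_diff form_cmult form_var1) simp_all

lemma form_newt: "b \<in> simplex n t \<Longrightarrow> form n t (newton n \<nu> t b)"
proof -
  assume b: "b \<in> simplex n t"
  have "form n ((t - weight n b) * 1 + sum (\<lambda>i. sum (\<lambda>_. 1) {..<b i}) {1..n})
     (\<lambda>x. x 0 ^ (t - weight n b) * (\<Prod>i\<in>{1..n}. \<Prod>j<b i. x i - of_nat (\<nu> j) * x 0))"
    by (intro form_mult form_power form_prod form_lin_diff form_var1) auto
  moreover have "(t - weight n b) * 1 + sum (\<lambda>i. sum (\<lambda>_. 1) {..<b i}) {1..n} = t"
    using b by (simp add: simplex_def weight_def)
  ultimately show ?thesis unfolding newton_def[abs_def] by simp
qed

lemma wt_upd: "i \<in> {1..n} \<Longrightarrow> weight n (b(i := c)) + b i = weight n b + c"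
proof -
  assume i: "i \<in> {1..n}"
  have split: "sum f {1..n} = f i + sum f ({1..n} - {i})" for f :: "nat \<Rightarrow> nat"
    by (rule sum.remove[OF finite_atLeastAtMost i])
  have "sum (b(i := c)) ({1..n} - {i}) = sum b ({1..n} - {i})" by (intro sum.cong) auto
  then show ?thesis unfolding weight_def split by simp
qed

lemma prod_upd:
  fixes g :: "nat \<Rightarrow> nat \<Rightarrow> complex"
  assumes "i \<in> {1..n}"
  shows "(\<Prod>i'\<in>{1..n}. \<Prod>j<(b(i := c)) i'. g i' j) = (\<Prod>j<c. g i j) * (\<Prod>i'\<in>{1..n} - {i}. \<Prod>j<b i'. g i' j)"
proof -
  have "(\<Prod>i'\<in>{1..n} - {i}. \<Prod>j<(b(i := c)) i'. g i' j) = (\<Prod>i'\<in>{1..n} - {i}. \<Prod>j<b i'. g i' j)"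
    by (intro prod.cong) auto
  then show ?thesis unfolding prod.remove[OF finite_atLeastAtMost assms] by simp
qed

lemma prod_shift: "(\<Prod>j<m + k. f j) = (\<Prod>j<m. f j) * (\<Prod>j<k. f (m + j))" for f :: "nat \<Rightarrow> complex"
  by (induction k) (simp_all add: mult.assoc)

lemma newt_mult_var:
  assumes "b \<in> simplex n t" "i \<in> {1..n}"
  shows "x i * newton n \<nu> t b x =
    newton n \<nu> (Suc t) (b(i := Suc (b i))) x + of_nat (\<nu> (b i)) * newton n \<nu> (Suc t) b x"
proof -
  have w: "weight n (b(i := Suc (b i))) = Suc (weight n b)" using wt_upd[OF assms(2), of b "Suc (b i)"] by simp
  have le: "weight n b \<le> t" using assms(1) by (simp add: simplex_def)
  let ?R = "\<Prod>i'\<in>{1..n} - {i}. \<Prod>j<b i'. x i' - of_nat (\<nu> j) * x 0"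
  have 1: "(\<Prod>i'\<in>{1..n}. \<Prod>j<(b(i := Suc (b i))) i'. x i' - of_nat (\<nu> j) * x 0) =
    (\<Prod>j<b i. x i - of_nat (\<nu> j) * x 0) * (x i - of_nat (\<nu> (b i)) * x 0) * ?R"
    unfolding prod_upd[OF assms(2)] by simp
  have 2: "(\<Prod>i'\<in>{1..n}. \<Prod>j<b i'. x i' - of_nat (\<nu> j) * x 0) = (\<Prod>j<b i. x i - of_nat (\<nu> j) * x 0) * ?R"
    using prod_upd[where b = b and c = "b i", OF assms(2)] by simp
  show ?thesis unfolding newton_def w 1 2 using le by (simp add: Suc_diff_le algebra_simps)
qed

lemma newt_mult_0: "b \<in> simplex n t \<Longrightarrow> x 0 * newton n \<nu> t b x = newton n \<nu> (Suc t) b x"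
  unfolding newton_def by (simp add: simplex_def Suc_diff_le)

text \<open>The span of the Newton elements of all degrees is closed under multiplication by the
  variables: multiplying by \<open>x i\<close> raises \<open>b i\<close> by one, up to a multiple of
  \<open>x 0\<close>.\<close>

lemma newt_span:
  assumes "form n t p"
  shows "\<exists>c. \<forall>x. p x = (\<Sum>b\<in>simplex n t. c b * newton n \<nu> t b x)"
proof -
  define sp where "sp t q \<longleftrightarrow> (\<exists>c. \<forall>x. q x = (\<Sum>b\<in>simplex n t. c b * newton n \<nu> t b x))" for t q
  have sp_add: "sp t (\<lambda>x. p x + q x)" if pq: "sp t p" "sp t q" for t p q
  proof -
    obtain c where c: "\<And>x. p x = (\<Sum>b\<in>simplex n t. c b * newton n \<nu> t b x)" using pq(1) unfolding sp_def by blast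
    obtain d where d: "\<And>x. q x = (\<Sum>b\<in>simplex n t. d b * newton n \<nu> t b x)" using pq(2) unfolding sp_def by blast
    show ?thesis unfolding sp_def
      by (rule exI[of _ "\<lambda>b. c b + d b"]) (simp add: c d distrib_right sum.distrib)
  qed
  have sp_cmult: "sp t (\<lambda>x. a * p x)" if p: "sp t p" for t p a
  proof -
    obtain c where c: "\<And>x. p x = (\<Sum>b\<in>simplex n t. c b * newton n \<nu> t b x)" using p unfolding sp_def by blast
    show ?thesis unfolding sp_def
      by (rule exI[of _ "\<lambda>b. a * c b"]) (simp add: c sum_distrib_left mult.assoc)
  qed
  have sp_newt: "sp t (newton n \<nu> t b)" if "b \<in> simplex n t" for t b
    unfolding sp_def
    by (rule exI[of _ "\<lambda>b'. if b' = b then 1 else 0"])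
      (use that finite_idx[of n t] in \<open>simp add: if_distrib[of "\<lambda>c. c * _"] cong: if_cong\<close>)
  have sp_sum: "sp t (\<lambda>x. \<Sum>b\<in>S. f b x)" if "finite S" "\<And>b. b \<in> S \<Longrightarrow> sp t (f b)" for t f and S :: "(nat \<Rightarrow> nat) set"
    using that
  proof (induction S rule: finite_induct)
    case empty
    show ?case unfolding sp_def by (rule exI[of _ "\<lambda>_. 0"]) simp
  next
    case (insert b S)
    then show ?case by (simp add: sp_add)
  qed
  from assms have "sp t p"
  proof (induction rule: form.induct)
    case (const c)
    have z: "(\<lambda>_. 0) \<in> simplex n 0" by (simp add: simplex_def weight_def)
    have "newton n \<nu> 0 (\<lambda>_. 0) = (\<lambda>x. 1)" by (simp add: newton_def fun_eq_iff)
    then show ?case using sp_cmult[OF sp_newt[OF z], of c] by simp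
  next
    case (var i t p)
    obtain c where c: "\<And>x. p x = (\<Sum>b\<in>simplex n t. c b * newton n \<nu> t b x)" using var.IH unfolding sp_def by blast
    have "sp (Suc t) (\<lambda>x. x i * newton n \<nu> t b x)" if b: "b \<in> simplex n t" for b
    proof (cases "i = 0")
      case True
      have "b \<in> simplex n (Suc t)" using b by (auto simp: simplex_def)
      then show ?thesis using sp_newt newt_mult_0[OF b] by (simp add: True)
    next
      case False
      then have i: "i \<in> {1..n}" using var.hyps(1) by simp
      have b1: "b \<in> simplex n (Suc t)" using b by (auto simp: simplex_def)
      have "b(i := Suc (b i)) \<in> simplex n (Suc t)"
        using b i wt_upd[OF i, of b "Suc (b i)"] by (auto simp: simplex_def)
      then show ?thesis unfolding newt_mult_var[OF b i] by (intro sp_add sp_cmult sp_newt b1)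
    qed
    then have "sp (Suc t) (\<lambda>x. \<Sum>b\<in>simplex n t. c b * (x i * newton n \<nu> t b x))"
      by (intro sp_sum sp_cmult finite_idx)
    then show ?case by (simp add: c sum_distrib_left mult_ac)
  next
    case (add t p q)
    then show ?case by (intro sp_add)
  qed
  then show ?thesis unfolding sp_def .
qed

text \<open>A product of falling factorials; it is nonzero just for \<open>b \<le> a\<close>
  coordinatewise, which makes the evaluation matrix triangular.\<close>

definition newton_val :: "nat \<Rightarrow> (nat \<Rightarrow> nat) \<Rightarrow> (nat \<Rightarrow> nat) \<Rightarrow> complex" where
  "newton_val n b a = (\<Prod>i\<in>{1..n}. \<Prod>j<b i. of_nat (a i) - of_nat j)"

lemma nval_nonzero: "newton_val n b a \<noteq> 0 \<longleftrightarrow> (\<forall>i\<in>{1..n}. b i \<le> a i)"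
  unfolding newton_val_def by (force simp: prod_zero_iff not_less)

lemma newt_lat:
  assumes "\<And>i j. i \<in> {1..n} \<Longrightarrow> j < b i \<Longrightarrow> \<nu> j = j"
  shows "newton n \<nu> t b (lattice_pt a) = newton_val n b a"
  unfolding newton_def newton_val_def using assms by (simp add: lattice_pt_def)

lemma newt_id_lat: "newton n (\<lambda>j. j) t b (lattice_pt a) = newton_val n b a"
  by (rule newt_lat) simp

text \<open>Induction on the weight of the node \<open>a\<close>: only \<open>b \<le> a\<close>
  contribute to the equation at \<open>a\<close>, and all of these except \<open>a\<close> itself
  have smaller weight. The same finite set indexes nodes and basis, so it need not be a full
  simplex.\<close>

lemma nval_independent:
  assumes A: "finite A" "\<And>a. a \<in> A \<Longrightarrow> (\<forall>i. i \<notin> {1..n} \<longrightarrow> a i = 0)"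
    and 0: "\<And>a. a \<in> A \<Longrightarrow> (\<Sum>b\<in>A. c b * newton_val n b a) = 0" and a: "a \<in> A"
  shows "c a = 0"
  using a
proof (induction "weight n a" arbitrary: a rule: less_induct)
  case less
  have "c b * newton_val n b a = 0" if "b \<in> A" "b \<noteq> a" for b
  proof (cases "newton_val n b a = 0")
    case False
    then have le: "\<forall>i\<in>{1..n}. b i \<le> a i" by (simp add: nval_nonzero)
    have "\<exists>i\<in>{1..n}. b i \<noteq> a i"
    proof (rule ccontr)
      assume "\<not> (\<exists>i\<in>{1..n}. b i \<noteq> a i)"
      then have "b i = a i" for i using A(2)[OF that(1)] A(2)[OF less.prems] by (cases "i \<in> {1..n}") auto
      then show False using that(2) by (auto simp: fun_eq_iff)
    qed
    then have "weight n b < weight n a" unfolding weight_def using le by (intro sum_strict_mono_ex1) (auto intro: le_neq_trans)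
    then show ?thesis using less.hyps that(1) by simp
  qed simp
  then have "(\<Sum>b\<in>A. c b * newton_val n b a) = (\<Sum>b\<in>A. if b = a then c a * newton_val n a a else 0)"
    by (intro sum.cong) auto
  also have "\<dots> = c a * newton_val n a a" using A(1) less.prems by simp
  finally show ?case using 0[OF less.prems] nval_nonzero[of n a a] by simp
qed

lemma square_system_solvable:
  fixes N :: "'x \<Rightarrow> 'x \<Rightarrow> 'c::field"
  assumes A: "finite A" and inj: "\<And>c. (\<And>a. a \<in> A \<Longrightarrow> (\<Sum>b\<in>A. c b * N b a) = 0) \<Longrightarrow> \<forall>b\<in>A. c b = 0"
  shows "\<exists>c. \<forall>a\<in>A. (\<Sum>b\<in>A. c b * N b a) = r a"
proof -
  \<comment> \<open>One more unknown, \<open>None\<close>, multiplies the right hand side. The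
    enlarged system has a nontrivial solution, in which this unknown is nonzero by
    injectivity.\<close>
  let ?S = "insert None (Some ` A)"
  have "card A < card ?S" using A by (simp add: card_image)
  from underdetermined_system[OF A _ this, of "\<lambda>s a. case s of None \<Rightarrow> r a | Some b \<Rightarrow> N b a"]
  obtain x where x: "\<exists>s\<in>?S. x s \<noteq> 0" "\<And>a. a \<in> A \<Longrightarrow> (\<Sum>s\<in>?S. x s * (case s of None \<Rightarrow> r a | Some b \<Rightarrow> N b a)) = 0"
    using A by blast
  have s: "x None * r a + (\<Sum>b\<in>A. x (Some b) * N b a) = 0" if "a \<in> A" for a
    using x(2)[OF that] A by (simp add: sum.reindex)
  have n0: "x None \<noteq> 0"
  proof
    assume "x None = 0"
    then have "\<forall>b\<in>A. x (Some b) = 0" using s by (intro inj) simp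
    with \<open>x None = 0\<close> x(1) show False by auto
  qed
  have "(\<Sum>b\<in>A. - x (Some b) / x None * N b a) = r a" if "a \<in> A" for a
  proof -
    have "(\<Sum>b\<in>A. - x (Some b) / x None * N b a) = - (\<Sum>b\<in>A. x (Some b) * N b a) / x None"
      by (simp add: sum_divide_distrib flip: sum_negf)
    also have "- (\<Sum>b\<in>A. x (Some b) * N b a) = x None * r a" using s[OF that] by (simp add: minus_equation_iff add_eq_0_iff2)
    finally show ?thesis using n0 by simp
  qed
  then show ?thesis by (intro exI[of _ "\<lambda>b. - x (Some b) / x None"]) blast
qed

lemma lattice_interpolation:
  assumes "A \<subseteq> simplex n t"
  shows "\<exists>p. form n t p \<and> (\<forall>a\<in>A. p (lattice_pt a) = r a)"
proof -
  have fin: "finite A" using assms finite_idx finite_subset by blast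
  have supp: "\<forall>i. i \<notin> {1..n} \<longrightarrow> a i = 0" if "a \<in> A" for a using that assms by (auto simp: simplex_def)
  have "\<exists>c. \<forall>a\<in>A. (\<Sum>b\<in>A. c b * newton_val n b a) = r a"
    using nval_independent[OF fin supp] by (intro square_system_solvable fin) blast
  then obtain c where c: "\<And>a. a \<in> A \<Longrightarrow> (\<Sum>b\<in>A. c b * newton_val n b a) = r a" by blast
  have "form n t (\<lambda>x. \<Sum>b\<in>A. c b * newton n (\<lambda>j. j) t b x)"
    using assms by (intro form_sum form_cmult form_newt) auto
  moreover have "(\<Sum>b\<in>A. c b * newton n (\<lambda>j. j) t b (lattice_pt a)) = r a" if "a \<in> A" for a
    using c[OF that] by (simp add: newt_id_lat)
  ultimately show ?thesis by (intro exI[of _ "\<lambda>x. \<Sum>b\<in>A. c b * newton n (\<lambda>j. j) t b x"]) simp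
qed

text \<open>The nodes of the simplex are as many as the Newton elements, so a form is determined by
  its values there. Since \<open>lattice_pt a 0 = 1\<close>, this also reduces identities between
  forms to dehomogenized ones.\<close>

lemma form_zero_if_lattice:
  assumes "form n t p" "\<And>a. a \<in> simplex n t \<Longrightarrow> p (lattice_pt a) = 0"
  shows "p x = 0"
proof -
  obtain c where c: "\<And>x. p x = (\<Sum>b\<in>simplex n t. c b * newton n (\<lambda>j. j) t b x)"
    using newt_span[OF assms(1)] by blast
  have "c a = 0" if "a \<in> simplex n t" for a
  proof (rule nval_independent[of "simplex n t" n c a])
    show "(\<Sum>b\<in>simplex n t. c b * newton_val n b a) = 0" if "a \<in> simplex n t" for a
      using assms(2)[OF that] unfolding c newt_id_lat .
  qed (rule finite_idx, simp add: simplex_def, rule that)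
  then show ?thesis unfolding c by (intro sum.neutral) simp
qed

lemma form_eq_if_lattice:
  assumes "form n t p" "form n t q" "\<And>a. a \<in> simplex n t \<Longrightarrow> p (lattice_pt a) = q (lattice_pt a)"
  shows "p x = q x"
  using form_zero_if_lattice[OF form_diff[OF assms(1,2)], of x] assms(3) by simp

section \<open>The grid\<close>

definition grid_form :: "nat \<Rightarrow> nat \<Rightarrow> (nat \<Rightarrow> complex) \<Rightarrow> complex" where
  "grid_form m i x = (\<Prod>j<m. x i - of_nat j * x 0)"

lemma form_gridf: "i \<le> n \<Longrightarrow> form n m (grid_form m i)"
  using form_prod[of "{..<m}" n "\<lambda>_. 1" "\<lambda>j x. x i - of_nat j * x 0"] form_lin_diff[of i n]
  by (simp add: grid_form_def[abs_def])

lemma gridf_vanish: "b \<in> box n m \<Longrightarrow> i \<in> {1..n} \<Longrightarrow> grid_form m i (lattice_pt b) = 0"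
  unfolding grid_form_def by (rule prod_zero) (auto simp: box_def lattice_pt_def intro!: bexI[of _ "b i"])

text \<open>Because the nodes repeat with period \<open>m\<close>, the first \<open>m\<close>
  factors in direction \<open>i\<close> are precisely the grid form, and the remaining ones start
  again with node 0.\<close>

lemma newt_outside_box:
  assumes "b \<in> simplex n t" "i \<in> {1..n}" "m \<le> b i"
  shows "newton n (\<lambda>j. j mod m) t b x = grid_form m i x * newton n (\<lambda>j. j mod m) (t - m) (b(i := b i - m)) x"
    and "b(i := b i - m) \<in> simplex n (t - m)"
proof -
  have w: "weight n (b(i := b i - m)) + m = weight n b" using wt_upd[OF assms(2), of b "b i - m"] assms(3) by simp
  then show "b(i := b i - m) \<in> simplex n (t - m)" using assms(1,2) by (auto simp: simplex_def)
  have e: "t - weight n b = t - m - weight n (b(i := b i - m))" using w by simp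
  let ?f = "\<lambda>j. x i - of_nat (j mod m) * x 0"
  have "(\<Prod>j<b i. ?f j) = (\<Prod>j<m + (b i - m). ?f j)" using assms(3) by simp
  also have "\<dots> = (\<Prod>j<m. ?f j) * (\<Prod>j<b i - m. ?f (m + j))"
    by (rule prod_shift)
  also have "(\<Prod>j<m. ?f j) = grid_form m i x" unfolding grid_form_def by (intro prod.cong) auto
  finally have p: "(\<Prod>j<b i. ?f j) = grid_form m i x * (\<Prod>j<b i - m. ?f j)" by simp
  show "newton n (\<lambda>j. j mod m) t b x = grid_form m i x * newton n (\<lambda>j. j mod m) (t - m) (b(i := b i - m)) x"
    unfolding newton_def e prod_upd[OF assms(2)] using p prod_upd[where b = b and c = "b i", OF assms(2)] by simp
qed

lemma newt_mod_box: "b \<in> box n m \<Longrightarrow> newton n (\<lambda>j. j mod m) t b (lattice_pt a) = newton_val n b a"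
proof (rule newt_lat)
  fix i j assume b: "b \<in> box n m" and "i \<in> {1..n}" "j < b i"
  then have "j < m" unfolding box_def using less_trans by blast
  then show "j mod m = j" by simp
qed

lemma newt_mod_vanish:
  assumes "b \<in> simplex n t" "b \<notin> box n m" "a \<in> box n m"
  shows "newton n (\<lambda>j. j mod m) t b (lattice_pt a) = 0"
proof -
  obtain i where i: "i \<in> {1..n}" "m \<le> b i" using assms(1,2) by (auto simp: simplex_def box_def not_less)
  show ?thesis using newt_outside_box(1)[OF assms(1) i] gridf_vanish[OF assms(3) i(1)] by simp
qed

text \<open>On grid points the elements outside the box vanish, while those inside take the
  triangular values \<open>newton_val\<close>; so vanishing on the grid kills all coefficients
  inside the box.\<close>

lemma grid_expansion:
  assumes "form n t p" "\<And>a. a \<in> box n m \<inter> simplex n t \<Longrightarrow> p (lattice_pt a) = 0"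
  shows "\<exists>c. \<forall>x. p x = (\<Sum>b\<in>simplex n t - box n m. c b * newton n (\<lambda>j. j mod m) t b x)"
proof -
  let ?A = "box n m \<inter> simplex n t"
  obtain c where c: "\<And>x. p x = (\<Sum>b\<in>simplex n t. c b * newton n (\<lambda>j. j mod m) t b x)"
    using newt_span[OF assms(1)] by blast
  have split: "p x = (\<Sum>b\<in>?A. c b * newton n (\<lambda>j. j mod m) t b x) + (\<Sum>b\<in>simplex n t - box n m. c b * newton n (\<lambda>j. j mod m) t b x)" for x
    unfolding c by (subst sum.Int_Diff[OF finite_idx, of _ n t "box n m"]) (simp add: Int_commute)
  have "c a = 0" if "a \<in> ?A" for a
  proof (rule nval_independent[of ?A n c a])
    fix a assume a: "a \<in> ?A"
    have "0 = p (lattice_pt a)" using assms(2) a by simp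
    also have "\<dots> = (\<Sum>b\<in>?A. c b * newton_val n b a)"
      unfolding split using a by (simp add: newt_mod_box newt_mod_vanish)
    finally show "(\<Sum>b\<in>?A. c b * newton_val n b a) = 0" by simp
  qed (use that finite_idx in \<open>auto simp: simplex_def\<close>)
  then show ?thesis using split by (intro exI[of _ c]) simp
qed

text \<open>The grid is a complete intersection with explicit cofactors: each Newton element that
  survives in \<open>grid_expansion\<close> is a multiple of some grid form.\<close>

lemma grid_ideal:
  assumes "form n t p" "\<And>a. a \<in> box n m \<inter> simplex n t \<Longrightarrow> p (lattice_pt a) = 0"
  shows "prods n (grid_form m ` {1..n}) (t - m) p"
proof -
  obtain c where c: "\<And>x. p x = (\<Sum>b\<in>simplex n t - box n m. c b * newton n (\<lambda>j. j mod m) t b x)"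
    using grid_expansion[OF assms] by blast
  have "prods n (grid_form m ` {1..n}) (t - m) (\<lambda>x. c b * newton n (\<lambda>j. j mod m) t b x)"
    if b: "b \<in> simplex n t - box n m" for b
  proof -
    obtain i where i: "i \<in> {1..n}" "m \<le> b i" using b by (auto simp: simplex_def box_def not_less)
    have b': "b \<in> simplex n t" using b by blast
    have "prods n (grid_form m ` {1..n}) (t - m) (newton n (\<lambda>j. j mod m) t b)"
      by (rule prods_eq[OF prods_gen[where k = "grid_form m i" and K = "grid_form m ` {1..n}", OF imageI[where f = "grid_form m", OF i(1)] form_newt[OF newt_outside_box(2)[OF b' i]]]])
        (rule newt_outside_box(1)[OF b' i])
    then show ?thesis by (rule prods_cmult)
  qed
  then show ?thesis by (intro prods_eq[OF prods_sum c])
qed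

text \<open>A vector of weight at most \<open>m\<close> outside the box has an entry that is at
  least \<open>m\<close>, so it is \<open>m\<close> times a unit vector; there are \<open>n\<close>
  of these.\<close>

lemma card_Z0:
  assumes "1 \<le> m"
  shows "card (box n m \<inter> simplex n m) + n = (n + m) choose n"
proof -
  let ?e = "\<lambda>i. (\<lambda>_. 0)(i := m)"
  have "simplex n m - box n m = ?e ` {1..n}"
  proof (intro equalityI subsetI)
    fix b assume b: "b \<in> simplex n m - box n m"
    then obtain i where i: "i \<in> {1..n}" "m \<le> b i" by (auto simp: simplex_def box_def not_less)
    have "weight n b = b i + (\<Sum>k\<in>{1..n} - {i}. b k)" unfolding weight_def using i(1) by (simp add: sum.remove)
    moreover have "weight n b \<le> m" using b by (simp add: simplex_def)
    ultimately have "b i = m" "(\<Sum>k\<in>{1..n} - {i}. b k) = 0" using i(2) by linarith+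
    then have z: "\<forall>k\<in>{1..n} - {i}. b k = 0" "b i = m" by (simp_all only: sum_eq_0_iff finite_Diff finite_atLeastAtMost)
    have "\<forall>k. k \<notin> {1..n} \<longrightarrow> b k = 0" using b unfolding simplex_def by blast
    with z have "b k = ?e i k" for k by (cases "k = i"; cases "k \<in> {1..n}") (simp_all del: atLeastAtMost_iff)
    then show "b \<in> ?e ` {1..n}" using i(1) by blast
  next
    fix b assume "b \<in> ?e ` {1..n}"
    then obtain i where i: "i \<in> {1..n}" "b = ?e i" by blast
    have "weight n (\<lambda>_. 0) = 0" by (simp add: weight_def)
    then have "weight n b = m" using wt_upd[OF i(1), of "\<lambda>_. 0" m] i(2) by simp
    moreover have "b k = 0" if "k \<notin> {1..n}" for k using that i by (cases "k = i") auto
    ultimately have "b \<in> simplex n m" unfolding simplex_def by blast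
    moreover have "\<not> b i < m" using i(2) by simp
    then have "b \<notin> box n m" using i(1) unfolding box_def by blast
    ultimately show "b \<in> simplex n m - box n m" by blast
  qed
  moreover have "inj_on ?e {1..n}" using assms by (intro inj_onI) (metis fun_upd_same fun_upd_other not_one_le_zero)
  ultimately have "card (simplex n m - box n m) = n" by (simp add: card_image)
  moreover have "card (simplex n m) = card (simplex n m \<inter> box n m) + card (simplex n m - box n m)"
    using card_Un_disjoint[of "simplex n m \<inter> box n m" "simplex n m - box n m"] finite_idx
    by (simp add: Int_Diff_Un Int_Diff_disjoint)
  ultimately show ?thesis using card_idx[of n m] by (simp add: Int_commute)
qed

text \<open>At a grid point the value is the number whose digits in base \<open>m\<close> are the
  coordinates, so it tells the grid points apart.\<close>

definition separator :: "nat \<Rightarrow> nat \<Rightarrow> (nat \<Rightarrow> complex) \<Rightarrow> complex" where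
  "separator n m x = (\<Sum>i\<in>{1..n}. of_nat (m ^ (i - 1)) * x i)"

lemma form_sepf: "form n 1 (separator n m)"
  unfolding separator_def[abs_def] by (intro form_sum form_cmult form_var1) simp

lemma sepf_inj: "inj_on (\<lambda>b. separator n m (lattice_pt b)) (box n m)"
proof (rule inj_onI)
  fix a b assume ab: "a \<in> box n m" "b \<in> box n m" "separator n m (lattice_pt a) = separator n m (lattice_pt b)"
  have s: "separator n m (lattice_pt c) = of_nat (\<Sum>i<n. c (Suc i) * m ^ i)" for c
  proof -
    have "separator n m (lattice_pt c) = (\<Sum>i\<in>{1..n}. of_nat (c i * m ^ (i - 1)))"
      unfolding separator_def by (intro sum.cong) (auto simp: lattice_pt_def)
    also have "\<dots> = (\<Sum>i<n. of_nat (c (Suc i) * m ^ i))"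
      by (rule sum.reindex_bij_witness[of _ Suc "\<lambda>i. i - 1"]) auto
    finally show ?thesis by simp
  qed
  have "(\<Sum>i<n. a (Suc i) * m ^ i) = (\<Sum>i<n. b (Suc i) * m ^ i)" using ab(3) unfolding s of_nat_eq_iff .
  then have eq: "\<forall>i<n. a (Suc i) = b (Suc i)"
    using ab(1,2) by (intro digits_inj) (auto simp: box_def)
  have "a i = b i" for i
  proof (cases "i \<in> {1..n}")
    case True
    then obtain k where "i = Suc k" "k < n" by (cases i) auto
    then show ?thesis using eq by simp
  qed (use ab in \<open>simp add: box_def\<close>)
  then show "a = b" by blast
qed

section \<open>Families of forms near a configuration\<close>

text \<open>Regularity is demanded of each value instead of each coefficient; with the lattice
  points as test points this is as good and avoids choosing a basis.\<close>

definition reg_family :: "'a set \<Rightarrow> ('a \<Rightarrow> complex) \<Rightarrow> nat \<Rightarrow> nat \<Rightarrow> (('a \<Rightarrow> complex) \<Rightarrow> (nat \<Rightarrow> complex) \<Rightarrow> complex) \<Rightarrow> bool" where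
  "reg_family I v0 n t P \<longleftrightarrow> (\<forall>v. form n t (P v)) \<and> (\<forall>y. reg I v0 (\<lambda>v. P v y))"

lemma rfamI: "(\<And>v. form n t (P v)) \<Longrightarrow> (\<And>y. reg I v0 (\<lambda>v. P v y)) \<Longrightarrow> reg_family I v0 n t P"
  unfolding reg_family_def by blast

lemma rfam_form: "reg_family I v0 n t P \<Longrightarrow> form n t (P v)"
  unfolding reg_family_def by blast

lemma rfam_reg: "reg_family I v0 n t P \<Longrightarrow> reg I v0 (\<lambda>v. P v y)"
  unfolding reg_family_def by blast

lemma rfam_const: "form n t p \<Longrightarrow> reg_family I v0 n t (\<lambda>_. p)"
  by (intro rfamI reg_const)

lemma rfam_add: "reg_family I v0 n t P \<Longrightarrow> reg_family I v0 n t Q \<Longrightarrow> reg_family I v0 n t (\<lambda>v y. P v y + Q v y)"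
  unfolding reg_family_def by (simp add: form.add reg_add)

lemma rfam_diff: "reg_family I v0 n t P \<Longrightarrow> reg_family I v0 n t Q \<Longrightarrow> reg_family I v0 n t (\<lambda>v y. P v y - Q v y)"
  unfolding reg_family_def by (simp add: form_diff reg_diff)

lemma rfam_mult: "reg_family I v0 n t P \<Longrightarrow> reg_family I v0 n s Q \<Longrightarrow> reg_family I v0 n (t + s) (\<lambda>v y. P v y * Q v y)"
  unfolding reg_family_def by (simp add: form_mult reg_mult)

lemma rfam_scale: "reg I v0 c \<Longrightarrow> reg_family I v0 n t P \<Longrightarrow> reg_family I v0 n t (\<lambda>v y. c v * P v y)"
  unfolding reg_family_def by (simp add: form_cmult reg_mult)

lemma rfam_sum: "(\<And>a. a \<in> S \<Longrightarrow> reg_family I v0 n t (P a)) \<Longrightarrow> reg_family I v0 n t (\<lambda>v y. \<Sum>a\<in>S. P a v y)"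
  unfolding reg_family_def by (simp add: form_sum reg_sum)

lemma rfam_prod:
  "finite S \<Longrightarrow> (\<And>a. a \<in> S \<Longrightarrow> reg_family I v0 n (d a) (P a)) \<Longrightarrow> reg_family I v0 n (sum d S) (\<lambda>v y. \<Prod>a\<in>S. P a v y)"
  unfolding reg_family_def by (simp add: form_prod reg_prod)

lemma rfam_power: "reg_family I v0 n t P \<Longrightarrow> reg_family I v0 n (k * t) (\<lambda>v y. P v y ^ k)"
  unfolding reg_family_def by (simp add: form_power reg_power)

text \<open>The family has as many members as the space of forms has dimensions, so evaluation at
  the lattice points gives a square matrix. It is invertible at \<open>v0\<close>, hence nearby,
  which yields regular expansion coefficients and independence at once.\<close>

lemma span_near:
  assumes fam: "\<And>x. x \<in> simplex n t \<Longrightarrow> reg_family I v0 n t (l x)"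
    and span: "\<And>p. form n t p \<Longrightarrow> \<exists>c. \<forall>y. p y = (\<Sum>x\<in>simplex n t. c x * l x v0 y)"
  obtains B where "\<And>x a. x \<in> simplex n t \<Longrightarrow> a \<in> simplex n t \<Longrightarrow> reg I v0 (B x a)"
    "eventually (\<lambda>v. (\<forall>p. form n t p \<longrightarrow>
        (\<forall>y. p y = (\<Sum>x\<in>simplex n t. (\<Sum>a\<in>simplex n t. B x a v * p (lattice_pt a)) * l x v y))) \<and>
      (\<forall>c. (\<forall>y. (\<Sum>x\<in>simplex n t. c x * l x v y) = 0) \<longrightarrow> (\<forall>x\<in>simplex n t. c x = 0))) (zariski_at I v0)"
proof -
  let ?X = "simplex n t"
  have "\<exists>c. \<forall>a'\<in>?X. (\<Sum>x\<in>?X. c x * l x v0 (lattice_pt a')) = (if a = a' then 1 else 0)" for a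
  proof -
    obtain p where p: "form n t p" "\<forall>a'\<in>?X. p (lattice_pt a') = (if a = a' then 1 else 0)"
      using lattice_interpolation[OF order_refl, of n t "\<lambda>a'. if a = a' then 1 else 0"] by blast
    obtain c where c: "\<forall>y. p y = (\<Sum>x\<in>?X. c x * l x v0 y)" using span[OF p(1)] ..
    show ?thesis using p(2) c by (intro exI[of _ c]) simp
  qed
  then have "\<forall>a. \<exists>c. \<forall>a'\<in>?X. (\<Sum>x\<in>?X. c x * l x v0 (lattice_pt a')) = (if a = a' then 1 else 0)" ..
  from choice[OF this] obtain c where
    c: "\<And>a a'. a' \<in> ?X \<Longrightarrow> (\<Sum>x\<in>?X. c a x * l x v0 (lattice_pt a')) = (if a = a' then 1 else 0)" by blast
  obtain B where B: "\<And>x y. x \<in> ?X \<Longrightarrow> y \<in> ?X \<Longrightarrow> reg I v0 (B x y)"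
    "eventually (\<lambda>v. \<forall>x\<in>?X. \<forall>z\<in>?X. (\<Sum>y\<in>?X. l y v (lattice_pt x) * B y z v) = (if x = z then 1 else 0) \<and>
      (\<Sum>y\<in>?X. B x y v * l z v (lattice_pt y)) = (if x = z then 1 else 0)) (zariski_at I v0)"
  proof (rule near_inverse[where X = ?X and A = "\<lambda>a x v. l x v (lattice_pt a)" and ?B0.0 = "\<lambda>x a. c a x"])
    show "finite ?X" by (rule finite_idx)
    show "reg I v0 (\<lambda>v. l y v (lattice_pt x))" if "x \<in> ?X" "y \<in> ?X" for x y by (rule rfam_reg[OF fam[OF that(2)]])
    show "(\<Sum>y\<in>?X. l y v0 (lattice_pt x) * c z y) = (if x = z then 1 else 0)" if "x \<in> ?X" "z \<in> ?X" for x z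
      using c[OF that(1), of z] by (simp add: mult.commute eq_commute)
  qed (rule that)
  have "eventually (\<lambda>v. (\<forall>p. form n t p \<longrightarrow>
        (\<forall>y. p y = (\<Sum>x\<in>?X. (\<Sum>a\<in>?X. B x a v * p (lattice_pt a)) * l x v y))) \<and>
      (\<forall>c. (\<forall>y. (\<Sum>x\<in>?X. c x * l x v y) = 0) \<longrightarrow> (\<forall>x\<in>?X. c x = 0))) (zariski_at I v0)"
  proof (rule eventually_mono[OF B(2)], intro conjI allI impI ballI)
    fix v p y
    assume h: "\<forall>x\<in>?X. \<forall>z\<in>?X. (\<Sum>y\<in>?X. l y v (lattice_pt x) * B y z v) = (if x = z then 1 else 0) \<and>
      (\<Sum>y\<in>?X. B x y v * l z v (lattice_pt y)) = (if x = z then 1 else 0)" and p: "form n t p"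
    show "p y = (\<Sum>x\<in>?X. (\<Sum>a\<in>?X. B x a v * p (lattice_pt a)) * l x v y)"
    proof (rule form_eq_if_lattice[OF p])
      show "form n t (\<lambda>y. \<Sum>x\<in>?X. (\<Sum>a\<in>?X. B x a v * p (lattice_pt a)) * l x v y)"
        by (intro form_sum form_cmult rfam_form[OF fam])
      fix a' assume a': "a' \<in> ?X"
      have "(\<Sum>x\<in>?X. (\<Sum>a\<in>?X. B x a v * p (lattice_pt a)) * l x v (lattice_pt a'))
        = (\<Sum>a\<in>?X. p (lattice_pt a) * (\<Sum>x\<in>?X. l x v (lattice_pt a') * B x a v))"
        unfolding sum_distrib_left sum_distrib_right by (subst sum.swap) (simp add: mult_ac)
      also have "\<dots> = (\<Sum>a\<in>?X. if a = a' then p (lattice_pt a) else 0)" using h a' by (intro sum.cong) auto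
      also have "\<dots> = p (lattice_pt a')" using a' finite_idx by simp
      finally show "p (lattice_pt a') = (\<Sum>x\<in>?X. (\<Sum>a\<in>?X. B x a v * p (lattice_pt a)) * l x v (lattice_pt a'))" by simp
    qed
  next
    fix v c x
    assume h: "\<forall>x\<in>?X. \<forall>z\<in>?X. (\<Sum>y\<in>?X. l y v (lattice_pt x) * B y z v) = (if x = z then 1 else 0) \<and>
      (\<Sum>y\<in>?X. B x y v * l z v (lattice_pt y)) = (if x = z then 1 else 0)"
      and c: "\<forall>y. (\<Sum>x\<in>?X. c x * l x v y) = 0" and x: "x \<in> ?X"
    have "0 = (\<Sum>a\<in>?X. B x a v * (\<Sum>z\<in>?X. c z * l z v (lattice_pt a)))" using c by simp
    also have "\<dots> = (\<Sum>z\<in>?X. c z * (\<Sum>a\<in>?X. B x a v * l z v (lattice_pt a)))"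
      unfolding sum_distrib_left by (subst sum.swap) (simp add: mult_ac)
    also have "\<dots> = (\<Sum>z\<in>?X. if z = x then c z else 0)" using h x by (intro sum.cong) auto
    also have "\<dots> = c x" using x finite_idx by simp
    finally show "c x = 0" by simp
  qed
  from that[OF B(1) this] show ?thesis .
qed

text \<open>It suffices to deform a basis: the deformed Lagrange basis of the simplex satisfies
  \<open>Q v\<close> and still spans by \<open>span_near\<close>, and \<open>Q v\<close> is a linear
  condition. In this way an ideal membership in one degree spreads from \<open>v0\<close> to a
  neighbourhood.\<close>

lemma open_span:
  assumes ex: "\<And>p. form n t p \<Longrightarrow> \<exists>P. reg_family I v0 n t P \<and> P v0 = p \<and> eventually (\<lambda>v. Q v (P v)) (zariski_at I v0)"
    and zero: "\<And>v. Q v (\<lambda>_. 0)"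
    and add: "\<And>v p q. Q v p \<Longrightarrow> Q v q \<Longrightarrow> Q v (\<lambda>y. p y + q y)"
    and cmult: "\<And>v c p. Q v p \<Longrightarrow> Q v (\<lambda>y. c * p y)"
  shows "eventually (\<lambda>v. \<forall>p. form n t p \<longrightarrow> Q v p) (zariski_at I v0)"
proof -
  let ?X = "simplex n t"
  have "\<forall>x. \<exists>P. reg_family I v0 n t P \<and> (\<forall>a\<in>?X. P v0 (lattice_pt a) = (if x = a then 1 else 0)) \<and> eventually (\<lambda>v. Q v (P v)) (zariski_at I v0)"
  proof
    fix x
    obtain p where p: "form n t p" "\<forall>a\<in>?X. p (lattice_pt a) = (if x = a then 1 else 0)"
      using lattice_interpolation[OF order_refl, of n t "\<lambda>a'. if x = a' then 1 else 0"] by blast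
    show "\<exists>P. reg_family I v0 n t P \<and> (\<forall>a\<in>?X. P v0 (lattice_pt a) = (if x = a then 1 else 0)) \<and> eventually (\<lambda>v. Q v (P v)) (zariski_at I v0)"
      using ex[OF p(1)] p(2) by blast
  qed
  from choice[OF this] obtain l where l: "\<And>x. reg_family I v0 n t (l x)"
    "\<And>x a. a \<in> ?X \<Longrightarrow> l x v0 (lattice_pt a) = (if x = a then 1 else 0)"
    "\<And>x. eventually (\<lambda>v. Q v (l x v)) (zariski_at I v0)" by blast
  have span: "\<exists>c. \<forall>y. p y = (\<Sum>x\<in>?X. c x * l x v0 y)" if p: "form n t p" for p
  proof (intro exI allI)
    fix y
    show "p y = (\<Sum>x\<in>?X. p (lattice_pt x) * l x v0 y)"
    proof (rule form_eq_if_lattice[OF p])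
      show "form n t (\<lambda>y. \<Sum>x\<in>?X. p (lattice_pt x) * l x v0 y)" by (intro form_sum form_cmult rfam_form[OF l(1)])
      fix a assume a: "a \<in> ?X"
      then show "p (lattice_pt a) = (\<Sum>x\<in>?X. p (lattice_pt x) * l x v0 (lattice_pt a))"
        using finite_idx by (simp add: l(2) if_distrib[of "\<lambda>c. _ * c"] cong: if_cong)
    qed
  qed
  obtain B where "\<And>x a. x \<in> ?X \<Longrightarrow> a \<in> ?X \<Longrightarrow> reg I v0 (B x a)" and B: "eventually (\<lambda>v. (\<forall>p. form n t p \<longrightarrow>
        (\<forall>y. p y = (\<Sum>x\<in>?X. (\<Sum>a\<in>?X. B x a v * p (lattice_pt a)) * l x v y))) \<and>
      (\<forall>c. (\<forall>y. (\<Sum>x\<in>?X. c x * l x v y) = 0) \<longrightarrow> (\<forall>x\<in>?X. c x = 0))) (zariski_at I v0)"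
  proof (rule span_near[where l = l and n = n and t = t and I = I and ?v0.0 = v0])
    show "reg_family I v0 n t (l x)" for x by (rule l(1))
    show "\<exists>c. \<forall>y. p y = (\<Sum>x\<in>?X. c x * l x v0 y)" if "form n t p" for p by (rule span[OF that])
  qed (rule that)
  have Qsum: "Q v (\<lambda>y. \<Sum>x\<in>S. c x * q x y)" if "finite S" "\<And>x. x \<in> S \<Longrightarrow> Q v (q x)" for v c q and S :: "(nat \<Rightarrow> nat) set"
    using that by (induction S rule: finite_induct) (simp_all add: zero add cmult)
  have "eventually (\<lambda>v. \<forall>x\<in>?X. Q v (l x v)) (zariski_at I v0)"
    using l(3) by (intro eventually_ball_finite finite_idx) blast
  with B show ?thesis
  proof eventually_elim
    case (elim v)
    show ?case
    proof (intro allI impI)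
      fix p assume p: "form n t p"
      have "p = (\<lambda>y. \<Sum>x\<in>?X. (\<Sum>a\<in>?X. B x a v * p (lattice_pt a)) * l x v y)"
        using elim(1) p by (intro ext) blast
      moreover have "Q v (\<lambda>y. \<Sum>x\<in>?X. (\<Sum>a\<in>?X. B x a v * p (lattice_pt a)) * l x v y)"
        using elim(2) by (intro Qsum finite_idx) blast
      ultimately show "Q v p" by metis
    qed
  qed
qed

text \<open>A configuration of points \<open>v\<^sub>j\<close> is the point \<open>v\<close> of affine space with coordinates \<open>v (j, k)\<close>.\<close>

definition point :: "(nat \<times> nat \<Rightarrow> complex) \<Rightarrow> nat \<Rightarrow> nat \<Rightarrow> complex" where
  "point v i = (\<lambda>k. v (i, k))"

definition dual :: "nat set \<Rightarrow> (nat \<Rightarrow> (nat \<Rightarrow> complex) \<Rightarrow> complex) \<Rightarrow> (nat \<Rightarrow> nat \<Rightarrow> complex) \<Rightarrow> bool" where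
  "dual J L x \<longleftrightarrow> (\<forall>i\<in>J. \<forall>j\<in>J. L i (x j) = (if i = j then 1 else 0))"

definition vanishing :: "nat \<Rightarrow> nat \<Rightarrow> nat set \<Rightarrow> (nat \<Rightarrow> nat \<Rightarrow> complex) \<Rightarrow> ((nat \<Rightarrow> complex) \<Rightarrow> complex) set" where
  "vanishing n m J x = {p. form n m p \<and> (\<forall>j\<in>J. p (x j) = 0)}"

lemma dualD: "dual J L x \<Longrightarrow> i \<in> J \<Longrightarrow> j \<in> J \<Longrightarrow> L i (x j) = (if i = j then 1 else 0)"
  unfolding dual_def by blast

lemma sum_dual:
  assumes "dual J L x" "j \<in> J" "finite J"
  shows "(\<Sum>i\<in>J. a i * L i (x j)) = a j"
proof -
  have "(\<Sum>i\<in>J. a i * L i (x j)) = (\<Sum>i\<in>J. if i = j then a j else 0)"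
    using assms by (intro sum.cong) (auto simp: dualD)
  then show ?thesis using assms by simp
qed

lemma vanI: "form n m p \<Longrightarrow> (\<And>j. j \<in> J \<Longrightarrow> p (x j) = 0) \<Longrightarrow> p \<in> vanishing n m J x"
  unfolding vanishing_def by blast

lemma van_form: "p \<in> vanishing n m J x \<Longrightarrow> form n m p"
  unfolding vanishing_def by blast

lemma van_zero: "p \<in> vanishing n m J x \<Longrightarrow> j \<in> J \<Longrightarrow> p (x j) = 0"
  unfolding vanishing_def by blast

lemma pol_row: "form n t p \<Longrightarrow> j \<in> J \<Longrightarrow> pol (J \<times> {..n}) (\<lambda>v. p (point v j))"
  using pol_comp[OF form_pol, of n t p "J \<times> {..n}" "\<lambda>k v. v (j, k)"] pol_var[of "(j, _)" "J \<times> {..n}"]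
  by (simp add: point_def)

text \<open>The matrix of the values of the old Lagrange forms at the moved points is the identity
  at \<open>v0\<close>; multiplication by its inverse restores duality.\<close>

lemma lagrange_near:
  assumes J: "finite J" and L0: "\<And>i. i \<in> J \<Longrightarrow> form n k (L0 i)" "dual J L0 (point v0)"
  obtains L where "\<And>i. i \<in> J \<Longrightarrow> reg_family (J \<times> {..n}) v0 n k (L i)" "\<And>i. i \<in> J \<Longrightarrow> L i v0 = L0 i"
    "eventually (\<lambda>v. dual J (\<lambda>i. L i v) (point v)) (zariski_at (J \<times> {..n}) v0)"
proof -
  let ?I = "J \<times> {..n}"
  obtain B where B: "\<And>x y. x \<in> J \<Longrightarrow> y \<in> J \<Longrightarrow> reg ?I v0 (B x y)"
    "eventually (\<lambda>v. \<forall>x\<in>J. \<forall>z\<in>J. (\<Sum>y\<in>J. L0 x (point v y) * B y z v) = (if x = z then 1 else 0) \<and>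
      (\<Sum>y\<in>J. B x y v * L0 y (point v z)) = (if x = z then 1 else 0)) (zariski_at ?I v0)"
  proof (rule near_inverse[where X = J and A = "\<lambda>i j v. L0 i (point v j)" and ?B0.0 = "\<lambda>x y. if x = y then 1 else 0"])
    show "finite J" by (rule J)
    show "reg ?I v0 (\<lambda>v. L0 x (point v y))" if "x \<in> J" "y \<in> J" for x y
      by (rule reg_pol, rule pol_row[OF L0(1)[OF that(1)] that(2)])
    show "(\<Sum>y\<in>J. L0 x (point v0 y) * (if y = z then 1 else 0)) = (if x = z then 1 else 0)"
      if "x \<in> J" "z \<in> J" for x z
      using that J dualD[OF L0(2)] by (simp add: if_distrib[of "\<lambda>c. _ * c"] cong: if_cong)
  qed (rule that)
  define L where "L i v y = (\<Sum>k\<in>J. B i k v * L0 k y)" for i v y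
  have 1: "reg_family ?I v0 n k (L i)" if "i \<in> J" for i
    unfolding L_def[abs_def] by (intro rfam_sum rfam_scale rfam_const B(1) L0(1) that)
  have 2: "L i v0 = L0 i" if i: "i \<in> J" for i
  proof
    fix y
    have B0: "B i j v0 = (if i = j then 1 else 0)" if j: "j \<in> J" for j
    proof -
      have "(\<Sum>k\<in>J. B i k v0 * L0 k (point v0 j)) = (if i = j then 1 else 0)"
        using eventually_zar_at[OF B(2)] i j by blast
      then show ?thesis by (simp add: sum_dual[OF L0(2) j J])
    qed
    have "L i v0 y = (\<Sum>k\<in>J. if k = i then L0 i y else 0)"
      unfolding L_def using B0 by (intro sum.cong) auto
    then show "L i v0 y = L0 i y" using i J by simp
  qed
  have 3: "eventually (\<lambda>v. dual J (\<lambda>i. L i v) (point v)) (zariski_at ?I v0)"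
    by (rule eventually_mono[OF B(2)]) (simp add: dual_def L_def)
  show ?thesis by (rule that[OF 1 2 3])
qed

text \<open>Subtracts the Lagrange interpolant of \<open>k\<close>, so that the result vanishes at
  the moved points; it is \<open>k\<close> itself where \<open>k\<close> already vanishes at the
  points.\<close>

definition deform :: "nat set \<Rightarrow> (nat \<Rightarrow> (nat \<times> nat \<Rightarrow> complex) \<Rightarrow> (nat \<Rightarrow> complex) \<Rightarrow> complex) \<Rightarrow>
    ((nat \<Rightarrow> complex) \<Rightarrow> complex) \<Rightarrow> (nat \<times> nat \<Rightarrow> complex) \<Rightarrow> (nat \<Rightarrow> complex) \<Rightarrow> complex" where
  "deform J L k v y = k y - (\<Sum>j\<in>J. k (point v j) * L j v y)"

lemma rfam_deform:
  assumes "\<And>i. i \<in> J \<Longrightarrow> reg_family (J \<times> {..n}) v0 n m (L i)" "form n m k"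
  shows "reg_family (J \<times> {..n}) v0 n m (deform J L k)"
  unfolding deform_def[abs_def]
  by (intro rfam_diff rfam_const rfam_sum rfam_scale assms reg_pol pol_row[OF assms(2)])

lemma deform_van:
  assumes "\<And>i. i \<in> J \<Longrightarrow> reg_family (J \<times> {..n}) v0 n m (L i)" "form n m k" "finite J" "dual J (\<lambda>i. L i v) (point v)"
  shows "deform J L k v \<in> vanishing n m J (point v)"
  by (rule vanI[OF rfam_form[OF rfam_deform[OF assms(1,2)]]])
    (simp_all add: deform_def sum_dual[OF assms(4) _ assms(3)])

lemma deform_at: "(\<And>j. j \<in> J \<Longrightarrow> k (point v j) = 0) \<Longrightarrow> deform J L k v = k"
  unfolding deform_def by (simp add: fun_eq_iff)

text \<open>Only the generators are deformed, the cofactors are kept.\<close>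

lemma deform_prods:
  assumes L: "\<And>i. i \<in> J \<Longrightarrow> reg_family (J \<times> {..n}) v0 n m (L i)" and J: "finite J"
    and p: "prods n (vanishing n m J (point v0)) s p"
  shows "\<exists>P. reg_family (J \<times> {..n}) v0 n (m + s) P \<and> P v0 = p \<and>
    (\<forall>v. dual J (\<lambda>i. L i v) (point v) \<longrightarrow> prods n (vanishing n m J (point v)) s (P v))"
  using p
proof (induction rule: prods.induct)
  case (zero s)
  show ?case by (intro exI[of _ "\<lambda>_ _. 0"]) (simp add: rfam_const form_zero prods.zero)
next
  case (step k s q p)
  then obtain P where P: "reg_family (J \<times> {..n}) v0 n (m + s) P" "P v0 = p"
    "\<And>v. dual J (\<lambda>i. L i v) (point v) \<Longrightarrow> prods n (vanishing n m J (point v)) s (P v)" by blast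
  note fk = van_form[OF step.hyps(1)]
  have "deform J L k v0 = k" by (rule deform_at) (rule van_zero[OF step.hyps(1)])
  moreover have "reg_family (J \<times> {..n}) v0 n (m + s) (\<lambda>v y. deform J L k v y * q y + P v y)"
    by (intro rfam_add rfam_mult rfam_deform L fk P(1) rfam_const step.hyps(2))
  moreover have "prods n (vanishing n m J (point v)) s (\<lambda>y. deform J L k v y * q y + P v y)"
    if "dual J (\<lambda>i. L i v) (point v)" for v
    by (intro prods.step deform_van[OF L fk J that] step.hyps(2) P(3)[OF that])
  ultimately show ?case using P(2) by (intro exI[of _ "\<lambda>v y. deform J L k v y * q y + P v y"]) simp
qed

section \<open>Ideals of finite sets of points\<close>

lemma form_Suc_decomp:
  assumes "form n (Suc t) p"
  shows "\<exists>q. (\<forall>i\<le>n. form n t (q i)) \<and> (\<forall>x. p x = (\<Sum>i\<le>n. x i * q i x))"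
  using assms
proof (induction "Suc t" p arbitrary: t rule: form.induct)
  case (var i t p)
  have "x i * p x = (\<Sum>j\<le>n. x j * (if j = i then p x else 0))" for x
    using var.hyps(1) by (simp add: if_distrib[of "\<lambda>c. _ * c"] cong: if_cong)
  moreover have "form n t (\<lambda>x. if j = i then p x else 0)" for j
    using var.hyps(2) form_zero by (cases "j = i") simp_all
  ultimately show ?case by (intro exI[of _ "\<lambda>j x. if j = i then p x else 0"]) blast
next
  case (add p q)
  obtain a where a: "\<forall>i\<le>n. form n t (a i)" "\<And>x. p x = (\<Sum>i\<le>n. x i * a i x)" using add.hyps(2) by blast
  obtain b where b: "\<forall>i\<le>n. form n t (b i)" "\<And>x. q x = (\<Sum>i\<le>n. x i * b i x)" using add.hyps(4) by blast
  show ?case using a b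
    by (intro exI[of _ "\<lambda>i x. a i x + b i x"]) (simp add: form.add distrib_left sum.distrib)
qed

text \<open>A hands-on form of Castelnuovo-Mumford regularity: if in degree \<open>t\<close> the
  Lagrange forms, multiplied by a power of \<open>y 0\<close>, span a complement of the ideal, then
  they do so in all higher degrees. The ideal then contains every form of such a degree that
  vanishes at the points, since the coefficients are values up to nonzero factors.\<close>

lemma ideal_regularity:
  assumes J: "finite J" and L: "\<And>j. j \<in> J \<Longrightarrow> form n k (L j)" "dual J L x" and kt: "k < t" and mt: "m \<le> t"
    and y0: "\<And>j. j \<in> J \<Longrightarrow> x j 0 \<noteq> 0"
    and span: "\<And>p. form n t p \<Longrightarrow> \<exists>a. prods n (vanishing n m J x) (t - m) (\<lambda>y. p y - (\<Sum>j\<in>J. a j * L j y) * y 0 ^ (t - k))"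
    and tu: "t \<le> u" and p: "form n u p" and p0: "\<And>j. j \<in> J \<Longrightarrow> p (x j) = 0"
  shows "prods n (vanishing n m J x) (u - m) p"
proof -
  let ?K = "vanishing n m J x"
  define dec where "dec u p \<longleftrightarrow> (\<exists>a. prods n ?K (u - m) (\<lambda>y. p y - (\<Sum>j\<in>J. a j * L j y) * y 0 ^ (u - k)))" for u p
  have dec_add: "dec u (\<lambda>y. p y + q y)" if pq: "dec u p" "dec u q" for u p q
  proof -
    obtain a where a: "prods n ?K (u - m) (\<lambda>y. p y - (\<Sum>j\<in>J. a j * L j y) * y 0 ^ (u - k))"
      using pq(1) unfolding dec_def ..
    obtain b where b: "prods n ?K (u - m) (\<lambda>y. q y - (\<Sum>j\<in>J. b j * L j y) * y 0 ^ (u - k))"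
      using pq(2) unfolding dec_def ..
    show ?thesis unfolding dec_def
      by (rule exI[of _ "\<lambda>j. a j + b j"], rule prods_eq[OF prods_add[OF a b]])
        (simp add: algebra_simps sum.distrib)
  qed
  have dec_cmult: "dec u (\<lambda>y. c * p y)" if pq: "dec u p" for u p c
  proof -
    obtain a where a: "prods n ?K (u - m) (\<lambda>y. p y - (\<Sum>j\<in>J. a j * L j y) * y 0 ^ (u - k))"
      using pq unfolding dec_def ..
    show ?thesis unfolding dec_def
      by (rule exI[of _ "\<lambda>j. c * a j"], rule prods_eq[OF prods_cmult[OF a, of c]])
        (simp add: algebra_simps sum_distrib_left)
  qed
  have dec_prods: "dec u p" if "prods n ?K (u - m) p" for u p
    unfolding dec_def using that by (intro exI[of _ "\<lambda>_. 0"]) simp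
  have dec_sum: "dec u (\<lambda>y. \<Sum>i\<in>S. f i y)" if "finite S" "\<And>i. i \<in> S \<Longrightarrow> dec u (f i)" for u f and S :: "nat set"
    using that by (induction S rule: finite_induct) (simp_all add: dec_add dec_prods prods.zero)
  have all: "\<forall>p. form n u p \<longrightarrow> dec u p"
    using tu
  proof (induction u rule: dec_induct)
    case base
    show ?case unfolding dec_def by (intro allI impI span)
  next
    case (step u)
    have S: "Suc u - m = (u - m) + 1" using step.hyps mt by simp
    have mult: "dec (Suc u) (\<lambda>y. y i * q y)" if i: "i \<le> n" and q: "form n u q" for i q
    proof -
      have "dec u q" using step.IH q by blast
      then obtain a where a: "prods n ?K (u - m) (\<lambda>y. q y - (\<Sum>j\<in>J. a j * L j y) * y 0 ^ (u - k))"
        unfolding dec_def ..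
      have A: "dec (Suc u) (\<lambda>y. (q y - (\<Sum>j\<in>J. a j * L j y) * y 0 ^ (u - k)) * y i)"
        by (rule dec_prods, unfold S, rule prods_mult[OF a form_var1[OF i]])
      obtain e where e: "u - k = Suc e" using step.hyps kt by (cases "u - k") auto
      \<comment> \<open>One factor \<open>y 0\<close> is set aside, which \<open>k < t\<close> makes
        possible. The rest has degree \<open>u\<close>, so the induction hypothesis decomposes it,
        and multiplying by \<open>y 0\<close> keeps the shape.\<close>
      have "dec (Suc u) (\<lambda>y. L j y * y 0 ^ (u - k) * y i)" if j: "j \<in> J" for j
      proof -
        have "form n (k + (u - k - 1) * 1 + 1) (\<lambda>y. L j y * y 0 ^ (u - k - 1) * y i)"
          using i by (intro form_mult form_power L(1) j form_var1) simp_all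
        moreover have "k + (u - k - 1) * 1 + 1 = u" using step.hyps kt by simp
        ultimately have "dec u (\<lambda>y. L j y * y 0 ^ (u - k - 1) * y i)" using step.IH by simp
        then obtain b where b: "prods n ?K (u - m)
            (\<lambda>y. L j y * y 0 ^ (u - k - 1) * y i - (\<Sum>j\<in>J. b j * L j y) * y 0 ^ (u - k))"
          unfolding dec_def ..
        have Sk: "Suc u - k = Suc (u - k)" using step.hyps kt by simp
        show ?thesis unfolding dec_def S
          by (rule exI[of _ b], rule prods_eq[OF prods_mult[OF b form_var1[of 0 n]]])
            (simp_all add: Sk e algebra_simps)
      qed
      then have B: "dec (Suc u) (\<lambda>y. \<Sum>j\<in>J. a j * (L j y * y 0 ^ (u - k) * y i))"
        by (intro dec_sum J dec_cmult)
      have "(\<lambda>y. y i * q y) = (\<lambda>y. (q y - (\<Sum>j\<in>J. a j * L j y) * y 0 ^ (u - k)) * y i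
          + (\<Sum>j\<in>J. a j * (L j y * y 0 ^ (u - k) * y i)))"
        by (simp add: fun_eq_iff algebra_simps sum_distrib_left sum_distrib_right)
      then show ?thesis using dec_add[OF A B] by simp
    qed
    show ?case
    proof (intro allI impI)
      fix p assume "form n (Suc u) p"
      from form_Suc_decomp[OF this] obtain q where q: "\<forall>i\<le>n. form n u (q i)" "\<And>x. p x = (\<Sum>i\<le>n. x i * q i x)"
        by blast
      have "dec (Suc u) (\<lambda>x. \<Sum>i\<le>n. x i * q i x)"
        using q(1) by (intro dec_sum mult) simp_all
      moreover have "p = (\<lambda>x. \<Sum>i\<le>n. x i * q i x)" by (rule ext) (rule q(2))
      ultimately show "dec (Suc u) p" by (simp only:)
    qed
  qed
  then have "dec u p" using p by blast
  then obtain a where a: "prods n ?K (u - m) (\<lambda>y. p y - (\<Sum>j\<in>J. a j * L j y) * y 0 ^ (u - k))"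
    unfolding dec_def ..
  have "a j = 0" if j: "j \<in> J" for j
  proof -
    have "p (x j) - (\<Sum>i\<in>J. a i * L i (x j)) * x j 0 ^ (u - k) = 0"
      by (rule prods_vanish[OF a]) (rule van_zero[OF _ j])
    then show ?thesis using p0[OF j] y0[OF j] by (simp add: sum_dual[OF L(2) j J])
  qed
  then show ?thesis using a by simp
qed

section \<open>Reduced zero schemes and the differentials of their equations\<close>

definition zeros_of :: "((nat \<Rightarrow> complex) \<Rightarrow> complex) set \<Rightarrow> (nat \<Rightarrow> complex) set" where
  "zeros_of K = {z. \<forall>k\<in>K. k z = 0}"

definition nonzero_pt :: "nat \<Rightarrow> (nat \<Rightarrow> complex) \<Rightarrow> bool" where
  "nonzero_pt n z \<longleftrightarrow> (\<exists>k\<le>n. z k \<noteq> 0)"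

text \<open>The factor may be 0, so that a zero vector \<open>z\<close> lies on every ray; the
  relation is symmetric only if \<open>z\<close> is nonzero.\<close>

definition ray :: "nat \<Rightarrow> (nat \<Rightarrow> complex) \<Rightarrow> (nat \<Rightarrow> complex) \<Rightarrow> bool" where
  "ray n w z \<longleftrightarrow> (\<exists>c. \<forall>k\<le>n. z k = c * w k)"

text \<open>
  The last conjunct says that the ideal generated by \<open>K\<close> and its radical agree in all large degrees;
  unlike saturatedness it can be read off from a single degree near the special configuration.
\<close>

definition reduced_on :: "nat \<Rightarrow> nat \<Rightarrow> ((nat \<Rightarrow> complex) \<Rightarrow> complex) set \<Rightarrow> (nat \<Rightarrow> complex) set \<Rightarrow> bool" where
  "reduced_on n m K W \<longleftrightarrow> finite W \<and> (\<forall>z\<in>zeros_of K. nonzero_pt n z \<longrightarrow> z 0 \<noteq> 0 \<and> (\<exists>w\<in>W. ray n w z)) \<and>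
    (\<exists>u0. \<forall>u\<ge>u0. \<forall>p. form n u p \<longrightarrow> (\<forall>z\<in>zeros_of K. z 0 \<noteq> 0 \<longrightarrow> p z = 0) \<longrightarrow> prods n K (u - m) p)"

lemma separating_linear:
  assumes "\<not> ray n w z"
  shows "\<exists>l. form n 1 l \<and> l w = 0 \<and> l z \<noteq> 0"
proof (cases "\<exists>i\<le>n. w i \<noteq> 0")
  case False
  have "\<exists>k\<le>n. z k \<noteq> 0" using assms unfolding ray_def by (metis mult_zero_left)
  then obtain k where "k \<le> n" "z k \<noteq> 0" by blast
  with False show ?thesis by (intro exI[of _ "\<lambda>y. y k"] conjI form_var1) auto
next
  case True
  then obtain i where i: "i \<le> n" "w i \<noteq> 0" by blast
  have "\<exists>k\<le>n. z k * w i \<noteq> z i * w k"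
  proof (rule ccontr)
    assume "\<not> (\<exists>k\<le>n. z k * w i \<noteq> z i * w k)"
    then have "\<forall>k\<le>n. z k = z i / w i * w k" using i(2) by (simp add: field_simps)
    with assms show False unfolding ray_def by blast
  qed
  then obtain k where k: "k \<le> n" "z k * w i \<noteq> z i * w k" by blast
  have "form n 1 (\<lambda>y. w i * y k - w k * y i)" by (intro form_diff form_cmult form_var1 i k)
  then show ?thesis using k(2) by (intro exI[of _ "\<lambda>y. w i * y k - w k * y i"]) (simp add: mult.commute)
qed

lemma separating_form:
  assumes "finite W" "\<And>w. w \<in> W \<Longrightarrow> \<not> ray n w z"
  shows "\<exists>p. form n (card W) p \<and> p z \<noteq> 0 \<and> (\<forall>w\<in>W. p w = 0)"
proof -
  have "\<forall>w\<in>W. \<exists>l. form n 1 l \<and> l w = 0 \<and> l z \<noteq> 0" using separating_linear assms(2) by blast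
  from bchoice[OF this] obtain l where l: "\<And>w. w \<in> W \<Longrightarrow> form n 1 (l w)" "\<And>w. w \<in> W \<Longrightarrow> l w w = 0"
    "\<And>w. w \<in> W \<Longrightarrow> l w z \<noteq> 0" by blast
  have "form n (sum (\<lambda>_. 1) W) (\<lambda>y. \<Prod>w\<in>W. l w y)" by (intro form_prod assms(1) l(1))
  moreover have "(\<Prod>w\<in>W. l w z) \<noteq> 0" using l(3) assms(1) by simp
  moreover have "(\<Prod>w\<in>W. l w w') = 0" if "w' \<in> W" for w'
    using l(2)[OF that] assms(1) that by (intro prod_zero) auto
  ultimately show ?thesis by (intro exI[of _ "\<lambda>y. \<Prod>w\<in>W. l w y"]) simp
qed

lemma form_mult_var_power: "form n t p \<Longrightarrow> i \<le> n \<Longrightarrow> form n (t + s) (\<lambda>y. p y * y i ^ s)"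
  using form_mult[OF _ form_power[OF form_var1, of i n s]] by simp

lemma van_comb:
  assumes "p \<in> vanishing n m J x" "q \<in> vanishing n m J x"
  shows "(\<lambda>y. a * p y + q y) \<in> vanishing n m J x"
  by (intro vanI form.add form_cmult van_form[OF assms(1)] van_form[OF assms(2)])
    (simp add: van_zero[OF assms(1)] van_zero[OF assms(2)])

lemma zero_van: "(\<lambda>_. 0) \<in> vanishing n m J x"
  by (intro vanI form_zero) simp

lemma dd_linear: "dd (\<lambda>y. \<Sum>k\<le>n. \<xi> k * y k) z u = (\<Sum>k\<le>n. \<xi> k * u k)"
  by (rule dd_eqI) (auto intro!: derivative_eq_intros simp: mult.commute)

text \<open>At a common zero of the generators only the terms \<open>q z * dk\<close> of the product
  rule survive, and these combine to the differential of a single form of degree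
  \<open>m\<close>.\<close>

lemma prods_dd:
  assumes "prods n (vanishing n m J x) s p" "z \<in> zeros_of (vanishing n m J x)"
  shows "\<exists>\<kappa>\<in>vanishing n m J x. \<forall>u. dd p z u = dd \<kappa> z u"
  using assms(1)
proof induction
  case (zero s)
  show ?case by (rule bexI[OF _ zero_van]) simp
next
  case (step k s q p)
  then obtain \<kappa> where \<kappa>: "\<kappa> \<in> vanishing n m J x" "\<And>u. dd p z u = dd \<kappa> z u" by blast
  note pk = form_pol[OF van_form[OF step.hyps(1)]] and pq = form_pol[OF step.hyps(2)]
    and pp = form_pol[OF prods_form[OF step.hyps(3) van_form]] and p\<kappa> = form_pol[OF van_form[OF \<kappa>(1)]]
  have "dd (\<lambda>y. k y * q y + p y) z u = dd (\<lambda>y. q z * k y + \<kappa> y) z u" for u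
  proof -
    have "k z = 0" using assms(2) step.hyps(1) unfolding zeros_of_def by blast
    have "dd (\<lambda>y. k y * q y + p y) z u = dd k z u * q z + dd q z u * k z + dd p z u"
      by (subst dd_add[where I = "{..n}"]) (simp_all add: pol_mult pk pq pp dd_mult[where I = "{..n}"])
    also have "\<dots> = q z * dd k z u + dd \<kappa> z u" using \<open>k z = 0\<close> \<kappa>(2) by simp
    also have "\<dots> = dd (\<lambda>y. q z * k y + \<kappa> y) z u"
      by (subst dd_add[where I = "{..n}"]) (simp_all add: pol_mult pk p\<kappa> dd_cmult[where I = "{..n}"])
    finally show ?thesis .
  qed
  then show ?case by (intro bexI[OF _ van_comb[OF step.hyps(1) \<kappa>(1)]]) blast
qed

text \<open>A reduced isolated zero is cut out transversally. The linear form with coefficients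
  \<open>\<xi>\<close> vanishes at \<open>z\<close>; multiplied by a form that vanishes at all other
  zeros it lies in the ideal, and \<open>prods_dd\<close> turns its differential into that of a
  generator.\<close>

lemma transversal:
  assumes red: "reduced_on n m (vanishing n m J x) W" and z: "z \<in> zeros_of (vanishing n m J x)" "z 0 \<noteq> 0"
    and \<xi>: "(\<Sum>k\<le>n. \<xi> k * z k) = 0"
  shows "\<exists>\<kappa>\<in>vanishing n m J x. \<forall>u. dd \<kappa> z u = (\<Sum>k\<le>n. \<xi> k * u k)"
proof -
  let ?K = "vanishing n m J x"
  from red have "\<exists>u0. \<forall>u\<ge>u0. \<forall>p. form n u p \<longrightarrow> (\<forall>z\<in>zeros_of ?K. z 0 \<noteq> 0 \<longrightarrow> p z = 0) \<longrightarrow> prods n ?K (u - m) p"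
    unfolding reduced_on_def by (elim conjE)
  then obtain u0 where u0: "\<forall>u\<ge>u0. \<forall>p. form n u p \<longrightarrow> (\<forall>z\<in>zeros_of ?K. z 0 \<noteq> 0 \<longrightarrow> p z = 0) \<longrightarrow> prods n ?K (u - m) p" ..
  have W: "finite W" using red unfolding reduced_on_def by (elim conjE)
  have W_ray: "\<exists>w\<in>W. ray n w z" if "z \<in> zeros_of ?K" "nonzero_pt n z" for z
    using red that unfolding reduced_on_def by (elim conjE) simp
  \<comment> \<open>The candidates away from \<open>z\<close>; a product of linear forms through
    them vanishes at all zeros except those on the ray of \<open>z\<close>.\<close>
  define W' where "W' = {w \<in> W. \<not> ray n w z}"
  have "finite W'" "\<And>w. w \<in> W' \<Longrightarrow> \<not> ray n w z" unfolding W'_def using W by simp_all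
  from separating_form[OF this] obtain E where E: "form n (card W') E" "E z \<noteq> 0" "\<forall>w\<in>W'. E w = 0" by blast
  let ?l = "\<lambda>y. \<Sum>k\<le>n. \<xi> k * y k"
  \<comment> \<open>Normalizes \<open>q z\<close> to 1. The factor \<open>y 0 ^ u0\<close> in
    \<open>q\<close> only raises the degree to the range in which reducedness applies.\<close>
  define c where "c = inverse (E z * z 0 ^ u0)"
  have c: "c * (E z * z 0 ^ u0) = 1" unfolding c_def by (rule left_inverse) (use E(2) z(2) in simp)
  define q where "q y = c * (E y * y 0 ^ u0)" for y
  have lf: "form n 1 ?l" by (intro form_sum form_cmult form_var1) simp
  have fq: "form n (card W' + u0) q" unfolding q_def[abs_def] by (intro form_cmult form_mult_var_power E(1)) simp
  have "prods n ?K ((1 + (card W' + u0)) - m) (\<lambda>y. ?l y * q y)"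
  proof (rule u0[rule_format, OF _ form_mult[OF lf fq]])
    show "u0 \<le> 1 + (card W' + u0)" by simp
    fix z' assume z': "z' \<in> zeros_of ?K" "z' 0 \<noteq> 0"
    then have "nonzero_pt n z'" using z'(2) unfolding nonzero_pt_def by blast
    then obtain w where w: "w \<in> W" "ray n w z'" using W_ray[OF z'(1)] by blast
    then obtain a where a: "\<forall>k\<le>n. z' k = a * w k" unfolding ray_def by blast
    show "?l z' * q z' = 0"
    proof (cases "ray n w z")
      case True
      then obtain b where b: "\<forall>k\<le>n. z k = b * w k" unfolding ray_def by blast
      have b0: "b \<noteq> 0" using b z(2) by auto
      have "?l z' = (\<Sum>k\<le>n. a / b * (\<xi> k * z k))" using a b b0 by (intro sum.cong) simp_all
      also have "\<dots> = 0" by (simp only: sum_distrib_left[symmetric] \<xi> mult_zero_right)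
      finally show ?thesis by simp
    next
      case False
      then have "E w = 0" using E(3) w(1) unfolding W'_def by blast
      then have "E z' = 0" using form_scale_cong[OF E(1), of z' a w] a by simp
      then show ?thesis unfolding q_def by simp
    qed
  qed
  from prods_dd[OF this z(1)] obtain \<kappa> where \<kappa>: "\<kappa> \<in> ?K" "\<And>u. dd (\<lambda>y. ?l y * q y) z u = dd \<kappa> z u" by blast
  have "dd \<kappa> z u = (\<Sum>k\<le>n. \<xi> k * u k)" for u
  proof -
    have "dd (\<lambda>y. ?l y * q y) z u = dd ?l z u * q z + dd q z u * ?l z"
      by (rule dd_mult[where I = "{..n}"]) (simp_all add: form_pol[OF lf] form_pol[OF fq])
    also have "\<dots> = (\<Sum>k\<le>n. \<xi> k * u k)" using \<xi> c by (simp add: dd_linear q_def)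
    finally show ?thesis using \<kappa>(2) by simp
  qed
  with \<kappa>(1) show ?thesis by blast
qed

text \<open>A form that vanishes at the points but not at \<open>w\<close> is made singular at the
  points by subtracting products \<open>\<kappa> j * L j\<close> with suitable differentials. As the
  \<open>\<kappa> j\<close> vanish at the base point \<open>w\<close>, the value there does not
  change.\<close>

lemma tangent_separator:
  assumes J: "finite J" and L: "\<And>j. j \<in> J \<Longrightarrow> form n m (L j)" "dual J L x" and y0: "\<And>j. j \<in> J \<Longrightarrow> x j 0 \<noteq> 0"
    and red: "reduced_on n m (vanishing n m J x) W" and m: "1 \<le> m"
    and w: "w \<in> zeros_of (vanishing n m J x)" "nonzero_pt n w" "\<And>j. j \<in> J \<Longrightarrow> \<not> ray n (x j) w"
  shows "\<exists>g. form n (2 * m) g \<and> (\<forall>j\<in>J. \<forall>u. dd g (x j) u = 0) \<and> g w \<noteq> 0"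
proof -
  let ?K = "vanishing n m J x"
  obtain k0 where k0: "k0 \<le> n" "w k0 \<noteq> 0" using w(2) unfolding nonzero_pt_def by blast
  have fk: "form n m (\<lambda>y. y k0 ^ m)" using form_power[OF form_var1[OF k0(1)], of m] by simp
  \<comment> \<open>If all Lagrange forms vanished at \<open>w\<close>, this element of the ideal
    would give \<open>w k0 ^ m = 0\<close>.\<close>
  have "(\<lambda>y. y k0 ^ m - (\<Sum>j\<in>J. x j k0 ^ m * L j y)) \<in> ?K"
    by (intro vanI form_diff form_sum form_cmult fk L(1)) (simp_all add: sum_dual[OF L(2) _ J])
  then have "w k0 ^ m = (\<Sum>j\<in>J. x j k0 ^ m * L j w)" using w(1) unfolding zeros_of_def by auto
  moreover have "(\<Sum>j\<in>J. x j k0 ^ m * L j w) = 0" if "\<forall>i\<in>J. L i w = 0" using that by (intro sum.neutral) simp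
  ultimately have "\<not> (\<forall>i\<in>J. L i w = 0)" using k0(2) by (metis power_not_zero)
  then have "\<exists>i\<in>J. L i w \<noteq> 0" by blast
  then obtain i where i: "i \<in> J" "L i w \<noteq> 0" by blast
  obtain l where l: "form n 1 l" "l (x i) = 0" "l w \<noteq> 0" using separating_linear[OF w(3)[OF i(1)]] by blast
  \<comment> \<open>The factor \<open>L i\<close> vanishes at the other points and \<open>l\<close>
    at \<open>x i\<close>; none of the factors vanishes at \<open>w\<close>.\<close>
  define h where "h y = L i y * l y * y k0 ^ (m - 1)" for y
  have fh: "form n (2 * m) h"
  proof -
    have "form n (m + 1 + (m - 1)) h" unfolding h_def[abs_def]
      by (intro form_mult_var_power form_mult L(1) i l k0(1))
    then show ?thesis using m by (simp add: mult_2)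
  qed
  have hx: "h (x j) = 0" if "j \<in> J" for j using l(2) dualD[OF L(2) i(1) that] by (cases "i = j") (simp_all add: h_def)
  have hw: "h w \<noteq> 0" using i l k0 by (simp add: h_def)
  have vzx: "x j \<in> zeros_of ?K" if "j \<in> J" for j using that by (auto simp: zeros_of_def dest: van_zero)
  have "\<exists>\<kappa>\<in>?K. \<forall>u. dd \<kappa> (x j) u = dd h (x j) u" if j: "j \<in> J" for j
  proof -
    have lin: "dd h (x j) u = (\<Sum>k\<le>n. dd h (x j) (unitv k) * u k)" for u
      by (rule pol_dd(1)[OF form_pol[OF fh] finite_atMost])
    \<comment> \<open>By Euler's formula the differential of \<open>h\<close> at a zero kills the
      radial direction, as \<open>transversal\<close> requires.\<close>
    have "(\<Sum>k\<le>n. dd h (x j) (unitv k) * x j k) = 0"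
      using form_euler[OF fh, of "x j"] hx[OF j] lin[of "x j"] by simp
    from transversal[where z = "x j" and \<xi> = "\<lambda>k. dd h (x j) (unitv k)", OF red vzx[OF j] y0[OF j] this]
    show ?thesis by (simp only: lin[symmetric])
  qed
  then have "\<forall>j\<in>J. \<exists>\<kappa>. \<kappa> \<in> ?K \<and> (\<forall>u. dd \<kappa> (x j) u = dd h (x j) u)" by blast
  from bchoice[OF this] obtain \<kappa> where \<kappa>: "\<And>j. j \<in> J \<Longrightarrow> \<kappa> j \<in> ?K" "\<And>j u. j \<in> J \<Longrightarrow> dd (\<kappa> j) (x j) u = dd h (x j) u"
    by blast
  define g where "g y = h y - (\<Sum>j\<in>J. \<kappa> j y * L j y)" for y
  have fkL: "form n (2 * m) (\<lambda>y. \<kappa> j y * L j y)" if "j \<in> J" for j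
    using form_mult[OF van_form[OF \<kappa>(1)[OF that]] L(1)[OF that]] by (simp add: mult_2)
  have fg: "form n (2 * m) g" unfolding g_def[abs_def] by (intro form_diff form_sum fh fkL)
  have "dd g (x i) u = 0" if i: "i \<in> J" for i u
  proof -
    have 1: "dd (\<lambda>y. \<kappa> j y * L j y) (x i) u = (if j = i then dd h (x i) u else 0)" if j: "j \<in> J" for j
    proof -
      have "dd (\<lambda>y. \<kappa> j y * L j y) (x i) u = dd (\<kappa> j) (x i) u * L j (x i) + dd (L j) (x i) u * \<kappa> j (x i)"
        by (rule dd_mult[where I = "{..n}"])
          (simp_all add: form_pol[OF van_form[OF \<kappa>(1)[OF j]]] form_pol[OF L(1)[OF j]])
      then show ?thesis using van_zero[OF \<kappa>(1)[OF j] i] dualD[OF L(2) j i] \<kappa>(2)[OF i] by auto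
    qed
    have pS: "pol {..n} (\<lambda>y. \<Sum>j\<in>J. \<kappa> j y * L j y)" by (rule form_pol[OF form_sum[OF fkL]])
    have pS': "pol {..n} (\<lambda>y. -1 * (\<Sum>j\<in>J. \<kappa> j y * L j y))" by (rule pol_mult[OF pol_const pS])
    have "dd g (x i) u = dd (\<lambda>y. h y + -1 * (\<Sum>j\<in>J. \<kappa> j y * L j y)) (x i) u"
      by (simp add: g_def[abs_def])
    also have "\<dots> = dd h (x i) u + dd (\<lambda>y. -1 * (\<Sum>j\<in>J. \<kappa> j y * L j y)) (x i) u"
      by (rule dd_add[OF form_pol[OF fh] pS' finite_atMost])
    also have "dd (\<lambda>y. -1 * (\<Sum>j\<in>J. \<kappa> j y * L j y)) (x i) u = -1 * dd (\<lambda>y. \<Sum>j\<in>J. \<kappa> j y * L j y) (x i) u"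
      by (rule dd_cmult[OF pS finite_atMost])
    also have "dd (\<lambda>y. \<Sum>j\<in>J. \<kappa> j y * L j y) (x i) u = (\<Sum>j\<in>J. dd (\<lambda>y. \<kappa> j y * L j y) (x i) u)"
      by (rule dd_sum[where I = "{..n}"]) (simp_all add: form_pol[OF fkL])
    also have "\<dots> = (\<Sum>j\<in>J. if j = i then dd h (x i) u else 0)" using 1 by (intro sum.cong) simp_all
    also have "\<dots> = dd h (x i) u" using i J by simp
    finally show ?thesis by simp
  qed
  moreover have "g w = h w"
  proof -
    have "\<kappa> j w = 0" if "j \<in> J" for j using w(1) \<kappa>(1)[OF that] unfolding zeros_of_def by blast
    then show ?thesis unfolding g_def by simp
  qed
  ultimately show ?thesis using fg hw by (intro exI[of _ g]) simp
qed

text \<open>These forms are the rows of a left inverse of the Jacobian of the power sum map.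
  Products such as \<open>L i * \<kappa>\<close> vanish doubly at the points with index other than
  \<open>i\<close>, so only the differential at \<open>x i\<close> has to be arranged.\<close>

lemma jacobian_forms:
  assumes L: "\<And>j. j \<in> J \<Longrightarrow> form n k (L j)" "dual J L x" and L': "\<And>j. j \<in> J \<Longrightarrow> form n m (L' j)" "dual J L' x"
    and y0: "\<And>j. j \<in> J \<Longrightarrow> x j 0 \<noteq> 0" and km: "1 \<le> k + m"
    and red: "reduced_on n m (vanishing n m J x) W" and i: "i \<in> J" and l: "l \<le> n"
  shows "\<exists>g. form n (k + m) g \<and> (\<forall>j\<in>J. \<forall>u. dd g (x j) u = (if i = j then u l else 0))"
proof -
  let ?K = "vanishing n m J x"
  let ?d = "of_nat (k + m) :: complex"
  have "k + m \<noteq> 0" using km by linarith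
  then have d0: "?d \<noteq> 0" by (simp only: of_nat_eq_0_iff not_False_eq_True)
  have pL: "pol {..n} (L i)" "pol {..n} (L' i)" using L(1) L'(1) i form_pol by blast+
  \<comment> \<open>By Euler's formula the differential of \<open>L i * L' i\<close> at
    \<open>x i\<close> takes the value \<open>k + m\<close> on \<open>x i\<close>. This scaling lets
    \<open>h\<close> account for the radial direction, so that the rest of the covector is one that
    \<open>transversal\<close> realizes.\<close>
  define a where "a = x i l / ?d"
  define h where "h y = a * (L i y * L' i y)" for y
  have fh: "form n (k + m) h" unfolding h_def[abs_def] by (intro form_cmult form_mult L L' i)
  have ddh: "dd h (x j) u = a * (dd (L i) (x j) u * L' i (x j) + dd (L' i) (x j) u * L i (x j))" for j u
    unfolding h_def using dd_cmult[OF pol_mult[OF pL] finite_atMost] dd_mult[OF pL finite_atMost] by simp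
  define \<xi> where "\<xi> k = unitv l k - dd h (x i) (unitv k)" for k
  have lin: "(\<Sum>k\<le>n. \<xi> k * u k) = u l - dd h (x i) u" for u
  proof -
    have "(\<Sum>k\<le>n. unitv l k * u k) = (\<Sum>k\<le>n. if k = l then u l else 0)"
      by (intro sum.cong) (auto simp: unitv_def)
    then have "(\<Sum>k\<le>n. unitv l k * u k) = u l" using l by simp
    then show ?thesis unfolding \<xi>_def left_diff_distrib sum_subtractf
      using pol_dd(1)[OF form_pol[OF fh] finite_atMost, of "x i" u] by simp
  qed
  have "dd h (x i) (x i) = x i l"
    using form_euler[OF fh, of "x i"] dualD[OF L(2) i i] dualD[OF L'(2) i i] d0 by (simp add: h_def a_def)
  then have "(\<Sum>k\<le>n. \<xi> k * x i k) = 0" using lin by simp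
  moreover have "x i \<in> zeros_of ?K" using i by (auto simp: zeros_of_def dest: van_zero)
  ultimately have "\<exists>\<kappa>\<in>?K. \<forall>u. dd \<kappa> (x i) u = (\<Sum>k\<le>n. \<xi> k * u k)"
    using transversal[where z = "x i" and \<xi> = \<xi>, OF red _ y0[OF i]] by blast
  then obtain \<kappa> where \<kappa>: "\<kappa> \<in> ?K" "\<And>u. dd \<kappa> (x i) u = u l - dd h (x i) u"
    unfolding lin by blast
  have p\<kappa>: "pol {..n} \<kappa>" using form_pol[OF van_form[OF \<kappa>(1)]] .
  have "dd (\<lambda>y. h y + L i y * \<kappa> y) (x j) u = (if i = j then u l else 0)" if j: "j \<in> J" for j u
  proof -
    have "dd (\<lambda>y. h y + L i y * \<kappa> y) (x j) u = dd h (x j) u + (dd (L i) (x j) u * \<kappa> (x j) + dd \<kappa> (x j) u * L i (x j))"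
      using dd_add[OF form_pol[OF fh] pol_mult[OF pL(1) p\<kappa>] finite_atMost] dd_mult[OF pL(1) p\<kappa> finite_atMost] by simp
    also have "\<dots> = (if i = j then u l else 0)"
      using van_zero[OF \<kappa>(1) j] dualD[OF L(2) i j] dualD[OF L'(2) i j] \<kappa>(2) ddh by auto
    finally show ?thesis .
  qed
  moreover have "form n (k + m) (\<lambda>y. h y + L i y * \<kappa> y)"
    by (intro form.add fh form_mult L i van_form[OF \<kappa>(1)])
  ultimately show ?thesis by blast
qed

text \<open>A further zero could be separated from the points by a form that vanishes at all of
  them; in large degree this form lies in the ideal, so it would vanish at that zero as
  well.\<close>

lemma reduced_on_points:
  assumes J: "finite J" and y0: "\<And>j. j \<in> J \<Longrightarrow> x j 0 \<noteq> 0"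
    and id: "\<And>u p. t \<le> u \<Longrightarrow> form n u p \<Longrightarrow> (\<And>j. j \<in> J \<Longrightarrow> p (x j) = 0) \<Longrightarrow> prods n (vanishing n m J x) (u - m) p"
  shows "reduced_on n m (vanishing n m J x) (x ` J)"
  unfolding reduced_on_def
proof (intro conjI ballI impI)
  let ?K = "vanishing n m J x"
  show "finite (x ` J)" using J by simp
  fix z assume z: "z \<in> zeros_of ?K" "nonzero_pt n z"
  then obtain k where k: "k \<le> n" "z k \<noteq> 0" unfolding nonzero_pt_def by blast
  show ray: "\<exists>w\<in>x ` J. ray n w z"
  proof (rule ccontr)
    assume neg: "\<not> (\<exists>w\<in>x ` J. ray n w z)"
    obtain p where p: "form n (card (x ` J)) p" "p z \<noteq> 0" "\<forall>w\<in>x ` J. p w = 0"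
      using separating_form[of "x ` J" n z] J neg by auto
    \<comment> \<open>The power of a coordinate that is nonzero at \<open>z\<close> raises the
      degree to at least \<open>t\<close>.\<close>
    have "prods n ?K (card (x ` J) + t - m) (\<lambda>y. p y * y k ^ t)"
      by (rule id[OF _ form_mult_var_power[OF p(1) k(1)]]) (use p(3) in auto)
    then have "p z * z k ^ t = 0" by (rule prods_vanish) (use z(1) in \<open>auto simp: zeros_of_def\<close>)
    then show False using p(2) k(2) by simp
  qed
  then obtain j c where j: "j \<in> J" "\<forall>k\<le>n. z k = c * x j k" unfolding ray_def by blast
  then have "c \<noteq> 0" using k by auto
  then show "z 0 \<noteq> 0" using j y0[OF j(1)] by simp
next
  let ?K = "vanishing n m J x"
  have "x j \<in> zeros_of ?K" if "j \<in> J" for j using that by (auto simp: zeros_of_def dest: van_zero)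
  then show "\<exists>u0. \<forall>u\<ge>u0. \<forall>p. form n u p \<longrightarrow> (\<forall>z\<in>zeros_of ?K. z 0 \<noteq> 0 \<longrightarrow> p z = 0) \<longrightarrow> prods n ?K (u - m) p"
    using id y0 by (intro exI[of _ t]) blast
qed

section \<open>Zero schemes described by a separating linear form\<close>

text \<open>In the chart \<open>y 0 = 1\<close> the assumptions make the coordinate ring a quotient
  of the polynomial ring in \<open>l\<close> modulo a product of distinct linear factors, hence
  reduced. The proof is homogeneous and keeps account of the powers of \<open>y 0\<close>. A
  candidate \<open>w i\<close> may fail to be a zero; the last clause records that the corresponding
  factor of the ring is then zero.\<close>

lemma finite_reduced_scheme:
  assumes K: "\<And>k. k \<in> K \<Longrightarrow> form n m k" and m: "1 \<le> m" and mt: "m < t" and D: "1 \<le> D" "D \<le> t"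
    and l: "form n 1 l" and inj: "inj_on rt {..<D}"
    and span: "\<And>p. form n t p \<Longrightarrow> \<exists>c. prods n K (t - m) (\<lambda>y. p y - (\<Sum>j<D. c j * (l y ^ j * y 0 ^ (t - j))))"
    and h: "prods n K (t - m) (\<lambda>y. (\<Prod>j<D. l y - rt j * y 0) * y 0 ^ (t - D))"
  obtains w where "\<And>i. i < D \<Longrightarrow> w i 0 = 1" "reduced_on n m K (w ` {..<D})"
    "\<And>i. i < D \<Longrightarrow> w i \<notin> zeros_of K \<or> l (w i) \<noteq> rt i \<Longrightarrow>
      prods n K (t + D - 2) (\<lambda>y. (\<Prod>j\<in>{..<D} - {i}. l y - rt j * y 0) * y 0 ^ (t - 1 + m))"
proof -
  \<comment> \<open>Up to a scalar and powers of \<open>y 0\<close>, the idempotent that belongs to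
    the root \<open>rt i\<close>.\<close>
  define e where "e i y = (\<Prod>j\<in>{..<D} - {i}. l y - rt j * y 0)" for i y
  have flin: "form n 1 (\<lambda>y. l y - c * y 0)" for c by (intro form_diff l form_cmult form_var1) simp
  have fe: "form n (D - 1) (e i)" if "i < D" for i
    using form_prod[of "{..<D} - {i}" n "\<lambda>_. 1" "\<lambda>j y. l y - rt j * y 0"] flin that
    by (simp add: e_def[abs_def])
  have split: "(\<Prod>j<D. l y - rt j * y 0) = (l y - rt i * y 0) * e i y" if "i < D" for i y
    unfolding e_def using that by (intro prod.remove) auto
  have "\<forall>k. \<exists>c. k \<le> n \<longrightarrow> prods n K (t - m) (\<lambda>y. y k * y 0 ^ (t - 1) - (\<Sum>j<D. c j * (l y ^ j * y 0 ^ (t - j))))"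
  proof
    fix k
    show "\<exists>c. k \<le> n \<longrightarrow> prods n K (t - m) (\<lambda>y. y k * y 0 ^ (t - 1) - (\<Sum>j<D. c j * (l y ^ j * y 0 ^ (t - j))))"
    proof (cases "k \<le> n")
      case True
      have "form n t (\<lambda>y. y k * y 0 ^ (t - 1))"
        using form_mult_var_power[OF form_var1[OF True], of 0 "t - 1"] D by simp
      from span[OF this] show ?thesis by blast
    qed simp
  qed
  from choice[OF this] obtain a where a: "\<And>k. k \<le> n \<Longrightarrow>
    prods n K (t - m) (\<lambda>y. y k * y 0 ^ (t - 1) - (\<Sum>j<D. a k j * (l y ^ j * y 0 ^ (t - j))))" by blast
  \<comment> \<open>Modulo the ideal the coordinate \<open>y k\<close> is a polynomial in
    \<open>l\<close> with coefficients \<open>a k\<close>; substituting the root \<open>rt i\<close>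
    gives the candidate point.\<close>
  define w where "w i k = (if k = 0 then 1 else \<Sum>j<D. a k j * rt i ^ j)" for i k
  \<comment> \<open>Chosen so that \<open>F y * y 0 ^ (t - 1) * e i y\<close>, with \<open>F\<close>
    of degree \<open>d\<close>, has degree \<open>m + (d + s)\<close>, i.e. cofactors of degree
    \<open>d + s\<close>.\<close>
  define s where "s = t + D - 2 - m"
  have s1: "t - m + (D - 1) = 1 + s" using mt D by (simp add: s_def)
  have sm: "m + s = t + D - 2" using mt D by (simp add: s_def)
  have H: "prods n K (1 + s) (\<lambda>y. (l y - rt i * y 0) * y 0 ^ (t - D) * e i y * q y)"
    if i: "i < D" and q: "form n (D - 1) q" for i q
    unfolding s1[symmetric] by (rule prods_eq[OF prods_mult[OF h q]]) (simp add: split[OF i])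
  \<comment> \<open>The product of \<open>e i\<close> with \<open>l - rt i * y 0\<close> lies in the
    ideal up to a power of \<open>y 0\<close>, so in front of \<open>e i\<close> every power of
    \<open>l\<close> may be replaced by that of \<open>rt i\<close>.\<close>
  have key1: "prods n K (1 + s) (\<lambda>y. (y k - w i k * y 0) * y 0 ^ (t - 1) * e i y)" if i: "i < D" and k: "k \<le> n" for i k
  proof (cases "k = 0")
    case True
    then show ?thesis by (simp add: w_def prods.zero)
  next
    case False
    have A: "prods n K (1 + s) (\<lambda>y. (y k * y 0 ^ (t - 1) - (\<Sum>j<D. a k j * (l y ^ j * y 0 ^ (t - j)))) * e i y)"
      unfolding s1[symmetric] by (rule prods_mult[OF a[OF k] fe[OF i]])
    have B: "prods n K (1 + s) (\<lambda>y. (l y ^ j * y 0 ^ (t - j) - rt i ^ j * y 0 ^ t) * e i y)" if j: "j < D" for j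
    proof (cases j)
      case 0
      then show ?thesis by (simp add: prods.zero)
    next
      case (Suc j')
      define q where "q y = (\<Sum>r<j. (rt i * y 0) ^ (j - Suc r) * l y ^ r) * y 0 ^ (D - j)" for y
      have "form n j' (\<lambda>y. (rt i * y 0) ^ (j - Suc r) * l y ^ r)" if "r < j" for r
      proof -
        have "form n ((j - Suc r) * 1 + r * 1) (\<lambda>y. (rt i * y 0) ^ (j - Suc r) * l y ^ r)"
          by (intro form_mult form_power form_cmult form_var1 l) simp
        then show ?thesis using that Suc by simp
      qed
      then have "form n (j' + (D - j)) q" unfolding q_def[abs_def] by (intro form_mult_var_power form_sum) auto
      moreover have "j' + (D - j) = D - 1" using Suc j by simp
      ultimately have "form n (D - 1) q" by simp
      from H[OF i this] show ?thesis
      proof (rule prods_eq)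
        fix y :: "nat \<Rightarrow> complex"
        have e1: "y 0 ^ (t - j) = y 0 ^ (t - D) * y 0 ^ (D - j)" using j D by (simp flip: power_add)
        have e2: "y 0 ^ t = y 0 ^ (t - j) * y 0 ^ j" using j D by (simp flip: power_add)
        have "l y ^ j * y 0 ^ (t - j) - rt i ^ j * y 0 ^ t = (l y ^ j - (rt i * y 0) ^ j) * y 0 ^ (t - j)"
          unfolding e2 by (simp add: algebra_simps power_mult_distrib)
        also have "\<dots> = (l y - rt i * y 0) * y 0 ^ (t - D) * q y"
          unfolding power_diff_sumr2 q_def e1 by (simp add: mult_ac)
        finally show "(l y ^ j * y 0 ^ (t - j) - rt i ^ j * y 0 ^ t) * e i y =
          (l y - rt i * y 0) * y 0 ^ (t - D) * e i y * q y" by (simp add: mult_ac)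
      qed
    qed
    have "prods n K (1 + s) (\<lambda>y. \<Sum>j<D. a k j * ((l y ^ j * y 0 ^ (t - j) - rt i ^ j * y 0 ^ t) * e i y))"
      by (intro prods_sum prods_cmult B) simp
    from prods_add[OF A this] show ?thesis
    proof (rule prods_eq)
      fix y :: "nat \<Rightarrow> complex"
      have t: "y 0 ^ t = y 0 * y 0 ^ (t - 1)" using D by (simp flip: power_Suc)
      have "(\<Sum>j<D. a k j * ((l y ^ j * y 0 ^ (t - j) - rt i ^ j * y 0 ^ t) * e i y)) =
        ((\<Sum>j<D. a k j * (l y ^ j * y 0 ^ (t - j))) - w i k * y 0 ^ t) * e i y"
      proof -
        have "(\<Sum>j<D. a k j * ((l y ^ j * y 0 ^ (t - j) - rt i ^ j * y 0 ^ t) * e i y)) =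
          (\<Sum>j<D. a k j * (l y ^ j * y 0 ^ (t - j)) - a k j * rt i ^ j * y 0 ^ t) * e i y"
          unfolding sum_distrib_right by (intro sum.cong) (simp_all add: algebra_simps)
        also have "(\<Sum>j<D. a k j * (l y ^ j * y 0 ^ (t - j)) - a k j * rt i ^ j * y 0 ^ t) =
          (\<Sum>j<D. a k j * (l y ^ j * y 0 ^ (t - j))) - w i k * y 0 ^ t"
          using False by (simp add: w_def sum_subtractf sum_distrib_right)
        finally show ?thesis .
      qed
      then show "(y k - w i k * y 0) * y 0 ^ (t - 1) * e i y =
        (y k * y 0 ^ (t - 1) - (\<Sum>j<D. a k j * (l y ^ j * y 0 ^ (t - j)))) * e i y +
        (\<Sum>j<D. a k j * ((l y ^ j * y 0 ^ (t - j) - rt i ^ j * y 0 ^ t) * e i y))"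
        unfolding t by (simp add: algebra_simps)
    qed
  qed
  have key2: "prods n K (d + s) (\<lambda>y. (F y - F (w i) * y 0 ^ d) * y 0 ^ (t - 1) * e i y)"
    if i: "i < D" and F: "form n d F" for i d F
    using F
  proof (induction rule: form.induct)
    case (const c)
    show ?case by (simp add: prods.zero)
  next
    case (var k d F)
    have A: "prods n K (Suc d + s) (\<lambda>y. (y k - w i k * y 0) * y 0 ^ (t - 1) * e i y * F y)"
      using prods_mult[OF key1[OF i var.hyps(1)] var.hyps(2)] by (simp add: add_ac)
    have B: "prods n K (Suc d + s) (\<lambda>y. w i k * ((F y - F (w i) * y 0 ^ d) * y 0 ^ (t - 1) * e i y * y 0))"
      using prods_cmult[OF prods_mult[OF var.IH form_var1[of 0 n]]] by simp
    show ?case by (rule prods_eq[OF prods_add[OF A B]]) (simp add: algebra_simps)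
  next
    case (add d F G)
    show ?case by (rule prods_eq[OF prods_add[OF add.IH]]) (simp add: algebra_simps)
  qed
  \<comment> \<open>If a generator is nonzero at \<open>w i\<close>, or \<open>l\<close> has the
    wrong value there, then \<open>key2\<close> says that a nonzero multiple of \<open>e i\<close>
    lies in the ideal.\<close>
  have key3: "prods n K (m + s) (\<lambda>y. e i y * y 0 ^ (t - 1 + m))" if i: "i < D" and or: "w i \<notin> zeros_of K \<or> l (w i) \<noteq> rt i" for i
    using or
  proof
    assume "w i \<notin> zeros_of K"
    then obtain k where k: "k \<in> K" "k (w i) \<noteq> 0" unfolding zeros_of_def by blast
    have "form n (D - 1 + (t - 1)) (\<lambda>y. e i y * y 0 ^ (t - 1))" by (intro form_mult_var_power fe i) simp
    moreover have "D - 1 + (t - 1) = m + s" unfolding sm using D mt m by linarith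
    ultimately have "form n (m + s) (\<lambda>y. e i y * y 0 ^ (t - 1))" by (simp only:)
    from prods_diff[OF prods_gen[OF k(1) this] key2[OF i K[OF k(1)]]]
    have "prods n K (m + s) (\<lambda>y. k y * (e i y * y 0 ^ (t - 1)) - (k y - k (w i) * y 0 ^ m) * y 0 ^ (t - 1) * e i y)" .
    from prods_cmult[OF this, of "inverse (k (w i))"] show ?thesis
      by (rule prods_eq) (use k(2) in \<open>simp add: field_simps power_add\<close>)
  next
    assume lw: "l (w i) \<noteq> rt i"
    have "form n (D - 1) (\<lambda>y. y 0 ^ (D - 1))" using form_power[OF form_var1[of 0 n], of "D - 1"] by simp
    from prods_diff[OF H[OF i this] key2[OF i l]]
    have "prods n K (1 + s) (\<lambda>y. (l y - rt i * y 0) * y 0 ^ (t - D) * e i y * y 0 ^ (D - 1) -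
      (l y - l (w i) * y 0 ^ 1) * y 0 ^ (t - 1) * e i y)" .
    then have *: "prods n K (1 + s) (\<lambda>y. (l (w i) - rt i) * (y 0 * y 0 ^ (t - 1) * e i y))"
    proof (rule prods_eq)
      fix y :: "nat \<Rightarrow> complex"
      have "y 0 ^ (t - 1) = y 0 ^ (t - D) * y 0 ^ (D - 1)" using D by (simp flip: power_add)
      then show "(l (w i) - rt i) * (y 0 * y 0 ^ (t - 1) * e i y) =
        (l y - rt i * y 0) * y 0 ^ (t - D) * e i y * y 0 ^ (D - 1) - (l y - l (w i) * y 0 ^ 1) * y 0 ^ (t - 1) * e i y"
        by (simp add: algebra_simps)
    qed
    have "form n (m - 1) (\<lambda>y. y 0 ^ (m - 1))" using form_power[OF form_var1[of 0 n], of "m - 1"] by simp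
    from prods_cmult[OF prods_mult[OF * this], of "inverse (l (w i) - rt i)"]
    have "prods n K (m + s) (\<lambda>y. inverse (l (w i) - rt i) * ((l (w i) - rt i) * (y 0 * y 0 ^ (t - 1) * e i y) * y 0 ^ (m - 1)))"
      using m by (simp add: add.commute)
    then show ?thesis
    proof (rule prods_eq)
      fix y :: "nat \<Rightarrow> complex"
      have "y 0 ^ (t - 1 + m) = y 0 * y 0 ^ (t - 1) * y 0 ^ (m - 1)"
        using m by (simp add: power_add power_eq_if[of _ m] mult_ac)
      then show "e i y * y 0 ^ (t - 1 + m) =
        inverse (l (w i) - rt i) * ((l (w i) - rt i) * (y 0 * y 0 ^ (t - 1) * e i y) * y 0 ^ (m - 1))"
        using lw by (simp add: mult_ac)
    qed
  qed
  \<comment> \<open>Coefficients of the Lagrange interpolation of the constant 1 at the roots: they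
    combine the \<open>e i\<close> to \<open>y 0 ^ (D - 1)\<close>, a partition of unity.\<close>
  define \<gamma> where "\<gamma> i = inverse (\<Prod>j\<in>{..<D} - {i}. rt i - rt j)" for i
  have lagrange: "y 0 ^ (D - 1) = (\<Sum>i<D. \<gamma> i * e i y)" for y
  proof (rule form_eq_if_lattice[where p = "\<lambda>y. y 0 ^ (D - 1)" and q = "\<lambda>y. \<Sum>i<D. \<gamma> i * e i y"
        and n = n and t = "D - 1"])
    show "form n (D - 1) (\<lambda>y. y 0 ^ (D - 1))" using form_power[OF form_var1[of 0 n], of "D - 1"] by simp
    show "form n (D - 1) (\<lambda>y. \<Sum>i<D. \<gamma> i * e i y)" by (intro form_sum form_cmult fe) simp
    fix b
    define P where "P = (\<Sum>i<D. Polynomial.smult (\<gamma> i) (\<Prod>j\<in>{..<D} - {i}. [:- rt j, 1:]))"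
    have pe: "poly P x = (\<Sum>i<D. \<gamma> i * (\<Prod>j\<in>{..<D} - {i}. x - rt j))" for x
      unfolding P_def by (simp add: poly_sum poly_prod)
    have "P = 1"
    proof (rule poly_eqI_degree[of "rt ` {..<D}"])
      have "degree (\<Prod>j\<in>{..<D} - {i}. [:- rt j, 1:]) \<le> D - 1" if "i < D" for i
        using degree_prod_sum_le[of "{..<D} - {i}" "\<lambda>j. [:- rt j, 1:]"] that by simp
      then have "degree P \<le> D - 1" unfolding P_def
        by (intro degree_sum_le order_trans[OF Polynomial.degree_smult_le]) auto
      then show "degree P < card (rt ` {..<D})" "degree (1 :: complex poly) < card (rt ` {..<D})"
        using D inj by (simp_all add: card_image)
      fix x assume "x \<in> rt ` {..<D}"
      then obtain i where i: "i < D" "x = rt i" by blast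
      have "\<gamma> i' * (\<Prod>j\<in>{..<D} - {i'}. x - rt j) = (if i' = i then 1 else 0)" if "i' < D" for i'
      proof (cases "i' = i")
        case True
        have "(\<Prod>j\<in>{..<D} - {i}. rt i - rt j) \<noteq> 0" using inj i by (auto simp: inj_on_def)
        then show ?thesis by (simp add: True \<gamma>_def i(2))
      next
        case False
        then have "(\<Prod>j\<in>{..<D} - {i'}. x - rt j) = 0" using i by (intro prod_zero) auto
        then show ?thesis using False by simp
      qed
      then have "poly P x = (\<Sum>i'<D. if i' = i then 1 else 0)" unfolding pe by (intro sum.cong) auto
      then show "poly P x = poly 1 x" using i by simp
    qed
    then have "(\<Sum>i<D. \<gamma> i * (\<Prod>j\<in>{..<D} - {i}. l (lattice_pt b) - rt j)) = 1" using pe[of "l (lattice_pt b)"] by simp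
    then show "lattice_pt b 0 ^ (D - 1) = (\<Sum>i<D. \<gamma> i * e i (lattice_pt b))" by (simp add: e_def lattice_pt_def)
  qed
  \<comment> \<open>Each \<open>e i * p\<close> lies in the ideal: by \<open>key2\<close> if
    \<open>w i\<close> is a zero, where \<open>p\<close> vanishes, and by \<open>key3\<close>
    otherwise. The partition of unity removes the \<open>e i\<close>.\<close>
  have key4: "prods n K (d + (m + s)) (\<lambda>y. p y * y 0 ^ (t - 1 + m + (D - 1)))"
    if p: "form n d p" and p0: "\<forall>z\<in>zeros_of K. z 0 \<noteq> 0 \<longrightarrow> p z = 0" for d p
  proof -
    have A: "prods n K (d + (m + s)) (\<lambda>y. e i y * y 0 ^ (t - 1 + m) * p y)" if i: "i < D" for i
    proof (cases "w i \<in> zeros_of K")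
      case True
      have "w i 0 = 1" by (simp add: w_def)
      then have "p (w i) = 0" using p0 True by simp
      then have B: "prods n K (d + s) (\<lambda>y. p y * y 0 ^ (t - 1) * e i y)" using key2[OF i p] by simp
      have C: "form n m (\<lambda>y. y 0 ^ m)" using form_power[OF form_var1[of 0 n], of m] by simp
      have "prods n K (d + s + m) (\<lambda>y. e i y * y 0 ^ (t - 1 + m) * p y)"
        by (rule prods_eq[OF prods_mult[OF B C]]) (simp add: power_add mult_ac)
      then show ?thesis by (simp add: add_ac)
    next
      case False
      then show ?thesis using prods_mult[OF key3[OF i] p] by (simp add: add_ac)
    qed
    have "prods n K (d + (m + s)) (\<lambda>y. \<Sum>i<D. \<gamma> i * (e i y * y 0 ^ (t - 1 + m) * p y))"
      by (intro prods_sum prods_cmult A) simp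
    then show ?thesis
    proof (rule prods_eq)
      fix y
      have "p y * y 0 ^ (t - 1 + m + (D - 1)) = (p y * y 0 ^ (t - 1 + m)) * (\<Sum>i<D. \<gamma> i * e i y)"
        by (simp only: power_add[of _ _ "D - 1"] lagrange mult.assoc)
      also have "\<dots> = (\<Sum>i<D. \<gamma> i * (e i y * y 0 ^ (t - 1 + m) * p y))"
        unfolding sum_distrib_left by (intro sum.cong) (simp_all add: mult_ac)
      finally show "p y * y 0 ^ (t - 1 + m + (D - 1)) = (\<Sum>i<D. \<gamma> i * (e i y * y 0 ^ (t - 1 + m) * p y))" .
    qed
  qed
  \<comment> \<open>Since \<open>j < D \<le> t\<close>, each of the spanning elements of degree
    \<open>t\<close> is divisible by \<open>y 0\<close>. By induction every form of degree
    \<open>u\<close> is, modulo the ideal, a multiple of \<open>y 0 ^ (u - t + 1)\<close>.\<close>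
  have dec: "\<exists>q. form n (t - 1) q \<and> prods n K (u - m) (\<lambda>y. p y - y 0 ^ (u - t + 1) * q y)"
    if "t \<le> u" "form n u p" for u p
    using that
  proof (induction u arbitrary: p rule: dec_induct)
    case base
    from span[OF base] obtain c where c: "prods n K (t - m) (\<lambda>y. p y - (\<Sum>j<D. c j * (l y ^ j * y 0 ^ (t - j))))" ..
    have f: "form n (t - 1) (\<lambda>y. l y ^ j * y 0 ^ (t - 1 - j))" if "j < D" for j
      using form_mult_var_power[OF form_power[OF l, of j], of 0 "t - 1 - j"] that D by simp
    have "y 0 ^ (t - j) = y 0 * y 0 ^ (t - 1 - j)" if "j < D" for j and y :: "nat \<Rightarrow> complex"
    proof -
      have "t - j = Suc (t - 1 - j)" using that D by simp
      then show ?thesis by simp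
    qed
    then have "(\<Sum>j<D. c j * (l y ^ j * y 0 ^ (t - j))) = y 0 ^ (t - t + 1) * (\<Sum>j<D. c j * (l y ^ j * y 0 ^ (t - 1 - j)))" for y
      by (simp add: sum_distrib_left mult_ac)
    moreover have "form n (t - 1) (\<lambda>y. \<Sum>j<D. c j * (l y ^ j * y 0 ^ (t - 1 - j)))"
      by (intro form_sum form_cmult f) simp
    ultimately show ?case using c
      by (intro exI[of _ "\<lambda>y. \<Sum>j<D. c j * (l y ^ j * y 0 ^ (t - 1 - j))"]) simp
  next
    case (step u)
    obtain g where g: "\<forall>i\<le>n. form n u (g i)" "\<And>x. p x = (\<Sum>i\<le>n. x i * g i x)"
      using form_Suc_decomp[OF step.prems] by blast
    have "\<forall>i. \<exists>q. i \<le> n \<longrightarrow> form n t q \<and> prods n K (Suc u - m) (\<lambda>y. y i * g i y - y 0 ^ (u - t + 1) * q y)"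
    proof
      fix i
      show "\<exists>q. i \<le> n \<longrightarrow> form n t q \<and> prods n K (Suc u - m) (\<lambda>y. y i * g i y - y 0 ^ (u - t + 1) * q y)"
      proof (cases "i \<le> n")
        case True
        obtain q where q: "form n (t - 1) q" "prods n K (u - m) (\<lambda>y. g i y - y 0 ^ (u - t + 1) * q y)"
          using step.IH g(1) True by blast
        have "form n t (\<lambda>y. y i * q y)" using form.var[OF True q(1)] D by simp
        moreover have "prods n K (Suc u - m) (\<lambda>y. y i * g i y - y 0 ^ (u - t + 1) * (y i * q y))"
        proof -
          have "prods n K (u - m + 1) (\<lambda>y. y i * g i y - y 0 ^ (u - t + 1) * (y i * q y))"
            by (rule prods_eq[OF prods_mult[OF q(2) form_var1[OF True]]]) (simp add: algebra_simps)
          then show ?thesis using step.hyps mt by (simp add: Suc_diff_le)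
        qed
        ultimately show ?thesis by blast
      qed simp
    qed
    from choice[OF this] obtain q where q: "\<And>i. i \<le> n \<Longrightarrow> form n t (q i)"
      "\<And>i. i \<le> n \<Longrightarrow> prods n K (Suc u - m) (\<lambda>y. y i * g i y - y 0 ^ (u - t + 1) * q i y)" by blast
    have "form n t (\<lambda>y. \<Sum>i\<le>n. q i y)" by (intro form_sum q) simp
    from span[OF this] obtain c where
      c: "prods n K (t - m) (\<lambda>y. (\<Sum>i\<le>n. q i y) - (\<Sum>j<D. c j * (l y ^ j * y 0 ^ (t - j))))" ..
    define Q where "Q y = (\<Sum>j<D. c j * (l y ^ j * y 0 ^ (t - 1 - j)))" for y
    have f: "form n (t - 1) (\<lambda>y. l y ^ j * y 0 ^ (t - 1 - j))" if "j < D" for j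
      using form_mult_var_power[OF form_power[OF l, of j], of 0 "t - 1 - j"] that D by simp
    have fQ: "form n (t - 1) Q" unfolding Q_def[abs_def] by (intro form_sum form_cmult f) simp
    have "y 0 ^ (t - j) = y 0 * y 0 ^ (t - 1 - j)" if "j < D" for j and y :: "nat \<Rightarrow> complex"
    proof -
      have "t - j = Suc (t - 1 - j)" using that D by simp
      then show ?thesis by simp
    qed
    then have Q: "(\<Sum>j<D. c j * (l y ^ j * y 0 ^ (t - j))) = y 0 * Q y" for y
      by (simp add: Q_def sum_distrib_left mult_ac)
    have P: "form n (u - t + 1) (\<lambda>y. y 0 ^ (u - t + 1))" using form_power[OF form_var1[of 0 n], of "u - t + 1"] by simp
    have "prods n K (t - m + (u - t + 1)) (\<lambda>y. ((\<Sum>i\<le>n. q i y) - y 0 * Q y) * y 0 ^ (u - t + 1))"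
      using prods_mult[OF c P] by (simp add: Q)
    moreover have d: "t - m + (u - t + 1) = Suc u - m" "Suc u - t + 1 = Suc (u - t + 1)" using step.hyps mt by simp_all
    ultimately have C: "prods n K (Suc u - m) (\<lambda>y. ((\<Sum>i\<le>n. q i y) - y 0 * Q y) * y 0 ^ (u - t + 1))" by (simp only: d)
    have S: "prods n K (Suc u - m) (\<lambda>y. \<Sum>i\<le>n. y i * g i y - y 0 ^ (u - t + 1) * q i y)"
      by (intro prods_sum q) simp
    have "prods n K (Suc u - m) (\<lambda>y. p y - y 0 ^ (Suc u - t + 1) * Q y)"
      unfolding d(2)
      by (rule prods_eq[OF prods_add[OF S C]])
        (simp add: g(2) sum_subtractf algebra_simps sum_distrib_left)
    with fQ show ?case by blast
  qed
  have fin: "reduced_on n m K (w ` {..<D})"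
    unfolding reduced_on_def
  proof (intro conjI ballI impI)
    show "finite (w ` {..<D})" by simp
    fix z assume z: "z \<in> zeros_of K" "nonzero_pt n z"
    have zv: "p z = 0" if "prods n K s' p" for s' p using that by (rule prods_vanish) (use z(1) in \<open>auto simp: zeros_of_def\<close>)
    obtain k where k: "k \<le> n" "z k \<noteq> 0" using z(2) unfolding nonzero_pt_def by blast
    show z0: "z 0 \<noteq> 0"
    proof
      assume z0: "z 0 = 0"
      have "form n t (\<lambda>y. y k ^ t)" using form_power[OF form_var1[OF k(1)], of t] by simp
      from span[OF this] obtain c where "prods n K (t - m) (\<lambda>y. y k ^ t - (\<Sum>j<D. c j * (l y ^ j * y 0 ^ (t - j))))" ..
      from zv[OF this] have "z k ^ t = (\<Sum>j<D. c j * (l z ^ j * z 0 ^ (t - j)))" by simp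
      also have "\<dots> = 0" using D by (intro sum.neutral) (simp add: z0)
      finally show False using k by simp
    qed
    have "(\<Sum>i<D. \<gamma> i * e i z) \<noteq> 0" using lagrange[of z, symmetric] z0 by simp
    then obtain i where i: "i < D" "e i z \<noteq> 0" by (metis (no_types, lifting) lessThan_iff mult_zero_right sum.neutral)
    have "z k = z 0 * w i k" if "k \<le> n" for k
      using zv[OF key1[OF i(1) that]] i(2) z0 by (simp add: mult.commute)
    then show "\<exists>w\<in>w ` {..<D}. ray n w z" using i(1) unfolding ray_def by blast
  next
    \<comment> \<open>The power of \<open>y 0\<close> that \<open>key4\<close> costs. In degrees
      from \<open>t + T\<close> on, \<open>dec\<close> provides at least this power, so no factor
      \<open>y 0\<close> is left in the conclusion.\<close>
    define T where "T = t - 1 + m + (D - 1)"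
    have "prods n K (u - m) p" if u: "t + T \<le> u" and p: "form n u p" and p0: "\<forall>z\<in>zeros_of K. z 0 \<noteq> 0 \<longrightarrow> p z = 0" for u p
    proof -
      obtain q where q: "form n (t - 1) q" "prods n K (u - m) (\<lambda>y. p y - y 0 ^ (u - t + 1) * q y)"
        using dec[OF _ p] u by auto
      have "q z = 0" if z: "z \<in> zeros_of K" "z 0 \<noteq> 0" for z
      proof -
        have "p z - z 0 ^ (u - t + 1) * q z = 0" by (rule prods_vanish[OF q(2)]) (use z(1) in \<open>auto simp: zeros_of_def\<close>)
        then show ?thesis using p0 z by simp
      qed
      then have A: "prods n K (t - 1 + (m + s)) (\<lambda>y. q y * y 0 ^ T)" using key4[OF q(1)] unfolding T_def by blast
      have P: "form n (u - t + 1 - T) (\<lambda>y. y 0 ^ (u - t + 1 - T))"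
        using form_power[OF form_var1[of 0 n], of "u - t + 1 - T"] by simp
      have d: "t - 1 + (m + s) + (u - t + 1 - T) = u - m" unfolding sm T_def using u[unfolded T_def] D mt m by simp
      have "prods n K (u - m) (\<lambda>y. q y * y 0 ^ T * y 0 ^ (u - t + 1 - T))"
        using prods_mult[OF A P] unfolding d .
      from prods_add[OF q(2) this] show ?thesis
      proof (rule prods_eq)
        fix y :: "nat \<Rightarrow> complex"
        have "T + (u - t + 1 - T) = u - t + 1" using u by linarith
        then have "y 0 ^ (u - t + 1) = y 0 ^ T * y 0 ^ (u - t + 1 - T)" by (simp only: power_add[symmetric])
        then show "p y = p y - y 0 ^ (u - t + 1) * q y + q y * y 0 ^ T * y 0 ^ (u - t + 1 - T)" by simp
      qed
    qed
    then show "\<exists>u0. \<forall>u\<ge>u0. \<forall>p. form n u p \<longrightarrow> (\<forall>z\<in>zeros_of K. z 0 \<noteq> 0 \<longrightarrow> p z = 0) \<longrightarrow> prods n K (u - m) p"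
      by blast
  qed
  show ?thesis
  proof (rule that[OF _ fin])
    show "w i 0 = 1" for i by (simp add: w_def)
    show "prods n K (t + D - 2) (\<lambda>y. (\<Prod>j\<in>{..<D} - {i}. l y - rt j * y 0) * y 0 ^ (t - 1 + m))"
      if "i < D" "w i \<notin> zeros_of K \<or> l (w i) \<noteq> rt i" for i
      using key3[OF that] unfolding sm e_def .
  qed
qed

text \<open>Both expressions define the same bilinear pairing between forms of degree
  \<open>m\<close> and \<open>k\<close>. Its rank is \<open>card J\<close> by the Lagrange forms,
  and at most the number of terms on the right.\<close>

lemma decomposition_zeros:
  fixes x :: "nat \<Rightarrow> nat \<Rightarrow> complex" and w :: "'s \<Rightarrow> nat \<Rightarrow> complex"
  assumes J: "finite J" and L: "\<And>j. j \<in> J \<Longrightarrow> form n m (L j)" "dual J L x"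
    and L': "\<And>j. j \<in> J \<Longrightarrow> form n k (L' j)" "dual J L' x" and S: "finite S"
    and eq: "\<And>g. form n (m + k) g \<Longrightarrow> (\<Sum>j\<in>J. g (x j)) = (\<Sum>i\<in>S. c i * g (w i))"
  shows "card J \<le> card S" and "card S = card J \<Longrightarrow> i \<in> S \<Longrightarrow> c i \<noteq> 0 \<and> w i \<in> zeros_of (vanishing n m J x)"
proof -
  have comb: "\<exists>a. (\<exists>j\<in>J. a j \<noteq> 0) \<and> (\<forall>i\<in>S'. (\<Sum>j\<in>J. a j * M j (w i)) = 0)"
    if "finite S'" "card S' < card J" for S' and M :: "nat \<Rightarrow> (nat \<Rightarrow> complex) \<Rightarrow> complex"
    using underdetermined_system[OF that(1) J that(2), of "\<lambda>j i. M j (w i)"] .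
  have ev: "(\<Sum>j\<in>J. p (x j) * q (x j)) = (\<Sum>i\<in>S. c i * (p (w i) * q (w i)))" if "form n m p" "form n k q" for p q
    using eq[OF form_mult[OF that]] by simp
  \<comment> \<open>Fewer than \<open>card J\<close> points leave a nontrivial combination of the
    \<open>L j\<close> that vanishes at all of them, yet it pairs nontrivially with some
    \<open>L' i\<close>. The version for subsets allows terms with coefficient 0 to be
    dropped.\<close>
  have 1: "card J \<le> card S'" if S': "S' \<subseteq> S" "\<And>i. i \<in> S - S' \<Longrightarrow> c i = 0" for S'
  proof (rule ccontr)
    assume "\<not> card J \<le> card S'"
    moreover have fS': "finite S'" using S' S finite_subset by blast
    ultimately obtain a where a: "\<exists>j\<in>J. a j \<noteq> 0" "\<forall>i\<in>S'. (\<Sum>j\<in>J. a j * L j (w i)) = 0"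
      using comb[of S' L] by auto
    obtain i where i: "i \<in> J" "a i \<noteq> 0" using a(1) by blast
    let ?p = "\<lambda>y. \<Sum>j\<in>J. a j * L j y"
    have fp: "form n m ?p" by (intro form_sum form_cmult L(1))
    have "(\<Sum>j\<in>J. ?p (x j) * L' i (x j)) = (\<Sum>i'\<in>S. c i' * (?p (w i') * L' i (w i')))"
      by (rule ev[OF fp L'(1)[OF i(1)]])
    also have "\<dots> = 0" using a(2) S'(2) by (intro sum.neutral) auto
    also have "(\<Sum>j\<in>J. ?p (x j) * L' i (x j)) = (\<Sum>j\<in>J. if j = i then a i else 0)"
      using dualD[OF L'(2) i(1)] by (intro sum.cong) (auto simp: sum_dual[OF L(2) _ J])
    finally show False using i J by simp
  qed
  show "card J \<le> card S" by (rule 1) auto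
  show "c i \<noteq> 0 \<and> w i \<in> zeros_of (vanishing n m J x)" if card: "card S = card J" and i: "i \<in> S"
  proof
    have less: "card (S - {i}) < card J" using card i S by (metis card_Diff1_less)
    show c0: "c i \<noteq> 0"
    proof
      assume "c i = 0"
      then have "card J \<le> card (S - {i})" by (intro 1) auto
      with less show False by simp
    qed
    have "p (w i) = 0" if p: "p \<in> vanishing n m J x" for p
    proof -
      \<comment> \<open>The form \<open>?q\<close> vanishes at all \<open>w i'\<close> except
        \<open>w i\<close>, so pairing it with a form \<open>p\<close> that vanishes at the
        \<open>x j\<close> isolates the term with \<open>p (w i)\<close>.\<close>
      obtain a where a: "\<exists>j\<in>J. a j \<noteq> 0" "\<forall>i'\<in>S - {i}. (\<Sum>j\<in>J. a j * L' j (w i')) = 0"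
        using comb[of "S - {i}" L'] less S by auto
      let ?q = "\<lambda>y. \<Sum>j\<in>J. a j * L' j y"
      have fq: "form n k ?q" by (intro form_sum form_cmult L'(1))
      have rhs: "(\<Sum>i'\<in>S. c i' * (p' (w i') * ?q (w i'))) = c i * (p' (w i) * ?q (w i))" for p' :: "(nat \<Rightarrow> complex) \<Rightarrow> complex"
      proof -
        have "(\<Sum>i'\<in>S - {i}. c i' * (p' (w i') * ?q (w i'))) = 0" using a(2) by (intro sum.neutral) auto
        then show ?thesis by (subst sum.remove[OF S i]) simp
      qed
      have q0: "?q (w i) \<noteq> 0"
      proof
        assume q0: "?q (w i) = 0"
        obtain j where j: "j \<in> J" "a j \<noteq> 0" using a(1) by blast
        have "(\<Sum>j'\<in>J. L j (x j') * ?q (x j')) = 0" using ev[OF L(1)[OF j(1)] fq] rhs[of "L j"] q0 by simp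
        moreover have "(\<Sum>j'\<in>J. L j (x j') * ?q (x j')) = (\<Sum>j'\<in>J. if j' = j then a j else 0)"
          using dualD[OF L(2) j(1)] by (intro sum.cong) (auto simp: sum_dual[OF L'(2) _ J])
        ultimately show False using j J by simp
      qed
      have "(\<Sum>j\<in>J. p (x j) * ?q (x j)) = 0" using van_zero[OF p] by (intro sum.neutral) simp
      then have "c i * (p (w i) * ?q (w i)) = 0" using ev[OF van_form[OF p] fq] rhs[of p] by simp
      then show ?thesis using c0 q0 by simp
    qed
    then show "w i \<in> zeros_of (vanishing n m J x)" unfolding zeros_of_def by blast
  qed
qed

section \<open>General configurations\<close>

definition has_lagrange :: "nat \<Rightarrow> nat \<Rightarrow> nat set \<Rightarrow> (nat \<Rightarrow> nat \<Rightarrow> complex) \<Rightarrow> bool" where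
  "has_lagrange n k J x \<longleftrightarrow> (\<exists>L. (\<forall>j\<in>J. form n k (L j)) \<and> dual J L x)"

definition good :: "nat \<Rightarrow> nat \<Rightarrow> nat \<Rightarrow> nat set \<Rightarrow> (nat \<Rightarrow> nat \<Rightarrow> complex) \<Rightarrow> (nat \<Rightarrow> complex) set \<Rightarrow> bool" where
  "good n m k J x W \<longleftrightarrow> has_lagrange n k J x \<and> has_lagrange n m J x \<and> (\<forall>j\<in>J. x j 0 \<noteq> 0) \<and> reduced_on n m (vanishing n m J x) W"

text \<open>Linear independence of the \<open>d\<close>-th powers of pairwise non-proportional
  vectors, expressed dually through the evaluation functionals on forms of degree
  \<open>d\<close>.\<close>

definition powers_indep :: "nat \<Rightarrow> nat \<Rightarrow> (nat \<Rightarrow> complex) set \<Rightarrow> bool" where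
  "powers_indep n d T \<longleftrightarrow> (\<forall>S c. finite S \<and> S \<subseteq> T \<and> (\<forall>z\<in>S. nonzero_pt n z) \<and>
    (\<forall>z\<in>S. \<forall>z'\<in>S. ray n z z' \<longrightarrow> z = z') \<and> (\<forall>g. form n d g \<longrightarrow> (\<Sum>z\<in>S. c z * g z) = 0)
    \<longrightarrow> (\<forall>z\<in>S. c z = 0))"

lemma form_y0_power: "form n s (\<lambda>y. y 0 ^ s)"
  using form_power[OF form_var1[of 0 n], of s] by simp

lemma pindep_points:
  assumes has_lagrange: "has_lagrange n k J x" "has_lagrange n m J x"
    and T: "\<And>z. z \<in> T \<Longrightarrow> nonzero_pt n z \<Longrightarrow> \<exists>j\<in>J. ray n (x j) z"
  shows "powers_indep n (m + k) T"
  unfolding powers_indep_def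
proof (intro allI impI ballI, elim conjE)
  fix S :: "(nat \<Rightarrow> complex) set" and c z1
  assume S: "finite S" "S \<subseteq> T" "\<forall>z\<in>S. nonzero_pt n z" "\<forall>z\<in>S. \<forall>z'\<in>S. ray n z z' \<longrightarrow> z = z'"
    and eq: "\<forall>g. form n (m + k) g \<longrightarrow> (\<Sum>z\<in>S. c z * g z) = 0" and z1: "z1 \<in> S"
  obtain L where L: "\<forall>j\<in>J. form n m (L j)" "dual J L x" using has_lagrange(2) unfolding has_lagrange_def by blast
  obtain L' where L': "\<forall>j\<in>J. form n k (L' j)" "dual J L' x" using has_lagrange(1) unfolding has_lagrange_def by blast
  have r: "\<exists>j\<in>J. ray n (x j) z" if "z \<in> S" for z
  proof -
    have "z \<in> T" "nonzero_pt n z" using S(2,3) that by blast+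
    then show ?thesis by (rule T)
  qed
  obtain j1 where j1: "j1 \<in> J" "ray n (x j1) z1" using r[OF z1] by blast
  obtain c1 where c1: "\<forall>k\<le>n. z1 k = c1 * x j1 k" using j1(2) unfolding ray_def by blast
  have c10: "c1 \<noteq> 0" using S(3) z1 c1 unfolding nonzero_pt_def by fastforce
  \<comment> \<open>A form of degree \<open>m + k\<close> that vanishes at all points except the one
    on whose ray \<open>z1\<close> lies.\<close>
  define g where "g y = L j1 y * L' j1 y" for y
  have fg: "form n (m + k) g" unfolding g_def[abs_def] using L(1) L'(1) j1(1) by (intro form_mult) simp_all
  have g0: "g z = 0" if z: "z \<in> S" "z \<noteq> z1" for z
  proof -
    obtain j where j: "j \<in> J" "ray n (x j) z" using r[OF z(1)] by blast
    obtain c where c: "\<forall>k\<le>n. z k = c * x j k" using j(2) unfolding ray_def by blast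
    have "j \<noteq> j1"
    proof
      assume "j = j1"
      then have "\<forall>k\<le>n. z k = c / c1 * z1 k" using c c1 c10 by simp
      then have "ray n z1 z" unfolding ray_def by blast
      then show False using S(4) z z1 by blast
    qed
    then have "g (x j) = 0" using dualD[OF L(2) j1(1) j(1)] by (simp add: g_def)
    then show ?thesis using form_scale_cong[OF fg, of z c "x j"] c by simp
  qed
  have "(\<Sum>z\<in>S. c z * g z) = (\<Sum>z\<in>S. if z = z1 then c z1 * g z1 else 0)"
    using g0 by (intro sum.cong) auto
  then have "c z1 * g z1 = 0" using eq fg S(1) z1 by simp
  moreover have "g z1 = c1 ^ (m + k)"
    using form_scale_cong[OF fg, of z1 c1 "x j1"] c1 dualD[OF L(2) j1(1) j1(1)] dualD[OF L'(2) j1(1) j1(1)]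
    by (simp add: g_def)
  ultimately show "c z1 = 0" using c10 by simp
qed

text \<open>In degree \<open>t\<close> the at most \<open>card W\<close> rays of zeros are separated
  by products of linear forms. If on the zeros each form of degree \<open>t\<close> agrees with a
  power of \<open>y 0\<close> times one of degree \<open>d\<close>, then separation holds in degree
  \<open>d\<close>, as \<open>y 0\<close> does not vanish at the zeros.\<close>

lemma pindep_descent:
  assumes red: "reduced_on n m K W" and W: "card W \<le> t"
    and dec: "\<And>p. form n t p \<Longrightarrow> \<exists>g. form n d g \<and> prods n K s (\<lambda>y. p y - y 0 ^ (t - d) * g y)"
  shows "powers_indep n d (zeros_of K)"
  unfolding powers_indep_def
proof (intro allI impI ballI, elim conjE)
  fix S :: "(nat \<Rightarrow> complex) set" and c z1
  assume S: "finite S" "S \<subseteq> zeros_of K" "\<forall>z\<in>S. nonzero_pt n z" "\<forall>z\<in>S. \<forall>z'\<in>S. ray n z z' \<longrightarrow> z = z'"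
    and eq: "\<forall>g. form n d g \<longrightarrow> (\<Sum>z\<in>S. c z * g z) = 0" and z1: "z1 \<in> S"
  have finW: "finite W" using red unfolding reduced_on_def by (elim conjE)
  have r: "z 0 \<noteq> 0 \<and> (\<exists>w\<in>W. ray n w z)" if "z \<in> S" for z
  proof -
    have "z \<in> zeros_of K" "nonzero_pt n z" using S(2,3) that by blast+
    then show ?thesis using red unfolding reduced_on_def by blast
  qed
  then have "\<forall>z\<in>S. \<exists>w. w \<in> W \<and> ray n w z" by blast
  from bchoice[OF this] obtain f where f: "\<And>z. z \<in> S \<Longrightarrow> f z \<in> W" "\<And>z. z \<in> S \<Longrightarrow> ray n (f z) z" by blast
  have "inj_on f S"
  proof (rule inj_onI)
    fix z z' assume z: "z \<in> S" "z' \<in> S" "f z = f z'"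
    obtain a where a: "\<forall>k\<le>n. z k = a * f z k" using f(2)[OF z(1)] unfolding ray_def by blast
    obtain b where b: "\<forall>k\<le>n. z' k = b * f z k" using f(2)[OF z(2)] z(3) unfolding ray_def by auto
    have "a \<noteq> 0" using r[OF z(1)] a by auto
    then have "\<forall>k\<le>n. z' k = b / a * z k" using a b by simp
    then have "ray n z z'" unfolding ray_def by blast
    then show "z = z'" using S(4) z by blast
  qed
  then have cardS: "card S \<le> card W" using f(1) by (intro card_inj_on_le[OF _ _ finW]) auto
  have "\<not> ray n z z1" if "z \<in> S - {z1}" for z using S(4) that z1 by blast
  from separating_form[OF _ this] S(1) obtain p where
    p: "form n (card (S - {z1})) p" "p z1 \<noteq> 0" "\<forall>z\<in>S - {z1}. p z = 0" by blast
  have "card (S - {z1}) \<le> t" using cardS W by (simp add: card_Diff_singleton[OF z1])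
  then have "form n t (\<lambda>y. p y * y 0 ^ (t - card (S - {z1})))"
    using form_mult_var_power[OF p(1), of 0 "t - card (S - {z1})"] by simp
  from dec[OF this] obtain g where g: "form n d g"
    "prods n K s (\<lambda>y. p y * y 0 ^ (t - card (S - {z1})) - y 0 ^ (t - d) * g y)" by blast
  have gz: "z 0 ^ (t - d) * g z = p z * z 0 ^ (t - card (S - {z1}))" if "z \<in> S" for z
  proof -
    have "p z * z 0 ^ (t - card (S - {z1})) - z 0 ^ (t - d) * g z = 0"
      by (rule prods_vanish[OF g(2)]) (use S(2) that in \<open>auto simp: zeros_of_def\<close>)
    then show ?thesis by simp
  qed
  have "g z = 0" if "z \<in> S" "z \<noteq> z1" for z using gz[OF that(1)] p(3) that r[OF that(1)] by simp
  then have "(\<Sum>z\<in>S. c z * g z) = (\<Sum>z\<in>S. if z = z1 then c z1 * g z1 else 0)"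
    by (intro sum.cong) auto
  then have "c z1 * g z1 = 0" using eq g(1) S(1) z1 by simp
  moreover have "g z1 \<noteq> 0" using gz[OF z1] p(2) r[OF z1] by auto
  ultimately show "c z1 = 0" by simp
qed

text \<open>With Lagrange forms of degree \<open>k\<close>, regularity starts in degree
  \<open>Suc k\<close> already: after subtracting an interpolant times \<open>y 0\<close>, a form of
  this degree is itself an element of the vanishing space.\<close>

lemma good_odd:
  assumes J: "finite J" and k: "has_lagrange n k J x" and y0: "\<And>j. j \<in> J \<Longrightarrow> x j 0 \<noteq> 0"
  shows "good n (Suc k) k J x (x ` J)"
proof -
  let ?K = "vanishing n (Suc k) J x"
  obtain L where L: "\<And>j. j \<in> J \<Longrightarrow> form n k (L j)" "dual J L x" using k unfolding has_lagrange_def by blast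
  have "has_lagrange n (Suc k) J x"
    unfolding has_lagrange_def
  proof (intro exI conjI ballI)
    fix j assume j: "j \<in> J"
    show "form n (Suc k) (\<lambda>y. inverse (x j 0) * (y 0 * L j y))" by (intro form_cmult form.var L(1) j) simp
  next
    show "dual J (\<lambda>j y. inverse (x j 0) * (y 0 * L j y)) x"
      using dualD[OF L(2)] y0 unfolding dual_def by auto
  qed
  moreover have "reduced_on n (Suc k) ?K (x ` J)"
  proof (rule reduced_on_points[where x = x and J = J, OF J y0])
    fix u p assume u: "Suc k \<le> u" and p: "form n u p" "\<And>j. j \<in> J \<Longrightarrow> p (x j) = 0"
    show "prods n ?K (u - Suc k) p"
    proof (rule ideal_regularity[OF J L _ order_refl y0 _ u p])
      fix p assume p: "form n (Suc k) p"
      let ?a = "\<lambda>j. p (x j) / x j 0"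
      have "(\<lambda>y. p y - (\<Sum>j\<in>J. ?a j * L j y) * y 0 ^ 1) \<in> ?K"
      proof (rule vanI)
        have "form n (k + 1) (\<lambda>y. (\<Sum>j\<in>J. ?a j * L j y) * y 0 ^ 1)"
          by (intro form_mult_var_power form_sum form_cmult L(1)) simp_all
        then show "form n (Suc k) (\<lambda>y. p y - (\<Sum>j\<in>J. ?a j * L j y) * y 0 ^ 1)" using p by (simp add: form_diff)
        show "p (x j) - (\<Sum>i\<in>J. ?a i * L i (x j)) * x j 0 ^ 1 = 0" if "j \<in> J" for j
          using sum_dual[OF L(2) that J, of ?a] y0[OF that] by simp
      qed
      from prods_gen[OF this form.const[of n 1]]
      show "\<exists>a. prods n ?K (Suc k - Suc k) (\<lambda>y. p y - (\<Sum>j\<in>J. a j * L j y) * y 0 ^ (Suc k - k))"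
        by (intro exI[of _ ?a]) simp
    qed simp_all
  qed simp_all
  ultimately show ?thesis unfolding good_def using k y0 by blast
qed

lemma y0_near:
  assumes "finite J" "\<And>j. j \<in> J \<Longrightarrow> point v0 j 0 \<noteq> 0"
  shows "eventually (\<lambda>v. \<forall>j\<in>J. point v j 0 \<noteq> 0) (zariski_at (J \<times> {..n}) v0)"
proof (intro eventually_ball_finite assms(1) ballI)
  fix j assume j: "j \<in> J"
  show "eventually (\<lambda>v. point v j 0 \<noteq> 0) (zariski_at (J \<times> {..n}) v0)"
    by (rule reg_nonzero[where f = "\<lambda>v. point v j 0", OF reg_pol assms(2)[OF j]]) (simp add: point_def pol_var j)
qed

lemma lattice_lagrange:
  assumes e: "inj_on e J" "e ` J \<subseteq> simplex n k" and x: "\<And>j. j \<in> J \<Longrightarrow> x j = lattice_pt (e j)"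
  obtains L where "\<And>j. j \<in> J \<Longrightarrow> form n k (L j)" "dual J L x"
proof -
  have "\<forall>i. \<exists>p. form n k p \<and> (\<forall>a\<in>e ` J. p (lattice_pt a) = (if a = e i then 1 else 0))"
    using lattice_interpolation[OF e(2), of "\<lambda>a. if a = e _ then 1 else 0"] by (intro allI)
  from choice[OF this] obtain L where L: "\<And>i. form n k (L i)"
    "\<And>i a. a \<in> e ` J \<Longrightarrow> L i (lattice_pt a) = (if a = e i then 1 else 0)" by blast
  have "dual J L x"
    unfolding dual_def using L(2) x e(1) by (auto simp: inj_on_eq_iff)
  with L(1) that show ?thesis by blast
qed

lemma near_odd:
  assumes J: "finite J" and e: "inj_on e J" "e ` J \<subseteq> simplex n k" and x: "\<And>j. j \<in> J \<Longrightarrow> point v0 j = lattice_pt (e j)"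
  shows "eventually (\<lambda>v. good n (Suc k) k J (point v) (point v ` J)) (zariski_at (J \<times> {..n}) v0)"
proof -
  obtain L0 where L0: "\<And>j. j \<in> J \<Longrightarrow> form n k (L0 j)" "dual J L0 (point v0)"
  proof (rule lattice_lagrange[where x = "point v0", OF e])
    show "point v0 j = lattice_pt (e j)" if "j \<in> J" for j by (rule x[OF that])
  qed (rule that)
  obtain L where L: "\<And>i. i \<in> J \<Longrightarrow> reg_family (J \<times> {..n}) v0 n k (L i)" "\<And>i. i \<in> J \<Longrightarrow> L i v0 = L0 i"
    "eventually (\<lambda>v. dual J (\<lambda>i. L i v) (point v)) (zariski_at (J \<times> {..n}) v0)"
  proof (rule lagrange_near[OF J _ L0(2)])
    show "form n k (L0 i)" if "i \<in> J" for i by (rule L0(1)[OF that])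
  qed (rule that)
  have y00: "point v0 j 0 \<noteq> 0" if "j \<in> J" for j by (simp add: x[OF that] lattice_pt_def)
  have y0n: "eventually (\<lambda>v. \<forall>j\<in>J. point v j 0 \<noteq> 0) (zariski_at (J \<times> {..n}) v0)"
    by (rule y0_near[OF J]) (rule y00)
  from L(3) y0n show ?thesis
  proof eventually_elim
    case v: (elim v)
    have "form n k (L i v)" if "i \<in> J" for i by (rule rfam_form[OF L(1)[OF that]])
    then have "has_lagrange n k J (point v)" unfolding has_lagrange_def using v(1) by (intro exI[of _ "\<lambda>i. L i v"]) simp
    then show ?case using v(2) by (intro good_odd J) simp_all
  qed
qed

text \<open>Leaving out the origin is what makes the base locus equal to the points: a product of
  parallel hyperplanes then vanishes at all chosen points but at no other point of the grid.\<close>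

lemma near_even:
  assumes J: "finite J" and m: "1 \<le> m" and e: "inj_on e J" "e ` J \<subseteq> box n m \<inter> simplex n m - {\<lambda>_. 0}"
    and x: "\<And>j. j \<in> J \<Longrightarrow> point v0 j = lattice_pt (e j)"
  shows "eventually (\<lambda>v. good n m m J (point v) (point v ` J)) (zariski_at (J \<times> {..n}) v0)"
proof -
  let ?Z1 = "box n m \<inter> simplex n m - {\<lambda>_. 0}"
  let ?I = "J \<times> {..n}"
  have eidx: "e ` J \<subseteq> simplex n m" using e(2) by blast
  obtain L0 where L0: "\<And>j. j \<in> J \<Longrightarrow> form n m (L0 j)" "dual J L0 (point v0)"
  proof (rule lattice_lagrange[where x = "point v0", OF e(1) eidx])
    show "point v0 j = lattice_pt (e j)" if "j \<in> J" for j by (rule x[OF that])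
  qed (rule that)
  obtain L where L: "\<And>i. i \<in> J \<Longrightarrow> reg_family ?I v0 n m (L i)" "\<And>i. i \<in> J \<Longrightarrow> L i v0 = L0 i"
    "eventually (\<lambda>v. dual J (\<lambda>i. L i v) (point v)) (zariski_at ?I v0)"
  proof (rule lagrange_near[OF J _ L0(2)])
    show "form n m (L0 i)" if "i \<in> J" for i by (rule L0(1)[OF that])
  qed (rule that)
  have y00: "point v0 j 0 \<noteq> 0" if "j \<in> J" for j by (simp add: x[OF that] lattice_pt_def)
  \<comment> \<open>In degree \<open>n * (m - 1)\<close> the whole grid can be interpolated; one
    more ensures \<open>m < t\<close>, which \<open>ideal_regularity\<close> asks for.\<close>
  define s where "s = n * (m - 1) + 1"
  define t where "t = m + s"
  let ?K0 = "vanishing n m J (point v0)"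
  \<comment> \<open>The hyperplanes on which the coordinates have sum \<open>1, \<dots>, m\<close>.
    Among grid points, exactly the origin and those of weight above \<open>m\<close> avoid
    them.\<close>
  define G where "G y = (\<Prod>j\<in>{1..m}. (\<Sum>i\<in>{1..n}. y i) - of_nat j * y 0)" for y :: "nat \<Rightarrow> complex"
  have fG: "form n m G"
  proof -
    have "form n (sum (\<lambda>_. 1) {1..m}) G" unfolding G_def[abs_def]
      by (intro form_prod form_diff form_sum form_cmult form_var1) auto
    then show ?thesis by simp
  qed
  have Glat: "G (lattice_pt a) = (\<Prod>j\<in>{1..m}. of_nat (weight n a) - of_nat j)" for a
  proof -
    have "(\<Sum>i\<in>{1..n}. lattice_pt a i) = of_nat (weight n a)" unfolding weight_def of_nat_sum by (intro sum.cong) (auto simp: lattice_pt_def)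
    then show ?thesis by (simp add: G_def lattice_pt_def)
  qed
  have wt0: "a = (\<lambda>_. 0)" if "weight n a = 0" "a \<in> box n m" for a
  proof
    fix i
    show "a i = 0" using that wt_ge[of i n a] unfolding box_def by (cases "i \<in> {1..n}") simp_all
  qed
  have G0: "G (lattice_pt a) = 0" if a: "a \<in> ?Z1" for a
  proof -
    have "weight n a \<noteq> 0" "weight n a \<le> m" using a wt0[of a] by (auto simp: simplex_def)
    then show ?thesis unfolding Glat by (intro prod_zero) (auto intro!: bexI[of _ "weight n a"])
  qed
  have G1: "G (lattice_pt a) \<noteq> 0" if a: "a \<in> box n m" "a \<notin> ?Z1" for a
  proof -
    have "weight n a \<notin> {1..m}"
    proof
      assume w: "weight n a \<in> {1..m}"
      then have "a \<in> simplex n m" using a(1) by (auto simp: simplex_def box_def)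
      moreover have "a \<noteq> (\<lambda>_. 0)" using w by (auto simp: weight_def)
      ultimately show False using a by blast
    qed
    then show ?thesis unfolding Glat by auto
  qed
  have vanlat: "p \<in> ?K0" if "form n m p" "\<And>a. a \<in> e ` J \<Longrightarrow> p (lattice_pt a) = 0" for p
    using that by (intro vanI) (simp_all add: x)
  have Gvan: "G \<in> ?K0" using fG G0 e(2) by (intro vanlat) blast+
  have gvan: "grid_form m ` {1..n} \<subseteq> ?K0"
  proof (intro image_subsetI vanlat)
    fix i a assume i: "i \<in> {1..n}"
    show "form n m (grid_form m i)" using i by (intro form_gridf) simp
    assume "a \<in> e ` J"
    then show "grid_form m i (lattice_pt a) = 0" using e(2) i by (intro gridf_vanish) auto
  qed
  have boxs: "box n m \<subseteq> simplex n s" by (rule box_subset_idx) (simp add: s_def)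
  have K0: "prods n ?K0 s p" if p: "form n t p" and p0: "\<And>a. a \<in> e ` J \<Longrightarrow> p (lattice_pt a) = 0" for p
  proof -
    obtain q where q: "form n m q" "\<forall>a\<in>?Z1. q (lattice_pt a) = p (lattice_pt a)"
      using lattice_interpolation[of ?Z1 n m "\<lambda>a. p (lattice_pt a)"] by blast
    have "q (lattice_pt a) = 0" if a: "a \<in> e ` J" for a
    proof -
      have "a \<in> ?Z1" using a e(2) by blast
      then show ?thesis using q(2) p0[OF a] by simp
    qed
    then have "q \<in> ?K0" by (intro vanlat q(1))
    then have A: "prods n ?K0 s (\<lambda>y. q y * y 0 ^ s)" by (rule prods_gen) (rule form_y0_power)
    define p' where "p' y = p y - q y * y 0 ^ s" for y
    have fp': "form n t p'" unfolding p'_def[abs_def] t_def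
      using p t_def by (intro form_diff form_mult_var_power q(1)) simp_all
    have p'0: "p' (lattice_pt a) = 0" if "a \<in> ?Z1" for a using q(2) that by (simp add: p'_def lattice_pt_def)
    obtain h where h: "form n s h" "\<forall>a\<in>box n m. h (lattice_pt a) = p' (lattice_pt a) / G (lattice_pt a)"
      using lattice_interpolation[OF boxs, of "\<lambda>a. p' (lattice_pt a) / G (lattice_pt a)"] by blast
    have B: "prods n ?K0 s (\<lambda>y. G y * h y)" by (rule prods_gen[OF Gvan h(1)])
    have "prods n (grid_form m ` {1..n}) (t - m) (\<lambda>y. p' y - G y * h y)"
    proof (rule grid_ideal)
      show "form n t (\<lambda>y. p' y - G y * h y)" using form_mult[OF fG h(1)] unfolding t_def[symmetric]
        by (intro form_diff fp')
      fix a assume "a \<in> box n m \<inter> simplex n t"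
      then show "p' (lattice_pt a) - G (lattice_pt a) * h (lattice_pt a) = 0"
        using h(2) G1[of a] p'0[of a] G0[of a] by (cases "a \<in> ?Z1") auto
    qed
    then have C: "prods n ?K0 s (\<lambda>y. p' y - G y * h y)" using prods_mono[OF _ gvan] by (simp add: t_def)
    show ?thesis by (rule prods_eq[OF prods_add[OF prods_add[OF A B] C]]) (simp add: p'_def)
  qed
  \<comment> \<open>The decomposition that \<open>ideal_regularity\<close> expects in degree
    \<open>t\<close>; it is linear in \<open>p\<close>, as \<open>open_span\<close> demands.\<close>
  define Q where "Q v p \<longleftrightarrow> (\<exists>a. prods n (vanishing n m J (point v)) s (\<lambda>y. p y - (\<Sum>j\<in>J. a j * L j v y) * y 0 ^ s))" for v p
  have "eventually (\<lambda>v. \<forall>p. form n t p \<longrightarrow> Q v p) (zariski_at ?I v0)"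
  proof (rule open_span)
    fix p assume p: "form n t p"
    define \<kappa> where "\<kappa> y = p y - (\<Sum>j\<in>J. p (point v0 j) * L0 j y) * y 0 ^ s" for y
    have f: "form n t \<kappa>" unfolding \<kappa>_def[abs_def]
    proof (intro form_diff p)
      show "form n t (\<lambda>y. (\<Sum>j\<in>J. p (point v0 j) * L0 j y) * y 0 ^ s)"
        unfolding t_def by (intro form_mult_var_power form_sum form_cmult L0(1)) simp_all
    qed
    have "\<kappa> (point v0 j) = 0" if j: "j \<in> J" for j
      using sum_dual[OF L0(2) j J, of "\<lambda>j. p (point v0 j)"] x[OF j] by (simp add: \<kappa>_def lattice_pt_def)
    then have "prods n ?K0 s \<kappa>" using x by (intro K0 f) auto
    from deform_prods[where L = L, OF L(1) J this] obtain P where P: "reg_family ?I v0 n (m + s) P" "P v0 = \<kappa>"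
      "\<And>v. dual J (\<lambda>i. L i v) (point v) \<Longrightarrow> prods n (vanishing n m J (point v)) s (P v)" by blast
    define P' where "P' v y = P v y + (\<Sum>j\<in>J. p (point v0 j) * L j v y) * y 0 ^ s" for v y
    have "reg_family ?I v0 n t P'" unfolding P'_def[abs_def] t_def
      by (intro rfam_add P(1) rfam_mult rfam_sum rfam_scale reg_const L(1) rfam_const form_y0_power)
    moreover have "P' v0 = p"
    proof
      fix y
      have "(\<Sum>j\<in>J. p (point v0 j) * L j v0 y) = (\<Sum>j\<in>J. p (point v0 j) * L0 j y)"
        by (intro sum.cong) (simp_all add: L(2))
      then show "P' v0 y = p y" by (simp add: P'_def P(2) \<kappa>_def)
    qed
    moreover have "Q v (P' v)" if "dual J (\<lambda>i. L i v) (point v)" for v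
      unfolding Q_def P'_def using P(3)[OF that] by (intro exI[of _ "\<lambda>j. p (point v0 j)"]) simp
    then have "eventually (\<lambda>v. Q v (P' v)) (zariski_at ?I v0)" by (rule eventually_mono[OF L(3)])
    ultimately show "\<exists>P. reg_family ?I v0 n t P \<and> P v0 = p \<and> eventually (\<lambda>v. Q v (P v)) (zariski_at ?I v0)" by blast
  next
    show "Q v (\<lambda>_. 0)" for v unfolding Q_def by (intro exI[of _ "\<lambda>_. 0"]) (simp add: prods.zero)
  next
    fix v p q assume pq: "Q v p" "Q v q"
    obtain a where a: "prods n (vanishing n m J (point v)) s (\<lambda>y. p y - (\<Sum>j\<in>J. a j * L j v y) * y 0 ^ s)"
      using pq(1) unfolding Q_def ..
    obtain b where b: "prods n (vanishing n m J (point v)) s (\<lambda>y. q y - (\<Sum>j\<in>J. b j * L j v y) * y 0 ^ s)"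
      using pq(2) unfolding Q_def ..
    show "Q v (\<lambda>y. p y + q y)" unfolding Q_def
      by (rule exI[of _ "\<lambda>j. a j + b j"], rule prods_eq[OF prods_add[OF a b]])
        (simp add: algebra_simps sum.distrib)
  next
    fix v c p assume "Q v p"
    then obtain a where a: "prods n (vanishing n m J (point v)) s (\<lambda>y. p y - (\<Sum>j\<in>J. a j * L j v y) * y 0 ^ s)"
      unfolding Q_def ..
    show "Q v (\<lambda>y. c * p y)" unfolding Q_def
      by (rule exI[of _ "\<lambda>j. c * a j"], rule prods_eq[OF prods_cmult[OF a, of c]])
        (simp add: algebra_simps sum_distrib_left)
  qed
  moreover have "eventually (\<lambda>v. \<forall>j\<in>J. point v j 0 \<noteq> 0) (zariski_at ?I v0)"
    by (rule y0_near[OF J]) (rule y00)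
  ultimately show ?thesis
    using L(3)
  proof eventually_elim
    case (elim v)
    have fL: "form n m (L i v)" if "i \<in> J" for i by (rule rfam_form[OF L(1)[OF that]])
    have y0: "point v j 0 \<noteq> 0" if "j \<in> J" for j using elim(2) that by blast
    have "reduced_on n m (vanishing n m J (point v)) (point v ` J)"
    proof (rule reduced_on_points[where x = "point v" and J = J, OF J y0])
      fix u p assume u: "t \<le> u" and p: "form n u p" "\<And>j. j \<in> J \<Longrightarrow> p (point v j) = 0"
      show "prods n (vanishing n m J (point v)) (u - m) p"
      proof (rule ideal_regularity[where t = t and L = "\<lambda>i. L i v", OF J fL elim(3) _ _ y0 _ u p])
        show "m < t" "m \<le> t" by (simp_all add: t_def s_def)
        fix p assume "form n t p"
        then have "Q v p" using elim(1) by blast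
        then show "\<exists>a. prods n (vanishing n m J (point v)) (t - m) (\<lambda>y. p y - (\<Sum>j\<in>J. a j * L j v y) * y 0 ^ (t - m))"
          by (simp add: Q_def t_def)
      qed simp_all
    qed simp_all
    moreover have "has_lagrange n m J (point v)" unfolding has_lagrange_def using elim(3) fL by (intro exI[of _ "\<lambda>i. L i v"]) simp
    ultimately show ?case unfolding good_def using elim(2) by blast
  qed
qed

section \<open>Simple roots as an open condition\<close>

lemma distinct_roots_resultant:
  fixes h :: "complex poly"
  assumes "finite A" "h = (\<Prod>a\<in>A. [:- a, 1:])"
  shows "resultant h (pderiv h) \<noteq> 0"
proof
  assume "resultant h (pderiv h) = 0"
  then have "degree (gcd h (pderiv h)) \<noteq> 0" by (simp add: resultant_0_gcd)
  then have "\<not> constant (poly (gcd h (pderiv h)))" by (simp add: constant_degree)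
  from fundamental_theorem_of_algebra[OF this] obtain z where "poly (gcd h (pderiv h)) z = 0" by blast
  then have z: "poly h z = 0" "poly (pderiv h) z = 0"
    by (metis dvd_trans gcd_dvd1 poly_eq_0_iff_dvd) (metis \<open>poly (gcd h (pderiv h)) z = 0\<close> dvd_trans gcd_dvd2 poly_eq_0_iff_dvd)
  then have zA: "z \<in> A" using assms by (auto simp: poly_prod)
  have h: "h = [:- z, 1:] * (\<Prod>a\<in>A - {z}. [:- a, 1:])" unfolding assms(2) by (rule prod.remove[OF assms(1) zA])
  have "poly (pderiv ([:- z, 1:] * q)) z = poly q z" for q :: "complex poly"
    by (simp only: pderiv_mult) (simp add: pderiv_pCons)
  then have "poly (pderiv h) z = poly (\<Prod>a\<in>A - {z}. [:- a, 1:]) z" by (subst h)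
  also have "\<dots> \<noteq> 0" using assms(1) by (simp add: poly_prod)
  finally show False using z(2) by simp
qed

lemma split_if_resultant:
  fixes h :: "complex poly"
  assumes "lead_coeff h = 1" "resultant h (pderiv h) \<noteq> 0"
  shows "\<exists>rt. inj_on rt {..<degree h} \<and> h = (\<Prod>j<degree h. [:- rt j, 1:])"
proof -
  have h0: "h \<noteq> 0" using assms(1) by auto
  have "rsquarefree h"
    unfolding rsquarefree_roots
  proof (intro allI notI, elim conjE)
    fix a assume "poly h a = 0" "poly (pderiv h) a = 0"
    then have "[:- a, 1:] dvd gcd h (pderiv h)" by (simp add: poly_eq_0_iff_dvd)
    then have "degree [:- a, 1:] \<le> degree (gcd h (pderiv h))" using h0 by (intro dvd_imp_degree_le) simp_all
    then show False using assms(2) by (simp add: resultant_0_gcd)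
  qed
  from complex_poly_decompose_rsquarefree[OF this]
  have eq: "h = (\<Prod>z | poly h z = 0. [:- z, 1:])" using assms(1) by simp
  let ?A = "{z. poly h z = 0}"
  have fin: "finite ?A" using h0 by (rule poly_roots_finite)
  have "degree h = card ?A" by (subst eq) (subst degree_prod_eq_sum_degree, simp_all)
  then obtain rt where rt: "bij_betw rt {..<degree h} ?A"
    using ex_bij_betw_nat_finite[OF fin] unfolding lessThan_atLeast0 by metis
  have "h = (\<Prod>j<degree h. [:- rt j, 1:])"
    by (subst eq) (rule prod.reindex_bij_betw[OF rt, symmetric])
  with rt show ?thesis unfolding bij_betw_def by blast
qed

text \<open>The resultant of a polynomial and its derivative is a regular function of the
  coefficients: being monic, the polynomial keeps its degree, so the Sylvester matrix has constant
  size. At \<open>v0\<close> the \<open>D\<close> known roots are all the roots, and they are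
  simple.\<close>

lemma distinct_roots_near:
  assumes D: "1 \<le> D" and c: "\<And>j. j < D \<Longrightarrow> reg I v0 (c j)" and A: "finite A" "card A = D"
    and roots: "\<And>a. a \<in> A \<Longrightarrow> a ^ D = (\<Sum>j<D. c j v0 * a ^ j)"
  shows "eventually (\<lambda>v. \<exists>rt. inj_on rt {..<D} \<and>
    (\<forall>x. x ^ D - (\<Sum>j<D. c j v * x ^ j) = (\<Prod>j<D. x - rt j))) (zariski_at I v0)"
proof -
  define h where "h v = Polynomial.monom 1 D - (\<Sum>j<D. Polynomial.monom (c j v) j)" for v
  have coeff_h: "poly.coeff (h v) i = (if i = D then 1 else 0) - (if i < D then c i v else 0)" for v i
    unfolding h_def by (simp add: coeff_sum)
  have poly_h: "poly (h v) x = x ^ D - (\<Sum>j<D. c j v * x ^ j)" for v x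
    unfolding h_def by (simp add: poly_monom poly_sum)
  have deg: "degree (h v) = D" for v
  proof (rule antisym)
    show "degree (h v) \<le> D" by (rule degree_le) (simp add: coeff_h)
    show "D \<le> degree (h v)" by (rule le_degree) (simp add: coeff_h)
  qed
  have lead: "lead_coeff (h v) = 1" for v by (simp add: deg coeff_h)
  have deg': "degree (pderiv (h v)) = D - 1" for v by (simp add: degree_pderiv deg)
  have reg_coeff: "reg I v0 (\<lambda>v. poly.coeff (h v) i)" for i
    unfolding coeff_h using c by (cases "i < D") (auto intro: reg_const reg_diff reg_uminus)
  have "reg I v0 (\<lambda>v. resultant (h v) (pderiv (h v)))"
    unfolding resultant_def sylvester_mat_def deg deg'
  proof (rule reg_det[OF sylvester_mat_sub_carrier])
    fix i j assume ij: "i < D + (D - 1)" "j < D + (D - 1)"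
    have "reg I v0 (\<lambda>v. poly.coeff (pderiv (h v)) i)" for i
      unfolding coeff_pderiv by (intro reg_mult reg_const reg_coeff)
    moreover have "reg I v0 (\<lambda>v. if P then f v else g v)" if "reg I v0 f" "reg I v0 g" for P f g
      using that by (cases P) simp_all
    ultimately show "reg I v0 (\<lambda>v. sylvester_mat_sub D (D - 1) (h v) (pderiv (h v)) $$ (i, j))"
      unfolding sylvester_mat_sub_index[OF ij] using reg_coeff by (simp add: reg_const)
  qed
  moreover have "resultant (h v0) (pderiv (h v0)) \<noteq> 0"
  proof (rule distinct_roots_resultant[OF A(1)])
    show "h v0 = (\<Prod>a\<in>A. [:- a, 1:])"
    proof (rule poly_eqI_degree_lead_coeff[where A = A and n = D])
      have dp: "degree (\<Prod>a\<in>A. [:- a, 1:]) = D" using A by (subst degree_prod_eq_sum_degree) simp_all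
      then show "degree (\<Prod>a\<in>A. [:- a, 1:]) \<le> D" by simp
      have "lead_coeff (\<Prod>a\<in>A. [:- a, 1:]) = 1" by (simp add: lead_coeff_prod)
      then show "poly.coeff (h v0) D = poly.coeff (\<Prod>a\<in>A. [:- a, 1:]) D" using lead[of v0] deg[of v0] dp by simp
      show "poly (h v0) a = poly (\<Prod>a\<in>A. [:- a, 1:]) a" if "a \<in> A" for a
      proof -
        have "(\<Prod>a'\<in>A. a - a') = 0" using A(1) that by auto
        then show ?thesis using roots[OF that] by (simp add: poly_h poly_prod)
      qed
    qed (use A deg in simp_all)
  qed
  ultimately have "eventually (\<lambda>v. resultant (h v) (pderiv (h v)) \<noteq> 0) (zariski_at I v0)" by (rule reg_nonzero)
  then show ?thesis
  proof (rule eventually_mono)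
    fix v assume "resultant (h v) (pderiv (h v)) \<noteq> 0"
    from split_if_resultant[OF lead this] obtain rt where
      rt: "inj_on rt {..<D}" "h v = (\<Prod>j<D. [:- rt j, 1:])" unfolding deg by blast
    have "x ^ D - (\<Sum>j<D. c j v * x ^ j) = (\<Prod>j<D. x - rt j)" for x
      using poly_h[of v x] arg_cong[OF rt(2), of "\<lambda>p. poly p x"] by (simp add: poly_prod)
    with rt(1) show "\<exists>rt. inj_on rt {..<D} \<and> (\<forall>x. x ^ D - (\<Sum>j<D. c j v * x ^ j) = (\<Prod>j<D. x - rt j))" by blast
  qed
qed

lemma prod_mod:
  fixes f :: "nat \<Rightarrow> complex"
  shows "(\<Prod>j<c. f (j mod m)) = (\<Prod>j<m. f j) ^ (c div m) * (\<Prod>j<c mod m. f j)"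
proof -
  have "(\<Prod>j<q * m + r. f (j mod m)) = (\<Prod>j<m. f j) ^ q * (\<Prod>j<r. f j)" if "r \<le> m" for q r
  proof (induction q)
    case 0
    show ?case using that by (auto intro!: prod.cong)
  next
    case (Suc q)
    have "(\<Prod>j<Suc q * m + r. f (j mod m)) = (\<Prod>j<m + (q * m + r). f (j mod m))" by (simp add: add.assoc)
    also have "\<dots> = (\<Prod>j<m. f (j mod m)) * (\<Prod>j<q * m + r. f ((m + j) mod m))" by (rule prod_shift)
    also have "(\<Prod>j<m. f (j mod m)) = (\<Prod>j<m. f j)" by (intro prod.cong) auto
    finally show ?case using Suc by simp
  qed
  from this[of "c mod m" "c div m"] show ?thesis by (cases "m = 0") (simp_all add: less_imp_le)
qed

text \<open>\<open>\<beta>\<close> numbers the grid points, and thereby the powers of the separating linear form.\<close>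

locale grid_config =
  fixes n m :: nat and J :: "nat set" and e :: "nat \<Rightarrow> nat \<Rightarrow> nat" and v0 :: "nat \<times> nat \<Rightarrow> complex"
    and L :: "nat \<Rightarrow> (nat \<times> nat \<Rightarrow> complex) \<Rightarrow> (nat \<Rightarrow> complex) \<Rightarrow> complex" and \<beta> :: "(nat \<Rightarrow> nat) \<Rightarrow> nat"
  assumes m: "1 \<le> m" and J: "finite J" and e: "bij_betw e J (box n m \<inter> simplex n m)"
    and x: "\<And>j. j \<in> J \<Longrightarrow> point v0 j = lattice_pt (e j)"
    and L: "\<And>i. i \<in> J \<Longrightarrow> reg_family (J \<times> {..n}) v0 n m (L i)"
    and dual_near: "eventually (\<lambda>v. dual J (\<lambda>i. L i v) (point v)) (zariski_at (J \<times> {..n}) v0)"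
    and beta: "bij_betw \<beta> (box n m) {..<card (box n m)}"
begin

abbreviation I where "I \<equiv> J \<times> {..n}"
abbreviation D where "D \<equiv> card (box n m)"
abbreviation K where "K v \<equiv> vanishing n m J (point v)"
abbreviation l where "l \<equiv> separator n m"

lemma D_pos: "1 \<le> D"
proof -
  have "(\<lambda>_. 0) \<in> box n m" using m by (simp add: box_def)
  then have "D \<noteq> 0" using finite_box by (auto simp: card_eq_0_iff)
  then show ?thesis by simp
qed

lemma y0_near': "eventually (\<lambda>v. \<forall>j\<in>J. point v j 0 \<noteq> 0) (zariski_at I v0)"
  by (rule y0_near[OF J]) (simp add: x lattice_pt_def)

text \<open>The grid forms corrected so as to vanish at the moved points; they generate the part of
  the ideal that is explicitly known near \<open>v0\<close>.\<close>

definition F where "F i = deform J L (grid_form m i)"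

lemma rfam_F: "i \<in> {1..n} \<Longrightarrow> reg_family I v0 n m (F i)"
  unfolding F_def by (intro rfam_deform L form_gridf) simp_all

lemma F_at: "i \<in> {1..n} \<Longrightarrow> F i v0 = grid_form m i"
proof -
  assume i: "i \<in> {1..n}"
  have "grid_form m i (point v0 j) = 0" if "j \<in> J" for j
  proof -
    have "e j \<in> box n m" using e that unfolding bij_betw_def by blast
    from gridf_vanish[OF this i] show ?thesis by (simp add: x[OF that])
  qed
  then show ?thesis unfolding F_def by (rule deform_at)
qed

lemma F_van: "dual J (\<lambda>i. L i v) (point v) \<Longrightarrow> i \<in> {1..n} \<Longrightarrow> F i v \<in> K v"
  unfolding F_def using L by (intro deform_van[where ?v0.0 = v0] form_gridf J) simp_all

text \<open>In the Newton element with nodes \<open>j mod m\<close>, every complete block of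
  \<open>m\<close> factors is a grid form; each such block is replaced by its deformation.\<close>

definition deformed_newton where
  "deformed_newton s b v y = y 0 ^ (s - weight n b) *
    (\<Prod>i\<in>{1..n}. F i v y ^ (b i div m) * (\<Prod>j<b i mod m. y i - of_nat j * y 0))"

lemma rfam_gf:
  assumes "b \<in> simplex n s"
  shows "reg_family I v0 n s (deformed_newton s b)"
proof -
  have "reg_family I v0 n (s - weight n b + sum (\<lambda>i. b i div m * m + sum (\<lambda>_. 1) {..<b i mod m}) {1..n})
    (\<lambda>v y. y 0 ^ (s - weight n b) * (\<Prod>i\<in>{1..n}. F i v y ^ (b i div m) * (\<Prod>j<b i mod m. y i - of_nat j * y 0)))"
    by (intro rfam_mult rfam_prod rfam_power rfam_const form_y0_power rfam_F form_prod form_lin_diff) simp_all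
  moreover have "s - weight n b + sum (\<lambda>i. b i div m * m + sum (\<lambda>_. 1) {..<b i mod m}) {1..n} = s"
    using assms by (simp add: simplex_def weight_def)
  ultimately show ?thesis unfolding deformed_newton_def[abs_def] by simp
qed

lemma gf_at: "deformed_newton s b v0 = newton n (\<lambda>j. j mod m) s b"
proof
  fix y
  have "F i v0 y ^ (b i div m) * (\<Prod>j<b i mod m. y i - of_nat j * y 0) = (\<Prod>j<b i. y i - of_nat (j mod m) * y 0)"
    if "i \<in> {1..n}" for i
    unfolding F_at[OF that] grid_form_def by (rule prod_mod[symmetric])
  then show "deformed_newton s b v0 y = newton n (\<lambda>j. j mod m) s b y" unfolding deformed_newton_def newton_def by simp
qed

lemma gf_step:
  assumes b: "b \<in> simplex n t" and i: "i \<in> {1..n}"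
  shows "deformed_newton (t + m) (b(i := b i + m)) v y = F i v y * deformed_newton t b v y"
    and "b(i := b i + m) \<in> simplex n (t + m)" and "b(i := b i + m) \<notin> box n m"
proof -
  have w: "weight n (b(i := b i + m)) = weight n b + m" using wt_upd[OF i, of b "b i + m"] by simp
  show "b(i := b i + m) \<in> simplex n (t + m)" using b i w by (auto simp: simplex_def)
  show "b(i := b i + m) \<notin> box n m" using i by (auto simp: box_def)
  let ?g = "\<lambda>b i. F i v y ^ (b i div m) * (\<Prod>j<b i mod m. y i - of_nat j * y 0)"
  have "(\<Prod>i'\<in>{1..n} - {i}. ?g (b(i := b i + m)) i') = (\<Prod>i'\<in>{1..n} - {i}. ?g b i')"
    by (intro prod.cong) auto
  then have "(\<Prod>i'\<in>{1..n}. ?g (b(i := b i + m)) i') = F i v y * (\<Prod>i'\<in>{1..n}. ?g b i')"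
    unfolding prod.remove[OF finite_atLeastAtMost i] using m by (simp add: mult_ac)
  then show "deformed_newton (t + m) (b(i := b i + m)) v y = F i v y * deformed_newton t b v y"
    unfolding deformed_newton_def w by (simp add: mult_ac)
qed

lemma gf_prods:
  assumes b: "b \<in> simplex n s" "b \<notin> box n m" and d: "dual J (\<lambda>i. L i v) (point v)"
  shows "prods n (K v) (s - m) (deformed_newton s b v)"
proof -
  obtain i where i: "i \<in> {1..n}" "m \<le> b i" using b by (auto simp: simplex_def box_def not_less)
  let ?b = "b(i := b i - m)"
  have "b i \<le> weight n b" using i(1) by (rule wt_ge)
  then have ms: "m \<le> s" using b i by (auto simp: simplex_def)
  have b': "?b \<in> simplex n (s - m)" by (rule newt_outside_box(2)[OF b(1) i])
  have "?b(i := ?b i + m) = b" using i(2) by auto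
  then have "deformed_newton s b v y = F i v y * deformed_newton (s - m) ?b v y" for y
    using gf_step(1)[OF b' i(1), of v y] ms by simp
  then show ?thesis
    by (intro prods_eq[OF prods_gen[OF F_van[OF d i(1)] rfam_form[OF rfam_gf[OF b']]]])
qed

text \<open>Elements outside the box lie in the ideal near \<open>v0\<close>. Those inside serve
  only to interpolate the grid, which the first \<open>D\<close> powers of the separating form do
  equally well.\<close>

definition adapted_basis where
  "adapted_basis s b v y = (if b \<in> box n m then l y ^ \<beta> b * y 0 ^ (s - \<beta> b) else deformed_newton s b v y)"

lemma beta_less: "b \<in> box n m \<Longrightarrow> \<beta> b < D"
  using beta unfolding bij_betw_def by auto

lemma form_lpow: "j \<le> s \<Longrightarrow> form n s (\<lambda>y. l y ^ j * y 0 ^ (s - j))"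
  using form_mult_var_power[where i = 0 and s = "s - j", OF form_power[where k = j, OF form_sepf[of n m]]] by simp

lemma rfam_ell:
  assumes "b \<in> simplex n s" "D \<le> s"
  shows "reg_family I v0 n s (adapted_basis s b)"
proof (cases "b \<in> box n m")
  case True
  then show ?thesis using beta_less[OF True] assms(2) unfolding adapted_basis_def[abs_def] by (simp add: rfam_const form_lpow)
next
  case False
  then show ?thesis using rfam_gf[OF assms(1)] unfolding adapted_basis_def[abs_def] by simp
qed

lemma sum_beta: "(\<Sum>b\<in>box n m. f (\<beta> b)) = (\<Sum>j<D. f j)" for f :: "nat \<Rightarrow> complex"
  by (rule sum.reindex_bij_betw[OF beta])

text \<open>A Vandermonde system: the separating form takes \<open>D\<close> distinct values on the
  grid.\<close>

lemma sep_interpolation: "\<exists>c. \<forall>a\<in>box n m. (\<Sum>b\<in>box n m. c b * l (lattice_pt a) ^ \<beta> b) = r a"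
proof (rule square_system_solvable[OF finite_box])
  fix c assume c: "\<And>a. a \<in> box n m \<Longrightarrow> (\<Sum>b\<in>box n m. c b * l (lattice_pt a) ^ \<beta> b) = 0"
  define P where "P = (\<Sum>b\<in>box n m. Polynomial.monom (c b) (\<beta> b))"
  have "P = 0"
  proof (rule poly_eqI_degree[of "(\<lambda>a. l (lattice_pt a)) ` box n m"])
    have "degree P \<le> D - 1" unfolding P_def
      using beta_less by (intro degree_sum_le finite_box order_trans[OF degree_monom_le]) fastforce
    then show "degree P < card ((\<lambda>a. l (lattice_pt a)) ` box n m)" "degree (0 :: complex poly) < card ((\<lambda>a. l (lattice_pt a)) ` box n m)"
      using D_pos by (simp_all add: card_image[OF sepf_inj])
    fix z assume "z \<in> (\<lambda>a. l (lattice_pt a)) ` box n m"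
    then show "poly P z = poly 0 z" using c by (auto simp: P_def poly_sum poly_monom)
  qed
  have "c b = 0" if b: "b \<in> box n m" for b
  proof -
    have "0 = poly.coeff P (\<beta> b)" using \<open>P = 0\<close> by simp
    also have "\<dots> = (\<Sum>b'\<in>box n m. if b' = b then c b' else 0)"
      unfolding P_def coeff_sum using beta b by (intro sum.cong) (auto simp: bij_betw_def inj_on_eq_iff)
    also have "\<dots> = c b" using finite_box b by simp
    finally show ?thesis by simp
  qed
  then show "\<forall>b\<in>box n m. c b = 0" by blast
qed

lemma near_basis:
  assumes s: "D \<le> s" "box n m \<subseteq> simplex n s"
  obtains B where "\<And>x a. x \<in> simplex n s \<Longrightarrow> a \<in> simplex n s \<Longrightarrow> reg I v0 (B x a)"
    "eventually (\<lambda>v. (\<forall>p. form n s p \<longrightarrow>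
        (\<forall>y. p y = (\<Sum>x\<in>simplex n s. (\<Sum>a\<in>simplex n s. B x a v * p (lattice_pt a)) * adapted_basis s x v y))) \<and>
      (\<forall>c. (\<forall>y. (\<Sum>x\<in>simplex n s. c x * adapted_basis s x v y) = 0) \<longrightarrow> (\<forall>x\<in>simplex n s. c x = 0))) (zariski_at I v0)"
proof (rule span_near[where l = "adapted_basis s" and n = n and t = s and I = I and ?v0.0 = v0])
  show "reg_family I v0 n s (adapted_basis s x)" if "x \<in> simplex n s" for x by (rule rfam_ell[OF that s(1)])
  fix p assume p: "form n s p"
  obtain c where c: "\<forall>a\<in>box n m. (\<Sum>b\<in>box n m. c b * l (lattice_pt a) ^ \<beta> b) = p (lattice_pt a)"
    using sep_interpolation[of "\<lambda>a. p (lattice_pt a)"] by blast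
  let ?q = "\<lambda>y. \<Sum>b\<in>box n m. c b * (l y ^ \<beta> b * y 0 ^ (s - \<beta> b))"
  have fq: "form n s ?q"
  proof (intro form_sum form_cmult form_lpow)
    fix b assume "b \<in> box n m"
    from beta_less[OF this] s(1) show "\<beta> b \<le> s" by simp
  qed
  have "p (lattice_pt a) - ?q (lattice_pt a) = 0" if "a \<in> box n m \<inter> simplex n s" for a using c that by (simp add: lattice_pt_def)
  from grid_expansion[OF form_diff[OF p fq] this] obtain d where
    d: "\<And>y. p y - ?q y = (\<Sum>b\<in>simplex n s - box n m. d b * newton n (\<lambda>j. j mod m) s b y)" by blast
  show "\<exists>c. \<forall>y. p y = (\<Sum>x\<in>simplex n s. c x * adapted_basis s x v0 y)"
  proof (intro exI allI)
    fix y
    let ?c = "\<lambda>x. if x \<in> box n m then c x else d x"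
    have "(\<Sum>x\<in>simplex n s. ?c x * adapted_basis s x v0 y) = (\<Sum>x\<in>simplex n s \<inter> box n m. ?c x * adapted_basis s x v0 y) + (\<Sum>x\<in>simplex n s - box n m. ?c x * adapted_basis s x v0 y)"
      by (rule sum.Int_Diff[OF finite_idx])
    also have "simplex n s \<inter> box n m = box n m" using s(2) by blast
    also have "(\<Sum>x\<in>box n m. ?c x * adapted_basis s x v0 y) = ?q y" by (intro sum.cong) (simp_all add: adapted_basis_def)
    also have "(\<Sum>x\<in>simplex n s - box n m. ?c x * adapted_basis s x v0 y) = p y - ?q y"
      unfolding d by (intro sum.cong) (simp_all add: adapted_basis_def gf_at)
    finally show "p y = (\<Sum>x\<in>simplex n s. ?c x * adapted_basis s x v0 y)" by simp
  qed
qed (rule that)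

lemma ell_split:
  assumes "box n m \<subseteq> simplex n s"
  shows "(\<Sum>x\<in>simplex n s. C x * adapted_basis s x v y) =
    (\<Sum>j<D. C (inv_into (box n m) \<beta> j) * (l y ^ j * y 0 ^ (s - j))) + (\<Sum>x\<in>simplex n s - box n m. C x * deformed_newton s x v y)"
proof -
  have inv: "inv_into (box n m) \<beta> (\<beta> x) = x" if "x \<in> box n m" for x
    using beta that by (simp add: bij_betw_def)
  have "(\<Sum>x\<in>simplex n s. C x * adapted_basis s x v y) = (\<Sum>x\<in>simplex n s \<inter> box n m. C x * adapted_basis s x v y) + (\<Sum>x\<in>simplex n s - box n m. C x * adapted_basis s x v y)"
    by (rule sum.Int_Diff[OF finite_idx])
  also have "simplex n s \<inter> box n m = box n m" using assms by blast
  also have "(\<Sum>x\<in>box n m. C x * adapted_basis s x v y) =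
    (\<Sum>x\<in>box n m. C (inv_into (box n m) \<beta> (\<beta> x)) * (l y ^ \<beta> x * y 0 ^ (s - \<beta> x)))"
    by (intro sum.cong) (simp_all add: adapted_basis_def inv)
  also have "\<dots> = (\<Sum>j<D. C (inv_into (box n m) \<beta> j) * (l y ^ j * y 0 ^ (s - j)))"
    by (rule sum_beta[of "\<lambda>j. C (inv_into (box n m) \<beta> j) * (l y ^ j * y 0 ^ (s - j))"])
  also have "(\<Sum>x\<in>simplex n s - box n m. C x * adapted_basis s x v y) = (\<Sum>x\<in>simplex n s - box n m. C x * deformed_newton s x v y)"
    by (intro sum.cong) (simp_all add: adapted_basis_def)
  finally show ?thesis .
qed

text \<open>In the adapted basis the forms of degree \<open>t\<close> are, modulo the ideal,
  polynomials in \<open>l\<close> of degree below \<open>D\<close>. Expanding \<open>l ^ D\<close>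
  yields a monic equation for \<open>l\<close> with regular coefficients and simple roots at
  \<open>v0\<close>, and \<open>finite_reduced_scheme\<close> applies nearby.\<close>

lemma near_scheme:
  assumes t: "D \<le> t" "box n m \<subseteq> simplex n t" "m < t"
  shows "eventually (\<lambda>v. \<exists>rt w. inj_on rt {..<D} \<and> (\<forall>i<D. w i 0 = 1) \<and> reduced_on n m (K v) (w ` {..<D}) \<and>
    (\<forall>i<D. w i \<notin> zeros_of (K v) \<or> l (w i) \<noteq> rt i \<longrightarrow>
      prods n (K v) (t + D - 2) (\<lambda>y. (\<Prod>j\<in>{..<D} - {i}. l y - rt j * y 0) * y 0 ^ (t - 1 + m)))) (zariski_at I v0)"
proof -
  obtain B where B: "\<And>x a. x \<in> simplex n t \<Longrightarrow> a \<in> simplex n t \<Longrightarrow> reg I v0 (B x a)"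
    and near: "eventually (\<lambda>v. (\<forall>p. form n t p \<longrightarrow>
        (\<forall>y. p y = (\<Sum>x\<in>simplex n t. (\<Sum>a\<in>simplex n t. B x a v * p (lattice_pt a)) * adapted_basis t x v y))) \<and>
      (\<forall>c. (\<forall>y. (\<Sum>x\<in>simplex n t. c x * adapted_basis t x v y) = 0) \<longrightarrow> (\<forall>x\<in>simplex n t. c x = 0))) (zariski_at I v0)"
    by (rule near_basis[OF t(1,2)]) (rule that)
  let ?i = "inv_into (box n m) \<beta>"
  have ibox: "?i j \<in> box n m" if "j < D" for j
    using beta that inv_into_into[of j \<beta> "box n m"] by (auto simp: bij_betw_def)
  define C where "C p x v = (\<Sum>a\<in>simplex n t. B x a v * p (lattice_pt a))" for p x v
  define h where "h y = l y ^ D * y 0 ^ (t - D)" for y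
  have fh: "form n t h" unfolding h_def[abs_def] by (rule form_lpow[OF t(1)])
  have exp: "p y = (\<Sum>j<D. C p (?i j) v * (l y ^ j * y 0 ^ (t - j))) + (\<Sum>x\<in>simplex n t - box n m. C p x v * deformed_newton t x v y)"
    if p: "form n t p" and v: "\<forall>p. form n t p \<longrightarrow>
        (\<forall>y. p y = (\<Sum>x\<in>simplex n t. (\<Sum>a\<in>simplex n t. B x a v * p (lattice_pt a)) * adapted_basis t x v y))" for p v y
  proof -
    have "p y = (\<Sum>x\<in>simplex n t. (\<Sum>a\<in>simplex n t. B x a v * p (lattice_pt a)) * adapted_basis t x v y)" using v p by blast
    then show ?thesis unfolding C_def by (simp only: ell_split[OF t(2)])
  qed
  \<comment> \<open>At \<open>v0\<close> the elements outside the box vanish on the grid, so the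
    \<open>D\<close> values of \<open>l\<close> at the grid points satisfy the equation.\<close>
  have "eventually (\<lambda>v. \<exists>rt. inj_on rt {..<D} \<and>
    (\<forall>x. x ^ D - (\<Sum>j<D. C h (?i j) v * x ^ j) = (\<Prod>j<D. x - rt j))) (zariski_at I v0)"
  proof (rule distinct_roots_near[OF D_pos])
    show "reg I v0 (\<lambda>v. C h (?i j) v)" if "j < D" for j
      unfolding C_def using ibox[OF that] t(2) by (intro reg_sum reg_mult reg_const B) blast+
    show "finite ((\<lambda>a. l (lattice_pt a)) ` box n m)" using finite_box by simp
    show "card ((\<lambda>a. l (lattice_pt a)) ` box n m) = D" by (rule card_image[OF sepf_inj])
    fix z assume "z \<in> (\<lambda>a. l (lattice_pt a)) ` box n m"
    then obtain a where a: "a \<in> box n m" "z = l (lattice_pt a)" by blast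
    have lat0: "lattice_pt a 0 = 1" by (simp add: lattice_pt_def)
    have "l (lattice_pt a) ^ D = h (lattice_pt a)" by (simp add: h_def lat0)
    also have "h (lattice_pt a) = (\<Sum>j<D. C h (?i j) v0 * (l (lattice_pt a) ^ j * lattice_pt a 0 ^ (t - j))) + (\<Sum>x\<in>simplex n t - box n m. C h x v0 * deformed_newton t x v0 (lattice_pt a))"
      using eventually_zar_at[OF near] by (intro exp fh) blast
    also have "(\<Sum>x\<in>simplex n t - box n m. C h x v0 * deformed_newton t x v0 (lattice_pt a)) = 0"
      using newt_mod_vanish[OF _ _ a(1)] by (intro sum.neutral) (simp add: gf_at)
    finally show "z ^ D = (\<Sum>j<D. C h (?i j) v0 * z ^ j)" by (simp add: lat0 a(2))
  qed
  with near dual_near show ?thesis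
  proof eventually_elim
    case (elim v)
    obtain rt where rt: "inj_on rt {..<D}" "\<And>x. x ^ D - (\<Sum>j<D. C h (?i j) v * x ^ j) = (\<Prod>j<D. x - rt j)"
      using elim(3) by blast
    have span: "prods n (K v) (t - m) (\<lambda>y. p y - (\<Sum>j<D. C p (?i j) v * (l y ^ j * y 0 ^ (t - j))))"
      if p: "form n t p" for p
    proof -
      have "prods n (K v) (t - m) (\<lambda>y. \<Sum>x\<in>simplex n t - box n m. C p x v * deformed_newton t x v y)"
        using elim(2) by (intro prods_sum prods_cmult gf_prods) simp_all
      then show ?thesis
      proof (rule prods_eq)
        show "p y - (\<Sum>j<D. C p (?i j) v * (l y ^ j * y 0 ^ (t - j))) = (\<Sum>x\<in>simplex n t - box n m. C p x v * deformed_newton t x v y)" for y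
          using exp[OF p, of v y] elim(1) by simp
      qed
    qed
    have heq: "(\<Prod>j<D. l y - rt j * y 0) * y 0 ^ (t - D) = h y - (\<Sum>j<D. C h (?i j) v * (l y ^ j * y 0 ^ (t - j)))" for y
    proof (rule form_eq_if_lattice[where n = n and t = t and p = "\<lambda>y. (\<Prod>j<D. l y - rt j * y 0) * y 0 ^ (t - D)"
          and q = "\<lambda>y. h y - (\<Sum>j<D. C h (?i j) v * (l y ^ j * y 0 ^ (t - j)))"])
      have "form n (sum (\<lambda>_. 1) {..<D} + (t - D)) (\<lambda>y. (\<Prod>j<D. l y - rt j * y 0) * y 0 ^ (t - D))"
        by (intro form_mult_var_power form_prod form_diff form_cmult form_sepf form_var1) simp_all
      then show "form n t (\<lambda>y. (\<Prod>j<D. l y - rt j * y 0) * y 0 ^ (t - D))" using t(1) by simp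
      have "form n t (\<lambda>y. l y ^ j * y 0 ^ (t - j))" if "j < D" for j
        using that t(1) by (intro form_lpow) simp
      then show "form n t (\<lambda>y. h y - (\<Sum>j<D. C h (?i j) v * (l y ^ j * y 0 ^ (t - j))))"
        by (intro form_diff fh form_sum form_cmult) simp
      show "(\<Prod>j<D. l (lattice_pt b) - rt j * lattice_pt b 0) * lattice_pt b 0 ^ (t - D) =
        h (lattice_pt b) - (\<Sum>j<D. C h (?i j) v * (l (lattice_pt b) ^ j * lattice_pt b 0 ^ (t - j)))" for b
        using rt(2)[of "l (lattice_pt b)"] by (simp add: h_def lattice_pt_def)
    qed
    obtain w where w: "\<And>i. i < D \<Longrightarrow> w i 0 = 1" "reduced_on n m (K v) (w ` {..<D})"
      "\<And>i. i < D \<Longrightarrow> w i \<notin> zeros_of (K v) \<or> l (w i) \<noteq> rt i \<Longrightarrow>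
      prods n (K v) (t + D - 2) (\<lambda>y. (\<Prod>j\<in>{..<D} - {i}. l y - rt j * y 0) * y 0 ^ (t - 1 + m))"
    proof (rule finite_reduced_scheme[where K = "K v" and l = l and rt = rt and D = D and n = n and m = m and t = t])
      show "form n m k" if "k \<in> K v" for k by (rule van_form[OF that])
      show "\<exists>c. prods n (K v) (t - m) (\<lambda>y. p y - (\<Sum>j<D. c j * (l y ^ j * y 0 ^ (t - j))))" if "form n t p" for p
        by (rule exI, rule span[OF that])
      show "prods n (K v) (t - m) (\<lambda>y. (\<Prod>j<D. l y - rt j * y 0) * y 0 ^ (t - D))"
        by (rule prods_eq[OF span[OF fh] heq])
      show "1 \<le> m" "m < t" "1 \<le> D" "D \<le> t" by (rule m t(3) D_pos t(1))+
      show "form n 1 l" by (rule form_sepf)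
      show "inj_on rt {..<D}" by (rule rt(1))
    qed (rule that)
    show ?case by (rule exI[of _ rt], rule exI[of _ w]) (use rt(1) w in simp)
  qed
qed

lemma box_idx: "n * m \<le> t \<Longrightarrow> box n m \<subseteq> simplex n t"
  by (rule box_subset_idx) (metis diff_le_self le_trans mult_le_mono2)

lemma near_good: "eventually (\<lambda>v. \<exists>W. card W \<le> D \<and> good n m m J (point v) W) (zariski_at I v0)"
proof -
  let ?t = "D + n * m + m + 1"
  have "D \<le> ?t" "box n m \<subseteq> simplex n ?t" "m < ?t" by (simp_all add: box_idx)
  from near_scheme[OF this] dual_near y0_near' show ?thesis
  proof eventually_elim
    case (elim v)
    obtain w :: "nat \<Rightarrow> nat \<Rightarrow> complex" where w: "reduced_on n m (K v) (w ` {..<D})" using elim(1) by blast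
    have "form n m (L i v)" if "i \<in> J" for i by (rule rfam_form[OF L[OF that]])
    then have "has_lagrange n m J (point v)" unfolding has_lagrange_def using elim(2) by (intro exI[of _ "\<lambda>i. L i v"]) simp
    moreover have "card (w ` {..<D}) \<le> D" using card_image_le[of "{..<D}" w] by simp
    ultimately show ?case unfolding good_def using w elim(3) by blast
  qed
qed

lemma gridf_K0: "grid_form m ` {1..n} \<subseteq> K v0"
proof (rule image_subsetI)
  fix i assume i: "i \<in> {1..n}"
  show "grid_form m i \<in> K v0" using F_van[OF eventually_zar_at[OF dual_near] i] F_at[OF i] by simp
qed

text \<open>The bound allows the grid to be interpolated in degree \<open>2 * m\<close>. So at
  \<open>v0\<close>, and then nearby, every form of large degree is a power of \<open>y 0\<close>
  times a form of degree \<open>2 * m\<close> modulo the ideal, and \<open>pindep_descent\<close>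
  applies.\<close>

lemma near_pindep:
  assumes nm: "n * (m - 1) \<le> 2 * m"
  shows "eventually (\<lambda>v. powers_indep n (2 * m) (zeros_of (K v))) (zariski_at I v0)"
proof -
  \<comment> \<open>At least \<open>D\<close>, hence large enough to separate all zeros by products
    of linear forms.\<close>
  define t where "t = D + n * m + 2 * m + 1"
  define Q where "Q v p \<longleftrightarrow> (\<exists>g. form n (2 * m) g \<and> prods n (K v) (t - m) (\<lambda>y. p y - y 0 ^ (t - 2 * m) * g y))" for v p
  have "eventually (\<lambda>v. \<forall>p. form n t p \<longrightarrow> Q v p) (zariski_at I v0)"
  proof (rule open_span)
    fix p assume p: "form n t p"
    obtain g where g: "form n (2 * m) g" "\<forall>a\<in>box n m. g (lattice_pt a) = p (lattice_pt a)"
      using lattice_interpolation[OF box_subset_idx[OF nm], of "\<lambda>a. p (lattice_pt a)"] by blast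
    have fg: "form n t (\<lambda>y. g y * y 0 ^ (t - 2 * m))"
    proof -
      have "2 * m + (t - 2 * m) = t" by (simp add: t_def)
      then show ?thesis using form_mult_var_power[OF g(1), of 0 "t - 2 * m"] by (simp only: le0)
    qed
    have "prods n (grid_form m ` {1..n}) (t - m) (\<lambda>y. p y - g y * y 0 ^ (t - 2 * m))"
      using g(2) by (intro grid_ideal form_diff p fg) (simp add: lattice_pt_def)
    from deform_prods[where L = L, OF L J prods_mono[OF this gridf_K0]]
    obtain P where P: "reg_family I v0 n (m + (t - m)) P" "P v0 = (\<lambda>y. p y - g y * y 0 ^ (t - 2 * m))"
      "\<And>v. dual J (\<lambda>i. L i v) (point v) \<Longrightarrow> prods n (K v) (t - m) (P v)" by blast
    let ?P = "\<lambda>v y. P v y + g y * y 0 ^ (t - 2 * m)"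
    have "m + (t - m) = t" by (simp add: t_def)
    then have "reg_family I v0 n t P" using P(1) by (simp only:)
    then have "reg_family I v0 n t ?P" by (intro rfam_add rfam_const fg)
    moreover have "?P v0 = p" by (simp add: P(2))
    moreover have "Q v (?P v)" if "dual J (\<lambda>i. L i v) (point v)" for v
      unfolding Q_def using P(3)[OF that] g(1) by (intro exI[of _ g]) (simp add: mult.commute)
    then have "eventually (\<lambda>v. Q v (?P v)) (zariski_at I v0)" by (rule eventually_mono[OF dual_near])
    ultimately show "\<exists>P. reg_family I v0 n t P \<and> P v0 = p \<and> eventually (\<lambda>v. Q v (P v)) (zariski_at I v0)" by blast
  next
    show "Q v (\<lambda>_. 0)" for v unfolding Q_def by (intro exI[of _ "\<lambda>_. 0"]) (simp add: prods.zero form_zero)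
  next
    fix v p q assume pq: "Q v p" "Q v q"
    obtain a where a: "form n (2 * m) a" "prods n (K v) (t - m) (\<lambda>y. p y - y 0 ^ (t - 2 * m) * a y)"
      using pq(1) unfolding Q_def by (elim exE conjE)
    obtain b where b: "form n (2 * m) b" "prods n (K v) (t - m) (\<lambda>y. q y - y 0 ^ (t - 2 * m) * b y)"
      using pq(2) unfolding Q_def by (elim exE conjE)
    show "Q v (\<lambda>y. p y + q y)" unfolding Q_def
      by (rule exI[of _ "\<lambda>y. a y + b y"], rule conjI[OF form.add[OF a(1) b(1)]], rule prods_eq[OF prods_add[OF a(2) b(2)]])
        (simp add: algebra_simps)
  next
    fix v c p assume pq: "Q v p"
    obtain a where a: "form n (2 * m) a" "prods n (K v) (t - m) (\<lambda>y. p y - y 0 ^ (t - 2 * m) * a y)"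
      using pq unfolding Q_def by (elim exE conjE)
    show "Q v (\<lambda>y. c * p y)" unfolding Q_def
      by (rule exI[of _ "\<lambda>y. c * a y"], rule conjI[OF form_cmult[OF a(1)]], rule prods_eq[OF prods_cmult[OF a(2), of c]])
        (simp add: algebra_simps)
  qed
  with near_good show ?thesis
  proof eventually_elim
    case (elim v)
    obtain W where W: "card W \<le> D" "reduced_on n m (K v) W" using elim(1) unfolding good_def by blast
    show ?case
    proof (rule pindep_descent[OF W(2), of t])
      show "card W \<le> t" using W(1) by (simp add: t_def)
      show "\<exists>g. form n (2 * m) g \<and> prods n (K v) (t - m) (\<lambda>y. p y - y 0 ^ (t - 2 * m) * g y)" if "form n t p" for p
        using elim(2) that unfolding Q_def by simp
    qed
  qed
qed

text \<open>None of the \<open>D\<close> zeros is lost near \<open>v0\<close>: there the ideal is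
  generated by the \<open>n\<close> deformed grid forms, and its part of degree \<open>T\<close>
  meets the span of the powers of \<open>l\<close> only in 0. So there are \<open>D\<close> rays of
  zeros, more than points.\<close>

lemma near_extra:
  assumes less: "card J < D"
  shows "eventually (\<lambda>v. \<exists>z\<in>zeros_of (K v). z 0 \<noteq> 0 \<and> (\<forall>j\<in>J. \<not> ray n (point v j) z)) (zariski_at I v0)"
proof -
  define t where "t = D + n * m + m + 1"
  \<comment> \<open>The degree of the form that \<open>near_scheme\<close> puts into the ideal if a
    candidate is not a zero.\<close>
  define T where "T = t + m + D - 2"
  have t: "D \<le> t" "box n m \<subseteq> simplex n t" "m < t" by (simp_all add: t_def box_idx)
  have T: "D \<le> T" "n * m \<le> T" "T - m + m = T" "T - m = t + D - 2" "D - 1 + (t - 1 + m) = T"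
    using m D_pos by (simp_all add: T_def t_def)
  have boxT: "box n m \<subseteq> simplex n T" by (rule box_idx[OF T(2)])
  obtain B where "\<And>x a. x \<in> simplex n T \<Longrightarrow> a \<in> simplex n T \<Longrightarrow> reg I v0 (B x a)"
    and near: "eventually (\<lambda>v. (\<forall>p. form n T p \<longrightarrow>
        (\<forall>y. p y = (\<Sum>x\<in>simplex n T. (\<Sum>a\<in>simplex n T. B x a v * p (lattice_pt a)) * adapted_basis T x v y))) \<and>
      (\<forall>c. (\<forall>y. (\<Sum>x\<in>simplex n T. c x * adapted_basis T x v y) = 0) \<longrightarrow> (\<forall>x\<in>simplex n T. c x = 0))) (zariski_at I v0)"
    by (rule near_basis[OF T(1) boxT]) (rule that)
  obtain B' where "\<And>x a. x \<in> simplex n (T - m) \<Longrightarrow> a \<in> simplex n (T - m) \<Longrightarrow> reg I v0 (B' x a)"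
    and near': "eventually (\<lambda>v. (\<forall>p. form n (T - m) p \<longrightarrow>
        (\<forall>y. p y = (\<Sum>x\<in>simplex n (T - m). (\<Sum>a\<in>simplex n (T - m). B' x a v * p (lattice_pt a)) * deformed_newton (T - m) x v y))) \<and>
      (\<forall>c. (\<forall>y. (\<Sum>x\<in>simplex n (T - m). c x * deformed_newton (T - m) x v y) = 0) \<longrightarrow> (\<forall>x\<in>simplex n (T - m). c x = 0))) (zariski_at I v0)"
  proof (rule span_near[where l = "deformed_newton (T - m)" and n = n and t = "T - m" and I = I and ?v0.0 = v0])
    show "reg_family I v0 n (T - m) (deformed_newton (T - m) x)" if "x \<in> simplex n (T - m)" for x by (rule rfam_gf[OF that])
    show "\<exists>c. \<forall>y. p y = (\<Sum>x\<in>simplex n (T - m). c x * deformed_newton (T - m) x v0 y)" if "form n (T - m) p" for p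
      unfolding gf_at by (rule newt_span[OF that])
  qed (rule that)
  \<comment> \<open>Near \<open>v0\<close> the Lagrange forms and the deformed grid forms together
    span all forms of degree \<open>m\<close>; this identifies the vanishing space in
    \<open>KF\<close>.\<close>
  define Q where "Q v p \<longleftrightarrow> (\<exists>a c. \<forall>y. p y = (\<Sum>j\<in>J. a j * L j v y) + (\<Sum>i\<in>{1..n}. c i * F i v y))" for v p
  have "eventually (\<lambda>v. \<forall>p. form n m p \<longrightarrow> Q v p) (zariski_at I v0)"
  proof (rule open_span)
    fix p assume p: "form n m p"
    have d0: "dual J (\<lambda>i. L i v0) (point v0)" by (rule eventually_zar_at[OF dual_near])
    let ?q = "\<lambda>y. p y - (\<Sum>j\<in>J. p (point v0 j) * L j v0 y)"
    have fq: "form n m ?q" using L by (intro form_diff p form_sum form_cmult rfam_form[where I = I and ?v0.0 = v0 and v = v0]) blast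
    have "?q (lattice_pt a) = 0" if a: "a \<in> box n m \<inter> simplex n m" for a
    proof -
      have "a \<in> e ` J" using e a by (simp only: bij_betw_def)
      then obtain j where j: "j \<in> J" "e j = a" by blast
      show ?thesis using sum_dual[OF d0 j(1) J, of "\<lambda>j. p (point v0 j)"] x[OF j(1)] j(2) by simp
    qed
    from grid_expansion[OF fq this] obtain d where
      d: "\<And>y. ?q y = (\<Sum>b\<in>simplex n m - box n m. d b * newton n (\<lambda>j. j mod m) m b y)" by blast
    have "\<exists>c. \<forall>y. (\<Sum>b\<in>simplex n m - box n m. d b * newton n (\<lambda>j. j mod m) m b y) = (\<Sum>i\<in>{1..n}. c i * grid_form m i y)"
    proof -
      have "\<forall>b\<in>simplex n m - box n m. \<exists>i. i \<in> {1..n} \<and> (\<forall>y. newton n (\<lambda>j. j mod m) m b y = grid_form m i y)"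
      proof
        fix b assume b: "b \<in> simplex n m - box n m"
        then obtain i where i: "i \<in> {1..n}" "m \<le> b i" by (auto simp: simplex_def box_def not_less)
        have b1: "b \<in> simplex n m" using b by blast
        have z: "b(i := b i - m) = (\<lambda>_. 0)" using newt_outside_box(2)[OF b1 i] idx_trivial[of n 0] by simp
        have "newton n (\<lambda>j. j mod m) m b y = grid_form m i y" for y
          unfolding newt_outside_box(1)[OF b1 i] z by (simp add: newton_def)
        then show "\<exists>i. i \<in> {1..n} \<and> (\<forall>y. newton n (\<lambda>j. j mod m) m b y = grid_form m i y)" using i(1) by blast
      qed
      from bchoice[OF this] obtain f where f: "\<forall>b\<in>simplex n m - box n m. f b \<in> {1..n} \<and> (\<forall>y. newton n (\<lambda>j. j mod m) m b y = grid_form m (f b) y)" ..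
      have "(\<Sum>b\<in>simplex n m - box n m. d b * newton n (\<lambda>j. j mod m) m b y) =
        (\<Sum>i\<in>{1..n}. (\<Sum>b\<in>{b \<in> simplex n m - box n m. f b = i}. d b) * grid_form m i y)" for y
      proof -
        have "(\<Sum>b\<in>simplex n m - box n m. d b * newton n (\<lambda>j. j mod m) m b y) = (\<Sum>b\<in>simplex n m - box n m. d b * grid_form m (f b) y)"
          using f by (intro sum.cong) simp_all
        also have "\<dots> = (\<Sum>i\<in>{1..n}. \<Sum>b\<in>{b \<in> simplex n m - box n m. f b = i}. d b * grid_form m (f b) y)"
          using f finite_idx by (intro sum.group[symmetric]) auto
        also have "\<dots> = (\<Sum>i\<in>{1..n}. (\<Sum>b\<in>{b \<in> simplex n m - box n m. f b = i}. d b) * grid_form m i y)"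
          unfolding sum_distrib_right by (intro sum.cong) auto
        finally show ?thesis .
      qed
      then show ?thesis by (intro exI allI)
    qed
    then obtain c where c: "\<And>y. ?q y = (\<Sum>i\<in>{1..n}. c i * grid_form m i y)" unfolding d[symmetric] by blast
    define P where "P v y = (\<Sum>j\<in>J. p (point v0 j) * L j v y) + (\<Sum>i\<in>{1..n}. c i * F i v y)" for v y
    have "reg_family I v0 n m P" unfolding P_def[abs_def] by (intro rfam_add rfam_sum rfam_scale reg_const L rfam_F)
    moreover have "P v0 = p"
    proof
      fix y
      have "(\<Sum>i\<in>{1..n}. c i * F i v0 y) = (\<Sum>i\<in>{1..n}. c i * grid_form m i y)"
        by (intro sum.cong) (simp_all add: F_at)
      then have "P v0 y = (\<Sum>j\<in>J. p (point v0 j) * L j v0 y) + ?q y" unfolding P_def c by simp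
      then show "P v0 y = p y" by simp
    qed
    moreover have "Q v (P v)" for v unfolding Q_def P_def
      by (rule exI[of _ "\<lambda>j. p (point v0 j)"], rule exI[of _ c]) simp
    ultimately show "\<exists>P. reg_family I v0 n m P \<and> P v0 = p \<and> eventually (\<lambda>v. Q v (P v)) (zariski_at I v0)" by auto
  next
    show "Q v (\<lambda>_. 0)" for v unfolding Q_def by (intro exI[of _ "\<lambda>_. 0"]) simp
  next
    fix v p q assume pq: "Q v p" "Q v q"
    obtain a c where a: "\<forall>y. p y = (\<Sum>j\<in>J. a j * L j v y) + (\<Sum>i\<in>{1..n}. c i * F i v y)"
      using pq(1) unfolding Q_def by (elim exE)
    obtain a' c' where a': "\<forall>y. q y = (\<Sum>j\<in>J. a' j * L j v y) + (\<Sum>i\<in>{1..n}. c' i * F i v y)"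
      using pq(2) unfolding Q_def by (elim exE)
    show "Q v (\<lambda>y. p y + q y)" unfolding Q_def
      by (rule exI[of _ "\<lambda>j. a j + a' j"], rule exI[of _ "\<lambda>j. c j + c' j"])
        (simp add: a a' distrib_right sum.distrib)
  next
    fix v b p assume pq: "Q v p"
    obtain a c where a: "\<forall>y. p y = (\<Sum>j\<in>J. a j * L j v y) + (\<Sum>i\<in>{1..n}. c i * F i v y)"
      using pq unfolding Q_def by (elim exE)
    show "Q v (\<lambda>y. b * p y)" unfolding Q_def
      by (rule exI[of _ "\<lambda>j. b * a j"], rule exI[of _ "\<lambda>j. b * c j"])
        (simp add: a distrib_left sum_distrib_left mult.assoc)
  qed
  with near_scheme[OF t] near near' dual_near y0_near' show ?thesis
  proof eventually_elim
    case (elim v)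
    note d = elim(4)
    obtain rt w where rt: "inj_on rt {..<D}" and w: "\<And>i. i < D \<Longrightarrow> w i 0 = 1"
      "\<And>i. i < D \<Longrightarrow> w i \<notin> zeros_of (K v) \<or> l (w i) \<noteq> rt i \<Longrightarrow>
      prods n (K v) (t + D - 2) (\<lambda>y. (\<Prod>j\<in>{..<D} - {i}. l y - rt j * y 0) * y 0 ^ (t - 1 + m))"
      using elim(1) by blast
    \<comment> \<open>Evaluation at the points kills the Lagrange part, so the deformed grid forms
      alone span the vanishing space.\<close>
    have KF: "\<exists>c. \<forall>y. k y = (\<Sum>i\<in>{1..n}. c i * F i v y)" if k: "k \<in> K v" for k
    proof -
      have "Q v k" using elim(6) van_form[OF k] by blast
      then obtain a c where a: "\<forall>y. k y = (\<Sum>j\<in>J. a j * L j v y) + (\<Sum>i\<in>{1..n}. c i * F i v y)"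
        unfolding Q_def by (elim exE)
      have "a j = 0" if j: "j \<in> J" for j
      proof -
        have "(\<Sum>i\<in>{1..n}. c i * F i v (point v j)) = 0"
          using van_zero[OF F_van[OF d] j] by (intro sum.neutral) simp
        then show ?thesis using a[rule_format, of "point v j"] van_zero[OF k j] sum_dual[OF d j J, of a] by simp
      qed
      then show ?thesis using a by (intro exI[of _ c]) simp
    qed
    \<comment> \<open>The span of the adapted basis outside the box. It contains the ideal in degree
      \<open>T\<close>, because \<open>F i\<close> times a deformed Newton element is again one,
      with \<open>b i\<close> raised by \<open>m\<close>.\<close>
    define sp where "sp p \<longleftrightarrow> (\<exists>c. \<forall>y. p y = (\<Sum>b\<in>simplex n T - box n m. c b * deformed_newton T b v y))" for p
    have sp0: "sp (\<lambda>y. 0)" unfolding sp_def by (rule exI[of _ "\<lambda>_. 0"]) simp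
    have sp_add: "sp (\<lambda>y. p y + q y)" if pq: "sp p" "sp q" for p q
    proof -
      obtain a where a: "\<forall>y. p y = (\<Sum>b\<in>simplex n T - box n m. a b * deformed_newton T b v y)" using pq(1) unfolding sp_def ..
      obtain c where c: "\<forall>y. q y = (\<Sum>b\<in>simplex n T - box n m. c b * deformed_newton T b v y)" using pq(2) unfolding sp_def ..
      show ?thesis unfolding sp_def
        by (rule exI[of _ "\<lambda>b. a b + c b"]) (simp add: a c distrib_right sum.distrib)
    qed
    have sp_cmult: "sp (\<lambda>y. r * p y)" if p: "sp p" for p r
    proof -
      obtain a where a: "\<forall>y. p y = (\<Sum>b\<in>simplex n T - box n m. a b * deformed_newton T b v y)" using p unfolding sp_def ..
      show ?thesis unfolding sp_def
        by (rule exI[of _ "\<lambda>b. r * a b"]) (simp add: a sum_distrib_left mult.assoc)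
    qed
    have sp_gf: "sp (deformed_newton T b v)" if "b \<in> simplex n T - box n m" for b
      unfolding sp_def
      by (rule exI[of _ "\<lambda>b'. if b' = b then 1 else 0"])
        (use that finite_idx[of n T] in \<open>simp add: if_distrib[of "\<lambda>c. c * _"] cong: if_cong\<close>)
    have sp_sum: "sp (\<lambda>y. \<Sum>i\<in>S. f i y)" if "finite S" "\<And>i. i \<in> S \<Longrightarrow> sp (f i)" for S :: "'s set" and f
      using that by (induction S rule: finite_induct) (simp_all add: sp0 sp_add)
    have sp_prods: "sp p" if "prods n (K v) (T - m) p" for p
      using that
    proof (induction "T - m" p rule: prods.induct)
      case zero
      show ?case by (rule sp0)
    next
      case (step k q p)
      obtain c where c: "\<And>y. k y = (\<Sum>i\<in>{1..n}. c i * F i v y)" using KF[OF step.hyps(1)] by blast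
      define b where "b x = (\<Sum>a\<in>simplex n (T - m). B' x a v * q (lattice_pt a))" for x
      have b: "q y = (\<Sum>x\<in>simplex n (T - m). b x * deformed_newton (T - m) x v y)" for y
        using elim(3) step.hyps(2) unfolding b_def by blast
      have "sp (\<lambda>y. F i v y * deformed_newton (T - m) x v y)" if "i \<in> {1..n}" "x \<in> simplex n (T - m)" for i x
      proof -
        have g: "(\<lambda>y. F i v y * deformed_newton (T - m) x v y) = deformed_newton T (x(i := x i + m)) v"
          using gf_step(1)[OF that(2,1), of v] T(3) by (simp add: fun_eq_iff)
        show ?thesis unfolding g using gf_step(2,3)[OF that(2,1)] T(3) by (intro sp_gf) simp
      qed
      then have "sp (\<lambda>y. \<Sum>i\<in>{1..n}. \<Sum>x\<in>simplex n (T - m). (c i * b x) * (F i v y * deformed_newton (T - m) x v y))"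
        by (intro sp_sum finite_idx finite_atLeastAtMost sp_cmult)
      moreover have "(\<lambda>y. \<Sum>i\<in>{1..n}. \<Sum>x\<in>simplex n (T - m). (c i * b x) * (F i v y * deformed_newton (T - m) x v y)) = (\<lambda>y. k y * q y)"
        unfolding c b sum_product by (simp add: mult_ac)
      ultimately show ?case using sp_add[OF _ step.hyps(4)] by simp
    qed
    \<comment> \<open>Otherwise the product of \<open>D - 1\<close> factors
      \<open>l - rt j * y 0\<close>, times a power of \<open>y 0\<close>, would lie both in
      \<open>sp\<close> and in the span of the basis elements inside the box.\<close>
    have wz: "w i \<in> zeros_of (K v) \<and> l (w i) = rt i" if i: "i < D" for i
    proof (rule ccontr)
      assume "\<not> (w i \<in> zeros_of (K v) \<and> l (w i) = rt i)"
      then have "prods n (K v) (T - m) (\<lambda>y. (\<Prod>j\<in>{..<D} - {i}. l y - rt j * y 0) * y 0 ^ (t - 1 + m))"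
        using w(2)[OF i] unfolding T(4) by blast
      from sp_prods[OF this] obtain c where c: "\<forall>y. (\<Prod>j\<in>{..<D} - {i}. l y - rt j * y 0) * y 0 ^ (t - 1 + m) =
        (\<Sum>b\<in>simplex n T - box n m. c b * deformed_newton T b v y)" unfolding sp_def ..
      define P where "P = (\<Prod>j\<in>{..<D} - {i}. [:- rt j, 1:])"
      have dP: "degree P = D - 1" unfolding P_def using i by (subst degree_prod_eq_sum_degree) simp_all
      have P0: "P \<noteq> 0" unfolding P_def by simp
      have "(\<Prod>j\<in>{..<D} - {i}. l y - rt j * y 0) * y 0 ^ (t - 1 + m) =
        (\<Sum>j<D. poly.coeff P j * (l y ^ j * y 0 ^ (T - j)))" for y
      proof (rule form_eq_if_lattice[where n = n and t = T and p = "\<lambda>y. (\<Prod>j\<in>{..<D} - {i}. l y - rt j * y 0) * y 0 ^ (t - 1 + m)"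
            and q = "\<lambda>y. \<Sum>j<D. poly.coeff P j * (l y ^ j * y 0 ^ (T - j))"])
        have "form n (sum (\<lambda>_. 1) ({..<D} - {i}) + (t - 1 + m)) (\<lambda>y. (\<Prod>j\<in>{..<D} - {i}. l y - rt j * y 0) * y 0 ^ (t - 1 + m))"
          by (intro form_mult_var_power form_prod form_diff form_cmult form_sepf form_var1) simp_all
        moreover have "sum (\<lambda>_. 1) ({..<D} - {i}) + (t - 1 + m) = T" using i T(5) by simp
        ultimately show "form n T (\<lambda>y. (\<Prod>j\<in>{..<D} - {i}. l y - rt j * y 0) * y 0 ^ (t - 1 + m))" by simp
        have "form n T (\<lambda>y. l y ^ j * y 0 ^ (T - j))" if "j < D" for j using that T(1) by (intro form_lpow) simp
        then show "form n T (\<lambda>y. \<Sum>j<D. poly.coeff P j * (l y ^ j * y 0 ^ (T - j)))" by (intro form_sum form_cmult) simp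
        fix b
        have lat0: "lattice_pt b 0 = 1" by (simp add: lattice_pt_def)
        have "{..D - 1} = {..<D}" using D_pos by auto
        then have "poly P (l (lattice_pt b)) = (\<Sum>j<D. poly.coeff P j * l (lattice_pt b) ^ j)" by (simp add: poly_altdef dP)
        moreover have "poly P (l (lattice_pt b)) = (\<Prod>j\<in>{..<D} - {i}. l (lattice_pt b) - rt j)" by (simp add: P_def poly_prod)
        ultimately show "(\<Prod>j\<in>{..<D} - {i}. l (lattice_pt b) - rt j * lattice_pt b 0) * lattice_pt b 0 ^ (t - 1 + m) =
          (\<Sum>j<D. poly.coeff P j * (l (lattice_pt b) ^ j * lattice_pt b 0 ^ (T - j)))" by (simp add: lat0)
      qed
      then have eq: "(\<Sum>j<D. poly.coeff P j * (l y ^ j * y 0 ^ (T - j))) = (\<Sum>b\<in>simplex n T - box n m. c b * deformed_newton T b v y)" for y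
        using c by simp
      define C where "C x = (if x \<in> box n m then poly.coeff P (\<beta> x) else - c x)" for x
      have "(\<Sum>x\<in>simplex n T. C x * adapted_basis T x v y) = 0" for y
      proof -
        have "(\<Sum>j<D. C (inv_into (box n m) \<beta> j) * (l y ^ j * y 0 ^ (T - j))) = (\<Sum>j<D. poly.coeff P j * (l y ^ j * y 0 ^ (T - j)))"
          using beta inv_into_into[of _ \<beta> "box n m"] f_inv_into_f[of _ \<beta> "box n m"]
          by (intro sum.cong) (auto simp: C_def bij_betw_def)
        moreover have "(\<Sum>x\<in>simplex n T - box n m. C x * deformed_newton T x v y) = - (\<Sum>x\<in>simplex n T - box n m. c x * deformed_newton T x v y)"
          unfolding sum_negf[symmetric] by (intro sum.cong) (simp_all add: C_def)
        ultimately show ?thesis unfolding ell_split[OF boxT] by (simp add: eq)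
      qed
      then have C0: "\<forall>x\<in>simplex n T. C x = 0" using elim(2) by blast
      \<comment> \<open>The basis element with number \<open>D - 1\<close> receives the leading
        coefficient of \<open>P\<close>, which is nonzero.\<close>
      have "D - 1 < D" using D_pos by simp
      then obtain x where x: "x \<in> box n m" "\<beta> x = D - 1" using beta unfolding bij_betw_def by (metis imageE lessThan_iff)
      have "C x = lead_coeff P" using x by (simp add: C_def dP)
      then show False using C0 x boxT P0 by auto
    qed
    show ?case
    proof (rule ccontr)
      assume neg: "\<not> (\<exists>z\<in>zeros_of (K v). z 0 \<noteq> 0 \<and> (\<forall>j\<in>J. \<not> ray n (point v j) z))"
      have "\<forall>i\<in>{..<D}. \<exists>j. j \<in> J \<and> ray n (point v j) (w i)"
      proof
        fix i assume "i \<in> {..<D}"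
        then have "w i \<in> zeros_of (K v)" "w i 0 \<noteq> 0" using wz w(1) by simp_all
        then show "\<exists>j. j \<in> J \<and> ray n (point v j) (w i)" using neg by blast
      qed
      from bchoice[OF this] obtain f where f: "\<And>i. i < D \<Longrightarrow> f i \<in> J" "\<And>i. i < D \<Longrightarrow> ray n (point v (f i)) (w i)" by auto
      have "inj_on f {..<D}"
      proof (rule inj_onI)
        fix i i' assume i: "i \<in> {..<D}" "i' \<in> {..<D}" "f i = f i'"
        obtain a where a: "\<forall>k\<le>n. w i k = a * point v (f i) k" using f(2)[of i] i unfolding ray_def by auto
        obtain a' where a': "\<forall>k\<le>n. w i' k = a' * point v (f i) k" using f(2)[of i'] i unfolding ray_def by auto
        have "a * point v (f i) 0 = 1" "a' * point v (f i) 0 = 1" using a a' w(1) i by auto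
        then have "a = a'" by (metis mult_cancel_right zero_neq_one mult_zero_right)
        then have "l (w i) = l (w i')" using a a' by (intro form_cong[OF form_sepf]) simp
        then show "i = i'" using wz i rt by (auto simp: inj_on_def)
      qed
      then have "card {..<D} \<le> card J" using f(1) J by (intro card_inj_on_le) auto
      then show False using less by simp
    qed
  qed
qed

end

section \<open>Polynomials and polynomial functions\<close>

declare One_nat_def [simp del]

abbreviation lookup where "lookup \<equiv> Poly_Mapping.lookup"
abbreviation keys where "keys \<equiv> Poly_Mapping.keys"
abbreviation single where "single \<equiv> Poly_Mapping.single"

definition mon :: "('i \<Rightarrow>\<^sub>0 nat) \<Rightarrow> ('i \<Rightarrow> complex) \<Rightarrow> complex" where
  "mon \<alpha> x = (\<Prod>i\<in>keys \<alpha>. x i ^ lookup \<alpha> i)"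

definition multifact :: "('i \<Rightarrow>\<^sub>0 nat) \<Rightarrow> complex" where
  "multifact \<alpha> = (\<Prod>i\<in>keys \<alpha>. fact (lookup \<alpha> i))"

lemma lookup_notin: "i \<notin> keys \<alpha> \<Longrightarrow> lookup \<alpha> i = 0"
  by (simp add: in_keys_iff)

lemma mon_superset: "finite A \<Longrightarrow> keys \<alpha> \<subseteq> A \<Longrightarrow> mon \<alpha> x = (\<Prod>i\<in>A. x i ^ lookup \<alpha> i)"
  unfolding mon_def by (rule prod.mono_neutral_left) (auto simp: lookup_notin)

lemma factp_superset: "finite A \<Longrightarrow> keys \<alpha> \<subseteq> A \<Longrightarrow> multifact \<alpha> = (\<Prod>i\<in>A. fact (lookup \<alpha> i))"
  unfolding multifact_def by (rule prod.mono_neutral_left) (auto simp: lookup_notin)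

lemma mono_degree_superset: "finite A \<Longrightarrow> keys \<alpha> \<subseteq> A \<Longrightarrow> mono_degree \<alpha> = (\<Sum>i\<in>A. lookup \<alpha> i)"
  unfolding mono_degree_def by (rule sum.mono_neutral_left) (auto simp: lookup_notin)

lemma factp_nonzero: "multifact \<alpha> \<noteq> 0"
  unfolding multifact_def by simp

lemma mon_add: "mon (\<alpha> + \<beta>) x = mon \<alpha> x * mon \<beta> x"
proof -
  let ?A = "keys \<alpha> \<union> keys \<beta>"
  have A: "finite ?A" "keys \<alpha> \<subseteq> ?A" "keys \<beta> \<subseteq> ?A" "keys (\<alpha> + \<beta>) \<subseteq> ?A"
    using keys_add[of \<alpha> \<beta>] by auto
  show ?thesis
    unfolding mon_superset[OF A(1,2)] mon_superset[OF A(1,3)] mon_superset[OF A(1,4)]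
    by (simp add: lookup_add power_add prod.distrib)
qed

lemma mono_degree_add: "mono_degree (\<alpha> + \<beta>) = mono_degree \<alpha> + mono_degree \<beta>"
proof -
  let ?A = "keys \<alpha> \<union> keys \<beta>"
  have A: "finite ?A" "keys \<alpha> \<subseteq> ?A" "keys \<beta> \<subseteq> ?A" "keys (\<alpha> + \<beta>) \<subseteq> ?A"
    using keys_add[of \<alpha> \<beta>] by auto
  show ?thesis
    unfolding mono_degree_superset[OF A(1,2)] mono_degree_superset[OF A(1,3)] mono_degree_superset[OF A(1,4)]
    by (simp add: lookup_add sum.distrib)
qed

lemma mon_zero [simp]: "mon 0 x = 1"
  by (simp add: mon_def)

lemma mon_single [simp]: "mon (single i k) x = x i ^ k"
  by (cases "k = 0") (simp_all add: mon_def)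

lemma mono_degree_single [simp]: "mono_degree (single i k) = k"
  by (cases "k = 0") (simp_all add: mono_degree_def)

lemma mono_degree_zero [simp]: "mono_degree 0 = 0"
  by (simp add: mono_degree_def)

lemma mono_degree_eq_0: "mono_degree \<alpha> = 0 \<longleftrightarrow> \<alpha> = 0"
proof
  assume "mono_degree \<alpha> = 0"
  then have "\<forall>i\<in>keys \<alpha>. lookup \<alpha> i = 0" by (simp add: mono_degree_def)
  then show "\<alpha> = 0" by (intro poly_mapping_eqI) (metis in_keys_iff lookup_zero)
qed simp

lemma single_unit_eq [simp]: "single i (1::nat) = single j 1 \<longleftrightarrow> i = j"
proof
  assume "single i (1::nat) = single j 1"
  then have "lookup (single i (1::nat)) i = lookup (single j 1) i" by simp
  then show "i = j" by (simp add: lookup_single when_def split: if_splits)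
qed simp

lemma unit_decomp: "lookup \<alpha> i \<noteq> 0 \<Longrightarrow> single i 1 + (\<alpha> - single i 1) = (\<alpha> :: 'i \<Rightarrow>\<^sub>0 nat)"
  by (rule poly_mapping_eqI) (auto simp: lookup_add lookup_minus lookup_single when_def)

lemma unit_add_eq: "single i (1::nat) + \<gamma> = \<alpha> \<longleftrightarrow> lookup \<alpha> i \<noteq> 0 \<and> \<gamma> = \<alpha> - single i 1"
proof
  assume "single i 1 + \<gamma> = \<alpha>"
  then show "lookup \<alpha> i \<noteq> 0 \<and> \<gamma> = \<alpha> - single i 1" by (auto simp: lookup_add)
qed (use unit_decomp in auto)

lemma mono_degree_1: "mono_degree \<alpha> = 1 \<Longrightarrow> \<exists>i\<in>keys \<alpha>. \<alpha> = single i 1"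
proof -
  assume d: "mono_degree \<alpha> = 1"
  then have "keys \<alpha> \<noteq> {}" by (auto simp: mono_degree_def)
  then obtain i where i: "i \<in> keys \<alpha>" by blast
  then have \<alpha>: "single i 1 + (\<alpha> - single i 1) = \<alpha>" by (intro unit_decomp) (simp add: in_keys_iff)
  then have "mono_degree (\<alpha> - single i 1) = 0" using d mono_degree_add[of "single i 1" "\<alpha> - single i 1"] by simp
  then have "\<alpha> - single i 1 = 0" by (simp only: mono_degree_eq_0)
  then show ?thesis using \<alpha> i by (metis add.right_neutral)
qed

lemma factp_unit_add: "multifact (single i 1 + \<gamma>) = of_nat (Suc (lookup \<gamma> i)) * multifact \<gamma>"
proof -
  let ?A = "insert i (keys \<gamma>)"
  have A: "finite ?A" "keys \<gamma> \<subseteq> ?A" "keys (single i 1 + \<gamma>) \<subseteq> ?A"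
    using keys_add[of "single i 1" \<gamma>] by auto
  have i: "i \<in> ?A" by simp
  have eq: "(\<Prod>j\<in>?A - {i}. fact (lookup (single i 1 + \<gamma>) j)) = (\<Prod>j\<in>?A - {i}. fact (lookup \<gamma> j) :: complex)"
    by (intro prod.cong) (auto simp: lookup_add lookup_single)
  show ?thesis
    unfolding factp_superset[OF A(1,2)] factp_superset[OF A(1,3)] prod.remove[OF A(1) i] eq
    by (simp add: lookup_add fact_Suc[unfolded Suc_eq_plus1_left])
qed

lemma poly_eval_superset: "finite A \<Longrightarrow> keys p \<subseteq> A \<Longrightarrow> poly_eval p x = (\<Sum>\<alpha>\<in>A. lookup p \<alpha> * mon \<alpha> x)"
  unfolding poly_eval_def mon_def[symmetric] by (rule sum.mono_neutral_left) (auto simp: lookup_notin)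

lemma poly_eval_add: "poly_eval (p + q) x = poly_eval p x + poly_eval q x"
proof -
  let ?A = "keys p \<union> keys q"
  have A: "finite ?A" "keys p \<subseteq> ?A" "keys q \<subseteq> ?A" "keys (p + q) \<subseteq> ?A"
    using keys_add[of p q] by auto
  show ?thesis
    unfolding poly_eval_superset[OF A(1,2)] poly_eval_superset[OF A(1,3)] poly_eval_superset[OF A(1,4)]
    by (simp add: lookup_add distrib_right sum.distrib)
qed

lemma poly_eval_zero [simp]: "poly_eval 0 x = 0"
  by (simp add: poly_eval_def)

lemma poly_eval_single [simp]: "poly_eval (single \<alpha> c) x = c * mon \<alpha> x"
  by (cases "c = 0") (simp_all add: poly_eval_def mon_def)

lemma poly_eval_sum: "poly_eval (\<Sum>a\<in>S. p a) x = (\<Sum>a\<in>S. poly_eval (p a) x)"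
  by (induction S rule: infinite_finite_induct) (simp_all add: poly_eval_add)

lemma poly_mapping_expand: "p = (\<Sum>\<alpha>\<in>keys p. single \<alpha> (lookup p \<alpha>))"
proof (rule poly_mapping_eqI)
  fix \<beta>
  have "lookup (\<Sum>\<alpha>\<in>keys p. single \<alpha> (lookup p \<alpha>)) \<beta> = (\<Sum>\<alpha>\<in>keys p. if \<alpha> = \<beta> then lookup p \<beta> else 0)"
    unfolding lookup_sum by (intro sum.cong) (auto simp: lookup_single when_def)
  then show "lookup p \<beta> = lookup (\<Sum>\<alpha>\<in>keys p. single \<alpha> (lookup p \<alpha>)) \<beta>" by (simp add: lookup_notin)
qed

lemma single_mult_expand:
  fixes q :: "('i \<Rightarrow>\<^sub>0 nat) \<Rightarrow>\<^sub>0 complex"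
  shows "single \<beta> c * q = (\<Sum>\<gamma>\<in>keys q. single (\<beta> + \<gamma>) (c * lookup q \<gamma>))"
  by (subst (1) poly_mapping_expand[of q]) (simp add: sum_distrib_left mult_single)

lemma poly_eval_single_mult: "poly_eval (single \<beta> c * q) x = c * mon \<beta> x * poly_eval q x"
  unfolding single_mult_expand poly_eval_sum
  by (simp add: mon_add poly_eval_def[of q] mon_def[symmetric] sum_distrib_left mult_ac)

lemma poly_eval_mult: "poly_eval (p * q) x = poly_eval p x * poly_eval q x"
proof -
  have "poly_eval (p * q) x = poly_eval ((\<Sum>\<alpha>\<in>keys p. single \<alpha> (lookup p \<alpha>)) * q) x"
    using poly_mapping_expand[of p] by simp
  also have "\<dots> = (\<Sum>\<alpha>\<in>keys p. lookup p \<alpha> * mon \<alpha> x * poly_eval q x)"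
    by (simp add: sum_distrib_right poly_eval_sum poly_eval_single_mult)
  finally show ?thesis by (simp add: poly_eval_def[of p] mon_def[symmetric] sum_distrib_right)
qed

lemma poly_eval_cscale: "poly_eval (cscale c p) x = c * poly_eval p x"
  unfolding cscale_def poly_eval_single_mult by simp

lemma poly_eval_one [simp]: "poly_eval 1 x = 1"
  using poly_eval_single[of 0 1 x] by simp

lemma poly_eval_power: "poly_eval (p ^ e) x = poly_eval p x ^ e"
  by (induction e) (simp_all add: poly_eval_mult)

lemma lookup_cscale [simp]: "lookup (cscale c p) \<alpha> = c * lookup p \<alpha>"
proof -
  have "lookup (cscale c p) \<alpha> = (\<Sum>\<gamma>\<in>keys p. if \<gamma> = \<alpha> then c * lookup p \<alpha> else 0)"
    unfolding cscale_def single_mult_expand lookup_sum by (intro sum.cong) (auto simp: lookup_single when_def)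
  then show ?thesis by (simp add: lookup_notin)
qed

lemma pol_cpoly:
  assumes "pol I P"
  shows "\<exists>p :: 'i cpoly. \<forall>x. poly_eval p x = P x"
  using assms
proof (induction rule: pol_induct)
  case (const c)
  show ?case by (rule exI[of _ "single 0 c"]) simp
next
  case (var i P)
  then obtain p where "\<forall>x. poly_eval p x = P x" by blast
  then show ?case by (intro exI[of _ "single (single i 1) 1 * p"]) (simp add: poly_eval_single_mult)
next
  case (add P Q)
  then obtain p q where "\<forall>x. poly_eval p x = P x" "\<forall>x. poly_eval q x = Q x" by blast
  then show ?case by (intro exI[of _ "p + q"]) (simp add: poly_eval_add)
qed

lemma polysI: "(\<And>\<alpha>. \<alpha> \<in> keys p \<Longrightarrow> keys \<alpha> \<subseteq> {0..n}) \<Longrightarrow> p \<in> polys n"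
  unfolding polys_def by blast

lemma formsI: "(\<And>\<alpha>. \<alpha> \<in> keys p \<Longrightarrow> keys \<alpha> \<subseteq> {0..n} \<and> mono_degree \<alpha> = d) \<Longrightarrow> p \<in> forms n d"
  unfolding forms_def polys_def by blast

lemma formsD: "p \<in> forms n d \<Longrightarrow> \<alpha> \<in> keys p \<Longrightarrow> keys \<alpha> \<subseteq> {0..n} \<and> mono_degree \<alpha> = d"
  unfolding forms_def polys_def by blast

lemma forms_polys: "p \<in> forms n d \<Longrightarrow> p \<in> polys n"
  unfolding forms_def by blast

lemma keys_add_subset: "keys (\<alpha> + \<beta>) \<subseteq> A" if "keys \<alpha> \<subseteq> A" "keys \<beta> \<subseteq> A"
  using keys_add[of \<alpha> \<beta>] that by blast

lemma polys_zero: "0 \<in> polys n"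
  by (rule polysI) simp

lemma polys_add: "p \<in> polys n \<Longrightarrow> q \<in> polys n \<Longrightarrow> p + q \<in> polys n"
  using keys_add[of p q] unfolding polys_def by blast

lemma polys_mult: "p \<in> polys n \<Longrightarrow> q \<in> polys n \<Longrightarrow> p * q \<in> polys n"
proof (rule polysI)
  fix \<alpha> assume pq: "p \<in> polys n" "q \<in> polys n" and "\<alpha> \<in> keys (p * q)"
  then obtain a b where "\<alpha> = a + b" "a \<in> keys p" "b \<in> keys q" using keys_mult[of p q] by blast
  then show "keys \<alpha> \<subseteq> {0..n}" using pq keys_add_subset[of a "{0..n}" b] unfolding polys_def by blast
qed

lemma polys_sum: "(\<And>a. a \<in> S \<Longrightarrow> p a \<in> polys n) \<Longrightarrow> (\<Sum>a\<in>S. p a) \<in> polys n"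
  by (induction S rule: infinite_finite_induct) (simp_all add: polys_zero polys_add)

lemma forms_zero: "0 \<in> forms n d"
  by (rule formsI) simp

lemma forms_add: "p \<in> forms n d \<Longrightarrow> q \<in> forms n d \<Longrightarrow> p + q \<in> forms n d"
  using keys_add[of p q] unfolding forms_def polys_def by blast

lemma forms_mult: "p \<in> forms n a \<Longrightarrow> q \<in> forms n b \<Longrightarrow> p * q \<in> forms n (a + b)"
proof (rule formsI)
  fix \<alpha> assume pq: "p \<in> forms n a" "q \<in> forms n b" and "\<alpha> \<in> keys (p * q)"
  then obtain \<beta> \<gamma> where \<alpha>: "\<alpha> = \<beta> + \<gamma>" "\<beta> \<in> keys p" "\<gamma> \<in> keys q" using keys_mult[of p q] by blast
  from formsD[OF pq(1) \<alpha>(2)] formsD[OF pq(2) \<alpha>(3)]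
  show "keys \<alpha> \<subseteq> {0..n} \<and> mono_degree \<alpha> = a + b"
    unfolding \<alpha>(1) mono_degree_add using keys_add_subset[of \<beta> "{0..n}" \<gamma>] by blast
qed

lemma forms_sum: "(\<And>a. a \<in> S \<Longrightarrow> p a \<in> forms n d) \<Longrightarrow> (\<Sum>a\<in>S. p a) \<in> forms n d"
  by (induction S rule: infinite_finite_induct) (simp_all add: forms_zero forms_add)

lemma forms_single: "keys \<alpha> \<subseteq> {0..n} \<Longrightarrow> mono_degree \<alpha> = d \<Longrightarrow> single \<alpha> c \<in> forms n d"
  by (rule formsI) (auto split: if_splits)

lemma forms_cscale: "p \<in> forms n d \<Longrightarrow> cscale c p \<in> forms n d"
  by (rule formsI) (auto dest: formsD simp: in_keys_iff)

lemma forms_one: "1 \<in> forms n 0"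
  using forms_single[of 0 n 0 1] by simp

lemma forms_power: "p \<in> forms n a \<Longrightarrow> p ^ e \<in> forms n (e * a)"
  by (induction e) (simp_all add: forms_one forms_mult)

lemma form_mon: "keys \<alpha> \<subseteq> {0..n} \<Longrightarrow> form n (mono_degree \<alpha>) (mon \<alpha>)"
proof -
  assume a: "keys \<alpha> \<subseteq> {0..n}"
  have "form n (sum (\<lambda>i. lookup \<alpha> i * 1) (keys \<alpha>)) (\<lambda>x. \<Prod>i\<in>keys \<alpha>. x i ^ lookup \<alpha> i)"
    using a by (intro form_prod form_power form_var1) auto
  then show ?thesis by (simp add: mono_degree_def mon_def[abs_def])
qed

lemma form_poly_eval: "p \<in> forms n d \<Longrightarrow> form n d (poly_eval p)"
proof -
  assume p: "p \<in> forms n d"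
  have "form n d (mon \<alpha>)" if "\<alpha> \<in> keys p" for \<alpha> using form_mon[of \<alpha> n] formsD[OF p that] by blast
  then have "form n d (\<lambda>x. \<Sum>\<alpha>\<in>keys p. lookup p \<alpha> * mon \<alpha> x)" by (intro form_sum form_cmult)
  then show ?thesis unfolding poly_eval_def[abs_def] mon_def[symmetric] .
qed

lemma form_is_poly_eval: "form n d g \<Longrightarrow> \<exists>p\<in>forms n d. poly_eval p = g"
proof (induction rule: form.induct)
  case (const c)
  show ?case by (rule bexI[of _ "single 0 c"]) (auto intro: forms_single)
next
  case (var i t g)
  then obtain p where p: "p \<in> forms n t" "poly_eval p = g" by blast
  have "single (single i 1) 1 * p \<in> forms n (1 + t)"
    using var.hyps(1) by (intro forms_mult forms_single p(1)) auto
  then show ?case using p(2) by (intro bexI[of _ "single (single i 1) 1 * p"]) (simp_all add: poly_eval_single_mult fun_eq_iff Suc_eq_plus1_left)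
next
  case (add t g h)
  then obtain p q where "p \<in> forms n t" "poly_eval p = g" "q \<in> forms n t" "poly_eval q = h" by blast
  then show ?case by (intro bexI[of _ "p + q"]) (simp_all add: poly_eval_add forms_add fun_eq_iff)
qed

text \<open>Only the variables up to \<open>n\<close> occur, so the exponent vectors restrict
  injectively to \<open>{0..n}\<close> and independence of the power products applies.\<close>

lemma poly_eval_eq_0:
  assumes p: "p \<in> polys n" and 0: "\<And>x. poly_eval p x = 0"
  shows "p = 0"
proof -
  let ?I = "{0..n}"
  define r where "r \<alpha> = restrict (lookup \<alpha>) ?I" for \<alpha> :: "nat \<Rightarrow>\<^sub>0 nat"
  define k where "k = Suc (\<Sum>\<alpha>\<in>keys p. mono_degree \<alpha>)"
  have sub: "keys \<alpha> \<subseteq> ?I" if "\<alpha> \<in> keys p" for \<alpha> using p that unfolding polys_def by blast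
  have bound: "lookup \<alpha> i < k" if "\<alpha> \<in> keys p" for \<alpha> i
  proof -
    have "lookup \<alpha> i \<le> mono_degree \<alpha>"
      by (cases "i \<in> keys \<alpha>") (simp_all add: mono_degree_def member_le_sum lookup_notin)
    also have "\<dots> \<le> (\<Sum>\<alpha>\<in>keys p. mono_degree \<alpha>)" using that by (intro member_le_sum) simp_all
    finally show ?thesis by (simp add: k_def)
  qed
  have rbox: "r ` keys p \<subseteq> Pi\<^sub>E ?I (\<lambda>_. {..<k})" using bound by (auto simp: r_def)
  have inj: "inj_on r (keys p)"
  proof (rule inj_onI)
    fix \<alpha> \<beta> assume ab: "\<alpha> \<in> keys p" "\<beta> \<in> keys p" "r \<alpha> = r \<beta>"
    show "\<alpha> = \<beta>"
    proof (rule poly_mapping_eqI)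
      fix i
      show "lookup \<alpha> i = lookup \<beta> i"
      proof (cases "i \<in> ?I")
        case True
        then show ?thesis using fun_cong[OF ab(3), of i] by (simp add: r_def)
      next
        case False
        then have "i \<notin> keys \<alpha>" "i \<notin> keys \<beta>" using sub ab by blast+
        then show ?thesis by (simp add: lookup_notin)
      qed
    qed
  qed
  have m: "power_product ?I (r \<alpha>) x = mon \<alpha> x" if "\<alpha> \<in> keys p" for \<alpha> x
    unfolding mon_superset[OF finite_atLeastAtMost sub[OF that]] power_product_def by (intro prod.cong) (simp_all add: r_def)
  define c where "c b = (if b \<in> r ` keys p then lookup p (inv_into (keys p) r b) else 0)" for b
  have cr: "c (r \<alpha>) = lookup p \<alpha>" if "\<alpha> \<in> keys p" for \<alpha> using that inj by (simp add: c_def)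
  have "(\<Sum>b\<in>Pi\<^sub>E ?I (\<lambda>_. {..<k}). c b * power_product ?I b x) = 0" for x
  proof -
    have "(\<Sum>b\<in>Pi\<^sub>E ?I (\<lambda>_. {..<k}). c b * power_product ?I b x) = (\<Sum>b\<in>r ` keys p. c b * power_product ?I b x)"
      using rbox by (intro sum.mono_neutral_right) (auto simp: finite_PiE c_def)
    also have "\<dots> = (\<Sum>\<alpha>\<in>keys p. lookup p \<alpha> * mon \<alpha> x)"
      by (subst sum.reindex[OF inj]) (simp add: cr m)
    also have "\<dots> = 0" using 0[of x] by (simp add: poly_eval_def mon_def)
    finally show ?thesis .
  qed
  then have "c (r \<alpha>) = 0" if "\<alpha> \<in> keys p" for \<alpha>
    using monos_independent[where I = ?I and k = k and x = c and b = "r \<alpha>"] rbox that by blast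
  then have "keys p = {}" using cr by (metis equals0I in_keys_iff)
  then show ?thesis by simp
qed

lemma poly_eval_inject:
  assumes "p \<in> polys n" "q \<in> polys n" "\<And>x. poly_eval p x = poly_eval q x"
  shows "p = q"
proof -
  have "cscale (-1) q \<in> polys n" using assms(2) unfolding polys_def by (auto simp: in_keys_iff)
  then have "p + cscale (-1) q = 0"
    using assms by (intro poly_eval_eq_0[of _ n] polys_add) (simp_all only: poly_eval_add poly_eval_cscale, simp)
  moreover have "p = (p + cscale (-1) q) + q" by (rule poly_mapping_eqI) (simp add: lookup_add)
  ultimately show ?thesis by simp
qed

section \<open>Powers of linear forms\<close>

lemma coord_outside: "v \<in> vecs n \<Longrightarrow> n < i \<Longrightarrow> coord v i = 0"
proof (rule ccontr)
  assume v: "v \<in> vecs n" "n < i" "coord v i \<noteq> 0"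
  then have "single i 1 \<in> keys v" by (simp add: coord_def in_keys_iff)
  from formsD[OF v(1) this] v(2) show False by simp
qed

definition linear_form :: "nat \<Rightarrow> (nat \<Rightarrow> complex) \<Rightarrow> nat cpoly" where
  "linear_form n x = (\<Sum>i\<le>n. single (single i 1) (x i))"

lemma vec_vecs: "linear_form n x \<in> vecs n"
  unfolding linear_form_def by (intro forms_sum forms_single) auto

lemma coord_vec: "coord (linear_form n x) i = (if i \<le> n then x i else 0)"
proof -
  have "coord (linear_form n x) i = (\<Sum>j\<le>n. if j = i then x i else 0)"
    unfolding coord_def linear_form_def lookup_sum by (intro sum.cong) (auto simp: lookup_single when_def)
  then show ?thesis by simp
qed

lemma vec_coord: "v \<in> vecs n \<Longrightarrow> linear_form n (coord v) = v"
proof (rule poly_mapping_eqI)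
  fix \<alpha> assume v: "v \<in> vecs n"
  have l: "lookup (linear_form n (coord v)) \<alpha> = (\<Sum>i\<le>n. if single i 1 = \<alpha> then coord v i else 0)"
    unfolding linear_form_def lookup_sum by (intro sum.cong) (auto simp: lookup_single when_def)
  show "lookup (linear_form n (coord v)) \<alpha> = lookup v \<alpha>"
  proof (cases "\<exists>i\<le>n. \<alpha> = single i 1")
    case True
    then obtain i where i: "i \<le> n" "\<alpha> = single i 1" by blast
    have "(\<Sum>j\<le>n. if single j 1 = \<alpha> then coord v j else 0) = (\<Sum>j\<le>n. if j = i then coord v i else 0)"
      unfolding i(2) by (intro sum.cong) auto
    then show ?thesis using l i by (simp add: coord_def)
  next
    case False
    then have "(\<Sum>i\<le>n. if single i 1 = \<alpha> then coord v i else 0) = 0" by (intro sum.neutral) auto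
    moreover have "\<alpha> \<notin> keys v"
    proof
      assume "\<alpha> \<in> keys v"
      from formsD[OF v this] mono_degree_1[of \<alpha>] False show False by force
    qed
    ultimately show ?thesis using l by (simp add: lookup_notin)
  qed
qed

lemma coord_cscale: "coord (cscale c v) i = c * coord v i"
  by (simp add: coord_def)

lemma vecs_eqI:
  assumes "v \<in> vecs n" "w \<in> vecs n" "\<And>i. i \<le> n \<Longrightarrow> coord v i = coord w i"
  shows "v = w"
proof -
  have "linear_form n (coord v) = linear_form n (coord w)" unfolding linear_form_def using assms(3) by (intro sum.cong) auto
  then show ?thesis using vec_coord assms(1,2) by simp
qed

lemma lookup_unit_mult:
  fixes q :: "nat cpoly"
  shows "lookup (single (single i 1) c * q) \<alpha> = (if lookup \<alpha> i = 0 then 0 else c * lookup q (\<alpha> - single i 1))"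
proof -
  have "lookup (single (single i 1) c * q) \<alpha> =
    (\<Sum>\<gamma>\<in>keys q. if \<gamma> = \<alpha> - single i 1 then (if lookup \<alpha> i = 0 then 0 else c * lookup q (\<alpha> - single i 1)) else 0)"
    unfolding single_mult_expand lookup_sum
    by (intro sum.cong) (auto simp: lookup_single when_def unit_add_eq)
  then show ?thesis by (simp add: lookup_notin)
qed

text \<open>The multinomial theorem. In the induction step the factor with index \<open>i\<close>
  contributes \<open>lookup \<alpha> i\<close>, and these numbers add up to the degree.\<close>

lemma lookup_power:
  assumes v: "v \<in> vecs n"
  shows "lookup (v ^ d) \<alpha> = (if mono_degree \<alpha> = d then fact d / multifact \<alpha> * mon \<alpha> (coord v) else 0)"
proof (induction d arbitrary: \<alpha>)
  case 0
  show ?case by (auto simp: lookup_one when_def mono_degree_eq_0 multifact_def)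
next
  case (Suc d)
  have "v ^ Suc d = linear_form n (coord v) * v ^ d" by (simp add: vec_coord[OF v])
  then have "lookup (v ^ Suc d) \<alpha> = (\<Sum>i\<le>n. lookup (single (single i 1) (coord v i) * v ^ d) \<alpha>)"
    unfolding linear_form_def by (simp add: sum_distrib_right lookup_sum)
  also have "\<dots> = (\<Sum>i\<le>n. if mono_degree \<alpha> = Suc d then fact d / multifact \<alpha> * mon \<alpha> (coord v) * of_nat (lookup \<alpha> i) else 0)"
  proof (intro sum.cong refl)
    fix i
    show "lookup (single (single i 1) (coord v i) * v ^ d) \<alpha> =
      (if mono_degree \<alpha> = Suc d then fact d / multifact \<alpha> * mon \<alpha> (coord v) * of_nat (lookup \<alpha> i) else 0)"
    proof (cases "lookup \<alpha> i = 0")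
      case False
      define \<gamma> where "\<gamma> = \<alpha> - single i 1"
      have \<alpha>: "\<alpha> = single i 1 + \<gamma>" using unit_decomp[OF False] by (simp add: \<gamma>_def)
      have "lookup \<alpha> i = Suc (lookup \<gamma> i)" by (simp add: \<alpha> lookup_add)
      moreover have "mono_degree \<alpha> = Suc (mono_degree \<gamma>)" by (simp add: \<alpha> mono_degree_add)
      moreover have "mon \<alpha> (coord v) = coord v i * mon \<gamma> (coord v)" by (simp add: \<alpha> mon_add)
      moreover have "multifact \<alpha> = of_nat (Suc (lookup \<gamma> i)) * multifact \<gamma>" unfolding \<alpha> by (rule factp_unit_add)
      ultimately show ?thesis
        unfolding lookup_unit_mult using False factp_nonzero[of \<gamma>]
        by (simp add: Suc.IH \<gamma>_def[symmetric] del: of_nat_Suc)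
    qed (simp add: lookup_unit_mult)
  qed
  also have "\<dots> = (if mono_degree \<alpha> = Suc d then fact (Suc d) / multifact \<alpha> * mon \<alpha> (coord v) else 0)"
  proof (cases "keys \<alpha> \<subseteq> {..n}")
    case True
    have "(\<Sum>i\<le>n. of_nat (lookup \<alpha> i) :: complex) = of_nat (mono_degree \<alpha>)"
      unfolding mono_degree_superset[OF finite_atMost True] by simp
    moreover have "(\<Sum>i\<le>n. fact d / multifact \<alpha> * mon \<alpha> (coord v) * of_nat (lookup \<alpha> i)) =
      fact d / multifact \<alpha> * mon \<alpha> (coord v) * (\<Sum>i\<le>n. of_nat (lookup \<alpha> i))" by (rule sum_distrib_left[symmetric])
    ultimately show ?thesis by (auto simp del: of_nat_Suc)
  next
    case False
    then obtain i where i: "i \<in> keys \<alpha>" "n < i" by force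
    then have "mon \<alpha> (coord v) = 0" unfolding mon_def
      using coord_outside[OF v i(2)] by (intro prod_zero) (auto intro!: bexI[of _ i] simp: in_keys_iff)
    then show ?thesis by simp
  qed
  finally show ?case .
qed

lemma forms_power_vec: "v \<in> vecs n \<Longrightarrow> v ^ d \<in> forms n d"
  using forms_power[of v n 1 d] by simp

lemma lookup_power_sum:
  assumes v: "\<And>j. j \<in> S \<Longrightarrow> v j \<in> vecs n"
  shows "lookup (\<Sum>j\<in>S. cscale (a j) (v j ^ d)) \<alpha> =
    (if mono_degree \<alpha> = d then fact d / multifact \<alpha> * (\<Sum>j\<in>S. a j * mon \<alpha> (coord (v j))) else 0)"
proof -
  have "lookup (\<Sum>j\<in>S. cscale (a j) (v j ^ d)) \<alpha> =
    (\<Sum>j\<in>S. if mono_degree \<alpha> = d then fact d / multifact \<alpha> * (a j * mon \<alpha> (coord (v j))) else 0)"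
    unfolding lookup_sum using lookup_power[OF v] by (intro sum.cong) auto
  then show ?thesis by (simp add: sum_distrib_left)
qed

lemma forms_power_sum: "(\<And>j. j \<in> S \<Longrightarrow> v j \<in> vecs n) \<Longrightarrow> (\<Sum>j\<in>S. cscale (a j) (v j ^ d)) \<in> forms n d"
  by (intro forms_sum forms_cscale forms_power_vec)

text \<open>Apolarity: evaluating a form at the points of a power sum is a pairing with the
  coefficients of the power sum, so it does not depend on the chosen representation.\<close>

lemma apply_form_power_sum:
  assumes v: "\<And>j. j \<in> S \<Longrightarrow> v j \<in> vecs n" and p: "p \<in> forms n d"
  shows "(\<Sum>j\<in>S. a j * poly_eval p (coord (v j))) =
    (\<Sum>\<alpha>\<in>keys p. lookup p \<alpha> * multifact \<alpha> / fact d * lookup (\<Sum>j\<in>S. cscale (a j) (v j ^ d)) \<alpha>)"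
proof -
  have "(\<Sum>j\<in>S. a j * poly_eval p (coord (v j))) = (\<Sum>\<alpha>\<in>keys p. \<Sum>j\<in>S. a j * (lookup p \<alpha> * mon \<alpha> (coord (v j))))"
    unfolding poly_eval_def mon_def[symmetric] sum_distrib_left by (rule sum.swap)
  also have "\<dots> = (\<Sum>\<alpha>\<in>keys p. lookup p \<alpha> * multifact \<alpha> / fact d * lookup (\<Sum>j\<in>S. cscale (a j) (v j ^ d)) \<alpha>)"
  proof (intro sum.cong refl)
    fix \<alpha> assume "\<alpha> \<in> keys p"
    then have d: "mono_degree \<alpha> = d" using formsD[OF p] by blast
    show "(\<Sum>j\<in>S. a j * (lookup p \<alpha> * mon \<alpha> (coord (v j)))) =
      lookup p \<alpha> * multifact \<alpha> / fact d * lookup (\<Sum>j\<in>S. cscale (a j) (v j ^ d)) \<alpha>"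
      using factp_nonzero[of \<alpha>] by (subst lookup_power_sum[where n = n]) (simp_all add: v d sum_distrib_left mult_ac)
  qed
  finally show ?thesis .
qed

text \<open>The bridge between forms as polynomials and the geometric arguments, which see
  \<open>f\<close> only as a functional on forms of degree \<open>d\<close>.\<close>

lemma power_sum_eqD:
  assumes v: "\<And>j. j \<in> S \<Longrightarrow> v j \<in> vecs n" and w: "\<And>j. j \<in> T \<Longrightarrow> w j \<in> vecs n"
    and eq: "(\<Sum>j\<in>S. cscale (a j) (v j ^ d)) = (\<Sum>j\<in>T. cscale (b j) (w j ^ d))" and g: "form n d g"
  shows "(\<Sum>j\<in>S. a j * g (coord (v j))) = (\<Sum>j\<in>T. b j * g (coord (w j)))"
proof -
  obtain p where p: "p \<in> forms n d" "poly_eval p = g" using form_is_poly_eval[OF g] by blast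
  have "(\<Sum>j\<in>S. a j * poly_eval p (coord (v j))) =
    (\<Sum>\<alpha>\<in>keys p. lookup p \<alpha> * multifact \<alpha> / fact d * lookup (\<Sum>j\<in>S. cscale (a j) (v j ^ d)) \<alpha>)"
    by (rule apply_form_power_sum[OF _ p(1)]) (rule v)
  also have "\<dots> = (\<Sum>j\<in>T. b j * poly_eval p (coord (w j)))"
    unfolding eq by (rule apply_form_power_sum[OF _ p(1), symmetric]) (rule w)
  finally show ?thesis unfolding p(2) .
qed

section \<open>The catalecticant of a power sum\<close>

lemma lookup_partial: "lookup (partial i f) \<beta> = of_nat (Suc (lookup \<beta> i)) * lookup f (\<beta> + single i 1)"
proof -
  have "lookup (partial i f) \<beta> =
    (\<Sum>\<alpha>\<in>keys f. if \<alpha> = \<beta> + single i 1 then of_nat (Suc (lookup \<beta> i)) * lookup f (\<beta> + single i 1) else 0)"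
    unfolding partial_def lookup_sum
  proof (intro sum.cong refl)
    fix \<alpha>
    show "lookup (single (\<alpha> - single i 1) (of_nat (lookup \<alpha> i) * lookup f \<alpha>)) \<beta> =
      (if \<alpha> = \<beta> + single i 1 then of_nat (Suc (lookup \<beta> i)) * lookup f (\<beta> + single i 1) else 0)"
    proof (cases "lookup \<alpha> i = 0")
      case True
      then have "\<alpha> \<noteq> \<beta> + single i 1" by (auto simp: lookup_add)
      then show ?thesis using True by simp
    next
      case False
      then have "\<alpha> - single i 1 = \<beta> \<longleftrightarrow> \<alpha> = \<beta> + single i 1"
        using unit_add_eq[of i \<beta> \<alpha>] by (auto simp: add.commute)
      then show ?thesis by (auto simp: lookup_single when_def lookup_add)
    qed
  qed
  then show ?thesis by (simp add: lookup_notin)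
qed

definition clinear :: "(nat cpoly \<Rightarrow> nat cpoly) \<Rightarrow> bool" where
  "clinear T \<longleftrightarrow> (\<forall>p q. T (p + q) = T p + T q) \<and> (\<forall>c p. T (cscale c p) = cscale c (T p))"

lemma clinear_partial: "clinear (partial i)"
  unfolding clinear_def
  by (intro conjI allI poly_mapping_eqI) (simp_all add: lookup_partial lookup_add distrib_left mult_ac)


lemma clinear_funpow: "clinear T \<Longrightarrow> clinear (T ^^ k)"
  by (induction k) (simp_all add: clinear_def)

lemma clinear_iter_partial: "clinear (iter_partial \<alpha>)"
proof -
  have "clinear (foldr (\<lambda>i. partial i ^^ a i) xs)" for a xs
    using clinear_funpow[OF clinear_partial] unfolding clinear_def by (induction xs) simp_all
  then show ?thesis unfolding iter_partial_def[abs_def] .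
qed

lemma clinear_sum:
  assumes "clinear T"
  shows "T (\<Sum>j\<in>S. cscale (a j) (f j)) = (\<Sum>j\<in>S. cscale (a j) (T (f j)))"
proof -
  have 0: "T 0 = 0" using assms unfolding clinear_def by (metis cpoly.scale_zero_left)
  show ?thesis
    using assms by (induction S rule: infinite_finite_induct) (simp_all add: 0 clinear_def)
qed

lemma partial_power:
  assumes v: "v \<in> vecs n"
  shows "partial i (v ^ Suc d) = cscale (of_nat (Suc d) * coord v i) (v ^ d)"
proof (rule poly_mapping_eqI)
  fix \<beta>
  have 1: "mono_degree (\<beta> + single i 1) = Suc (mono_degree \<beta>)" by (simp add: mono_degree_add)
  have 2: "mon (\<beta> + single i 1) (coord v) = mon \<beta> (coord v) * coord v i" by (simp add: mon_add)
  have 3: "multifact (\<beta> + single i 1) = of_nat (Suc (lookup \<beta> i)) * multifact \<beta>"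
    using factp_unit_add[of i \<beta>] by (simp add: add.commute)
  have 4: "of_nat (Suc (lookup \<beta> i)) \<noteq> (0::complex)" by (simp del: of_nat_Suc)
  show "lookup (partial i (v ^ Suc d)) \<beta> = lookup (cscale (of_nat (Suc d) * coord v i) (v ^ d)) \<beta>"
    unfolding lookup_partial lookup_cscale lookup_power[OF v] 1 2 3 fact_Suc
    using 4 by (simp del: of_nat_Suc)
qed

lemma partial_funpow_power:
  assumes v: "v \<in> vecs n" and "k \<le> d"
  shows "(partial i ^^ k) (v ^ d) = cscale (fact d / fact (d - k) * coord v i ^ k) (v ^ (d - k))"
  using assms(2)
proof (induction k)
  case 0
  show ?case by (simp add: cpoly.scale_one)
next
  case (Suc k)
  obtain e where e: "d - k = Suc e" "d - Suc k = e" using Suc.prems by (metis Suc_diff_Suc Suc_le_lessD)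
  have "(partial i ^^ Suc k) (v ^ d) = partial i (cscale (fact d / fact (Suc e) * coord v i ^ k) (v ^ Suc e))"
    using Suc e by simp
  also have "\<dots> = cscale (fact d / fact (Suc e) * coord v i ^ k) (cscale (of_nat (Suc e) * coord v i) (v ^ e))"
    using clinear_partial[of i] unfolding clinear_def by (simp only: partial_power[OF v])
  also have "\<dots> = cscale (fact d / fact e * coord v i ^ Suc k) (v ^ e)"
    by (simp add: field_simps del: of_nat_Suc)
  finally show ?case by (simp add: e)
qed

lemma iter_partial_power:
  assumes v: "v \<in> vecs n" and le: "mono_degree \<alpha> \<le> d"
  shows "iter_partial \<alpha> (v ^ d) = cscale (fact d / fact (d - mono_degree \<alpha>) * mon \<alpha> (coord v)) (v ^ (d - mono_degree \<alpha>))"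
proof -
  let ?a = "lookup \<alpha>"
  have "foldr (\<lambda>i. partial i ^^ ?a i) xs (v ^ d) =
    cscale (fact d / fact (d - (\<Sum>i\<in>set xs. ?a i)) * (\<Prod>i\<in>set xs. coord v i ^ ?a i)) (v ^ (d - (\<Sum>i\<in>set xs. ?a i)))"
    if "distinct xs" "(\<Sum>i\<in>set xs. ?a i) \<le> d" for xs
    using that
  proof (induction xs)
    case Nil
    show ?case by (simp add: cpoly.scale_one)
  next
    case (Cons i xs)
    let ?s = "\<Sum>i\<in>set xs. ?a i"
    have s: "(\<Sum>i\<in>set (i # xs). ?a i) = ?a i + ?s" using Cons.prems by simp
    have le: "?a i \<le> d - ?s" using Cons.prems s by simp
    have d: "d - ?s - ?a i = d - (?a i + ?s)" by simp
    let ?c = "fact d / fact (d - ?s) * (\<Prod>i\<in>set xs. coord v i ^ ?a i)"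
    have "foldr (\<lambda>i. partial i ^^ ?a i) (i # xs) (v ^ d) = (partial i ^^ ?a i) (cscale ?c (v ^ (d - ?s)))"
      using Cons by simp
    also have "\<dots> = cscale ?c (cscale (fact (d - ?s) / fact (d - ?s - ?a i) * coord v i ^ ?a i) (v ^ (d - ?s - ?a i)))"
      using clinear_funpow[OF clinear_partial[of i], of "?a i"] unfolding clinear_def
      by (simp only: partial_funpow_power[OF v le])
    also have "\<dots> = cscale (fact d / fact (d - (?a i + ?s)) * (\<Prod>i\<in>set (i # xs). coord v i ^ ?a i)) (v ^ (d - (?a i + ?s)))"
      using Cons.prems unfolding d by (simp add: mult_ac)
    finally show ?case unfolding s .
  qed
  from this[of "sorted_list_of_set (keys \<alpha>)"] le
  show ?thesis unfolding iter_partial_def mono_degree_def mon_def by simp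
qed

text \<open>A differential operator of order \<open>m\<close> acts on \<open>v ^ d\<close> as
  multiplication of \<open>v ^ (d - m)\<close> by its symbol at \<open>v\<close>, up to a factor
  that depends only on \<open>d\<close> and \<open>m\<close>.\<close>

lemma catalecticant_power_sum:
  assumes v: "\<And>j. j \<in> S \<Longrightarrow> v j \<in> vecs n" and p: "p \<in> forms n m" and "m \<le> d"
  shows "catalecticant (\<Sum>j\<in>S. cscale (a j) (v j ^ d)) p =
    (\<Sum>j\<in>S. cscale (fact d / fact (d - m) * (a j * poly_eval p (coord (v j)))) (v j ^ (d - m)))"
proof -
  have "catalecticant (\<Sum>j\<in>S. cscale (a j) (v j ^ d)) p =
    (\<Sum>\<alpha>\<in>keys p. \<Sum>j\<in>S. cscale (lookup p \<alpha>) (cscale (a j) (cscale (fact d / fact (d - m) * mon \<alpha> (coord (v j))) (v j ^ (d - m)))))"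
    unfolding catalecticant_def
  proof (intro sum.cong refl)
    fix \<alpha> assume "\<alpha> \<in> keys p"
    then have \<alpha>: "mono_degree \<alpha> = m" using formsD[OF p] by blast
    have i: "iter_partial \<alpha> (v j ^ d) = cscale (fact d / fact (d - m) * mon \<alpha> (coord (v j))) (v j ^ (d - m))"
      if "j \<in> S" for j using iter_partial_power[OF v[OF that], of \<alpha> d] \<alpha> assms(3) by simp
    show "cscale (lookup p \<alpha>) (iter_partial \<alpha> (\<Sum>j\<in>S. cscale (a j) (v j ^ d))) =
      (\<Sum>j\<in>S. cscale (lookup p \<alpha>) (cscale (a j) (cscale (fact d / fact (d - m) * mon \<alpha> (coord (v j))) (v j ^ (d - m)))))"
      unfolding clinear_sum[OF clinear_iter_partial] cpoly.scale_sum_right using i by (intro sum.cong) simp_all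
  qed
  also have "\<dots> = (\<Sum>j\<in>S. \<Sum>\<alpha>\<in>keys p. cscale (lookup p \<alpha>) (cscale (a j) (cscale (fact d / fact (d - m) * mon \<alpha> (coord (v j))) (v j ^ (d - m)))))"
    by (rule sum.swap)
  also have "\<dots> = (\<Sum>j\<in>S. cscale (fact d / fact (d - m) * (a j * poly_eval p (coord (v j)))) (v j ^ (d - m)))"
  proof (intro sum.cong refl)
    fix j
    have "fact d / fact (d - m) * (a j * poly_eval p (coord (v j))) =
      (\<Sum>\<alpha>\<in>keys p. lookup p \<alpha> * (a j * (fact d / fact (d - m) * mon \<alpha> (coord (v j)))))"
      unfolding poly_eval_def mon_def[symmetric] sum_distrib_left by (intro sum.cong) (simp_all add: mult_ac)
    then show "(\<Sum>\<alpha>\<in>keys p. cscale (lookup p \<alpha>) (cscale (a j) (cscale (fact d / fact (d - m) * mon \<alpha> (coord (v j))) (v j ^ (d - m))))) =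
      cscale (fact d / fact (d - m) * (a j * poly_eval p (coord (v j)))) (v j ^ (d - m))"
      by (simp only: cpoly.scale_sum_left cpoly.scale_scale)
  qed
  finally show ?thesis .
qed

section \<open>Kernel and zero set of the catalecticant\<close>

lemma cscale_power: "cscale c v ^ d = cscale (c ^ d) (v ^ d)"
  unfolding cscale_def by (induction d) (simp_all add: mult_single mult_ac single_one)

lemma form_cscale: "form n t g \<Longrightarrow> g (coord (cscale c v)) = c ^ t * g (coord v)"
  by (rule form_scale_cong) (simp_all add: coord_cscale)

lemma poly_eval_cscale_point: "p \<in> forms n m \<Longrightarrow> poly_eval p (coord (cscale c v)) = c ^ m * poly_eval p (coord v)"
  by (rule form_cscale[OF form_poly_eval])

lemma line_altdef: "line v = range (\<lambda>c. cscale c v)"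
  unfolding line_def by (rule cpoly.span_singleton)

lemma in_line: "v \<in> line v"
  unfolding line_altdef using cpoly.scale_one[of v] by (intro image_eqI[of _ _ 1]) simp_all

lemma vanishes_at_line: "p \<in> forms n m \<Longrightarrow> vanishes_at p (line v) \<longleftrightarrow> poly_eval p (coord v) = 0"
  using in_line[of v] unfolding vanishes_at_def by (auto simp: line_altdef poly_eval_cscale_point)

lemma nz_coord: "v \<in> vecs n \<Longrightarrow> nonzero_pt n (coord v) \<longleftrightarrow> v \<noteq> 0"
proof
  assume "v \<in> vecs n" "v \<noteq> 0"
  then show "nonzero_pt n (coord v)"
    using vecs_eqI[of v n 0] forms_zero[of n 1] unfolding nonzero_pt_def by (auto simp: coord_def)
qed (auto simp: nonzero_pt_def coord_def)

lemma ray_coord: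
  assumes "v \<in> vecs n" "w \<in> vecs n"
  shows "ray n (coord v) (coord w) \<longleftrightarrow> (\<exists>c. w = cscale c v)"
proof
  assume "ray n (coord v) (coord w)"
  then obtain c where "\<forall>k\<le>n. coord w k = c * coord v k" unfolding ray_def by blast
  then have "w = cscale c v" using assms by (intro vecs_eqI[of _ n] forms_cscale) (simp_all add: coord_cscale)
  then show "\<exists>c. w = cscale c v" ..
qed (auto simp: ray_def coord_cscale)

lemma line_cscale: "c \<noteq> 0 \<Longrightarrow> line (cscale c v) = line v"
proof -
  assume c: "c \<noteq> 0"
  have "cscale a v = cscale (a / c) (cscale c v)" for a using c by simp
  then have "range (\<lambda>a. cscale a v) \<subseteq> range (\<lambda>a. cscale a (cscale c v))" by blast
  then show ?thesis unfolding line_altdef by auto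
qed

lemma line_eq_iff:
  assumes "v \<in> vecs n" "w \<in> vecs n" "w \<noteq> 0"
  shows "line v = line w \<longleftrightarrow> ray n (coord v) (coord w)"
proof
  assume "line v = line w"
  then show "ray n (coord v) (coord w)"
    using in_line[of w] assms unfolding ray_coord[OF assms(1,2)] line_altdef by auto
next
  assume "ray n (coord v) (coord w)"
  then obtain c where c: "w = cscale c v" using ray_coord assms by blast
  then have "c \<noteq> 0" using assms(3) by auto
  then show "line v = line w" unfolding c by (rule line_cscale[symmetric])
qed

lemma proj_spaceE:
  assumes "z \<in> proj_space n"
  obtains v where "v \<in> vecs n" "v \<noteq> 0" "z = line v"
  using assms unfolding proj_space_def by blast

lemma line_in_zero_set:
  assumes "K \<subseteq> forms n m" "v \<in> vecs n" "v \<noteq> 0"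
  shows "line v \<in> zero_set n K \<longleftrightarrow> coord v \<in> zeros_of (poly_eval ` K)"
proof -
  have "line v \<in> proj_space n" using assms(2,3) unfolding proj_space_def by blast
  then show ?thesis
    using vanishes_at_line[of _ n m v] assms(1) unfolding zero_set_def zeros_of_def by auto
qed

lemma finite_zero_set:
  assumes K: "K \<subseteq> forms n m" and red: "reduced_on n m (poly_eval ` K) W"
  shows "finite (zero_set n K)"
proof (rule finite_subset)
  show "finite ((\<lambda>w. line (linear_form n w)) ` W)" using red unfolding reduced_on_def by blast
  show "zero_set n K \<subseteq> (\<lambda>w. line (linear_form n w)) ` W"
  proof
    fix z assume z: "z \<in> zero_set n K"
    then obtain v where v: "v \<in> vecs n" "v \<noteq> 0" "z = line v"
      using proj_spaceE[of z n] unfolding zero_set_def by blast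
    then have "coord v \<in> zeros_of (poly_eval ` K)" "nonzero_pt n (coord v)" using z line_in_zero_set[OF K] nz_coord by blast+
    then obtain w where w: "w \<in> W" "ray n w (coord v)" using red unfolding reduced_on_def by blast
    then have "ray n (coord (linear_form n w)) (coord v)" by (auto simp: ray_def coord_vec)
    then have "line (linear_form n w) = line v" using line_eq_iff vec_vecs v by blast
    then show "z \<in> (\<lambda>w. line (linear_form n w)) ` W" using w(1) v(3) by blast
  qed
qed

lemma ideal_of_zero: "0 \<in> ideal_of n K"
  unfolding ideal_of_def by (intro CollectI exI[of _ "{}"]) simp

lemma ideal_of_step:
  assumes k: "k \<in> K" and q: "q \<in> polys n" and r: "r \<in> ideal_of n K"
  shows "q * k + r \<in> ideal_of n K"
proof -
  obtain A a where A: "finite A" "A \<subseteq> K" "\<forall>q\<in>A. a q \<in> polys n" "r = (\<Sum>q\<in>A. a q * q)"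
    using r unfolding ideal_of_def by blast
  define b where "b p = (if p \<in> A then a p else 0) + (if p = k then q else 0)" for p
  have "(\<Sum>p\<in>insert k A. b p * p) = (\<Sum>p\<in>insert k A. (if p \<in> A then a p * p else 0)) + (\<Sum>p\<in>insert k A. if p = k then q * p else 0)"
    unfolding sum.distrib[symmetric] b_def by (intro sum.cong) (auto simp: algebra_simps)
  also have "(\<Sum>p\<in>insert k A. if p \<in> A then a p * p else 0) = r"
    unfolding A(4) using A(1) by (intro sum.mono_neutral_cong_right) auto
  also have "(\<Sum>p\<in>insert k A. if p = k then q * p else 0) = q * k"
    using A(1) by (subst sum.delta) auto
  finally have "q * k + r = (\<Sum>p\<in>insert k A. b p * p)" by simp
  moreover have "\<forall>p\<in>insert k A. b p \<in> polys n" using A(3) q by (auto simp: b_def polys_zero intro: polys_add)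
  ultimately show ?thesis unfolding ideal_of_def using A(1,2) k by blast
qed

lemma ideal_of_add:
  assumes p: "p \<in> ideal_of n K" and q: "q \<in> ideal_of n K"
  shows "p + q \<in> ideal_of n K"
proof -
  obtain A a where A: "finite A" "A \<subseteq> K" "\<forall>q\<in>A. a q \<in> polys n" "p = (\<Sum>q\<in>A. a q * q)"
    using p unfolding ideal_of_def by blast
  have "(\<Sum>q\<in>A. a q * q) + q \<in> ideal_of n K" using A(1,2,3)
  proof (induction A rule: finite_induct)
    case (insert k A)
    have "a k * k + ((\<Sum>q\<in>A. a q * q) + q) \<in> ideal_of n K"
      using insert by (intro ideal_of_step) simp_all
    then show ?case using insert.hyps by (simp add: add.assoc)
  qed (simp add: q)
  then show ?thesis using A(4) by simp
qed

lemma ideal_of_sum: "(\<And>a. a \<in> S \<Longrightarrow> p a \<in> ideal_of n K) \<Longrightarrow> (\<Sum>a\<in>S. p a) \<in> ideal_of n K"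
  by (induction S rule: infinite_finite_induct) (simp_all add: ideal_of_zero ideal_of_add)

lemma ideal_of_polys: "K \<subseteq> polys n \<Longrightarrow> ideal_of n K \<subseteq> polys n"
  unfolding ideal_of_def by (auto intro!: polys_sum polys_mult)

lemma ideal_of_vanish: "p \<in> ideal_of n K \<Longrightarrow> z \<in> zeros_of (poly_eval ` K) \<Longrightarrow> poly_eval p z = 0"
  unfolding ideal_of_def zeros_of_def by (auto simp: poly_eval_sum poly_eval_mult subset_iff intro!: sum.neutral)

lemma prods_ideal_of:
  assumes "prods n (poly_eval ` K) s f"
  shows "\<exists>r\<in>ideal_of n K. poly_eval r = f"
  using assms
proof (induction rule: prods.induct)
  case zero
  show ?case by (rule bexI[OF _ ideal_of_zero]) auto
next
  case (step k s q p)
  then obtain \<kappa> \<rho> r where k: "\<kappa> \<in> K" "k = poly_eval \<kappa>" and q: "\<rho> \<in> forms n s" "q = poly_eval \<rho>"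
    and r: "r \<in> ideal_of n K" "p = poly_eval r"
    using form_is_poly_eval[OF step.hyps(2)] by blast
  have "\<rho> * \<kappa> + r \<in> ideal_of n K" by (intro ideal_of_step k r forms_polys[OF q(1)])
  then show ?case
    by (rule rev_bexI) (simp add: fun_eq_iff poly_eval_add poly_eval_mult k q r mult.commute)
qed

text \<open>The equation is available for nonzero \<open>t\<close> only, since scaling must preserve
  the condition \<open>z 0 \<noteq> 0\<close>; an additional factor \<open>t\<close> in
  \<open>P\<close> settles the value at 0.\<close>

lemma zero_sum_powers:
  assumes U: "finite U" and 0: "\<And>t. t \<noteq> 0 \<Longrightarrow> (\<Sum>u\<in>U. t ^ u * c u) = (0::complex)" and u: "u \<in> U"
  shows "c u = 0"
proof -
  define P where "P = (\<Sum>u\<in>U. monom (c u) (Suc u))"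
  have "poly P t = 0" for t
  proof (cases "t = 0")
    case False
    have "poly P t = t * (\<Sum>u\<in>U. t ^ u * c u)"
      by (simp add: P_def poly_sum poly_monom sum_distrib_left mult_ac)
    then show ?thesis using 0[OF False] by simp
  qed (simp add: P_def poly_sum poly_monom)
  then have "P = 0" using poly_all_0_iff_0 by blast
  then have "coeff P (Suc u) = 0" by simp
  moreover have "coeff P (Suc u) = (\<Sum>u'\<in>U. if u' = u then c u else 0)"
    unfolding P_def coeff_sum by (intro sum.cong) auto
  ultimately show ?thesis using U u by simp
qed

definition hom_part :: "nat \<Rightarrow> nat cpoly \<Rightarrow> nat cpoly" where
  "hom_part u p = (\<Sum>\<alpha>\<in>{\<alpha>\<in>keys p. mono_degree \<alpha> = u}. single \<alpha> (lookup p \<alpha>))"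

lemma sum_hom_part: "p = (\<Sum>u\<in>mono_degree ` keys p. hom_part u p)"
  by (subst poly_mapping_expand[of p], subst sum.image_gen[of _ _ mono_degree]) (simp_all add: hom_part_def)

lemma forms_hom_part: "p \<in> polys n \<Longrightarrow> hom_part u p \<in> forms n u"
  unfolding hom_part_def polys_def by (intro forms_sum forms_single) auto

text \<open>An element of the radical of the saturation vanishes at the zeros, and so do its
  homogeneous parts; in large degrees such forms are in the ideal by \<open>reduced_on\<close>,
  which is membership in the saturation.\<close>

lemma reduced_zero_schemeI:
  assumes K: "K \<subseteq> forms n m" and red: "reduced_on n m (poly_eval ` K) W"
  shows "reduced_zero_scheme n K"
  unfolding reduced_zero_scheme_def
proof (intro ballI allI impI)
  fix p e assume p: "p \<in> polys n" and pe: "p ^ e \<in> saturation n (ideal_of n K)"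
  obtain k where k: "\<And>q. q \<in> forms n k \<Longrightarrow> q * p ^ e \<in> ideal_of n K" using pe unfolding saturation_def by blast
  obtain u0 where u0: "\<And>u f. u0 \<le> u \<Longrightarrow> form n u f \<Longrightarrow> (\<forall>z\<in>zeros_of (poly_eval ` K). z 0 \<noteq> 0 \<longrightarrow> f z = 0) \<Longrightarrow>
      prods n (poly_eval ` K) (u - m) f" using red unfolding reduced_on_def by blast
  \<comment> \<open>This single multiplier suffices, as it is nonzero at the zeros in
    question.\<close>
  let ?y0 = "single (single 0 k) 1 :: nat cpoly"
  have "?y0 \<in> forms n k" by (rule forms_single) auto
  from k[OF this] have vanishing: "poly_eval p z = 0" if "z \<in> zeros_of (poly_eval ` K)" "z 0 \<noteq> 0" for z
    using ideal_of_vanish[of "?y0 * p ^ e" n K z] that by (simp add: poly_eval_mult poly_eval_power)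
  \<comment> \<open>The zero set is a cone, so \<open>p\<close> vanishes at all multiples of
    \<open>z\<close>, and comparing powers of the scaling factor separates the parts.\<close>
  have part: "poly_eval (hom_part u p) z = 0" if z: "z \<in> zeros_of (poly_eval ` K)" "z 0 \<noteq> 0" for u z
  proof (cases "u \<in> mono_degree ` keys p")
    case True
    show ?thesis
    proof (rule zero_sum_powers[of "mono_degree ` keys p"])
      fix t :: complex assume t: "t \<noteq> 0"
      have "(\<lambda>i. t * z i) \<in> zeros_of (poly_eval ` K)"
        using z(1) form_scale[OF form_poly_eval[of _ n m], of _ t z] K unfolding zeros_of_def by auto
      then have "poly_eval p (\<lambda>i. t * z i) = 0" using vanishing z(2) t by simp
      then have "poly_eval (\<Sum>u\<in>mono_degree ` keys p. hom_part u p) (\<lambda>i. t * z i) = 0"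
        using sum_hom_part[of p] by simp
      then show "(\<Sum>u\<in>mono_degree ` keys p. t ^ u * poly_eval (hom_part u p) z) = 0"
        unfolding poly_eval_sum using form_scale[OF form_poly_eval[OF forms_hom_part[OF p]], of _ t z] by simp
    qed (use True in auto)
  next
    case False
    then have no: "{\<alpha>\<in>keys p. mono_degree \<alpha> = u} = {}" by blast
    show ?thesis unfolding hom_part_def no by simp
  qed
  have "q * p \<in> ideal_of n K" if q: "q \<in> forms n u0" for q
  proof -
    have "q * hom_part u p \<in> ideal_of n K" for u
    proof -
      have f: "q * hom_part u p \<in> forms n (u0 + u)" by (rule forms_mult[OF q forms_hom_part[OF p]])
      have "prods n (poly_eval ` K) (u0 + u - m) (poly_eval (q * hom_part u p))"
        by (rule u0[OF _ form_poly_eval[OF f]]) (auto simp: poly_eval_mult part)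
      then obtain r where r: "r \<in> ideal_of n K" "poly_eval r = poly_eval (q * hom_part u p)"
        using prods_ideal_of by blast
      have "r \<in> polys n" using r(1) ideal_of_polys[of K n] K forms_polys by blast
      then have "r = q * hom_part u p" using r(2) forms_polys[OF f] by (intro poly_eval_inject[of r n]) simp_all
      then show ?thesis using r(1) by simp
    qed
    then have "(\<Sum>u\<in>mono_degree ` keys p. q * hom_part u p) \<in> ideal_of n K" by (intro ideal_of_sum)
    then show ?thesis unfolding sum_distrib_left[symmetric] sum_hom_part[of p, symmetric] .
  qed
  then show "p \<in> saturation n (ideal_of n K)" unfolding saturation_def using p by blast
qed

text \<open>Lagrange forms of degree \<open>k\<close> make the powers \<open>V j ^ k\<close>
  independent, so the image of \<open>p\<close> is zero only if every value of \<open>p\<close> at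
  the points is.\<close>

lemma cat_ker_power_sum:
  assumes J: "finite J" and V: "\<And>j. j \<in> J \<Longrightarrow> V j \<in> vecs n" and has_lagrange: "has_lagrange n k J (\<lambda>j. coord (V j))"
  shows "cat_ker n m (\<Sum>j\<in>J. V j ^ (m + k)) = {p \<in> forms n m. \<forall>j\<in>J. poly_eval p (coord (V j)) = 0}"
proof -
  let ?C = "fact (m + k) / fact k :: complex"
  obtain L where L: "\<And>j. j \<in> J \<Longrightarrow> form n k (L j)" "dual J L (\<lambda>j. coord (V j))" using has_lagrange unfolding has_lagrange_def by blast
  have cat: "catalecticant (\<Sum>j\<in>J. V j ^ (m + k)) p = (\<Sum>j\<in>J. cscale (?C * poly_eval p (coord (V j))) (V j ^ k))"
    if "p \<in> forms n m" for p
  proof -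
    have "catalecticant (\<Sum>j\<in>J. cscale 1 (V j ^ (m + k))) p =
      (\<Sum>j\<in>J. cscale (fact (m + k) / fact (m + k - m) * (1 * poly_eval p (coord (V j)))) (V j ^ (m + k - m)))"
      by (rule catalecticant_power_sum[OF V that]) simp_all
    then show ?thesis by simp
  qed
  have "poly_eval p (coord (V i)) = 0"
    if p: "p \<in> forms n m" and 0: "catalecticant (\<Sum>j\<in>J. V j ^ (m + k)) p = 0" and i: "i \<in> J" for p i
  proof -
    have "(\<Sum>j\<in>J. ?C * poly_eval p (coord (V j)) * L i (coord (V j))) =
        (\<Sum>j\<in>{}. ?C * poly_eval p (coord (V j)) * L i (coord (V j)))"
      by (rule power_sum_eqD[where n = n and d = k]) (use V 0 L(1)[OF i] in \<open>simp_all add: cat[OF p]\<close>)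
    moreover have "(\<Sum>j\<in>J. ?C * poly_eval p (coord (V j)) * L i (coord (V j))) =
        (\<Sum>j\<in>J. if j = i then ?C * poly_eval p (coord (V j)) else 0)"
      by (intro sum.cong) (auto simp: dualD[OF L(2) i])
    ultimately show ?thesis using J i by simp
  qed
  then show ?thesis unfolding cat_ker_def by (auto simp: cat)
qed

lemma poly_eval_van:
  "poly_eval ` {p \<in> forms n m. \<forall>j\<in>J. poly_eval p (coord (V j)) = 0} = vanishing n m J (\<lambda>j. coord (V j))"
  unfolding vanishing_def using form_poly_eval form_is_poly_eval by fastforce

text \<open>The image lies in the span of the independent powers \<open>V j ^ k\<close>, and
  Lagrange forms of degree \<open>m\<close> show that it contains each of them.\<close>

lemma cat_rank_power_sum:
  assumes J: "finite J" and V: "\<And>j. j \<in> J \<Longrightarrow> V j \<in> vecs n"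
    and k: "has_lagrange n k J (\<lambda>j. coord (V j))" and m: "has_lagrange n m J (\<lambda>j. coord (V j))"
  shows "cat_rank n m (\<Sum>j\<in>J. V j ^ (m + k)) = card J"
proof -
  let ?f = "\<Sum>j\<in>J. V j ^ (m + k)"
  let ?C = "fact (m + k) / fact k :: complex"
  let ?B = "(\<lambda>j. V j ^ k) ` J"
  obtain L where L: "\<And>j. j \<in> J \<Longrightarrow> form n m (L j)" "dual J L (\<lambda>j. coord (V j))" using m unfolding has_lagrange_def by blast
  obtain L' where L': "\<And>j. j \<in> J \<Longrightarrow> form n k (L' j)" "dual J L' (\<lambda>j. coord (V j))" using k unfolding has_lagrange_def by blast
  have cat: "catalecticant ?f p = (\<Sum>j\<in>J. cscale (?C * poly_eval p (coord (V j))) (V j ^ k))"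
    if "p \<in> forms n m" for p
  proof -
    have "catalecticant (\<Sum>j\<in>J. cscale 1 (V j ^ (m + k))) p =
      (\<Sum>j\<in>J. cscale (fact (m + k) / fact (m + k - m) * (1 * poly_eval p (coord (V j)))) (V j ^ (m + k - m)))"
      by (rule catalecticant_power_sum[OF V that]) simp_all
    then show ?thesis by simp
  qed
  have ind: "c i = 0" if "(\<Sum>j\<in>J. cscale (c j) (V j ^ k)) = 0" "i \<in> J" for c i
  proof -
    have "(\<Sum>j\<in>J. c j * L' i (coord (V j))) = (\<Sum>j\<in>{}. c j * L' i (coord (V j)))"
      by (rule power_sum_eqD[where n = n and d = k]) (use V that L'(1) in simp_all)
    moreover have "(\<Sum>j\<in>J. c j * L' i (coord (V j))) = (\<Sum>j\<in>J. if j = i then c i else 0)"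
      by (intro sum.cong) (auto simp: dualD[OF L'(2) that(2)])
    ultimately show ?thesis using J that(2) by simp
  qed
  have inj: "inj_on (\<lambda>j. V j ^ k) J"
  proof (rule inj_onI, rule ccontr)
    fix i j assume ij: "i \<in> J" "j \<in> J" "V i ^ k = V j ^ k" "i \<noteq> j"
    have "(\<Sum>l\<in>J. cscale ((if l = i then 1 else 0) - (if l = j then 1 else 0)) (V l ^ k)) =
      (\<Sum>l\<in>J. if l = i then V i ^ k else 0) - (\<Sum>l\<in>J. if l = j then V j ^ k else 0)"
      unfolding sum_subtractf[symmetric] by (intro sum.cong) (auto simp: cpoly.scale_left_diff_distrib)
    then have "(\<Sum>l\<in>J. cscale ((if l = i then 1 else 0) - (if l = j then 1 else 0)) (V l ^ k)) = 0"
      using ij J by simp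
    from ind[OF this ij(1)] ij(4) show False by simp
  qed
  show ?thesis unfolding cat_rank_def
  proof (rule cpoly.dim_unique)
    show "?B \<subseteq> catalecticant ?f ` forms n m"
    proof
      fix b assume "b \<in> ?B"
      then obtain i where i: "i \<in> J" "b = V i ^ k" by blast
      obtain p where p: "p \<in> forms n m" "poly_eval p = L i" using form_is_poly_eval[OF L(1)[OF i(1)]] by blast
      let ?p = "cscale (1 / ?C) p"
      have "catalecticant ?f ?p = (\<Sum>j\<in>J. if j = i then V i ^ k else 0)"
        unfolding cat[OF forms_cscale[OF p(1)]]
        by (intro sum.cong) (auto simp: poly_eval_cscale p(2) dualD[OF L(2) i(1)])
      then have "catalecticant ?f ?p = b" using J i by simp
      then show "b \<in> catalecticant ?f ` forms n m" using forms_cscale[OF p(1)] by blast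
    qed
    show "catalecticant ?f ` forms n m \<subseteq> cpoly.span ?B"
      by (auto simp: cat simp del: times_divide_eq_left intro!: cpoly.span_sum cpoly.span_scale cpoly.span_base[OF imageI])
    show "cpoly.independent ?B"
    proof
      assume "cpoly.dependent ?B"
      then obtain u where u: "\<exists>v\<in>?B. u v \<noteq> 0" "(\<Sum>v\<in>?B. cscale (u v) v) = 0"
        using cpoly.dependent_finite[of ?B] J by auto
      from u(2) have "(\<Sum>j\<in>J. cscale (u (V j ^ k)) (V j ^ k)) = 0" by (simp add: sum.reindex[OF inj])
      from ind[OF this] u(1) show False by blast
    qed
    show "card ?B = card J" by (rule card_image[OF inj])
  qed
qed

section \<open>Expressions as sums of powers\<close>

lemma expr_value_nth: "expr_value d xs = (\<Sum>i<length xs. cscale (fst (xs ! i)) (snd (xs ! i) ^ d))"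
  unfolding expr_value_def sum_list_sum_nth by (simp add: case_prod_beta atLeast0LessThan)

lemma expr_of_nth: "expr_of n d f xs \<Longrightarrow> i < length xs \<Longrightarrow> snd (xs ! i) \<in> vecs n"
  unfolding expr_of_def using nth_mem[of i xs] by (auto simp: case_prod_beta)

lemma complex_root_exists: "0 < d \<Longrightarrow> \<exists>t. t ^ d = (c :: complex)"
proof
  assume "0 < d"
  then show "rcis (root d (cmod c)) (Arg c / real d) ^ d = c"
    by (simp add: DeMoivre2 rcis_cmod_Arg)
qed

lemma absorb_coefficients:
  assumes d: "0 < d" and e: "expr_of n d f xs"
  obtains V where "\<And>i. i < length xs \<Longrightarrow> V i \<in> vecs n"
    "\<And>i. i < length xs \<Longrightarrow> \<exists>t. V i = cscale t (snd (xs ! i)) \<and> t ^ d = fst (xs ! i)"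
    "f = (\<Sum>i<length xs. V i ^ d)"
proof -
  have "\<forall>i. \<exists>t. t ^ d = fst (xs ! i)" using complex_root_exists[OF d] by blast
  then obtain t where t: "\<And>i. t i ^ d = fst (xs ! i)" using choice[of "\<lambda>i t. t ^ d = fst (xs ! i)"] by blast
  have "f = (\<Sum>i<length xs. cscale (t i) (snd (xs ! i)) ^ d)"
    using e unfolding expr_of_def expr_value_nth by (simp add: cscale_power t)
  then show ?thesis
    using expr_of_nth[OF e] t by (intro that[of "\<lambda>i. cscale (t i) (snd (xs ! i))"]) (auto intro: forms_cscale)
qed

text \<open>Needed because \<open>sym_rank\<close> is a \<open>LEAST\<close>, which says something
  only if an expression exists. Powers of the lattice vectors of the simplex suffice.\<close>

lemma powers_span:
  assumes f: "f \<in> forms n d"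
  shows "\<exists>xs. expr_of n d f xs"
proof -
  let ?A = "simplex n d"
  have "\<forall>a\<in>?A. \<exists>p. p \<in> forms n d \<and> (\<forall>b\<in>?A. poly_eval p (lattice_pt b) = (if a = b then 1 else 0))"
  proof
    fix a assume "a \<in> ?A"
    obtain g where g: "form n d g" "\<forall>b\<in>?A. g (lattice_pt b) = (if a = b then 1 else 0)"
      using lattice_interpolation[OF subset_refl, of n d "\<lambda>b. if a = b then 1 else 0"] by blast
    then show "\<exists>p. p \<in> forms n d \<and> (\<forall>b\<in>?A. poly_eval p (lattice_pt b) = (if a = b then 1 else 0))"
      using form_is_poly_eval[OF g(1)] by blast
  qed
  from bchoice[OF this] obtain L where
    L: "\<And>a. a \<in> ?A \<Longrightarrow> L a \<in> forms n d" "\<And>a b. a \<in> ?A \<Longrightarrow> b \<in> ?A \<Longrightarrow> poly_eval (L a) (lattice_pt b) = (if a = b then 1 else 0)"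
    by blast
  \<comment> \<open>\<open>F\<close> is the functional on forms that \<open>f\<close> defines by
    apolarity; its values on the Lagrange basis are the coefficients of the expression.\<close>
  define G where "G \<alpha> = multifact \<alpha> / fact d * lookup f \<alpha>" for \<alpha>
  define F where "F p = (\<Sum>\<alpha>\<in>keys f. lookup p \<alpha> * G \<alpha>)" for p
  have v: "linear_form n (lattice_pt a) \<in> vecs n" for a by (rule vec_vecs)
  have mon: "mon \<alpha> (coord (linear_form n (lattice_pt a))) = mon \<alpha> (lattice_pt a)" if "keys \<alpha> \<subseteq> {0..n}" for \<alpha> a
    unfolding mon_def using that by (intro prod.cong) (auto simp: coord_vec)
  have eq: "f = (\<Sum>a\<in>?A. cscale (F (L a)) (linear_form n (lattice_pt a) ^ d))"
  proof (rule poly_mapping_eqI)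
    fix \<alpha>
    show "lookup f \<alpha> = lookup (\<Sum>a\<in>?A. cscale (F (L a)) (linear_form n (lattice_pt a) ^ d)) \<alpha>"
    proof (cases "keys \<alpha> \<subseteq> {0..n} \<and> mono_degree \<alpha> = d")
      case True
      have s: "single \<alpha> 1 \<in> forms n d" using True by (intro forms_single) auto
      \<comment> \<open>The monomial \<open>\<alpha>\<close> expanded in the Lagrange basis;
        applying \<open>F\<close> to it gives the coefficient of \<open>f\<close> at
        \<open>\<alpha>\<close>.\<close>
      have "(\<Sum>a\<in>?A. cscale (mon \<alpha> (lattice_pt a)) (L a)) = single \<alpha> 1"
      proof (rule poly_eval_inject[OF forms_polys forms_polys])
        show s': "(\<Sum>a\<in>?A. cscale (mon \<alpha> (lattice_pt a)) (L a)) \<in> forms n d" by (intro forms_sum forms_cscale L(1))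
        show "poly_eval (\<Sum>a\<in>?A. cscale (mon \<alpha> (lattice_pt a)) (L a)) x = poly_eval (single \<alpha> 1) x" for x
        proof (rule form_eq_if_lattice[OF form_poly_eval[OF s'] form_poly_eval[OF s]])
          fix b assume b: "b \<in> ?A"
          have "poly_eval (\<Sum>a\<in>?A. cscale (mon \<alpha> (lattice_pt a)) (L a)) (lattice_pt b) = (\<Sum>a\<in>?A. if a = b then mon \<alpha> (lattice_pt b) else 0)"
            unfolding poly_eval_sum poly_eval_cscale using b by (intro sum.cong) (auto simp: L(2))
          then show "poly_eval (\<Sum>a\<in>?A. cscale (mon \<alpha> (lattice_pt a)) (L a)) (lattice_pt b) = poly_eval (single \<alpha> 1) (lattice_pt b)"
            using b by (simp add: finite_idx)
        qed
      qed (rule s)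
      then have lk: "(\<Sum>a\<in>?A. mon \<alpha> (lattice_pt a) * lookup (L a) \<beta>) = (if \<alpha> = \<beta> then 1 else 0)" for \<beta>
        using lookup_sum[of "\<lambda>a. cscale (mon \<alpha> (lattice_pt a)) (L a)" ?A \<beta>] by (simp add: lookup_single when_def)
      have "(\<Sum>a\<in>?A. F (L a) * mon \<alpha> (lattice_pt a)) = (\<Sum>a\<in>?A. \<Sum>\<beta>\<in>keys f. mon \<alpha> (lattice_pt a) * lookup (L a) \<beta> * G \<beta>)"
        unfolding F_def sum_distrib_right by (intro sum.cong refl) (simp only: mult_ac)
      also have "\<dots> = (\<Sum>\<beta>\<in>keys f. \<Sum>a\<in>?A. mon \<alpha> (lattice_pt a) * lookup (L a) \<beta> * G \<beta>)"
        by (rule sum.swap)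
      also have "\<dots> = (\<Sum>\<beta>\<in>keys f. if \<alpha> = \<beta> then G \<beta> else 0)"
        unfolding sum_distrib_right[symmetric] lk by (intro sum.cong) auto
      also have "\<dots> = G \<alpha>" by (simp add: lookup_notin G_def)
      finally have "(\<Sum>a\<in>?A. F (L a) * mon \<alpha> (lattice_pt a)) = G \<alpha>" .
      then show ?thesis
        using True factp_nonzero[of \<alpha>] by (subst lookup_power_sum[where n = n]) (simp_all add: vec_vecs mon G_def)
    next
      case False
      have z: "lookup u \<alpha> = 0" if "u \<in> forms n d" for u
        using formsD[OF that] False by (metis lookup_notin)
      have "(\<Sum>a\<in>?A. cscale (F (L a)) (linear_form n (lattice_pt a) ^ d)) \<in> forms n d" by (intro forms_power_sum vec_vecs)
      then show ?thesis using f by (simp only: z)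
    qed
  qed
  obtain as where as: "set as = ?A" "distinct as" using finite_distinct_list[OF finite_idx] by blast
  have "expr_of n d f (map (\<lambda>a. (F (L a), linear_form n (lattice_pt a))) as)"
    unfolding expr_of_def expr_value_def using vec_vecs eq as
    by (auto simp: sum_list_distinct_conv_sum_set comp_def)
  then show ?thesis ..
qed

lemma expr_of_rank:
  assumes "f \<in> forms_of_rank n d r"
  obtains xs where "expr_of n d f xs" "length xs = r"
proof -
  have f: "f \<in> forms n d" "sym_rank n d f = r" using assms unfolding forms_of_rank_def by auto
  obtain ys where "expr_of n d f ys" using powers_span[OF f(1)] by blast
  then have "\<exists>xs. expr_of n d f xs \<and> length xs = sym_rank n d f"
    unfolding sym_rank_def by (intro LeastI[of "\<lambda>r. \<exists>xs. expr_of n d f xs \<and> length xs = r"]) blast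
  then show ?thesis using f(2) that by blast
qed

section \<open>Uniqueness of decompositions\<close>

text \<open>A zero vector, or two proportional ones, could be removed from the right hand side,
  leaving fewer than \<open>card J\<close> terms against the rank count.\<close>

lemma decomposition_distinct:
  fixes x :: "nat \<Rightarrow> nat \<Rightarrow> complex" and w :: "'s \<Rightarrow> nat \<Rightarrow> complex"
  assumes J: "finite J" and has_lagrange: "has_lagrange n k J x" "has_lagrange n m J x" and d: "0 < m + k"
    and S: "finite S" "card S = card J"
    and eq: "\<And>g. form n (m + k) g \<Longrightarrow> (\<Sum>j\<in>J. g (x j)) = (\<Sum>i\<in>S. c i * g (w i))"
  shows "i \<in> S \<Longrightarrow> c i \<noteq> 0 \<and> w i \<in> zeros_of (vanishing n m J x)"
    and "i \<in> S \<Longrightarrow> nonzero_pt n (w i)"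
    and "i \<in> S \<Longrightarrow> i' \<in> S \<Longrightarrow> ray n (w i) (w i') \<Longrightarrow> i = i'"
proof -
  obtain L where L: "\<And>j. j \<in> J \<Longrightarrow> form n m (L j)" "dual J L x" using has_lagrange(2) unfolding has_lagrange_def by blast
  obtain L' where L': "\<And>j. j \<in> J \<Longrightarrow> form n k (L' j)" "dual J L' x" using has_lagrange(1) unfolding has_lagrange_def by blast
  have 1: "card J \<le> card S'" if "finite S'" and "\<And>g. form n (m + k) g \<Longrightarrow> (\<Sum>j\<in>J. g (x j)) = (\<Sum>i\<in>S'. c' i * g (w i))"
    for S' c' by (rule decomposition_zeros(1)[OF J _ L(2) _ L'(2) that(1)]) (use L(1) L'(1) that(2) in auto)
  show "c i \<noteq> 0 \<and> w i \<in> zeros_of (vanishing n m J x)" if "i \<in> S"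
    by (rule decomposition_zeros(2)[OF J _ L(2) _ L'(2) S(1) _ S(2) that]) (use L(1) L'(1) eq in auto)
  have less: "card (S - {i}) < card J" if "i \<in> S" for i
    using card_Diff1_less[OF S(1) that] S(2) by simp
  show "nonzero_pt n (w i)" if i: "i \<in> S"
  proof (rule ccontr)
    assume "\<not> nonzero_pt n (w i)"
    then have z: "w i l = 0 * w i l" if "l \<le> n" for l using that by (simp add: nonzero_pt_def)
    have "g (w i) = 0" if "form n (m + k) g" for g
      using form_scale_cong[OF that z] by (simp only: zero_power[OF d] mult_zero_left)
    then have "card J \<le> card (S - {i})" using S(1) i by (intro 1[where c' = c]) (simp_all add: eq sum.remove)
    with less[OF i] show False by simp
  qed
  show "i = i'" if ii: "i \<in> S" "i' \<in> S" and r: "ray n (w i) (w i')"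
  proof (rule ccontr)
    assume ne: "i \<noteq> i'"
    obtain t where t: "\<forall>k\<le>n. w i' k = t * w i k" using r unfolding ray_def by blast
    have "(\<Sum>a\<in>S. c a * g (w a)) = (\<Sum>a\<in>S - {i'}. (c(i := c i + c i' * t ^ (m + k))) a * g (w a))"
      if g: "form n (m + k) g" for g
    proof -
      have gi: "g (w i') = t ^ (m + k) * g (w i)" using form_scale_cong[OF g, of "w i'" t "w i"] t by blast
      have "i \<in> S - {i'}" using ii ne by blast
      then show ?thesis using S(1) ii(2) by (simp add: sum.remove gi algebra_simps)
    qed
    then have "card J \<le> card (S - {i'})"
      using S(1) eq by (intro 1[where c' = "c(i := c i + c i' * t ^ (m + k))"]) simp_all
    with less[OF ii(2)] show False by simp
  qed
qed

lemma pindep_family: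
  assumes T: "powers_indep n d T" and A: "finite A" "\<And>a. a \<in> A \<Longrightarrow> z a \<in> T" "\<And>a. a \<in> A \<Longrightarrow> nonzero_pt n (z a)"
    and r: "\<And>a b. a \<in> A \<Longrightarrow> b \<in> A \<Longrightarrow> ray n (z a) (z b) \<Longrightarrow> a = b"
    and eq: "\<And>g. form n d g \<Longrightarrow> (\<Sum>a\<in>A. c a * g (z a)) = 0" and a: "a \<in> A"
  shows "c a = 0"
proof -
  have "ray n y y" for y unfolding ray_def by (intro exI[of _ 1]) simp
  then have inj: "inj_on z A" by (intro inj_onI r) simp_all
  let ?c = "\<lambda>y. c (inv_into A z y)"
  have "\<forall>y\<in>z ` A. ?c y = 0"
  proof (rule T[unfolded powers_indep_def, THEN spec, THEN spec, THEN mp], intro conjI allI impI)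
    fix g assume g: "form n d g"
    show "(\<Sum>y\<in>z ` A. ?c y * g y) = 0" unfolding sum.reindex[OF inj] using eq[OF g] inj by (simp cong: sum.cong)
  qed (use A r in auto)
  then show ?thesis using a inj by simp
qed

lemma ray_sym: "nonzero_pt n z \<Longrightarrow> ray n w z \<Longrightarrow> ray n z w"
proof -
  assume z: "nonzero_pt n z" "ray n w z"
  then obtain c where c: "\<forall>k\<le>n. z k = c * w k" unfolding ray_def by blast
  then have "c \<noteq> 0" using z(1) by (auto simp: nonzero_pt_def)
  then show ?thesis unfolding ray_def using c by (intro exI[of _ "1 / c"]) simp
qed

lemma ray_trans: "ray n x y \<Longrightarrow> ray n y z \<Longrightarrow> ray n x z"
  unfolding ray_def by (metis mult.assoc)

text \<open>Terms on the right that are proportional to one on the left are merged into it;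
  independence of the powers then forces equal coefficients. So a nonzero term on the left has a
  partner, a single one since the points on the right are pairwise non-proportional.\<close>

lemma pindep_match:
  fixes w :: "'s \<Rightarrow> nat \<Rightarrow> complex" and u :: "'t \<Rightarrow> nat \<Rightarrow> complex"
  assumes T: "powers_indep n d T" and fin: "finite I" "finite J"
    and wT: "\<And>i. i \<in> I \<Longrightarrow> w i \<in> T \<and> nonzero_pt n (w i)" and uT: "\<And>j. j \<in> J \<Longrightarrow> u j \<in> T \<and> nonzero_pt n (u j)"
    and wr: "\<And>a b. a \<in> I \<Longrightarrow> b \<in> I \<Longrightarrow> ray n (w a) (w b) \<Longrightarrow> a = b"
    and ur: "\<And>a b. a \<in> J \<Longrightarrow> b \<in> J \<Longrightarrow> ray n (u a) (u b) \<Longrightarrow> a = b"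
    and eq: "\<And>g. form n d g \<Longrightarrow> (\<Sum>i\<in>I. c i * g (w i)) = (\<Sum>j\<in>J. b j * g (u j))"
    and i: "i \<in> I" "c i \<noteq> 0"
  shows "\<exists>j\<in>J. \<exists>t. t \<noteq> 0 \<and> (\<forall>k\<le>n. u j k = t * w i k) \<and> c i = b j * t ^ d"
proof -
  \<comment> \<open>The points on the right without a partner on the left. Together with the points
    on the left they are pairwise non-proportional, as independence requires.\<close>
  define M where "M = {j \<in> J. \<forall>i\<in>I. \<not> ray n (w i) (u j)}"
  have "\<forall>j\<in>J - M. \<exists>i t. i \<in> I \<and> (\<forall>k\<le>n. u j k = t * w i k)" unfolding M_def ray_def by blast
  from bchoice[OF this] obtain p where "\<forall>j\<in>J - M. \<exists>t. p j \<in> I \<and> (\<forall>k\<le>n. u j k = t * w (p j) k)" ..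
  from bchoice[OF this] obtain t where pt: "\<And>j. j \<in> J - M \<Longrightarrow> p j \<in> I"
    "\<And>j k. j \<in> J - M \<Longrightarrow> k \<le> n \<Longrightarrow> u j k = t j * w (p j) k" by blast
  have t0: "t j \<noteq> 0" if "j \<in> J - M" for j using uT[of j] pt(2)[OF that] that by (auto simp: nonzero_pt_def)
  define e where "e i = (\<Sum>j\<in>{j \<in> J - M. p j = i}. b j * t j ^ d)" for i
  define C where "C = case_sum (\<lambda>i. c i - e i) (\<lambda>j. - b j)"
  define z where "z = case_sum w u"
  have "C (Inl i) = 0"
  proof (rule pindep_family[OF T, where A = "I <+> M" and z = z])
    show "finite (I <+> M)" using fin by (simp add: M_def)
    show "z a \<in> T" "nonzero_pt n (z a)" if "a \<in> I <+> M" for a using that wT uT by (auto simp: z_def M_def)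
    show "a = a'" if a: "a \<in> I <+> M" "a' \<in> I <+> M" "ray n (z a) (z a')" for a a'
      using a(1)
    proof (rule PlusE)
      fix x assume x: "x \<in> I" "a = Inl x"
      show ?thesis using a(2)
      proof (rule PlusE)
        fix y assume "y \<in> I" "a' = Inl y"
        then show ?thesis using a(3) x wr by (simp add: z_def)
      next
        fix y assume "y \<in> M" "a' = Inr y"
        then show ?thesis using a(3) x by (simp add: z_def M_def)
      qed
    next
      fix x assume x: "x \<in> M" "a = Inr x"
      show ?thesis using a(2)
      proof (rule PlusE)
        fix y assume y: "y \<in> I" "a' = Inl y"
        then have "nonzero_pt n (w y)" "ray n (u x) (w y)" using a(3) x wT by (simp_all add: z_def)
        then have "ray n (w y) (u x)" by (rule ray_sym)
        then show ?thesis using x y by (simp add: M_def)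
      next
        fix y assume "y \<in> M" "a' = Inr y"
        then show ?thesis using a(3) x ur by (simp add: z_def M_def)
      qed
    qed
    show "Inl i \<in> I <+> M" using i by blast
    fix g assume g: "form n d g"
    have "(\<Sum>j\<in>J - M. b j * g (u j)) = (\<Sum>j\<in>J - M. b j * t j ^ d * g (w (p j)))"
      using form_scale_cong[OF g pt(2)] by (intro sum.cong) simp_all
    also have "\<dots> = (\<Sum>i\<in>I. \<Sum>j\<in>{j \<in> J - M. p j = i}. b j * t j ^ d * g (w (p j)))"
      by (rule sum.group[symmetric]) (use fin pt(1) in auto)
    also have "\<dots> = (\<Sum>i\<in>I. e i * g (w i))"
      unfolding e_def sum_distrib_right by (intro sum.cong refl) simp
    finally have 1: "(\<Sum>j\<in>J - M. b j * g (u j)) = (\<Sum>i\<in>I. e i * g (w i))" .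
    have "(\<Sum>j\<in>J. b j * g (u j)) = (\<Sum>j\<in>J - M. b j * g (u j)) + (\<Sum>j\<in>M. b j * g (u j))"
      using fin(2) by (intro sum.subset_diff) (auto simp: M_def)
    then have "(\<Sum>i\<in>I. (c i - e i) * g (w i)) + (\<Sum>j\<in>M. - b j * g (u j)) = 0"
      using eq[OF g] 1 by (simp add: left_diff_distrib sum_subtractf sum_negf)
    then show "(\<Sum>a\<in>I <+> M. C a * g (z a)) = 0"
      using fin by (subst sum.Plus) (simp_all add: M_def C_def z_def)
  qed
  then have ei: "e i \<noteq> 0" using i(2) by (simp add: C_def)
  have "e i = 0" if "{j \<in> J - M. p j = i} = {}" unfolding e_def that by simp
  with ei obtain j where j: "j \<in> J - M" "p j = i" by blast
  have r: "ray n (w i) (u a)" if "a \<in> J - M" "p a = i" for a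
    unfolding ray_def using pt(2)[OF that(1)] that(2) by (intro exI[of _ "t a"]) simp
  have "{j' \<in> J - M. p j' = i} = {j}"
  proof (intro equalityI subsetI)
    fix j' assume j': "j' \<in> {j' \<in> J - M. p j' = i}"
    have J: "j \<in> J" "j' \<in> J" using j j' by blast+
    have "ray n (u j') (u j)" by (rule ray_trans[OF ray_sym r[OF j]]) (use uT[OF J(2)] r j' in auto)
    then show "j' \<in> {j}" using ur[OF J(2,1)] by simp
  qed (use j in blast)
  then have "e i = b j * t j ^ d" by (simp add: e_def)
  then have "t j \<noteq> 0 \<and> (\<forall>k\<le>n. u j k = t j * w i k) \<and> c i = b j * t j ^ d"
    using \<open>C (Inl i) = 0\<close> t0[OF j(1)] pt(2)[OF j(1)] j(2) by (simp add: C_def)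
  moreover have "j \<in> J" using j(1) by blast
  ultimately show ?thesis by blast
qed

section \<open>The outputs of the algorithm\<close>

definition proper_expr :: "nat \<Rightarrow> (nat \<Rightarrow> complex) set \<Rightarrow> power_expr \<Rightarrow> bool" where
  "proper_expr n T xs \<longleftrightarrow>
     (\<forall>i<length xs. fst (xs ! i) \<noteq> 0 \<and> snd (xs ! i) \<in> vecs n \<and> coord (snd (xs ! i)) \<in> T \<and> nonzero_pt n (coord (snd (xs ! i)))) \<and>
     (\<forall>i<length xs. \<forall>j<length xs. ray n (coord (snd (xs ! i))) (coord (snd (xs ! j))) \<longrightarrow> i = j)"

lemma expr_apply_form:
  assumes "expr_of n d f xs" "expr_of n d f ys" "form n d g"
  shows "(\<Sum>i<length xs. fst (xs ! i) * g (coord (snd (xs ! i)))) = (\<Sum>i<length ys. fst (ys ! i) * g (coord (snd (ys ! i))))"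
proof (rule power_sum_eqD[OF _ _ _ assms(3)])
  show "snd (xs ! i) \<in> vecs n" if "i \<in> {..<length xs}" for i using expr_of_nth[OF assms(1)] that by simp
  show "snd (ys ! i) \<in> vecs n" if "i \<in> {..<length ys}" for i using expr_of_nth[OF assms(2)] that by simp
  show "(\<Sum>i<length xs. cscale (fst (xs ! i)) (snd (xs ! i) ^ d)) = (\<Sum>i<length ys. cscale (fst (ys ! i)) (snd (ys ! i) ^ d))"
    using assms(1,2) unfolding expr_of_def expr_value_nth by simp
qed

text \<open>Matching terms gives a map of indices that is injective, because the points of
  \<open>xs\<close> are pairwise non-proportional; equal lengths make it a permutation.\<close>

lemma expr_equivI:
  assumes T: "powers_indep n d T" and xs: "expr_of n d f xs" "proper_expr n T xs" and ys: "expr_of n d f ys" "proper_expr n T ys"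
    and len: "length xs = length ys"
  shows "expr_equiv d xs ys"
proof -
  let ?N = "length ys"
  let ?w = "\<lambda>i. coord (snd (xs ! i))" and ?u = "\<lambda>i. coord (snd (ys ! i))"
  have "\<exists>j t. j < ?N \<and> t \<noteq> 0 \<and> snd (ys ! j) = cscale t (snd (xs ! i)) \<and> fst (xs ! i) = fst (ys ! j) * t ^ d"
    if i: "i < ?N" for i
  proof -
    have "\<exists>j\<in>{..<length ys}. \<exists>t. t \<noteq> 0 \<and> (\<forall>k\<le>n. ?u j k = t * ?w i k) \<and> fst (xs ! i) = fst (ys ! j) * t ^ d"
      by (rule pindep_match[OF T, where I = "{..<length xs}"])
        (use xs ys i len expr_apply_form[OF xs(1) ys(1)] in \<open>auto simp: proper_expr_def\<close>)
    then obtain j t where jt: "j < ?N" "t \<noteq> 0" "\<forall>k\<le>n. ?u j k = t * ?w i k" "fst (xs ! i) = fst (ys ! j) * t ^ d" by blast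
    have "snd (ys ! j) = cscale t (snd (xs ! i))"
      by (rule vecs_eqI[OF expr_of_nth[OF ys(1) jt(1)] forms_cscale[OF expr_of_nth[OF xs(1)]]])
        (use jt i len in \<open>simp_all add: coord_cscale\<close>)
    then show ?thesis using jt by blast
  qed
  then obtain \<sigma> \<tau> where s: "\<And>i. i < ?N \<Longrightarrow> \<sigma> i < ?N \<and> \<tau> i \<noteq> 0 \<and> snd (ys ! \<sigma> i) = cscale (\<tau> i) (snd (xs ! i)) \<and>
      fst (xs ! i) = fst (ys ! \<sigma> i) * \<tau> i ^ d" by metis
  have inj: "inj_on \<sigma> {..<?N}"
  proof (rule inj_onI)
    fix i i' assume a: "i \<in> {..<?N}" "i' \<in> {..<?N}" "\<sigma> i = \<sigma> i'"
    have "cscale (\<tau> i) (snd (xs ! i)) = cscale (\<tau> i') (snd (xs ! i'))" using s[of i] s[of i'] a by simp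
    then have "\<tau> i * ?w i k = \<tau> i' * ?w i' k" for k unfolding coord_cscale[symmetric] by simp
    then have "?w i' k = (\<tau> i / \<tau> i') * ?w i k" for k using s[of i'] a by (simp add: field_simps)
    then have "ray n (?w i) (?w i')" unfolding ray_def by blast
    then show "i = i'" using xs(2) a len unfolding proper_expr_def by simp
  qed
  then have bij: "\<sigma> ` {..<?N} = {..<?N}" using s by (intro endo_inj_surj) auto
  let ?zs = "map (\<lambda>i. ys ! \<sigma> i) [0..<?N]"
  have "mset ?zs = image_mset ((!) ys) (image_mset \<sigma> (mset_set {..<?N}))"
    by (simp add: atLeast0LessThan image_mset.compositionality comp_def)
  also have "image_mset \<sigma> (mset_set {..<?N}) = mset_set {..<?N}" unfolding image_mset_mset_set[OF inj] bij ..
  also have "image_mset ((!) ys) (mset_set {..<?N}) = mset (map ((!) ys) [0..<?N])"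
    by (simp add: atLeast0LessThan)
  finally have "mset ?zs = mset ys" by (simp only: map_nth)
  moreover have "list_all2 (\<lambda>(a, v) (b, w). \<exists>t. t \<noteq> 0 \<and> w = cscale t v \<and> a = b * t ^ d) xs ?zs"
    unfolding list_all2_conv_all_nth using len s by (auto simp: case_prod_beta)
  ultimately show ?thesis unfolding expr_equiv_def by blast
qed

lemma expr_value_filter: "expr_value d (filter (\<lambda>(c, v). c \<noteq> 0) xs) = expr_value d xs"
  unfolding expr_value_def by (induction xs) auto

lemma step4_expr:
  assumes "cat_step4 n d f Y out"
  shows "expr_of n d f out"
proof -
  obtain vs cs where vs: "set vs \<subseteq> vecs n - {0}" "expr_value d (zip cs vs) = f" "out = filter (\<lambda>(c, v). c \<noteq> 0) (zip cs vs)"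
    using assms unfolding cat_step4_def by blast
  then show ?thesis unfolding expr_of_def using expr_value_filter[of d "zip cs vs"]
    by (auto dest!: set_zip_rightD)
qed

lemma step4_length_card:
  assumes "cat_step4 n d f Y out"
  shows "length out \<le> card Y"
proof -
  obtain vs cs where vs: "distinct (map line vs)" "set (map line vs) = Y" "length cs = length vs"
    "out = filter (\<lambda>(c, v). c \<noteq> 0) (zip cs vs)"
    using assms unfolding cat_step4_def by blast
  have "length out \<le> length vs" using vs(3,4) length_filter_le[of _ "zip cs vs"] by simp
  then show ?thesis using distinct_card[OF vs(1)] vs(2) by simp
qed

locale power_sum =
  fixes n m k :: nat and J :: "nat set" and V :: "nat \<Rightarrow> nat cpoly" and f :: "nat cpoly"
  assumes J: "finite J" and V: "\<And>j. j \<in> J \<Longrightarrow> V j \<in> vecs n"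
    and f: "f = (\<Sum>j\<in>J. V j ^ (m + k))" and d_pos: "0 < m + k"
    and lagr_k: "has_lagrange n k J (\<lambda>j. coord (V j))" and lagr_m: "has_lagrange n m J (\<lambda>j. coord (V j))"
begin

abbreviation "x j \<equiv> coord (V j)"
abbreviation "Ker \<equiv> vanishing n m J x"

lemma cat_ker: "cat_ker n m f = {p \<in> forms n m. \<forall>j\<in>J. poly_eval p (x j) = 0}"
  unfolding f by (rule cat_ker_power_sum[OF J V lagr_k])

lemma poly_eval_cat_ker: "poly_eval ` cat_ker n m f = Ker"
  unfolding cat_ker by (rule poly_eval_van)

lemma cat_ker_forms: "cat_ker n m f \<subseteq> forms n m"
  unfolding cat_ker by blast

lemma cat_rank: "cat_rank n m f = card J"
  unfolding f by (rule cat_rank_power_sum[OF J V lagr_k lagr_m])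

lemma expr_points:
  assumes "expr_of n (m + k) f xs" "form n (m + k) g"
  shows "(\<Sum>j\<in>J. g (x j)) = (\<Sum>i<length xs. fst (xs ! i) * g (coord (snd (xs ! i))))"
proof -
  have "(\<Sum>j\<in>J. 1 * g (x j)) = (\<Sum>i<length xs. fst (xs ! i) * g (coord (snd (xs ! i))))"
    by (rule power_sum_eqD[OF V _ _ assms(2)])
      (use assms(1) f expr_of_nth[OF assms(1)] in \<open>simp_all add: expr_of_def expr_value_nth\<close>)
  then show ?thesis by simp
qed

lemma points_proper:
  assumes "i \<in> J"
  shows "x i \<in> zeros_of Ker" "nonzero_pt n (x i)" "j \<in> J \<Longrightarrow> ray n (x i) (x j) \<Longrightarrow> i = j"
  using decomposition_distinct[OF J lagr_k lagr_m d_pos J refl, of "\<lambda>_. 1" x i] assms by auto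

lemma points_zero_set: "j \<in> J \<Longrightarrow> line (V j) \<in> zero_set n (cat_ker n m f)"
  using line_in_zero_set[OF cat_ker_forms V] points_proper(1,2) nz_coord[OF V] poly_eval_cat_ker by auto

lemma inj_lines: "inj_on (\<lambda>j. line (V j)) J"
  by (intro inj_onI points_proper(3)) (use line_eq_iff V points_proper(2) nz_coord in blast)+

lemma sym_rank_le: "expr_of n (m + k) f xs \<Longrightarrow> card J \<le> length xs"
proof -
  assume e: "expr_of n (m + k) f xs"
  obtain L where L: "\<And>j. j \<in> J \<Longrightarrow> form n m (L j)" "dual J L x" using lagr_m unfolding has_lagrange_def by blast
  obtain L' where L': "\<And>j. j \<in> J \<Longrightarrow> form n k (L' j)" "dual J L' x" using lagr_k unfolding has_lagrange_def by blast
  have "card J \<le> card {..<length xs}"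
    by (rule decomposition_zeros(1)[OF J _ L(2) _ L'(2)]) (use L(1) L'(1) expr_points[OF e] in auto)
  then show ?thesis by simp
qed

lemma sym_rank: "sym_rank n (m + k) f = card J"
  unfolding sym_rank_def
proof (rule Least_equality)
  let ?xs = "map (\<lambda>j. (1, V j)) (sorted_list_of_set J)"
  have "expr_of n (m + k) f ?xs"
    unfolding expr_of_def expr_value_def using J V f
    by (auto simp: comp_def sum_list_distinct_conv_sum_set)
  then show "\<exists>xs. expr_of n (m + k) f xs \<and> length xs = card J" by (intro exI[of _ ?xs]) simp
qed (use sym_rank_le in blast)

lemma proper_decomposition:
  assumes e: "expr_of n (m + k) f xs" and l: "length xs = card J"
    and T: "\<And>i. i < length xs \<Longrightarrow> coord (snd (xs ! i)) \<in> zeros_of Ker \<Longrightarrow> nonzero_pt n (coord (snd (xs ! i))) \<Longrightarrow> coord (snd (xs ! i)) \<in> T"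
  shows "proper_expr n T xs"
proof -
  let ?w = "\<lambda>i. coord (snd (xs ! i))"
  have c: "card {..<length xs} = card J" using l by simp
  have eq: "(\<Sum>j\<in>J. g (x j)) = (\<Sum>i\<in>{..<length xs}. fst (xs ! i) * g (?w i))" if "form n (m + k) g" for g
    by (rule expr_points[OF e that])
  note dd = decomposition_distinct[OF J lagr_k lagr_m d_pos finite_lessThan c, of "\<lambda>i. fst (xs ! i)" ?w, OF eq]
  have 1: "fst (xs ! i) \<noteq> 0 \<and> ?w i \<in> zeros_of Ker \<and> nonzero_pt n (?w i)" if "i < length xs" for i
    using dd(1,2)[of i] that by simp
  have 2: "i = j" if "i < length xs" "j < length xs" "ray n (?w i) (?w j)" for i j
    using dd(3)[of i j] that by simp
  show ?thesis unfolding proper_expr_def using 1 2 T expr_of_nth[OF e] by simp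
qed

text \<open>Coefficient 1 at the \<open>V j\<close> and 0 at all other points solves the linear
  system.\<close>

lemma step4_exists:
  assumes Y: "finite Y" "Y \<subseteq> proj_space n" "\<And>j. j \<in> J \<Longrightarrow> line (V j) \<in> Y"
  shows "\<exists>out. cat_step4 n (m + k) f Y out"
proof -
  obtain ls where ls: "set ls = Y - (\<lambda>j. line (V j)) ` J" "distinct ls"
    using finite_distinct_list[of "Y - (\<lambda>j. line (V j)) ` J"] Y(1) by auto
  define rep where "rep l = (SOME v. v \<in> vecs n \<and> v \<noteq> 0 \<and> line v = l)" for l
  have rep: "rep l \<in> vecs n \<and> rep l \<noteq> 0 \<and> line (rep l) = l" if "l \<in> Y" for l
    unfolding rep_def by (rule someI_ex) (use Y(2) that proj_spaceE[of l n] in blast)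
  let ?js = "sorted_list_of_set J"
  let ?vs = "map V ?js @ map rep ls"
  let ?cs = "replicate (length ?js) 1 @ replicate (length ls) (0 :: complex)"
  have V0: "V j \<noteq> 0" if "j \<in> J" for j using points_proper(2)[OF that] nz_coord[OF V[OF that]] by simp
  have ml: "map line (map rep ls) = ls" using rep ls(1) by (auto intro!: map_idI)
  have mj: "distinct (map line (map V ?js))" using inj_lines J by (simp add: distinct_map comp_def)
  have "zip ?cs ?vs = map (\<lambda>j. (1, V j)) ?js @ map (\<lambda>l. (0, rep l)) ls"
    by (simp add: zip_replicate1 comp_def)
  then have "expr_value (m + k) (zip ?cs ?vs) = f"
    unfolding expr_value_def f using J by (simp add: comp_def sum_list_distinct_conv_sum_set)
  moreover have "set ?vs \<subseteq> vecs n - {0}" using V V0 rep ls(1) J by auto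
  moreover have "distinct (map line ?vs)" "set (map line ?vs) = Y"
    unfolding map_append ml using mj ls Y(3) J by (auto simp: comp_def)
  ultimately show ?thesis unfolding cat_step4_def by (intro exI[of _ ?vs] exI[of _ ?cs] exI) auto
qed

text \<open>Even with extra points in \<open>Y\<close>, independence matches the terms that survive
  with distinct \<open>V j\<close>, so no solution of the linear system is longer than the
  rank.\<close>

lemma step4_length:
  assumes T: "powers_indep n (m + k) (zeros_of Ker)" and Y: "Y \<subseteq> zero_set n (cat_ker n m f)" and c4: "cat_step4 n (m + k) f Y out"
  shows "length out \<le> card J"
proof -
  obtain vs cs where vs: "set vs \<subseteq> vecs n - {0}" "distinct (map line vs)" "set (map line vs) = Y"
    "length cs = length vs" "expr_value (m + k) (zip cs vs) = f" "out = filter (\<lambda>(c, v). c \<noteq> 0) (zip cs vs)"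
    using c4 unfolding cat_step4_def by blast
  let ?N = "length vs"
  let ?S = "{i \<in> {..<?N}. cs ! i \<noteq> 0}"
  have vin: "vs ! i \<in> vecs n" "vs ! i \<noteq> 0" if "i < ?N" for i using vs(1) that nth_mem by blast+
  have e: "expr_of n (m + k) f (zip cs vs)" unfolding expr_of_def using vs(1,5) by (auto dest: set_zip_rightD)
  have w: "coord (vs ! i) \<in> zeros_of Ker \<and> nonzero_pt n (coord (vs ! i))" if i: "i < ?N" for i
  proof -
    have "line (vs ! i) \<in> zero_set n (cat_ker n m f)" using Y vs(3) i nth_mem[OF i] by auto
    then show ?thesis using line_in_zero_set[OF cat_ker_forms vin[OF i]] nz_coord vin[OF i] poly_eval_cat_ker by auto
  qed
  have wr: "i = j" if "i < ?N" "j < ?N" "ray n (coord (vs ! i)) (coord (vs ! j))" for i j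
  proof -
    have "map line vs ! i = map line vs ! j"
      using line_eq_iff[OF vin(1)[OF that(1)] vin[OF that(2)]] that by simp
    then show ?thesis using vs(2) that nth_eq_iff_index_eq[OF vs(2)] by simp
  qed
  have eq: "(\<Sum>i\<in>{..<?N}. cs ! i * g (coord (vs ! i))) = (\<Sum>j\<in>J. 1 * g (x j))" if "form n (m + k) g" for g
    using expr_points[OF e that] vs(4) by simp
  have "\<exists>j. j \<in> J \<and> (\<exists>t. t \<noteq> 0 \<and> (\<forall>k\<le>n. x j k = t * coord (vs ! i) k))" if i: "i \<in> ?S" for i
  proof -
    have "\<exists>j\<in>J. \<exists>t. t \<noteq> 0 \<and> (\<forall>k\<le>n. x j k = t * coord (vs ! i) k) \<and> cs ! i = 1 * t ^ (m + k)"
      by (rule pindep_match[OF T finite_lessThan J _ _ _ _ eq]) (use w wr points_proper i in auto)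
    then show ?thesis by blast
  qed
  then have "\<forall>i\<in>?S. \<exists>j. j \<in> J \<and> (\<exists>t. t \<noteq> 0 \<and> (\<forall>k\<le>n. x j k = t * coord (vs ! i) k))" by blast
  from bchoice[OF this] obtain \<sigma> where
    s: "\<And>i. i \<in> ?S \<Longrightarrow> \<sigma> i \<in> J \<and> (\<exists>t. t \<noteq> 0 \<and> (\<forall>k\<le>n. x (\<sigma> i) k = t * coord (vs ! i) k))" by blast
  have "inj_on \<sigma> ?S"
  proof (rule inj_onI)
    fix i i' assume a: "i \<in> ?S" "i' \<in> ?S" "\<sigma> i = \<sigma> i'"
    obtain t where t: "t \<noteq> 0" "\<forall>k\<le>n. x (\<sigma> i) k = t * coord (vs ! i) k" using s[OF a(1)] by blast
    obtain t' where t': "t' \<noteq> 0" "\<forall>k\<le>n. x (\<sigma> i) k = t' * coord (vs ! i') k" using s[OF a(2)] a(3) by auto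
    have "ray n (coord (vs ! i)) (coord (vs ! i'))"
      unfolding ray_def
    proof (intro exI allI impI)
      fix k assume "k \<le> n"
      then have "t * coord (vs ! i) k = t' * coord (vs ! i') k" using t t' by simp
      then show "coord (vs ! i') k = (t / t') * coord (vs ! i) k" using t' by (simp add: field_simps)
    qed
    then show "i = i'" using wr a by simp
  qed
  then have "card ?S \<le> card J" using s J by (intro card_inj_on_le) auto
  moreover have "length out = card ?S"
    unfolding vs(6) length_filter_conv_card using vs(4) by (auto intro!: arg_cong[of _ _ card] simp: case_prod_beta)
  ultimately show ?thesis by simp
qed

lemma unique_decomposition:
  assumes T: "powers_indep n (m + k) T" and e: "expr_of n (m + k) f out" "length out \<le> card J"
    and pr: "\<And>xs. expr_of n (m + k) f xs \<Longrightarrow> length xs = card J \<Longrightarrow> proper_expr n T xs"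
  shows "unique_waring_decomposition n (m + k) f out"
proof -
  have l: "length out = card J" using e sym_rank_le[OF e(1)] by simp
  show ?thesis
    unfolding unique_waring_decomposition_def waring_decomposition_def sym_rank
  proof (intro conjI allI impI e(1) l)
    fix ys assume ys: "expr_of n (m + k) f ys \<and> length ys = card J"
    show "expr_equiv (m + k) out ys"
      by (rule expr_equivI[OF T e(1) pr[OF e(1) l]]) (use ys pr[of ys] l in auto)
  qed
qed

lemma cat_algorithm_unique:
  assumes red: "reduced_on n m Ker W" and ord: "cat_order (m + k) = m" and T: "powers_indep n (m + k) (zeros_of Ker)"
  shows "produces_unique_waring cat_algorithm n (m + k) f"
proof -
  have zs: "cat_zero_set n (m + k) f = zero_set n (cat_ker n m f)" unfolding cat_zero_set_def ord ..
  have fin: "finite (zero_set n (cat_ker n m f))"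
    by (rule finite_zero_set[OF cat_ker_forms]) (use red poly_eval_cat_ker in simp)
  have s3: "cat_step3 n (m + k) f"
    unfolding cat_step3_def zs ord using fin red reduced_zero_schemeI[OF cat_ker_forms] poly_eval_cat_ker by simp
  have "\<exists>out. cat_step4 n (m + k) f (zero_set n (cat_ker n m f)) out"
    by (rule step4_exists[OF fin _ points_zero_set]) (auto simp: zero_set_def)
  moreover have "unique_waring_decomposition n (m + k) f out"
    if "cat_step4 n (m + k) f (zero_set n (cat_ker n m f)) out" for out
    by (rule unique_decomposition[OF T step4_expr[OF that] step4_length[OF T subset_refl that]])
      (rule proper_decomposition, assumption+)
  ultimately show ?thesis unfolding produces_unique_waring_def cat_algorithm_def zs using s3 by blast
qed

text \<open>Independence is available only for the rays of the \<open>V j\<close>; the assumption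
  \<open>only\<close> places the points of every minimal expression there. The length of an output
  is bounded by the size of the subset instead.\<close>

lemma cat_algorithm_subsets_unique:
  assumes red: "reduced_on n m Ker W" and ord: "cat_order (m + k) = m"
    and only: "\<And>xs i. expr_of n (m + k) f xs \<Longrightarrow> length xs = card J \<Longrightarrow> i < length xs \<Longrightarrow>
      coord (snd (xs ! i)) \<in> zeros_of Ker \<Longrightarrow> nonzero_pt n (coord (snd (xs ! i))) \<Longrightarrow> \<exists>j\<in>J. ray n (x j) (coord (snd (xs ! i)))"
  shows "produces_unique_waring cat_algorithm_subsets n (m + k) f"
proof -
  let ?T = "{z. \<exists>j\<in>J. ray n (x j) z}"
  have zs: "cat_zero_set n (m + k) f = zero_set n (cat_ker n m f)" unfolding cat_zero_set_def ord ..
  have fin: "finite (zero_set n (cat_ker n m f))"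
    by (rule finite_zero_set[OF cat_ker_forms]) (use red poly_eval_cat_ker in simp)
  have s3: "cat_step3 n (m + k) f"
    unfolding cat_step3_def zs ord using fin red reduced_zero_schemeI[OF cat_ker_forms] poly_eval_cat_ker by simp
  have T: "powers_indep n (m + k) ?T" by (rule pindep_points[OF lagr_k lagr_m]) blast
  let ?Y = "(\<lambda>j. line (V j)) ` J"
  have Y: "?Y \<subseteq> zero_set n (cat_ker n m f)" "card ?Y = card J" using points_zero_set card_image[OF inj_lines] by blast+
  have "?Y \<subseteq> proj_space n" using Y(1) by (auto simp: zero_set_def)
  then have "\<exists>out. cat_step4 n (m + k) f ?Y out" using J by (intro step4_exists) auto
  moreover have "unique_waring_decomposition n (m + k) f out"
    if "cat_step4 n (m + k) f Y out" "card Y = card J" for Y out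
  proof (rule unique_decomposition[OF T step4_expr[OF that(1)]])
    show "length out \<le> card J" using step4_length_card[OF that(1)] that(2) by simp
    show "proper_expr n ?T xs" if "expr_of n (m + k) f xs" "length xs = card J" for xs
      by (rule proper_decomposition[OF that]) (use only[OF that] in blast)
  qed
  ultimately show ?thesis
    unfolding produces_unique_waring_def cat_algorithm_subsets_def zs ord cat_rank using s3 Y by blast
qed

end

section \<open>General power sums\<close>

definition multidegrees :: "nat \<Rightarrow> nat \<Rightarrow> (nat \<Rightarrow>\<^sub>0 nat) set" where
  "multidegrees n d = {\<beta>. keys \<beta> \<subseteq> {0..n} \<and> mono_degree \<beta> = d}"

definition power_coeff :: "nat \<Rightarrow> nat set \<Rightarrow> (nat \<Rightarrow>\<^sub>0 nat) \<Rightarrow> (nat \<times> nat \<Rightarrow> complex) \<Rightarrow> complex" where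
  "power_coeff d J \<beta> v = fact d / multifact \<beta> * (\<Sum>j\<in>J. mon \<beta> (point v j))"

text \<open>By \<open>power_coeff_dd_pairing\<close>, in the spirit of Terracini's lemma, a form
  singular at all points is a functional that kills the image of the differential of the power sum
  map. So the tangent space at \<open>y\<close> is contained in that at \<open>x\<close>.\<close>

definition tangent_transfer :: "nat \<Rightarrow> nat \<Rightarrow> nat set \<Rightarrow> (nat \<Rightarrow> nat \<Rightarrow> complex) \<Rightarrow> (nat \<Rightarrow> nat \<Rightarrow> complex) \<Rightarrow> bool" where
  "tangent_transfer n d J x y \<longleftrightarrow>
     (\<forall>g. form n d g \<longrightarrow> (\<forall>j\<in>J. \<forall>u. dd g (x j) u = 0) \<longrightarrow> (\<forall>j\<in>J. \<forall>u. dd g (y j) u = 0))"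

lemma finite_mults: "finite (multidegrees n d)"
proof (rule finite_imageD)
  show "finite (lookup ` multidegrees n d)"
  proof (rule finite_subset)
    show "finite {f. \<forall>i. (i \<in> {0..n} \<longrightarrow> f i \<in> {0..d}) \<and> (i \<notin> {0..n} \<longrightarrow> f i = 0)}"
      by (rule finite_set_of_finite_funs) simp_all
    show "lookup ` multidegrees n d \<subseteq> {f. \<forall>i. (i \<in> {0..n} \<longrightarrow> f i \<in> {0..d}) \<and> (i \<notin> {0..n} \<longrightarrow> f i = 0)}"
    proof
      fix f assume "f \<in> lookup ` multidegrees n d"
      then obtain \<beta> where b: "f = lookup \<beta>" "keys \<beta> \<subseteq> {0..n}" "mono_degree \<beta> = d" unfolding multidegrees_def by blast
      have "lookup \<beta> i \<le> d" for i
        unfolding b(3)[symmetric] mono_degree_def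
        by (cases "i \<in> keys \<beta>") (simp_all add: member_le_sum lookup_notin)
      moreover have "lookup \<beta> i = 0" if "i \<notin> {0..n}" for i using b(2) that by (intro lookup_notin) blast
      ultimately show "f \<in> {f. \<forall>i. (i \<in> {0..n} \<longrightarrow> f i \<in> {0..d}) \<and> (i \<notin> {0..n} \<longrightarrow> f i = 0)}" using b(1) by simp
    qed
  qed
  show "inj_on lookup (multidegrees n d)" by (intro inj_onI) (simp add: lookup_inject)
qed

lemma pol_power_coeff: "\<beta> \<in> multidegrees n d \<Longrightarrow> pol (J \<times> {..n}) (power_coeff d J \<beta>)"
  unfolding power_coeff_def[abs_def] multidegrees_def
  using form_mon[of \<beta> n] by (intro pol_mult pol_sum pol_const) (auto intro: pol_row)

lemma lookup_vec_power_sum: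
  "lookup (\<Sum>j\<in>J. linear_form n (point v j) ^ d) \<beta> = (if \<beta> \<in> multidegrees n d then power_coeff d J \<beta> v else 0)"
proof -
  have l: "lookup (\<Sum>j\<in>J. cscale 1 (linear_form n (point v j) ^ d)) \<beta> =
    (if mono_degree \<beta> = d then fact d / multifact \<beta> * (\<Sum>j\<in>J. 1 * mon \<beta> (coord (linear_form n (point v j)))) else 0)"
    by (rule lookup_power_sum) (rule vec_vecs)
  have f: "(\<Sum>j\<in>J. cscale 1 (linear_form n (point v j) ^ d)) \<in> forms n d" by (intro forms_power_sum vec_vecs)
  show ?thesis
  proof (cases "\<beta> \<in> multidegrees n d")
    case True
    have "mon \<beta> (coord (linear_form n (point v j))) = mon \<beta> (point v j)" for j
      unfolding mon_def using True by (intro prod.cong) (auto simp: coord_vec multidegrees_def)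
    then show ?thesis using True l by (simp add: power_coeff_def multidegrees_def)
  next
    case False
    then have "\<beta> \<notin> keys (\<Sum>j\<in>J. cscale 1 (linear_form n (point v j) ^ d))" using formsD[OF f] unfolding multidegrees_def by blast
    then show ?thesis using False by (simp add: lookup_notin)
  qed
qed

lemma dd_rows:
  assumes "form n t g" "finite J"
  shows "dd (\<lambda>v. \<Sum>j\<in>J. g (point v j)) v u = (\<Sum>j\<in>J. dd g (point v j) (point u j))"
proof -
  have "dd (\<lambda>v. \<Sum>j\<in>J. g (point v j)) v u = (\<Sum>j\<in>J. dd (\<lambda>v. g (point v j)) v u)"
    by (rule dd_sum[of _ "J \<times> {..n}"]) (use assms pol_row in auto)
  also have "\<dots> = (\<Sum>j\<in>J. dd g (point v j) (point u j))" unfolding dd_def point_def ..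
  finally show ?thesis .
qed

lemma power_coeff_pairing:
  assumes p: "p \<in> forms n d"
  shows "(\<Sum>\<beta>\<in>multidegrees n d. lookup p \<beta> * multifact \<beta> / fact d * power_coeff d J \<beta> v) = (\<Sum>j\<in>J. poly_eval p (point v j))"
proof -
  have "keys p \<subseteq> multidegrees n d" using formsD[OF p] unfolding multidegrees_def by blast
  then have "poly_eval p x = (\<Sum>\<beta>\<in>multidegrees n d. lookup p \<beta> * mon \<beta> x)" for x
    by (rule poly_eval_superset[OF finite_mults])
  then have "(\<Sum>j\<in>J. poly_eval p (point v j)) = (\<Sum>j\<in>J. \<Sum>\<beta>\<in>multidegrees n d. lookup p \<beta> * mon \<beta> (point v j))"
    by simp
  also have "\<dots> = (\<Sum>\<beta>\<in>multidegrees n d. lookup p \<beta> * (\<Sum>j\<in>J. mon \<beta> (point v j)))"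
    unfolding sum_distrib_left by (rule sum.swap)
  also have "\<dots> = (\<Sum>\<beta>\<in>multidegrees n d. lookup p \<beta> * multifact \<beta> / fact d * power_coeff d J \<beta> v)"
    by (intro sum.cong) (simp_all add: power_coeff_def factp_nonzero)
  finally show ?thesis by simp
qed

lemma power_coeff_dd_pairing:
  assumes p: "p \<in> forms n d" and J: "finite J"
  shows "(\<Sum>\<beta>\<in>multidegrees n d. lookup p \<beta> * multifact \<beta> / fact d * dd (power_coeff d J \<beta>) v u) =
    (\<Sum>j\<in>J. dd (poly_eval p) (point v j) (point u j))"
proof -
  have I: "finite (J \<times> {..n})" using J by simp
  have "(\<Sum>\<beta>\<in>multidegrees n d. lookup p \<beta> * multifact \<beta> / fact d * dd (power_coeff d J \<beta>) v u) =
    (\<Sum>\<beta>\<in>multidegrees n d. dd (\<lambda>v. lookup p \<beta> * multifact \<beta> / fact d * power_coeff d J \<beta> v) v u)"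
    by (intro sum.cong refl dd_cmult[symmetric, OF pol_power_coeff I])
  also have "\<dots> = dd (\<lambda>v. \<Sum>\<beta>\<in>multidegrees n d. lookup p \<beta> * multifact \<beta> / fact d * power_coeff d J \<beta> v) v u"
    by (rule dd_sum[symmetric, OF _ I]) (intro pol_mult pol_const pol_power_coeff)
  also have "\<dots> = (\<Sum>j\<in>J. dd (poly_eval p) (point v j) (point u j))"
    unfolding power_coeff_pairing[OF p] by (rule dd_rows[OF form_poly_eval[OF p] J])
  finally show ?thesis .
qed

lemma forms_of_rank_power_sum:
  assumes f: "f \<in> forms_of_rank n d r" and d: "0 < d"
  obtains v where "f = (\<Sum>j=1..r. linear_form n (point v j) ^ d)"
proof -
  obtain xs where xs: "expr_of n d f xs" "length xs = r" using expr_of_rank[OF f] .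
  obtain V where V: "\<And>i. i < length xs \<Longrightarrow> V i \<in> vecs n" "f = (\<Sum>i<length xs. V i ^ d)"
    using absorb_coefficients[OF d xs(1)] by metis
  let ?v = "\<lambda>(j, k). coord (V (j - 1)) k"
  have "(\<Sum>j=1..r. linear_form n (point ?v j) ^ d) = (\<Sum>i<r. linear_form n (point ?v (Suc i)) ^ d)"
    by (simp only: One_nat_def sum.atLeast1_atMost_eq)
  also have "\<dots> = f" unfolding V(2) xs(2) using V(1) xs(2) by (intro sum.cong refl) (simp add: point_def vec_coord)
  finally show ?thesis using that[of ?v] by metis
qed

text \<open>The polynomial from \<open>generic_transfer\<close> is evaluated at the coefficients of
  the sum, so it treats all \<open>V'\<close> with this sum alike; hence \<open>Q\<close> may use
  \<open>G\<close> for each of them. Density holds because the forms of rank \<open>r\<close> are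
  values of the power sum map, which is polynomial on an affine space.\<close>

lemma general_power_sums:
  fixes G :: "(nat \<Rightarrow> nat \<Rightarrow> complex) \<Rightarrow> bool"
  assumes d: "0 < d" and near: "eventually (\<lambda>v. G (point v)) (zariski_at ({1..r} \<times> {..n}) v0)"
    and jac: "\<And>i l. i \<in> {1..r} \<Longrightarrow> l \<le> n \<Longrightarrow>
      \<exists>g. form n d g \<and> (\<forall>j\<in>{1..r}. \<forall>u. dd g (point v0 j) u = (if i = j then u l else 0))"
    and Q: "\<And>V. (\<And>j. j \<in> {1..r} \<Longrightarrow> V j \<in> vecs n) \<Longrightarrow>
      (\<And>V'. (\<And>j. j \<in> {1..r} \<Longrightarrow> V' j \<in> vecs n) \<Longrightarrow> (\<Sum>j=1..r. V' j ^ d) = (\<Sum>j=1..r. V j ^ d) \<Longrightarrow>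
        G (\<lambda>j. coord (V' j)) \<and> tangent_transfer n d {1..r} (\<lambda>j. coord (V j)) (\<lambda>j. coord (V' j))) \<Longrightarrow>
      sym_rank n d (\<Sum>j=1..r. V j ^ d) = r \<and> Q (\<Sum>j=1..r. V j ^ d)"
  shows "for_general (forms_of_rank n d r) Q"
proof -
  let ?J = "{1..r}" and ?B = "multidegrees n d"
  let ?I = "?J \<times> {..n}"
  let ?\<phi> = "power_coeff d ?J"
  let ?s = "\<lambda>v. \<Sum>j=1..r. linear_form n (point v j) ^ d"
  have "\<forall>c\<in>?I. \<exists>p. p \<in> forms n d \<and> (\<forall>j\<in>?J. \<forall>u. dd (poly_eval p) (point v0 j) u = (if fst c = j then u (snd c) else 0))"
  proof
    fix c assume "c \<in> ?I"
    then have "fst c \<in> ?J" "snd c \<le> n" by auto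
    from jac[OF this] obtain g where g: "form n d g" "\<forall>j\<in>?J. \<forall>u. dd g (point v0 j) u = (if fst c = j then u (snd c) else 0)" by blast
    obtain p where "p \<in> forms n d" "poly_eval p = g" using form_is_poly_eval[OF g(1)] by blast
    then show "\<exists>p. p \<in> forms n d \<and> (\<forall>j\<in>?J. \<forall>u. dd (poly_eval p) (point v0 j) u = (if fst c = j then u (snd c) else 0))"
      using g(2) by blast
  qed
  from bchoice[OF this] obtain p where pp: "\<forall>c\<in>?I. p c \<in> forms n d \<and>
    (\<forall>j\<in>?J. \<forall>u. dd (poly_eval (p c)) (point v0 j) u = (if fst c = j then u (snd c) else 0))" ..
  have p: "p c \<in> forms n d"
    "\<And>j u. j \<in> ?J \<Longrightarrow> dd (poly_eval (p c)) (point v0 j) u = (if fst c = j then u (snd c) else 0)"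
    if "c \<in> ?I" for c using bspec[OF pp that] by simp_all
  \<comment> \<open>Read as functionals on coefficients, the forms given by \<open>jac\<close> are a
    left inverse of the Jacobian of the coefficient map.\<close>
  have jc: "(\<Sum>\<beta>\<in>?B. lookup (p c) \<beta> * multifact \<beta> / fact d * dd (?\<phi> \<beta>) v0 (unitv c')) = (if c = c' then 1 else 0)"
    if c: "c \<in> ?I" for c c'
  proof -
    have "(\<Sum>\<beta>\<in>?B. lookup (p c) \<beta> * multifact \<beta> / fact d * dd (?\<phi> \<beta>) v0 (unitv c')) =
      (\<Sum>j\<in>?J. if fst c = j then point (unitv c') j (snd c) else 0)"
      unfolding power_coeff_dd_pairing[OF p(1)[OF c] finite_atLeastAtMost] by (intro sum.cong refl p(2)[OF c])
    also have "\<dots> = point (unitv c') (fst c) (snd c)" using c by (subst sum.delta') auto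
    finally show ?thesis by (auto simp: point_def unitv_def)
  qed
  have "\<exists>P. pol ?B P \<and> (\<exists>v. P (\<lambda>b. ?\<phi> b v) \<noteq> 0) \<and> (\<forall>v. P (\<lambda>b. ?\<phi> b v) \<noteq> 0 \<longrightarrow> G (point v) \<and>
    (\<forall>w. (\<forall>b\<in>?B. ?\<phi> b w = ?\<phi> b v) \<longrightarrow>
      (\<forall>x. (\<forall>u. (\<Sum>b\<in>?B. x b * dd (?\<phi> b) v u) = 0) \<longrightarrow> (\<forall>u. (\<Sum>b\<in>?B. x b * dd (?\<phi> b) w u) = 0))))"
  proof (rule generic_transfer[where a = "\<lambda>c \<beta>. lookup (p c) \<beta> * multifact \<beta> / fact d", OF _ finite_mults _ _ near])
    show "pol ?I (?\<phi> b)" if "b \<in> ?B" for b by (rule pol_power_coeff[OF that])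
    show "(\<Sum>\<beta>\<in>?B. lookup (p c) \<beta> * multifact \<beta> / fact d * dd (?\<phi> \<beta>) v0 (unitv c')) = (if c = c' then 1 else 0)"
      if "c \<in> ?I" for c c' by (rule jc[OF that])
  qed simp
  then obtain P where P0: "pol ?B P" "\<exists>v. P (\<lambda>b. ?\<phi> b v) \<noteq> 0" "\<forall>v. P (\<lambda>b. ?\<phi> b v) \<noteq> 0 \<longrightarrow> G (point v) \<and>
    (\<forall>w. (\<forall>b\<in>?B. ?\<phi> b w = ?\<phi> b v) \<longrightarrow>
      (\<forall>x. (\<forall>u. (\<Sum>b\<in>?B. x b * dd (?\<phi> b) v u) = 0) \<longrightarrow> (\<forall>u. (\<Sum>b\<in>?B. x b * dd (?\<phi> b) w u) = 0)))"
    by (elim exE conjE) (rule that, assumption, rule exI, assumption+)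
  note P = P0(1,2)
  have PG: "G (point v)" if "P (\<lambda>b. ?\<phi> b v) \<noteq> 0" for v
    by (rule P0(3)[THEN spec, THEN mp, OF that, THEN conjunct1])
  have PT: "(\<Sum>b\<in>?B. x b * dd (?\<phi> b) w u) = 0"
    if 1: "P (\<lambda>b. ?\<phi> b v) \<noteq> 0" and 2: "\<And>b. b \<in> ?B \<Longrightarrow> ?\<phi> b w = ?\<phi> b v"
      and 3: "\<And>u. (\<Sum>b\<in>?B. x b * dd (?\<phi> b) v u) = 0" for v w x u
    using P0(3)[THEN spec, THEN mp, OF 1, THEN conjunct2, THEN spec, of w] 2 3 by blast
  obtain p' where p': "\<And>x. poly_eval p' x = P x" using pol_cpoly[OF P(1)] by blast
  have ev: "poly_eval p' (lookup (?s v)) = P (\<lambda>b. ?\<phi> b v)" for v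
    unfolding p' by (rule pol_cong[OF P(1)]) (simp add: lookup_vec_power_sum)
  have key: "sym_rank n d (?s v) = r \<and> Q (?s v)" if v: "P (\<lambda>b. ?\<phi> b v) \<noteq> 0" for v
  proof (rule Q)
    show "linear_form n (point v j) \<in> vecs n" for j by (rule vec_vecs)
    fix V' :: "nat \<Rightarrow> nat cpoly"
    assume V': "\<And>j. j \<in> ?J \<Longrightarrow> V' j \<in> vecs n" "(\<Sum>j=1..r. V' j ^ d) = ?s v"
    have coords: "?s (\<lambda>(j, k). coord (W j) k) = (\<Sum>j=1..r. W j ^ d)"
      if "\<And>j. j \<in> ?J \<Longrightarrow> W j \<in> vecs n" for W
      using that by (intro sum.cong refl) (simp add: point_def vec_coord)
    \<comment> \<open>Entries of \<open>v\<close> with second index above \<open>n\<close> are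
      arbitrary, whereas those of \<open>?v\<close> are 0; passing to \<open>?v\<close> makes its
      rows equal to the coordinates of the vectors.\<close>
    let ?w = "\<lambda>(j, k). coord (V' j) k" and ?v = "\<lambda>(j, k). coord (linear_form n (point v j)) k"
    have s: "?s ?w = ?s v" "?s ?v = ?s v"
      using coords[of V'] coords[of "\<lambda>j. linear_form n (point v j)"] V' vec_vecs by simp_all
    have \<phi>: "?\<phi> b ?w = ?\<phi> b ?v" if "b \<in> ?B" for b
      using arg_cong[OF s(1), of "\<lambda>f. lookup f b"] arg_cong[OF s(2), of "\<lambda>f. lookup f b"] that
      by (simp add: lookup_vec_power_sum)
    have nonzero_pt: "P (\<lambda>b. ?\<phi> b ?w) \<noteq> 0" "P (\<lambda>b. ?\<phi> b ?v) \<noteq> 0" using v ev[of v] ev[of ?w] ev[of ?v] s by simp_all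
    have rows: "point ?w = (\<lambda>j. coord (V' j))" "point ?v = (\<lambda>j. coord (linear_form n (point v j)))" by (simp_all add: point_def fun_eq_iff)
    have "tangent_transfer n d ?J (point ?v) (point ?w)"
      unfolding tangent_transfer_def
    proof (intro allI impI ballI)
      fix g and j :: nat and u :: "nat \<Rightarrow> complex"
      assume g: "form n d g" and 0: "\<forall>j\<in>?J. \<forall>u. dd g (point ?v j) u = 0" and j: "j \<in> ?J"
      obtain q where q: "q \<in> forms n d" "poly_eval q = g" using form_is_poly_eval[OF g] by blast
      \<comment> \<open>A tangent vector that moves only the point with index \<open>j\<close>,
        which isolates the differential of \<open>g\<close> there.\<close>
      let ?u = "\<lambda>(i, k). if i = j then u k else 0"
      let ?x = "\<lambda>\<beta>. lookup q \<beta> * multifact \<beta> / fact d"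
      note pair = power_coeff_dd_pairing[OF q(1) finite_atLeastAtMost[of 1 r], unfolded q(2)]
      have "(\<Sum>b\<in>?B. ?x b * dd (?\<phi> b) ?w ?u) = 0"
        by (rule PT[OF nonzero_pt(2) \<phi>]) (simp_all only: pair 0 sum.neutral_const cong: sum.cong)
      then have "(\<Sum>i\<in>?J. dd g (point ?w i) (point ?u i)) = 0" unfolding pair .
      moreover have "(\<Sum>i\<in>?J. dd g (point ?w i) (point ?u i)) = (\<Sum>i\<in>?J. if i = j then dd g (point ?w j) u else 0)"
      proof (intro sum.cong refl)
        fix i
        have "dd g x (\<lambda>_. 0) = 0" for x
          by (rule dd_eqI) simp
        then show "dd g (point ?w i) (point ?u i) = (if i = j then dd g (point ?w j) u else 0)"
          by (simp add: point_def)
      qed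
      ultimately show "dd g (point ?w j) u = 0" using j by simp
    qed
    then show "G (\<lambda>j. coord (V' j)) \<and> tangent_transfer n d ?J (\<lambda>j. coord (linear_form n (point v j))) (\<lambda>j. coord (V' j))"
      using PG[OF nonzero_pt(1)] unfolding rows by blast
  qed
  let ?F = "forms_of_rank n d r"
  let ?U = "{f \<in> ?F. poly_eval p' (lookup f) \<noteq> 0}"
  have sF: "?s v \<in> ?F" if "P (\<lambda>b. ?\<phi> b v) \<noteq> 0" for v
  proof -
    have "?s v \<in> forms n d" by (intro forms_sum forms_power_vec vec_vecs)
    then show ?thesis using key[OF that] unfolding forms_of_rank_def by simp
  qed
  show ?thesis unfolding for_general_def
  proof (intro exI[of _ ?U] conjI ballI)
    obtain v where v: "P (\<lambda>b. ?\<phi> b v) \<noteq> 0" using P(2) ..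
    have "?s v \<in> ?U" using sF[OF v] v by (simp only: mem_Collect_eq ev simp_thms)
    then show "?U \<noteq> {}" by blast
    show "zariski_open_in ?F ?U" unfolding zariski_open_in_def by (intro exI[of _ "{p'}"]) simp
    show "Q f" if f: "f \<in> ?U" for f
    proof -
      obtain w where w: "f = ?s w" using forms_of_rank_power_sum[OF _ d, of f n r] f by blast
      then have "P (\<lambda>b. ?\<phi> b w) \<noteq> 0" using f ev[of w] by simp
      from key[OF this] show ?thesis unfolding w by (rule conjunct2)
    qed
    show "zariski_dense_in ?F ?U" unfolding zariski_dense_in_def
    proof (intro conjI allI impI ballI)
      fix R f assume R: "\<forall>f\<in>?U. poly_eval R (lookup f) = 0" and f: "f \<in> ?F"
      obtain w where w: "f = ?s w" using forms_of_rank_power_sum[OF f d] .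
      \<comment> \<open>Pulled back to configurations, \<open>R\<close> becomes a polynomial
        function that is zero wherever \<open>P\<close> is not.\<close>
      have "pol ?I (\<lambda>v. lookup (?s v) \<beta>)" for \<beta>
        unfolding lookup_vec_power_sum by (cases "\<beta> \<in> ?B") (simp_all add: pol_power_coeff)
      then have 1: "pol ?I (\<lambda>v. poly_eval R (lookup (?s v)))"
        unfolding poly_eval_def by (intro pol_sum pol_mult pol_const pol_prod pol_power)
      have 2: "pol ?I (\<lambda>v. P (\<lambda>b. ?\<phi> b v))" by (rule pol_comp[OF P(1) pol_power_coeff])
      have "poly_eval R (lookup (?s w)) = 0"
      proof (rule pol_zero_if_mult_zero[OF 2 1 v])
        fix z assume z: "P (\<lambda>b. ?\<phi> b z) \<noteq> 0"
        have "?s z \<in> ?U" using sF[OF z] z by (simp only: mem_Collect_eq ev simp_thms)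
        then show "poly_eval R (lookup (?s z)) = 0" using R by blast
      qed
      then show "poly_eval R (lookup f) = 0" unfolding w .
    qed blast
  qed
qed

section \<open>The catalecticant algorithm for general forms\<close>

lemma good_jacobian:
  assumes "good n m k J x W" "0 < m + k" "i \<in> J" "l \<le> n"
  shows "\<exists>g. form n (m + k) g \<and> (\<forall>j\<in>J. \<forall>u. dd g (x j) u = (if i = j then u l else 0))"
proof -
  obtain L where L: "\<forall>j\<in>J. form n k (L j)" "dual J L x" using assms(1) unfolding good_def has_lagrange_def by blast
  obtain L' where L': "\<forall>j\<in>J. form n m (L' j)" "dual J L' x" using assms(1) unfolding good_def has_lagrange_def by blast
  have "\<exists>g. form n (k + m) g \<and> (\<forall>j\<in>J. \<forall>u. dd g (x j) u = (if i = j then u l else 0))"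
    by (rule jacobian_forms[OF _ L(2) _ L'(2)]) (use assms L(1) L'(1) in \<open>auto simp: good_def\<close>)
  then show ?thesis by (simp add: add.commute)
qed

lemma good_power_sum:
  assumes "good n m k {1..r} (\<lambda>j. coord (V j)) W" "\<And>j. j \<in> {1..r} \<Longrightarrow> V j \<in> vecs n" "0 < m + k"
  shows "power_sum n m k {1..r} V (\<Sum>j=1..r. V j ^ (m + k))"
  using assms unfolding good_def by unfold_locales auto

lemma general_good:
  fixes G :: "(nat \<Rightarrow> nat \<Rightarrow> complex) \<Rightarrow> bool"
  assumes d: "0 < m + k" and near: "eventually (\<lambda>v. G (point v)) (zariski_at ({1..r} \<times> {..n}) v0)"
    and G: "\<And>x. G x \<Longrightarrow> \<exists>W. good n m k {1..r} x W"
    and Q: "\<And>V. (\<And>j. j \<in> {1..r} \<Longrightarrow> V j \<in> vecs n) \<Longrightarrow>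
      (\<And>V'. (\<And>j. j \<in> {1..r} \<Longrightarrow> V' j \<in> vecs n) \<Longrightarrow> (\<Sum>j=1..r. V' j ^ (m + k)) = (\<Sum>j=1..r. V j ^ (m + k)) \<Longrightarrow>
        G (\<lambda>j. coord (V' j)) \<and> power_sum n m k {1..r} V' (\<Sum>j=1..r. V j ^ (m + k)) \<and>
        tangent_transfer n (m + k) {1..r} (\<lambda>j. coord (V j)) (\<lambda>j. coord (V' j))) \<Longrightarrow>
      Q (\<Sum>j=1..r. V j ^ (m + k))"
  shows "for_general (forms_of_rank n (m + k) r) Q"
proof (rule general_power_sums[OF d near])
  obtain W where W: "good n m k {1..r} (point v0) W" using G[OF eventually_zar_at[OF near]] ..
  show "\<exists>g. form n (m + k) g \<and> (\<forall>j\<in>{1..r}. \<forall>u. dd g (point v0 j) u = (if i = j then u l else 0))"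
    if "i \<in> {1..r}" "l \<le> n" for i l by (rule good_jacobian[OF W d that])
  fix V :: "nat \<Rightarrow> nat cpoly"
  assume V: "\<And>j. j \<in> {1..r} \<Longrightarrow> V j \<in> vecs n"
    and H: "\<And>V'. (\<And>j. j \<in> {1..r} \<Longrightarrow> V' j \<in> vecs n) \<Longrightarrow> (\<Sum>j=1..r. V' j ^ (m + k)) = (\<Sum>j=1..r. V j ^ (m + k)) \<Longrightarrow>
        G (\<lambda>j. coord (V' j)) \<and> tangent_transfer n (m + k) {1..r} (\<lambda>j. coord (V j)) (\<lambda>j. coord (V' j))"
  have ps: "power_sum n m k {1..r} V' (\<Sum>j=1..r. V j ^ (m + k))"
    if V': "\<And>j. j \<in> {1..r} \<Longrightarrow> V' j \<in> vecs n" and eq: "(\<Sum>j=1..r. V' j ^ (m + k)) = (\<Sum>j=1..r. V j ^ (m + k))" for V'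
  proof -
    have "G (\<lambda>j. coord (V' j))" using H[OF V' eq] ..
    from G[OF this] obtain W' where "good n m k {1..r} (\<lambda>j. coord (V' j)) W'" ..
    from good_power_sum[OF this V' d] show ?thesis unfolding eq .
  qed
  have "sym_rank n (m + k) (\<Sum>j=1..r. V j ^ (m + k)) = r"
    using power_sum.sym_rank[OF ps[OF V refl]] by simp
  moreover have "Q (\<Sum>j=1..r. V j ^ (m + k))" by (rule Q[OF V]) (use H ps in blast)+
  ultimately show "sym_rank n (m + k) (\<Sum>j=1..r. V j ^ (m + k)) = r \<and> Q (\<Sum>j=1..r. V j ^ (m + k))" ..
qed

lemma (in power_sum) vanishing_forms_points: "cat_ker n m f = vanishing_forms n m ((\<lambda>j. line (V j)) ` J)"
  unfolding cat_ker vanishing_forms_def using vanishes_at_line[of _ n m] by auto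

text \<open>Here the zeros of the kernel are just the rays of the points, so the Lagrange forms give
  independence of the powers at all zeros.\<close>

lemma general_exact:
  assumes d: "0 < m + k" "cat_order (m + k) = m"
    and near: "eventually (\<lambda>v. good n m k {1..r} (point v) (point v ` {1..r})) (zariski_at ({1..r} \<times> {..n}) v0)"
  shows "for_general (forms_of_rank n (m + k) r) (\<lambda>f. \<forall>v. is_power_sum n (m + k) r v f \<longrightarrow>
    cat_ker n m f = vanishing_forms n m (points r v) \<and> produces_unique_waring cat_algorithm n (m + k) f)"
proof (rule general_good[where G = "\<lambda>x. good n m k {1..r} x (x ` {1..r})", OF d(1) near])
  fix V :: "nat \<Rightarrow> nat cpoly"
  let ?f = "\<Sum>j=1..r. V j ^ (m + k)"
  assume H: "\<And>V'. (\<And>j. j \<in> {1..r} \<Longrightarrow> V' j \<in> vecs n) \<Longrightarrow> (\<Sum>j=1..r. V' j ^ (m + k)) = ?f \<Longrightarrow>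
        good n m k {1..r} (\<lambda>j. coord (V' j)) ((\<lambda>j. coord (V' j)) ` {1..r}) \<and> power_sum n m k {1..r} V' ?f \<and>
        tangent_transfer n (m + k) {1..r} (\<lambda>j. coord (V j)) (\<lambda>j. coord (V' j))"
  show "\<forall>v. is_power_sum n (m + k) r v ?f \<longrightarrow>
    cat_ker n m ?f = vanishing_forms n m (points r v) \<and> produces_unique_waring cat_algorithm n (m + k) ?f"
  proof (intro allI impI)
    fix v assume "is_power_sum n (m + k) r v ?f"
    then have v: "\<And>j. j \<in> {1..r} \<Longrightarrow> v j \<in> vecs n" "(\<Sum>j=1..r. v j ^ (m + k)) = ?f"
      unfolding is_power_sum_def by simp_all
    let ?x = "\<lambda>j. coord (v j)"
    from H[OF v] have good: "good n m k {1..r} ?x (?x ` {1..r})" and ps: "power_sum n m k {1..r} v ?f" by blast+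
    interpret power_sum n m k "{1..r}" v ?f by (rule ps)
    have red: "reduced_on n m Ker (?x ` {1..r})" using good unfolding good_def by blast
    have "powers_indep n (m + k) (zeros_of Ker)"
      by (rule pindep_points[OF lagr_k lagr_m]) (use red in \<open>auto simp: reduced_on_def\<close>)
    then show "cat_ker n m ?f = vanishing_forms n m (points r v) \<and> produces_unique_waring cat_algorithm n (m + k) ?f"
      using vanishing_forms_points cat_algorithm_unique[OF red d(2)] by (simp add: points_def)
  qed
qed blast

lemma general_independent:
  assumes d: "0 < m + k" "cat_order (m + k) = m"
    and near: "eventually (\<lambda>v. (\<exists>W. good n m k {1..r} (point v) W) \<and> powers_indep n (m + k) (zeros_of (vanishing n m {1..r} (point v))))
      (zariski_at ({1..r} \<times> {..n}) v0)"
  shows "for_general (forms_of_rank n (m + k) r) (produces_unique_waring cat_algorithm n (m + k))"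
proof (rule general_good[where G = "\<lambda>x. (\<exists>W. good n m k {1..r} x W) \<and> powers_indep n (m + k) (zeros_of (vanishing n m {1..r} x))", OF d(1) near])
  fix V :: "nat \<Rightarrow> nat cpoly"
  let ?f = "\<Sum>j=1..r. V j ^ (m + k)" and ?x = "\<lambda>j. coord (V j)"
  assume V: "\<And>j. j \<in> {1..r} \<Longrightarrow> V j \<in> vecs n" and
    H: "\<And>V'. (\<And>j. j \<in> {1..r} \<Longrightarrow> V' j \<in> vecs n) \<Longrightarrow> (\<Sum>j=1..r. V' j ^ (m + k)) = ?f \<Longrightarrow>
        ((\<exists>W. good n m k {1..r} (\<lambda>j. coord (V' j)) W) \<and> powers_indep n (m + k) (zeros_of (vanishing n m {1..r} (\<lambda>j. coord (V' j))))) \<and>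
        power_sum n m k {1..r} V' ?f \<and> tangent_transfer n (m + k) {1..r} ?x (\<lambda>j. coord (V' j))"
  interpret power_sum n m k "{1..r}" V ?f using H[OF V refl] by blast
  obtain W where "good n m k {1..r} ?x W" using H[OF V refl] by blast
  then have "reduced_on n m Ker W" unfolding good_def by blast
  from cat_algorithm_unique[OF this d(2)] show "produces_unique_waring cat_algorithm n (m + k) ?f"
    using H[OF V refl] by blast
qed blast

text \<open>A minimal expression with a point off the rays of the \<open>V j\<close> would use a
  further base point. A form singular at the \<open>V j\<close> but nonzero there is singular at the
  points of that expression too, since tangent spaces agree, and so vanishes there by Euler's
  formula.\<close>

lemma general_tangent:
  assumes d: "1 \<le> m" "cat_order (m + m) = m"
    and near: "eventually (\<lambda>v. \<exists>W. good n m m {1..r} (point v) W) (zariski_at ({1..r} \<times> {..n}) v0)"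
  shows "for_general (forms_of_rank n (m + m) r) (produces_unique_waring cat_algorithm_subsets n (m + m))"
proof (rule general_good[where G = "\<lambda>x. \<exists>W. good n m m {1..r} x W", OF _ near])
  show d0: "0 < m + m" using d(1) by simp
  fix V :: "nat \<Rightarrow> nat cpoly"
  let ?f = "\<Sum>j=1..r. V j ^ (m + m)" and ?x = "\<lambda>j. coord (V j)"
  assume V: "\<And>j. j \<in> {1..r} \<Longrightarrow> V j \<in> vecs n" and
    H: "\<And>V'. (\<And>j. j \<in> {1..r} \<Longrightarrow> V' j \<in> vecs n) \<Longrightarrow> (\<Sum>j=1..r. V' j ^ (m + m)) = ?f \<Longrightarrow>
        (\<exists>W. good n m m {1..r} (\<lambda>j. coord (V' j)) W) \<and>
        power_sum n m m {1..r} V' ?f \<and> tangent_transfer n (m + m) {1..r} ?x (\<lambda>j. coord (V' j))"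
  interpret power_sum n m m "{1..r}" V ?f using H[OF V refl] by blast
  obtain W where W: "good n m m {1..r} ?x W" using H[OF V refl] by blast
  then have red: "reduced_on n m Ker W" unfolding good_def by blast
  obtain L where L: "\<forall>j\<in>{1..r}. form n m (L j)" "dual {1..r} L ?x" using lagr_m unfolding has_lagrange_def by blast
  show "produces_unique_waring cat_algorithm_subsets n (m + m) ?f"
  proof (rule cat_algorithm_subsets_unique[OF red d(2)], rule ccontr)
    fix xs :: power_expr and i
    let ?w = "coord (snd (xs ! i))"
    assume xs: "expr_of n (m + m) ?f xs" "length xs = card {1..r}" and i: "i < length xs"
      and w: "?w \<in> zeros_of Ker" "nonzero_pt n ?w" and no: "\<not> (\<exists>j\<in>{1..r}. ray n (?x j) ?w)"
    have "\<exists>g. form n (2 * m) g \<and> (\<forall>j\<in>{1..r}. \<forall>u. dd g (?x j) u = 0) \<and> g ?w \<noteq> 0"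
      by (rule tangent_separator[OF finite_atLeastAtMost _ L(2) _ red d(1) w])
        (use L(1) W no in \<open>auto simp: good_def\<close>)
    then obtain g where g: "form n (m + m) g" "\<forall>j\<in>{1..r}. \<forall>u. dd g (?x j) u = 0" "g ?w \<noteq> 0"
      unfolding mult_2 by blast
    \<comment> \<open>The coefficients are absorbed into the vectors, because
      \<open>tangent_transfer\<close> compares sums of pure powers.\<close>
    obtain V0 where V0: "\<And>i. i < length xs \<Longrightarrow> V0 i \<in> vecs n"
      "\<And>i. i < length xs \<Longrightarrow> \<exists>t. V0 i = cscale t (snd (xs ! i)) \<and> t ^ (m + m) = fst (xs ! i)"
      "?f = (\<Sum>i<length xs. V0 i ^ (m + m))"
    proof (rule absorb_coefficients[OF d0 xs(1)])
    qed (rule that)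
    have len: "length xs = r" using xs(2) by simp
    have "(\<Sum>j=1..r. V0 (j - 1) ^ (m + m)) = (\<Sum>i<r. V0 i ^ (m + m))"
      by (simp add: One_nat_def sum.atLeast1_atMost_eq)
    then have "(\<Sum>j=1..r. V0 (j - 1) ^ (m + m)) = ?f" using V0(3) len by simp
    moreover have "V0 (j - 1) \<in> vecs n" if "j \<in> {1..r}" for j using that len by (intro V0(1)) auto
    ultimately have "tangent_transfer n (m + m) {1..r} ?x (\<lambda>j. coord (V0 (j - 1)))"
      using H[of "\<lambda>j. V0 (j - 1)"] by blast
    then have "\<forall>j\<in>{1..r}. \<forall>u. dd g (coord (V0 (j - 1))) u = 0" unfolding tangent_transfer_def using g(1,2) by blast
    moreover have "Suc i \<in> {1..r}" using i len by simp
    ultimately have "dd g (coord (V0 (Suc i - 1))) (coord (V0 i)) = 0" by blast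
    then have g0: "g (coord (V0 i)) = 0" using form_euler[OF g(1)] d0 by simp
    obtain t where t: "V0 i = cscale t (snd (xs ! i))" "t ^ (m + m) = fst (xs ! i)" using V0(2)[OF i] by blast
    have "t ^ (m + m) * g ?w = 0" using g0 form_cscale[OF g(1), of t "snd (xs ! i)"] unfolding t(1) by simp
    moreover have "fst (xs ! i) \<noteq> 0"
      using proper_decomposition[OF xs, of UNIV] i unfolding proper_expr_def by blast
    ultimately show False using t(2) g(3) by simp
  qed
qed

lemma general_extra:
  assumes d: "0 < m + k"
    and near: "eventually (\<lambda>v. (\<exists>W. good n m k {1..r} (point v) W) \<and>
      (\<exists>z\<in>zeros_of (vanishing n m {1..r} (point v)). z 0 \<noteq> 0 \<and> (\<forall>j\<in>{1..r}. \<not> ray n (point v j) z))) (zariski_at ({1..r} \<times> {..n}) v0)"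
  shows "for_general (forms_of_rank n (m + k) r) (\<lambda>f. \<forall>v. is_power_sum n (m + k) r v f \<longrightarrow>
    points r v \<subset> zero_set n (cat_ker n m f))"
proof (rule general_good[where G = "\<lambda>x. (\<exists>W. good n m k {1..r} x W) \<and>
      (\<exists>z\<in>zeros_of (vanishing n m {1..r} x). z 0 \<noteq> 0 \<and> (\<forall>j\<in>{1..r}. \<not> ray n (x j) z))", OF d near])
  fix V :: "nat \<Rightarrow> nat cpoly"
  let ?f = "\<Sum>j=1..r. V j ^ (m + k)"
  assume H: "\<And>V'. (\<And>j. j \<in> {1..r} \<Longrightarrow> V' j \<in> vecs n) \<Longrightarrow> (\<Sum>j=1..r. V' j ^ (m + k)) = ?f \<Longrightarrow>
        ((\<exists>W. good n m k {1..r} (\<lambda>j. coord (V' j)) W) \<and>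
          (\<exists>z\<in>zeros_of (vanishing n m {1..r} (\<lambda>j. coord (V' j))). z 0 \<noteq> 0 \<and> (\<forall>j\<in>{1..r}. \<not> ray n (coord (V' j)) z))) \<and>
        power_sum n m k {1..r} V' ?f \<and> tangent_transfer n (m + k) {1..r} (\<lambda>j. coord (V j)) (\<lambda>j. coord (V' j))"
  show "\<forall>v. is_power_sum n (m + k) r v ?f \<longrightarrow> points r v \<subset> zero_set n (cat_ker n m ?f)"
  proof (intro allI impI psubsetI)
    fix v assume "is_power_sum n (m + k) r v ?f"
    then have v: "\<And>j. j \<in> {1..r} \<Longrightarrow> v j \<in> vecs n" "(\<Sum>j=1..r. v j ^ (m + k)) = ?f"
      unfolding is_power_sum_def by simp_all
    interpret power_sum n m k "{1..r}" v ?f using H[OF v] by blast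
    show "points r v \<subseteq> zero_set n (cat_ker n m ?f)" unfolding points_def using points_zero_set by blast
    obtain z where z: "z \<in> zeros_of Ker" "z 0 \<noteq> 0" "\<forall>j\<in>{1..r}. \<not> ray n (coord (v j)) z" using H[OF v] by blast
    let ?z = "linear_form n z"
    have cz: "coord ?z i = z i" if "i \<le> n" for i using that by (simp add: coord_vec)
    then have "coord ?z 0 \<noteq> 0" using z(2) by simp
    then have z0: "?z \<noteq> 0" using nz_coord[OF vec_vecs] by (auto simp: nonzero_pt_def)
    have "coord ?z \<in> zeros_of Ker"
      unfolding zeros_of_def
    proof (intro CollectI ballI)
      fix p assume p: "p \<in> Ker"
      then have "form n m p" unfolding vanishing_def by blast
      then have "p (coord ?z) = p z" by (rule form_cong) (rule cz)
      then show "p (coord ?z) = 0" using z(1) p unfolding zeros_of_def by simp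
    qed
    then have in0: "line ?z \<in> zero_set n (cat_ker n m ?f)"
      using line_in_zero_set[OF cat_ker_forms vec_vecs z0] poly_eval_cat_ker by simp
    have "line ?z \<notin> points r v"
    proof
      assume "line ?z \<in> points r v"
      then obtain j where j: "j \<in> {1..r}" "line (v j) = line ?z" unfolding points_def by auto
      then have "ray n (coord (v j)) (coord ?z)" using line_eq_iff[OF v(1)[OF j(1)] vec_vecs z0] by blast
      then have "ray n (coord (v j)) z" unfolding ray_def using cz by simp
      then show False using z(3) j(1) by blast
    qed
    then show "points r v \<noteq> zero_set n (cat_ker n m ?f)" using in0 by blast
  qed
qed blast

section \<open>Existence of the special configuration, and strict inclusions\<close>

lemma grid_config_exists:
  assumes m: "1 \<le> m" and r: "r + n = (n + m) choose n"
  shows "\<exists>e v0 L \<beta>. grid_config n m {1..r} e v0 L \<beta>"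
proof -
  let ?A = "box n m \<inter> simplex n m"
  have fin: "finite ?A" using finite_box by blast
  have "card {1..r} = card ?A" using card_Z0[OF m, of n] r by simp
  then obtain e where e: "bij_betw e {1..r} ?A" using finite_same_card_bij[OF finite_atLeastAtMost fin] by blast
  then have e': "inj_on e {1..r}" "e ` {1..r} \<subseteq> simplex n m" by (auto simp: bij_betw_def)
  define v0 where "v0 = (\<lambda>(j, k). lattice_pt (e j) k)"
  have v0: "point v0 j = lattice_pt (e j)" for j by (simp add: v0_def point_def)
  obtain L0 where L0: "\<And>j. j \<in> {1..r} \<Longrightarrow> form n m (L0 j)" "dual {1..r} L0 (point v0)"
    using lattice_lagrange[OF e', of "point v0"] v0 by metis
  obtain L where L: "\<And>i. i \<in> {1..r} \<Longrightarrow> reg_family ({1..r} \<times> {..n}) v0 n m (L i)"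
    "eventually (\<lambda>v. dual {1..r} (\<lambda>i. L i v) (point v)) (zariski_at ({1..r} \<times> {..n}) v0)"
  proof (rule lagrange_near[OF finite_atLeastAtMost _ L0(2)])
    show "form n m (L0 i)" if "i \<in> {1..r}" for i by (rule L0(1)[OF that])
  qed (rule that)
  obtain \<beta> where "bij_betw \<beta> (box n m) {..<card (box n m)}"
    using ex_bij_betw_finite_nat[OF finite_box, of n m] by (auto simp: atLeast0LessThan)
  then have "grid_config n m {1..r} e v0 L \<beta>" using m e v0 L by unfold_locales auto
  then show ?thesis by blast
qed

text \<open>If the far corner of the grid has weight above \<open>m\<close>, the grid has more
  points than the configuration, and the surplus persists for nearby configurations.\<close>

lemma general_strict:
  assumes m: "1 \<le> m" and r: "r + n = (n + m) choose n" and n: "m < n * (m - 1)"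
  shows "for_general (forms_of_rank n (2 * m) r) (\<lambda>f. \<forall>v. is_power_sum n (2 * m) r v f \<longrightarrow>
    points r v \<subset> zero_set n (cat_ker n m f))"
proof -
  obtain e v0 L \<beta> where "grid_config n m {1..r} e v0 L \<beta>" using grid_config_exists[OF m r] by blast
  then interpret grid_config n m "{1..r}" e v0 L \<beta> .
  let ?b = "\<lambda>i. if i \<in> {1..n} then m - 1 else 0"
  have "?b \<in> box n m" using m by (auto simp: box_def)
  moreover have "?b \<notin> simplex n m" using n by (simp add: simplex_def weight_def)
  ultimately have "box n m \<inter> simplex n m \<subset> box n m" by blast
  then have "card (box n m \<inter> simplex n m) < card (box n m)" by (rule psubset_card_mono[OF finite_box])
  then have "card {1..r} < card (box n m)" using bij_betw_same_card[OF e] by simp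
  from near_extra[OF this] have "eventually (\<lambda>v. (\<exists>W. good n m m {1..r} (point v) W) \<and>
      (\<exists>z\<in>zeros_of (vanishing n m {1..r} (point v)). z 0 \<noteq> 0 \<and> (\<forall>j\<in>{1..r}. \<not> ray n (point v j) z))) (zariski_at ({1..r} \<times> {..n}) v0)"
    using near_good by eventually_elim blast
  from general_extra[OF _ this] show ?thesis using m by (simp add: mult_2)
qed

theorem theorem2p4:
  fixes n d r m :: nat
  assumes "d \<ge> 1" and "m = nat \<lceil>real d / 2\<rceil>"
  shows
    "((even d \<and> r + n + 1 \<le> (n + m) choose n) \<or> (odd d \<and> r \<le> (n + m - 1) choose n) \<longrightarrow>
        for_general (forms_of_rank n d r) (\<lambda>f. \<forall>v. is_power_sum n d r v f \<longrightarrow>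
          cat_ker n m f = vanishing_forms n m (points r v) \<and>
          produces_unique_waring cat_algorithm n d f))
     \<and> (even d \<and> r + n = (n + m) choose n \<longrightarrow>
        (n = 2 \<longrightarrow> for_general (forms_of_rank n d r)
          (\<lambda>f. produces_unique_waring cat_algorithm n d f)) \<and>
        (n \<ge> 3 \<longrightarrow> for_general (forms_of_rank n d r)
          (\<lambda>f. produces_unique_waring cat_algorithm_subsets n d f)))
     \<and> (\<exists>m' \<ge> 1. \<exists>r'. r' + 2 = (2 + m') choose 2 \<and>
        for_general (forms_of_rank 2 (2 * m') r') (\<lambda>f. \<forall>v. is_power_sum 2 (2 * m') r' v f \<longrightarrow>
          points r' v \<subset> zero_set 2 (cat_ker 2 m' f)))
     \<and> (\<exists>n' \<ge> 3. \<exists>m' \<ge> 1. \<exists>r'. r' + n' = (n' + m') choose n' \<and>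
        for_general (forms_of_rank n' (2 * m') r') (\<lambda>f. \<forall>v. is_power_sum n' (2 * m') r' v f \<longrightarrow>
          points r' v \<subset> zero_set n' (cat_ker n' m' f)))"
proof -
  have ord: "cat_order d = m" unfolding cat_order_def assms(2) ..
  have even: "d = m + m \<and> 1 \<le> m" if "even d"
    using that assms by (auto elim!: evenE)
  have odd: "\<exists>k. d = Suc k + k \<and> m = Suc k" if od: "odd d"
  proof -
    obtain c where c: "d = 2 * c + 1" using od by (rule oddE)
    have "\<lceil>real d / 2\<rceil> = int c + 1" unfolding ceiling_eq_iff c by simp
    then show ?thesis using c assms(2) by (intro exI[of _ c]) simp
  qed
  have pick: "\<exists>e v0. inj_on e {1..r} \<and> e ` {1..r} \<subseteq> A \<and> (\<forall>j. point v0 j = lattice_pt (e j))"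
    if A: "finite A" "r \<le> card A" for A
  proof -
    obtain e where "inj_on e {1..r}" "e ` {1..r} \<subseteq> A" using inj_on_iff_card_le[of "{1..r}" A] A by auto
    moreover have "point (\<lambda>(j, k). lattice_pt (e j) k) j = lattice_pt (e j)" for j by (simp add: point_def)
    ultimately show ?thesis by blast
  qed
  have 1: "for_general (forms_of_rank n d r) (\<lambda>f. \<forall>v. is_power_sum n d r v f \<longrightarrow>
      cat_ker n m f = vanishing_forms n m (points r v) \<and> produces_unique_waring cat_algorithm n d f)"
    if "even d" "r + n + 1 \<le> (n + m) choose n"
  proof -
    have m: "d = m + m" "1 \<le> m" using even[OF that(1)] by simp_all
    let ?A = "box n m \<inter> simplex n m"
    \<comment> \<open>Removing the origin costs one point, which is why the bound on
      \<open>r\<close> is one lower than the size of the full configuration.\<close>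
    have "(\<lambda>_. 0) \<in> ?A" using m(2) by (simp add: box_def simplex_def weight_def)
    then have "card (?A - {\<lambda>_. 0}) = card ?A - 1" using finite_box by simp
    then have "r \<le> card (?A - {\<lambda>_. 0})" using card_Z0[OF m(2), of n] that(2) by simp
    then obtain e v0 where e: "inj_on e {1..r}" "e ` {1..r} \<subseteq> ?A - {\<lambda>_. 0}" "\<forall>j. point v0 j = lattice_pt (e j)"
      using pick[of "?A - {\<lambda>_. 0}"] finite_box by blast
    have "eventually (\<lambda>v. good n m m {1..r} (point v) (point v ` {1..r})) (zariski_at ({1..r} \<times> {..n}) v0)"
      by (rule near_even[OF finite_atLeastAtMost m(2) e(1,2)]) (simp add: e(3))
    from general_exact[OF _ _ this] show ?thesis using m ord by simp
  qed
  have 2: "for_general (forms_of_rank n d r) (\<lambda>f. \<forall>v. is_power_sum n d r v f \<longrightarrow>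
      cat_ker n m f = vanishing_forms n m (points r v) \<and> produces_unique_waring cat_algorithm n d f)"
    if "odd d" "r \<le> (n + m - 1) choose n"
  proof -
    from odd[OF that(1)] obtain k where k: "d = Suc k + k" "m = Suc k" by blast
    have "r \<le> card (simplex n k)" using that(2) k by (simp add: card_idx)
    then obtain e v0 where e: "inj_on e {1..r}" "e ` {1..r} \<subseteq> simplex n k" "\<forall>j. point v0 j = lattice_pt (e j)"
      using pick[OF finite_idx] by blast
    have "eventually (\<lambda>v. good n (Suc k) k {1..r} (point v) (point v ` {1..r})) (zariski_at ({1..r} \<times> {..n}) v0)"
      by (rule near_odd[OF finite_atLeastAtMost e(1,2)]) (simp add: e(3))
    from general_exact[OF _ _ this] show ?thesis using k ord by simp
  qed
  have 3: "for_general (forms_of_rank n d r) (produces_unique_waring cat_algorithm n d)"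
    if "even d" "r + n = (n + m) choose n" "n = 2"
  proof -
    have dm: "d = m + m" "1 \<le> m" using even[OF that(1)] by simp_all
    from grid_config_exists[OF dm(2) that(2)] obtain e v0 L \<beta> where "grid_config n m {1..r} e v0 L \<beta>" by blast
    then interpret grid_config n m "{1..r}" e v0 L \<beta> .
    have "n * (m - 1) \<le> 2 * m" using that(3) by simp
    from near_pindep[OF this] near_good
    have "eventually (\<lambda>v. (\<exists>W. good n m m {1..r} (point v) W) \<and> powers_indep n (m + m) (zeros_of (vanishing n m {1..r} (point v))))
      (zariski_at ({1..r} \<times> {..n}) v0)" unfolding mult_2 by eventually_elim blast
    from general_independent[OF _ _ this] show ?thesis using dm ord by simp
  qed
  have 4: "for_general (forms_of_rank n d r) (produces_unique_waring cat_algorithm_subsets n d)"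
    if "even d" "r + n = (n + m) choose n"
  proof -
    have dm: "d = m + m" "1 \<le> m" using even[OF that(1)] by simp_all
    from grid_config_exists[OF dm(2) that(2)] obtain e v0 L \<beta> where "grid_config n m {1..r} e v0 L \<beta>" by blast
    then interpret grid_config n m "{1..r}" e v0 L \<beta> .
    have "eventually (\<lambda>v. \<exists>W. good n m m {1..r} (point v) W) (zariski_at ({1..r} \<times> {..n}) v0)"
      using near_good by eventually_elim blast
    from general_tangent[OF dm(2) _ this] show ?thesis using dm(1) ord by simp
  qed
  have 5: "(5 choose 2 :: nat) = 10" "(5 choose 3 :: nat) = 10" by (simp_all add: numeral_eq_Suc)
  \<comment> \<open>Sextics in three variables: 8 of the 9 points of a 3 by 3 grid. For
    \<open>n = 2\<close> the condition \<open>m < n * (m - 1)\<close> first holds at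
    \<open>m = 3\<close>.\<close>
  have 6: "for_general (forms_of_rank 2 (2 * 3) 8) (\<lambda>f. \<forall>v. is_power_sum 2 (2 * 3) 8 v f \<longrightarrow>
      points 8 v \<subset> zero_set 2 (cat_ker 2 3 f))"
    by (rule general_strict) (simp_all add: 5)
  \<comment> \<open>Quartics in four variables: 7 of the 8 vertices of a cube; for
    \<open>n = 3\<close> the condition first holds at \<open>m = 2\<close>.\<close>
  have 7: "for_general (forms_of_rank 3 (2 * 2) 7) (\<lambda>f. \<forall>v. is_power_sum 3 (2 * 2) 7 v f \<longrightarrow>
      points 7 v \<subset> zero_set 3 (cat_ker 3 2 f))"
    by (rule general_strict) (simp_all add: 5)
  show ?thesis
  proof (intro conjI impI)
    show "\<exists>m'\<ge>1. \<exists>r'. r' + 2 = (2 + m') choose 2 \<and>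
        for_general (forms_of_rank 2 (2 * m') r') (\<lambda>f. \<forall>v. is_power_sum 2 (2 * m') r' v f \<longrightarrow>
          points r' v \<subset> zero_set 2 (cat_ker 2 m' f))"
      by (rule exI[of _ 3], rule conjI, simp, rule exI[of _ 8], rule conjI[OF _ 6]) (simp add: 5)
    show "\<exists>n'\<ge>3. \<exists>m'\<ge>1. \<exists>r'. r' + n' = (n' + m') choose n' \<and>
        for_general (forms_of_rank n' (2 * m') r') (\<lambda>f. \<forall>v. is_power_sum n' (2 * m') r' v f \<longrightarrow>
          points r' v \<subset> zero_set n' (cat_ker n' m' f))"
      by (rule exI[of _ 3], rule conjI, simp, rule exI[of _ 2], rule conjI, simp, rule exI[of _ 7], rule conjI[OF _ 7])
        (simp add: 5)
  qed (use 1 2 3 4 in blast)+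
qed

end
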